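(* Let $p\in(1,\infty]$ and suppose that $\Omega\subset\mathbb{R}^N$ is a domain of class $C^{0,\omega}$ with boundary $\Gamma$. Let $u$ be the bounded viscosity solution of $$u_t=\Delta_p^G u \ \text{ in } \Omega\times(0,\infty),\qquad u=0 \ \text{ on } \Omega\times\{0\},\qquad u=1\ \text{ on } \Gamma\times(0,\infty).$$ Then $$4t\log u(x,t)+p'\,d_\Gamma(x)^2=O(t\log\psi_\omega(t))\quad\text{as } t\to0^+,$$ uniformly on every compact subset of $\overline{\Omega}$. In particular, if $t\log\psi_\omega(t)\to0$ as $t\to0^+$, then $\lim_{t\to0^+}4t\log u(x,t)=-p'\,d_\Gamma(x)^2$ uniformly on every compact subset of $\overline{\Omega}$.
   Context: $N\ge2$; a domain is a connected open set, not necessarily bounded, with nonempty boundary $\Gamma$; $d_\Gamma(x)=\inf\{|x-y|:y\in\Gamma\}$. $p'=p/(p-1)$ for $1<p<\infty$ and $p'=1$ for $p=\infty$. $f=O(g)$ means $|f|\le C|g|$ for small parameter; "uniformly on a compact set" means $C$ and the range of the parameter are independent of $x$ in that set. Class $C^{0,\omega}$: let $\omega:(0,\infty)\to(0,\infty)$ be strictly increasing and continuous with $\omega(\tau)\to0$ as $\tau\to0^+$ (set $\omega(0)=0$). $\Omega$ is of class $C^{0,\omega}$ if there is $r>0$ such that for every $x_0\in\Gamma$ there are a coordinate system $(y',y_N)\in\mathbb{R}^{N-1}\times\mathbb{R}$ and $\zeta:\mathbb{R}^{N-1}\to\mathbb{R}$ with (i) $B_r(x_0)\cap\Omega=\{(y',y_N)\in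 B_r(x_0):y_N<\zeta(y')\}$; (ii) $B_r(x_0)\cap\Gamma=\{(y',y_N)\in B_r(x_0):y_N=\zeta(y')\}$; (iii) $|\zeta(y')-\zeta(z')|\le\omega(|y'-z'|)$ for all $(y',\zeta(y')),(z',\zeta(z'))\in B_r(x_0)\cap\Gamma$. Set $\psi_\omega(\sigma)=\min_{0\le s\le r}\sqrt{s^2+[\omega(s)-\sigma]^2}$ for $\sigma\ge0$. Game-theoretic $p$-laplacian: $\Delta_p^Gu=\frac1p\Delta u+\left(1-\frac2p\right)\frac{\langle\nabla^2u\,\nabla u,\nabla u\rangle}{|\nabla u|^2}$ (with $1/p=0$ if $p=\infty$), i.e. $\Delta_p^Gu=-F(\nabla u,\nabla^2u)$ where, for $\xi\in\mathbb{R}^N\setminus\{0\}$ and $X$ a symmetric $N\times N$ matrix, $F(\xi,X)=-\mathrm{tr}[A(\xi)X]$, $A(\xi)=\frac1pI+\left(1-\frac2p\right)\frac{\xi\otimes\xi}{|\xi|^2}$. The semicontinuous envelopes are $F_*(\xi,X)=\lim_{\delta\to0^+}\inf\{F(\eta,Y):\eta\ne0,|\eta-\xi|<\delta,|Y-X|<\delta\}$ and $F^*=-(-F)_*$. Viscosity solutions of $u_t=\Delta_p^Gu$ in $\Omega\times(0,\infty)$: an upper semicontinuous $u$ is a subsolution if $\phi_t+F_*(\nabla\phi,\nabla^2\phi)\le0$ at $(x,t)$ whenever $\phi\in C^2(\Omega\times(0,\infty))$ and $u-\phi$ attains its maximum at $(x,t)$; a lower semicontinuous $v$ is a supersolution if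 $\psi_t+F^*(\nabla\psi,\nabla^2\psi)\ge0$ at $(x,t)$ whenever $\psi\in C^2(\Omega\times(0,\infty))$ and $v-\psi$ attains its minimum at $(x,t)$; a solution is both. The initial and boundary values are attained continuously on $\Omega\times\{0\}$ and $\Gamma\times(0,\infty)$; the bounded viscosity solution of the problem is unique by comparison. *)

theory Defs
  imports "HOL-Analysis.Analysis"
begin

section \<open>Domains of class \<open>C\<^sup>0\<^sup>,\<^sup>\<omega>\<close>\<close>

definition modulus :: "(real \<Rightarrow> real) \<Rightarrow> bool" where
  "modulus \<omega> \<longleftrightarrow>
     (\<forall>\<tau>>0. \<omega> \<tau> > 0) \<and> strict_mono_on {0<..} \<omega> \<and> continuous_on {0<..} \<omega> \<and>
     (\<omega> \<longlongrightarrow> 0) (at_right 0) \<and> \<omega> 0 = 0"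

text \<open>
  A Cartesian coordinate system \<open>(y', y\<^sub>N)\<close> of \<open>\<real>\<^sup>N\<close> is given by the unit vector \<open>e\<close> of the
  \<open>y\<^sub>N\<close>-axis: the copy of \<open>\<real>\<^sup>N\<^sup>-\<^sup>1\<close> in which \<open>y'\<close> lives is the hyperplane orthogonal to \<open>e\<close>, and
  the point with coordinates \<open>(y', y\<^sub>N)\<close> is \<open>y' + y\<^sub>N e\<close>.  A choice of orthonormal basis in the
  hyperplane does not change \<open>\<bar>y' - z'\<bar>\<close>, and a shift of the origin is absorbed by \<open>\<zeta>\<close>, whose
  values off the hyperplane are never used.
\<close>

definition hyperplane :: "real^'n \<Rightarrow> (real^'n) set" where
  "hyperplane e = {y'. y' \<bullet> e = 0}"

definition class_C0 :: "real \<Rightarrow> (real \<Rightarrow> real) \<Rightarrow> (real^'n) set \<Rightarrow> bool" where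
  "class_C0 r \<omega> \<Omega> \<longleftrightarrow>
     r > 0 \<and>
     (\<forall>x0 \<in> frontier \<Omega>. \<exists>e \<zeta>. norm e = 1 \<and>
        ball x0 r \<inter> \<Omega> =
          {y' + yN *\<^sub>R e | y' yN. y' \<in> hyperplane e \<and> y' + yN *\<^sub>R e \<in> ball x0 r \<and> yN < \<zeta> y'} \<and>
        ball x0 r \<inter> frontier \<Omega> =
          {y' + yN *\<^sub>R e | y' yN. y' \<in> hyperplane e \<and> y' + yN *\<^sub>R e \<in> ball x0 r \<and> yN = \<zeta> y'} \<and>
        (\<forall>y' \<in> hyperplane e. \<forall>z' \<in> hyperplane e.
           y' + \<zeta> y' *\<^sub>R e \<in> ball x0 r \<inter> frontier \<Omega> \<longrightarrow>
           z' + \<zeta> z' *\<^sub>R e \<in> ball x0 r \<inter> frontier \<Omega> \<longrightarrow>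
           \<bar>\<zeta> y' - \<zeta> z'\<bar> \<le> \<omega> (norm (y' - z'))))"

definition psi :: "real \<Rightarrow> (real \<Rightarrow> real) \<Rightarrow> real \<Rightarrow> real" where
  "psi r \<omega> \<sigma> = (INF s\<in>{0..r}. sqrt (s\<^sup>2 + (\<omega> s - \<sigma>)\<^sup>2))"

text \<open>The infimum is a minimum.\<close>

lemma psi_attained:
  assumes "modulus \<omega>" "0 \<le> r"
  obtains s where "s \<in> {0..r}" "psi r \<omega> \<sigma> = sqrt (s\<^sup>2 + (\<omega> s - \<sigma>)\<^sup>2)"
    "\<And>s'. s' \<in> {0..r} \<Longrightarrow> psi r \<omega> \<sigma> \<le> sqrt (s'\<^sup>2 + (\<omega> s' - \<sigma>)\<^sup>2)"
proof -
  have "continuous (at x within {0..}) \<omega>" if "x \<ge> 0" for x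
  proof (cases "x = 0")
    case True
    have "at (0::real) within {0..} = at_right 0"
      by (rule at_within_nhd[of _ UNIV]) auto
    moreover have "(\<omega> \<longlongrightarrow> \<omega> 0) (at_right 0)"
      using assms(1) by (metis modulus_def)
    ultimately show ?thesis
      using True by (simp add: continuous_within)
  next
    case False
    then have "isCont \<omega> x"
      using that assms(1) continuous_on_eq_continuous_at[of "{0<..}" \<omega>]
      unfolding modulus_def by auto
    then show ?thesis
      by (rule continuous_at_imp_continuous_at_within)
  qed
  then have "continuous_on {0..} \<omega>"
    by (simp add: continuous_on_eq_continuous_within)
  then have "continuous_on {0..r} \<omega>"
    by (rule continuous_on_subset) auto
  then have "continuous_on {0..r} (\<lambda>s. sqrt (s\<^sup>2 + (\<omega> s - \<sigma>)\<^sup>2))"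
    by (intro continuous_intros)
  then obtain s where s: "s \<in> {0..r}"
    "\<forall>s'\<in>{0..r}. sqrt (s\<^sup>2 + (\<omega> s - \<sigma>)\<^sup>2) \<le> sqrt (s'\<^sup>2 + (\<omega> s' - \<sigma>)\<^sup>2)"
    using continuous_attains_inf[of "{0..r}" "\<lambda>s. sqrt (s\<^sup>2 + (\<omega> s - \<sigma>)\<^sup>2)"] assms(2) by auto
  then have "psi r \<omega> \<sigma> = sqrt (s\<^sup>2 + (\<omega> s - \<sigma>)\<^sup>2)"
    unfolding psi_def by (intro cInf_eq_minimum) auto
  then show ?thesis
    using s by (intro that[of s]) auto
qed

section \<open>The game-theoretic \<open>p\<close>-laplacian\<close>

text \<open>\<open>1/p\<close> for \<open>p \<in> (1, \<infinity>]\<close>; in \<^typ>\<open>ereal\<close>, \<open>1/\<infinity> = 0\<close>.\<close>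

definition recip :: "ereal \<Rightarrow> real" where
  "recip p = real_of_ereal (1 / p)"

definition conj_exp :: "ereal \<Rightarrow> real" where
  "conj_exp p = (if p = \<infinity> then 1 else real_of_ereal p / (real_of_ereal p - 1))"

definition outer :: "real^'n \<Rightarrow> real^'n^'n" where
  "outer \<xi> = (\<chi> i j. \<xi> $ i * \<xi> $ j)"

definition coeff_A :: "ereal \<Rightarrow> real^'n \<Rightarrow> real^'n^'n" where
  "coeff_A p \<xi> = recip p *\<^sub>R mat 1 + ((1 - 2 * recip p) / (norm \<xi>)\<^sup>2) *\<^sub>R outer \<xi>"

definition op_F :: "ereal \<Rightarrow> real^'n \<Rightarrow> real^'n^'n \<Rightarrow> real" where
  "op_F p \<xi> X = - trace (coeff_A p \<xi> ** X)"

text \<open>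
  Semicontinuous envelopes of a function of \<open>(\<xi>, X)\<close>, \<open>\<xi> \<noteq> 0\<close> and \<open>X\<close> symmetric.  They are
  real-valued only for functions that, like \<^const>\<open>op_F\<close>, are bounded near every
  \<open>(\<xi>, X)\<close>, including \<open>\<xi> = 0\<close>; then the infimum below is monotone and bounded in \<open>\<delta>\<close>, so that
  the limit exists.
\<close>

definition lower_envelope ::
    "(real^'n \<Rightarrow> real^'n^'n \<Rightarrow> real) \<Rightarrow> real^'n \<Rightarrow> real^'n^'n \<Rightarrow> real" where
  "lower_envelope G \<xi> X =
     Lim (at_right 0)
       (\<lambda>\<delta>. Inf {G \<eta> Y | \<eta> Y. \<eta> \<noteq> 0 \<and> transpose Y = Y \<and> norm (\<eta> - \<xi>) < \<delta> \<and> norm (Y - X) < \<delta>})"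

definition upper_envelope ::
    "(real^'n \<Rightarrow> real^'n^'n \<Rightarrow> real) \<Rightarrow> real^'n \<Rightarrow> real^'n^'n \<Rightarrow> real" where
  "upper_envelope G \<xi> X = - lower_envelope (\<lambda>\<eta> Y. - G \<eta> Y) \<xi> X"

section \<open>Viscosity solutions\<close>

text \<open>Twice continuously differentiable on an open set (continuity of \<open>\<phi>\<close> and of its first
  derivative is automatic).\<close>

definition C2_on :: "'a::real_normed_vector set \<Rightarrow> ('a \<Rightarrow> real) \<Rightarrow> bool" where
  "C2_on S \<phi> \<longleftrightarrow>
     (\<exists>(D1 :: 'a \<Rightarrow> 'a \<Rightarrow>\<^sub>L real) (D2 :: 'a \<Rightarrow> 'a \<Rightarrow>\<^sub>L 'a \<Rightarrow>\<^sub>L real).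
        (\<forall>z\<in>S. (\<phi> has_derivative blinfun_apply (D1 z)) (at z)) \<and>
        (\<forall>z\<in>S. (D1 has_derivative blinfun_apply (D2 z)) (at z)) \<and>
        continuous_on S D2)"

definition partial :: "'n \<Rightarrow> (real^'n \<Rightarrow> real) \<Rightarrow> real^'n \<Rightarrow> real" where
  "partial i f x = deriv (\<lambda>h. f (x + h *\<^sub>R axis i 1)) 0"

definition gradient :: "(real^'n \<Rightarrow> real) \<Rightarrow> real^'n \<Rightarrow> real^'n" where
  "gradient f x = (\<chi> i. partial i f x)"

definition hessian :: "(real^'n \<Rightarrow> real) \<Rightarrow> real^'n \<Rightarrow> real^'n^'n" where
  "hessian f x = (\<chi> i j. partial i (partial j f) x)"

definition usc_on :: "'a::topological_space set \<Rightarrow> ('a \<Rightarrow> real) \<Rightarrow> bool" where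
  "usc_on S u \<longleftrightarrow> (\<forall>z\<in>S. \<forall>c>u z. \<forall>\<^sub>F w in at z within S. u w < c)"

definition lsc_on :: "'a::topological_space set \<Rightarrow> ('a \<Rightarrow> real) \<Rightarrow> bool" where
  "lsc_on S u \<longleftrightarrow> (\<forall>z\<in>S. \<forall>c<u z. \<forall>\<^sub>F w in at z within S. c < u w)"

definition viscosity_subsolution ::
    "ereal \<Rightarrow> (real^'n) set \<Rightarrow> ((real^'n) \<times> real \<Rightarrow> real) \<Rightarrow> bool" where
  "viscosity_subsolution p \<Omega> u \<longleftrightarrow>
     usc_on (\<Omega> \<times> {0<..}) u \<and>
     (\<forall>\<phi> x t. C2_on (\<Omega> \<times> {0<..}) \<phi> \<longrightarrow> x \<in> \<Omega> \<longrightarrow> t > 0 \<longrightarrow>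
        (\<forall>z \<in> \<Omega> \<times> {0<..}. u z - \<phi> z \<le> u (x, t) - \<phi> (x, t)) \<longrightarrow>
        deriv (\<lambda>s. \<phi> (x, s)) t +
          lower_envelope (op_F p) (gradient (\<lambda>y. \<phi> (y, t)) x) (hessian (\<lambda>y. \<phi> (y, t)) x) \<le> 0)"

definition viscosity_supersolution ::
    "ereal \<Rightarrow> (real^'n) set \<Rightarrow> ((real^'n) \<times> real \<Rightarrow> real) \<Rightarrow> bool" where
  "viscosity_supersolution p \<Omega> v \<longleftrightarrow>
     lsc_on (\<Omega> \<times> {0<..}) v \<and>
     (\<forall>\<psi> x t. C2_on (\<Omega> \<times> {0<..}) \<psi> \<longrightarrow> x \<in> \<Omega> \<longrightarrow> t > 0 \<longrightarrow>
        (\<forall>z \<in> \<Omega> \<times> {0<..}. v z - \<psi> z \<ge> v (x, t) - \<psi> (x, t)) \<longrightarrow>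
        deriv (\<lambda>s. \<psi> (x, s)) t +
          upper_envelope (op_F p) (gradient (\<lambda>y. \<psi> (y, t)) x) (hessian (\<lambda>y. \<psi> (y, t)) x) \<ge> 0)"

definition viscosity_solution ::
    "ereal \<Rightarrow> (real^'n) set \<Rightarrow> ((real^'n) \<times> real \<Rightarrow> real) \<Rightarrow> bool" where
  "viscosity_solution p \<Omega> u \<longleftrightarrow> viscosity_subsolution p \<Omega> u \<and> viscosity_supersolution p \<Omega> u"

text \<open>
  The initial-boundary value problem.  The data are attained continuously on \<open>\<Omega> \<times> {0}\<close> and on
  \<open>\<Gamma> \<times> (0, \<infinity>)\<close>; nothing is prescribed on \<open>\<Gamma> \<times> {0}\<close>, where the two data are incompatible.
\<close>

definition bounded_solution ::
    "ereal \<Rightarrow> (real^'n) set \<Rightarrow> ((real^'n) \<times> real \<Rightarrow> real) \<Rightarrow> bool" where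
  "bounded_solution p \<Omega> u \<longleftrightarrow>
     bounded (u ` (\<Omega> \<times> {0<..})) \<and>
     viscosity_solution p \<Omega> u \<and>
     (\<forall>x\<in>\<Omega>. u (x, 0) = 0) \<and>
     (\<forall>x\<in>frontier \<Omega>. \<forall>t>0. u (x, t) = 1) \<and>
     (\<forall>z \<in> \<Omega> \<times> {0} \<union> frontier \<Omega> \<times> {0<..}. continuous (at z within closure \<Omega> \<times> {0..}) u)"

end

theory Submission
  imports Defs
begin

text \<open>
  The solution behaves like \<open>exp (- p' d\<^sup>2 / (4 t))\<close>, where \<open>d\<close> is the distance to the boundary
  \<open>\<Gamma>\<close>, because along a radial function the operator acts as \<open>b = 1 - 1/p = 1/p'\<close> times the second
  radial derivative plus a curvature term of lower order.  A one-dimensional Gaussian with diffusion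
  constant \<open>b\<close> is therefore almost a solution, and comparison with two radial barriers, one from
  each side, gives the theorem after taking logarithms.

  From above: for \<open>x0\<close> in \<open>\<Omega>\<close> at distance \<open>d\<close> from \<open>\<Gamma>\<close>, an exponential of the smoothed distance
  to \<open>x0\<close> with rate \<open>d / (2 b t0)\<close> is a supersolution that is at least \<open>sup u\<close> on the sphere of
  radius \<open>d\<close>.  Its value at \<open>(x0, t0)\<close> is \<open>exp (- d\<^sup>2 / (4 b t0))\<close> up to a power of \<open>d\<^sup>2 / t0\<close>
  (\<open>gaussian_upper_bound\<close>), which costs \<open>O(t log t)\<close>.

  From below: in a domain of class \<open>C\<^sup>0\<^sup>,\<^sup>\<omega>\<close> a boundary point moved by \<open>t\<close> along the axis of the chart is
  the centre of a ball of radius \<open>\<psi>\<^sub>\<omega>(t)\<close> in the exterior (\<open>exterior_ball\<close>).  A Gaussian centred there,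
  multiplied by \<open>(\<psi>\<^sub>\<omega>(t)\<^sup>2 / t)\<^sup>\<beta>\<close>, is a subsolution not exceeding \<open>1\<close> outside that ball, hence lies
  below \<open>u\<close> (\<open>exterior_ball_lower\<close>).  The prefactor is the source of the error \<open>t log \<psi>\<^sub>\<omega>(t)\<close>.

  The second comparison needs \<open>u \<ge> 0\<close>, and this is the hard part: on the corner set \<open>\<Gamma> \<times> {0}\<close> the
  data jump and no value is prescribed, so the maximum principle applies to \<open>W = - u\<close>, a subsolution
  equal to \<open>- 1\<close> on \<open>\<Gamma>\<close>, only once it is known that \<open>W\<close> has nonpositive upper limits at the corners
  (\<open>corner_limsup_nonpos\<close>).  Suppose that the upper limit is \<open>a > 0\<close> at \<open>y0\<close>.  By the first barrier,
  at time \<open>t\<close> the function \<open>W\<close> is of size \<open>a\<close> only in a layer of width \<open>O(sqrt t)\<close> along \<open>\<Gamma>\<close>.  Moved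
  by \<open>\<delta>\<close> along the axis of the chart this layer lies in the exterior, where \<open>W\<close> is continued by
  \<open>- 1\<close>.  Hence \<open>W(x,t)\<^sup>2 / a\<^sup>2 + \<beta> (W(y + \<delta> e, t) - a') - \<bar>x - y\<bar>\<^sup>4 t\<^sup>-\<^sup>5\<^sup>/\<^sup>2\<close>, corrected by
  terms that localise in space and time, has its maximum at an interior point.  There the equation is violated:
  the square yields a gain proportional to the square of the gradient, which absorbs the time derivative of the
  penalty, and the perturbation caused by the localisation costs \<open>O(t\<^sup>-\<^sup>5\<^sup>/\<^sup>6)\<close>, which is integrable
  in time and dominated by the derivative of \<open>C t\<^sup>1\<^sup>/\<^sup>6\<close>.

  The subsolutions are merely semicontinuous.  The interior maximum is turned into second-order
  information by sup-convolution and by Jensen's lemma with Alexandrov's theorem (\<open>jensen_alexandrov\<close>,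
  \<open>doubling_jets\<close>); both rest on Rademacher's theorem (\<open>rademacher\<close>).
\<close>

section \<open>Lipschitz functions are differentiable almost everywhere\<close>

text \<open>
  After adding \<open>(L + 1) x\<close> the function is an increasing homeomorphism \<open>\<psi>\<close> of the line, and the image
  of Lebesgue measure under the inverse of \<open>\<psi>\<close> is absolutely continuous; its density gives the derivative
  at almost every point.
\<close>

lemma lipschitz_real_right_derivative_ae:
  fixes f :: "real => real"
  assumes lip: "L-lipschitz_on UNIV f"
  obtains N where "negligible N"
    "!!x. x \<notin> N ==> \<exists>l. ((\<lambda>h. (f (x + h) - f x) / h) \<longlongrightarrow> l) (at_right 0)"
proof -
  have L0: "L >= 0" using lip lipschitz_on_nonneg by blast
  define \<psi> where "\<psi> x = f x + (L + 1) * x" for x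
  have fl: "\<bar>f x - f y\<bar> <= L * \<bar>x - y\<bar>" for x y
    using lipschitz_onD[OF lip, of x y] by (simp add: dist_real_def)
  have low: "\<psi> y - \<psi> x >= y - x" if "x <= y" for x y
    using fl[of y x] that by (simp add: \<psi>_def algebra_simps abs_le_iff)
  have up: "\<bar>\<psi> y - \<psi> x\<bar> <= (2 * L + 1) * \<bar>y - x\<bar>" for x y
  proof -
    have "\<bar>\<psi> y - \<psi> x\<bar> = \<bar>(f y - f x) + (L + 1) * (y - x)\<bar>" by (simp add: \<psi>_def algebra_simps)
    also have "\<dots> <= \<bar>f y - f x\<bar> + (L+1) * \<bar>y - x\<bar>"
      using L0 abs_triangle_ineq[of "f y - f x" "(L + 1) * (y - x)"] by (simp add: abs_mult)
    finally show ?thesis using fl[of y x] by (simp add: algebra_simps)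
  qed
  have mono: "strict_mono \<psi>"
    by (rule strict_monoI) (use low in \<open>smt (verit)\<close>)
  have cont: "continuous_on UNIV \<psi>"
    unfolding \<psi>_def using lipschitz_on_continuous_on[OF lip] by (intro continuous_intros)
  have surj: "surj \<psi>"
  proof -
    have "\<exists>x. \<psi> x = y" for y
    proof -
      define b where "b = \<bar>y - \<psi> 0\<bar>"
      have "\<psi> (-b) <= y" "y <= \<psi> b" using low[of "-b" 0] low[of 0 b] by (auto simp: b_def)
      then show ?thesis using IVT'[of \<psi> "-b" y b] cont continuous_on_subset b_def by fastforce
    qed
    then show ?thesis by (metis surjI)
  qed
  have inj: "inj \<psi>" using mono strict_mono_on_imp_inj_on by blast
  define g where "g = inv \<psi>"
  have g\<psi>: "g (\<psi> x) = x" and \<psi>g: "\<psi> (g y) = y" for x y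
    using inj surj by (auto simp: g_def surj_f_inv_f)
  have gcont: "continuous_on UNIV g"
  proof -
    have "1-lipschitz_on UNIV g"
    proof (rule lipschitz_onI)
      fix x y :: real
      have "dist (g x) (g y) <= dist x y"
        using low[of "g x" "g y"] low[of "g y" "g x"] by (cases "g x <= g y") (auto simp: \<psi>g dist_real_def)
      then show "dist (g x) (g y) <= 1 * dist x y" by simp
    qed simp
    then show ?thesis by (rule lipschitz_on_continuous_on)
  qed
  then have gm [measurable]: "g \<in> borel_measurable borel" by (rule borel_measurable_continuous_onI)
  define \<mu> where "\<mu> = distr lborel borel g"
  have vim: "g -` A = \<psi> ` A" for A
    by (auto simp: g\<psi> \<psi>g image_iff) (metis \<psi>g)
  have em: "emeasure \<mu> A = emeasure lborel (\<psi> ` A)" if "A \<in> sets borel" for A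
    using that by (simp add: \<mu>_def emeasure_distr vim)
  have ac: "absolutely_continuous lborel \<mu>"
    unfolding absolutely_continuous_def
  proof
    fix A :: "real set" assume A: "A \<in> null_sets lborel"
    then have An: "negligible A" "A \<in> sets borel"
      by (auto simp: negligible_iff_null_sets null_sets_completionI)
    have "negligible (\<psi> ` A)"
    proof (rule negligible_locally_Lipschitz_image[OF _ An(1)])
      fix x assume "x \<in> A"
      show "\<exists>T B. open T \<and> x \<in> T \<and> (\<forall>y\<in>A \<inter> T. norm (\<psi> y - \<psi> x) <= B * norm (y - x))"
        using up by (intro exI[of _ UNIV] exI[of _ "2*L+1"]) auto
    qed simp
    moreover have "\<psi> ` A \<in> sets borel"
      using measurable_sets[OF gm An(2)] by (simp add: vim)
    ultimately have "emeasure lborel (\<psi> ` A) = 0"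
      by (metis negligible_iff_null_sets null_setsD1 null_sets_completion_iff sets_lborel)
    then show "A \<in> null_sets \<mu>" using em[OF An(2)] An(2) by (auto simp: null_sets_def \<mu>_def)
  qed
  obtain h where h [measurable]: "h \<in> borel_measurable lborel" and dens: "density lborel h = \<mu>"
    using sigma_finite_measure.Radon_Nikodym[OF sigma_finite_lborel ac] by (auto simp: \<mu>_def)
  have img: "\<psi> ` {a..b} = {\<psi> a..\<psi> b}" if "a <= b" for a b
  proof
    show "\<psi> ` {a..b} \<subseteq> {\<psi> a..\<psi> b}" using mono by (auto simp: strict_mono_less_eq)
    show "{\<psi> a..\<psi> b} \<subseteq> \<psi> ` {a..b}"
    proof
      fix y assume "y \<in> {\<psi> a..\<psi> b}"
      then have "g y \<in> {a..b}" using mono by (metis \<psi>g atLeastAtMost_iff strict_mono_less_eq)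
      then show "y \<in> \<psi> ` {a..b}" by (metis \<psi>g imageI)
    qed
  qed
  have nn: "(\<integral>\<^sup>+x. h x * indicator {a..b} x \<partial>lborel) = ennreal (\<psi> b - \<psi> a)" if "a <= b" for a b
  proof -
    have "(\<integral>\<^sup>+x. h x * indicator {a..b} x \<partial>lborel) = emeasure (density lborel h) {a..b}"
      by (simp add: emeasure_density)
    also have "\<dots> = emeasure lborel {\<psi> a..\<psi> b}" using dens em img[OF that] by simp
    also have "\<dots> = ennreal (\<psi> b - \<psi> a)" using mono that by (simp add: strict_mono_less_eq)
    finally show ?thesis .
  qed
  define k where "k x = enn2real (h x)" for x
  have km [measurable]: "k \<in> borel_measurable borel" unfolding k_def by measurable
  have hi: "(k has_integral (\<psi> b - \<psi> a)) {a..b}" if "a <= b" for a b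
  proof -
    have "AE x in lborel. h x * indicator {a..b} x \<noteq> \<infinity>"
      by (rule nn_integral_PInf_AE) (use nn[OF that] in auto)
    then have eq: "AE x in lborel. ennreal (k x * indicator {a..b} x) = h x * indicator {a..b} x"
      by eventually_elim (auto simp: k_def indicator_def less_top)
    have "(\<integral>\<^sup>+x. ennreal (k x * indicator {a..b} x) \<partial>lborel) = ennreal (\<psi> b - \<psi> a)"
      using nn_integral_cong_AE[OF eq] nn[OF that] by simp
    then have "((\<lambda>x. k x * indicator {a..b} x) has_integral (\<psi> b - \<psi> a)) UNIV"
      by (intro nn_integral_has_integral) (use mono that in \<open>auto simp: k_def strict_mono_less_eq\<close>)
    then have "((\<lambda>x. if x \<in> {a..b} then k x else 0) has_integral (\<psi> b - \<psi> a)) UNIV"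
      by (rule has_integral_eq[rotated]) auto
    then show ?thesis using has_integral_restrict_UNIV by blast
  qed
  have "k integrable_on cbox a b" for a b
    using hi[of a b] by (cases "a <= b") (auto simp: integrable_on_def)
  then obtain N where N: "negligible N" and
    NN: "!!x e. x \<notin> N ==> 0 < e ==> \<exists>d>0. \<forall>h. 0 < h \<and> h < d -->
        norm (integral (cbox x (x + h *\<^sub>R One)) k /\<^sub>R h ^ DIM(real) - k x) < e"
    using integrable_ccontinuous_explicit[of k] by blast
  show ?thesis
  proof (rule that[OF N])
    fix x assume "x \<notin> N"
    have "((\<lambda>h. (f (x + h) - f x) / h) \<longlongrightarrow> k x - (L + 1)) (at_right 0)"
    proof (rule tendstoI)
      fix e :: real assume "e > 0"
      then obtain d where d: "d > 0" "!!h. 0 < h ==> h < d ==>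
         norm (integral (cbox x (x + h *\<^sub>R One)) k /\<^sub>R h ^ DIM(real) - k x) < e"
        using NN[OF \<open>x \<notin> N\<close>] by blast
      have "dist ((f (x + h) - f x) / h) (k x - (L+1)) < e" if "0 < h" "h < d" for h
      proof -
        have "integral (cbox x (x + h *\<^sub>R One)) k = \<psi> (x + h) - \<psi> x"
          using hi[of x "x + h"] that by (auto intro: integral_unique)
        then have "norm ((\<psi> (x + h) - \<psi> x) / h - k x) < e"
          using d(2)[OF that] by (simp add: divide_inverse mult.commute)
        moreover have "(\<psi> (x + h) - \<psi> x) / h = (f (x + h) - f x) / h + (L + 1)"
          using that by (simp add: \<psi>_def field_simps)
        ultimately show ?thesis by (simp add: dist_real_def algebra_simps)
      qed
      then show "\<forall>\<^sub>F h in at_right 0. dist ((f (x + h) - f x) / h) (k x - (L+1)) < e"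
        using d(1) by (auto simp: eventually_at_right_field)
    qed
    then show "\<exists>l. ((\<lambda>h. (f (x + h) - f x) / h) \<longlongrightarrow> l) (at_right 0)" by blast
  qed
qed

definition dquot :: "('a::real_normed_vector => real) => 'a => nat => 'a => real" where
  "dquot F v n x = real (Suc n) * (F (x + v /\<^sub>R real (Suc n)) - F x)"

lemma dquot_bound:
  assumes lip: "L-lipschitz_on UNIV F"
  shows "\<bar>dquot F v n x\<bar> <= L * norm v"
proof -
  have "\<bar>F (x + v /\<^sub>R real (Suc n)) - F x\<bar> <= L * norm (v /\<^sub>R real (Suc n))"
    using lipschitz_onD[OF lip, of "x + v /\<^sub>R real (Suc n)" x] by (simp add: dist_norm)
  then have "real (Suc n) * \<bar>F (x + v /\<^sub>R real (Suc n)) - F x\<bar> <= real (Suc n) * (L * norm (v /\<^sub>R real (Suc n)))"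
    by (intro mult_left_mono) auto
  also have "\<dots> = L * norm v" by simp
  finally show ?thesis by (simp add: dquot_def abs_mult)
qed

lemma dquot_measurable:
  fixes F :: "'a::euclidean_space => real"
  assumes lip: "L-lipschitz_on UNIV F"
  shows "dquot F v n \<in> borel_measurable borel"
proof -
  have [measurable]: "F \<in> borel_measurable borel"
    using lipschitz_on_continuous_on[OF lip] by (rule borel_measurable_continuous_onI)
  show ?thesis unfolding dquot_def by measurable
qed

text \<open>
  By Fubini's theorem along lines in direction \<open>v\<close>, from the one-dimensional case.
\<close>

lemma lipschitz_directional_derivative_ae:
  fixes F :: "'a::euclidean_space => real" and v :: 'a
  assumes lip: "L-lipschitz_on UNIV F"
  shows "AE x in lborel. convergent (\<lambda>n. dquot F v n x)"
proof -
  define G where "G = {x. Cauchy (\<lambda>n. dquot F v n x)}"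
  have Gm: "G \<in> sets borel"
    using sets_Collect_Cauchy[of "dquot F v" borel] dquot_measurable[OF lip] by (simp add: G_def)
  have line: "AE t in lborel. x + t *\<^sub>R v \<in> G" for x
  proof -
    have lipt: "(norm v * L)-lipschitz_on UNIV (\<lambda>t. F (x + t *\<^sub>R v))"
    proof (rule lipschitz_onI)
      fix s t :: real
      have "dist (F (x + s *\<^sub>R v)) (F (x + t *\<^sub>R v)) <= L * dist (x + s *\<^sub>R v) (x + t *\<^sub>R v)"
        by (rule lipschitz_onD[OF lip]) auto
      also have "dist (x + s *\<^sub>R v) (x + t *\<^sub>R v) = norm v * dist s t"
        by (simp add: dist_norm flip: scaleR_diff_left)
      finally show "dist (F (x + s *\<^sub>R v)) (F (x + t *\<^sub>R v)) <= norm v * L * dist s t" by (simp add: algebra_simps)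
    qed (use lipschitz_on_nonneg[OF lip] in auto)
    obtain N where N: "negligible N"
      "!!t. t \<notin> N ==> \<exists>l. ((\<lambda>h. (F (x + (t + h) *\<^sub>R v) - F (x + t *\<^sub>R v)) / h) \<longlongrightarrow> l) (at_right 0)"
      by (rule lipschitz_real_right_derivative_ae[OF lipt]) (rule that, auto)
    have "x + t *\<^sub>R v \<in> G" if tN: "t \<notin> N" for t
    proof -
      obtain l where l: "((\<lambda>h. (F (x + (t + h) *\<^sub>R v) - F (x + t *\<^sub>R v)) / h) \<longlongrightarrow> l) (at_right 0)"
        using N(2)[OF tN] by blast
      have "filterlim (\<lambda>n. 1 / real (Suc n)) (at_right 0) sequentially"
        unfolding filterlim_at using LIMSEQ_inverse_real_of_nat by (simp add: inverse_eq_divide)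
      from filterlim_compose[OF l this]
      have "(\<lambda>n. (F (x + (t + 1 / real (Suc n)) *\<^sub>R v) - F (x + t *\<^sub>R v)) / (1 / real (Suc n))) \<longlonglongrightarrow> l" .
      moreover have "(F (x + (t + 1 / real (Suc n)) *\<^sub>R v) - F (x + t *\<^sub>R v)) / (1 / real (Suc n))
          = dquot F v n (x + t *\<^sub>R v)" for n
        by (simp add: dquot_def scaleR_add_left add.assoc inverse_eq_divide)
      ultimately have "(\<lambda>n. dquot F v n (x + t *\<^sub>R v)) \<longlonglongrightarrow> l" by simp
      then show ?thesis unfolding G_def using LIMSEQ_imp_Cauchy by blast
    qed
    then have "AE t in lebesgue. x + t *\<^sub>R v \<in> G"
      using N(1) by (auto simp: negligible_iff_null_sets intro!: AE_I'[of N])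
    then show ?thesis by (simp add: AE_completion_iff)
  qed
  have "emeasure lborel (- G) = (\<integral>\<^sup>+ t. emeasure lborel (-G) * indicator {0..1} t \<partial>(lborel :: real measure))"
    by (simp add: nn_integral_cmult)
  also have "\<dots> = (\<integral>\<^sup>+ t. (\<integral>\<^sup>+ x. indicator (-G) (x + t *\<^sub>R v) * indicator {0..1} t \<partial>lborel) \<partial>(lborel :: real measure))"
  proof (intro nn_integral_cong)
    fix t :: real
    have "emeasure lborel (-G) = emeasure (distr lborel borel ((+) (t *\<^sub>R v))) (-G)"
      by (simp add: lborel_distr_plus)
    also have "\<dots> = (\<integral>\<^sup>+ x. indicator (-G) (x + t *\<^sub>R v) \<partial>lborel)"
      using Gm by (subst nn_integral_indicator[symmetric], simp, subst nn_integral_distr) (auto simp: add.commute)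
    finally show "emeasure lborel (- G) * indicator {0..1} t =
        (\<integral>\<^sup>+ x. indicator (-G) (x + t *\<^sub>R v) * indicator {0..1} t \<partial>lborel)"
      using Gm by (subst nn_integral_multc) auto
  qed
  also have "\<dots> = (\<integral>\<^sup>+ x. (\<integral>\<^sup>+ t. indicator (-G) (x + t *\<^sub>R v) * indicator {0..1} t \<partial>(lborel :: real measure)) \<partial>lborel)"
  proof -
    define iG where "iG = (indicator (-G) :: 'a => ennreal)"
    define i1 where "i1 = (indicator {0..1} :: real => ennreal)"
    have [measurable]: "iG \<in> borel_measurable borel" "i1 \<in> borel_measurable borel"
      using Gm by (auto simp: iG_def i1_def)
    have "(\<integral>\<^sup>+ t. (\<integral>\<^sup>+ x. iG (x + t *\<^sub>R v) * i1 t \<partial>lborel) \<partial>lborel) =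
        (\<integral>\<^sup>+ x. (\<integral>\<^sup>+ t. iG (x + t *\<^sub>R v) * i1 t \<partial>lborel) \<partial>lborel)"
      by (rule lborel_pair.Fubini') measurable
    then show ?thesis by (simp add: iG_def i1_def)
  qed
  also have "\<dots> = (\<integral>\<^sup>+ x. 0 \<partial>(lborel :: 'a measure))"
  proof (intro nn_integral_cong)
    fix x :: 'a
    have "AE t in lborel. indicator (-G) (x + t *\<^sub>R v) * indicator {0..1} t = (0::ennreal)"
      using line[of x] by eventually_elim auto
    then have "(\<integral>\<^sup>+ t. indicator (-G) (x + t *\<^sub>R v) * indicator {0..1} t \<partial>lborel) = (\<integral>\<^sup>+ t. 0 \<partial>(lborel :: real measure))"
      by (rule nn_integral_cong_AE)
    then show "(\<integral>\<^sup>+ t. indicator (-G) (x + t *\<^sub>R v) * indicator {0..1} t \<partial>lborel) = 0" by simp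
  qed
  finally have "emeasure lborel (- G) = 0" by simp
  then have "AE x in lborel. x \<in> G" using Gm by (intro AE_I'[of "-G"]) auto
  then show ?thesis by eventually_elim (simp add: G_def Cauchy_convergent_iff)
qed

definition dlim :: "('a::real_normed_vector => real) => 'a => 'a => real" where
  "dlim F v x = lim (\<lambda>n. dquot F v n x)"

lemma dlim_measurable:
  fixes F :: "'a::euclidean_space => real"
  assumes "L-lipschitz_on UNIV F"
  shows "dlim F v \<in> borel_measurable borel"
  unfolding dlim_def by (intro borel_measurable_lim_metric dquot_measurable[OF assms])

lemma dquot_tendsto_dlim: "convergent (\<lambda>n. dquot F v n x) ==> (\<lambda>n. dquot F v n x) \<longlonglongrightarrow> dlim F v x"
  by (simp add: dlim_def convergent_LIMSEQ_iff)

lemma dlim_right_limit: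
  fixes F :: "'a::euclidean_space => real"
  assumes lip: "L-lipschitz_on UNIV F" and conv: "convergent (\<lambda>n. dquot F v n x)"
  shows "((\<lambda>h. (F (x + h *\<^sub>R v) - F x) / h) \<longlongrightarrow> dlim F v x) (at_right 0)"
proof (rule tendstoI)
  fix e :: real assume e: "e > 0"
  define l where "l = dlim F v x"
  define C where "C = L * norm v + \<bar>l\<bar>"
  have C0: "C >= 0" using lipschitz_on_nonneg[OF lip] by (simp add: C_def)
  have "\<forall>\<^sub>F n in sequentially. dist (dquot F v n x) l < e / 4"
    using dquot_tendsto_dlim[OF conv] e unfolding l_def by (intro tendstoD) auto
  then obtain n0 where n0: "!!n. n >= n0 ==> \<bar>dquot F v n x - l\<bar> < e / 4"
    by (auto simp: eventually_sequentially dist_real_def)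
  define d where "d = min (1/2) (min (1 / (real n0 + 2)) (e / (4 * (C + 1))))"
  have d: "d > 0" using e C0 by (simp add: d_def)
  have "\<bar>(F (x + h *\<^sub>R v) - F x) / h - l\<bar> < e" if h: "0 < h" "h < d" for h
  proof -
    define m where "m = nat \<lfloor>1 / h\<rfloor>"
    have h2: "h < 1/2" "h < 1 / (real n0 + 2)" "h < e / (4 * (C+1))" using h by (auto simp: d_def)
    have "1 / h > real n0 + 2" using h2(2) h(1) by (simp add: field_simps)
    then have fl: "\<lfloor>1 / h\<rfloor> >= int n0 + 1" by linarith
    have m1: "real m <= 1 / h" "1 / h < real m + 1" "m >= n0 + 1"
      using fl by (auto simp: m_def of_nat_nat) (use fl in linarith)+
    have mpos: "real m > 0" using m1(3) by simp
    have mh: "real m * h <= 1" "1 < real m * h + h" using m1 h(1) by (auto simp: field_simps)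
    have "1 / real m - h = (1 - real m * h) / real m" using mpos by (simp add: field_simps)
    then have im: "1 / real m - h >= 0" "1 / real m - h <= h / real m"
      using mh mpos by (auto intro!: divide_right_mono)
    define n where "n = m - 1"
    have mn: "m = Suc n" "n >= n0" using m1(3) by (auto simp: n_def)
    have A: "\<bar>F (x + (1 / real m) *\<^sub>R v) - F x - l / real m\<bar> <= e / 4 / real m"
    proof -
      have "F (x + (1 / real m) *\<^sub>R v) - F x - l / real m = (dquot F v n x - l) / real m"
        using mpos by (simp add: dquot_def mn(1) inverse_eq_divide field_simps)
      also have "\<bar>\<dots>\<bar> = \<bar>dquot F v n x - l\<bar> / real m" using mpos by (simp add: abs_divide)
      also have "\<dots> <= e / 4 / real m"
        using n0[OF mn(2)] mpos by (intro divide_right_mono) auto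
      finally show ?thesis .
    qed
    have B: "\<bar>F (x + h *\<^sub>R v) - F (x + (1 / real m) *\<^sub>R v)\<bar> <= L * norm v * (1 / real m - h)"
    proof -
      have "\<bar>F (x + h *\<^sub>R v) - F (x + (1 / real m) *\<^sub>R v)\<bar> <= L * dist (x + h *\<^sub>R v) (x + (1 / real m) *\<^sub>R v)"
        using lipschitz_onD[OF lip, of "x + h *\<^sub>R v" "x + (1 / real m) *\<^sub>R v"] by (simp add: dist_real_def)
      also have "dist (x + h *\<^sub>R v) (x + (1 / real m) *\<^sub>R v) = norm v * (1 / real m - h)"
        using im by (simp add: dist_norm flip: scaleR_diff_left)
      finally show ?thesis by (simp add: mult.assoc)
    qed
    have "\<bar>F (x + h *\<^sub>R v) - F x - h * l\<bar>
       <= \<bar>F (x + h *\<^sub>R v) - F (x + (1 / real m) *\<^sub>R v)\<bar> + \<bar>F (x + (1 / real m) *\<^sub>R v) - F x - l / real m\<bar> + \<bar>l / real m - h * l\<bar>"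
      by linarith
    also have "\<bar>l / real m - h * l\<bar> = \<bar>l\<bar> * (1 / real m - h)"
    proof -
      have "l / real m - h * l = l * (1 / real m - h)" by (simp add: algebra_simps)
      then show ?thesis using im by (simp add: abs_mult)
    qed
    finally have "\<bar>F (x + h *\<^sub>R v) - F x - h * l\<bar> <= C * (1 / real m - h) + e / 4 / real m"
      using A B by (simp add: C_def algebra_simps)
    also have "\<dots> <= C * (h / real m) + e / 4 / real m" using im C0 by (intro add_mono mult_left_mono) auto
    finally have D: "\<bar>F (x + h *\<^sub>R v) - F x - h * l\<bar> <= (C * h + e / 4) * (1 / real m)" by (simp add: algebra_simps)
    have "1 / real m <= 2 * h"
    proof -
      have "1 <= 2 * (real m * h)" using mh(2) h2(1) by linarith
      then show ?thesis using mpos by (simp add: field_simps)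
    qed
    then have "\<bar>F (x + h *\<^sub>R v) - F x - h * l\<bar> <= (C * h + e / 4) * (2 * h)"
      using D C0 h(1) e by (meson add_nonneg_nonneg divide_nonneg_pos less_imp_le mult_left_mono mult_nonneg_nonneg order_trans zero_less_numeral)
    then have "\<bar>F (x + h *\<^sub>R v) - F x - h * l\<bar> / h <= 2 * C * h + e / 2"
      using h(1) by (simp add: field_simps)
    moreover have "2 * C * h < e / 2"
    proof -
      have "h * (4 * (C+1)) < e" using h2(3) C0 by (simp add: field_simps)
      then have "4 * (C * h) + 4 * h < e" by (simp add: algebra_simps)
      then show ?thesis using h(1) by (simp add: algebra_simps)
    qed
    moreover have "\<bar>(F (x + h *\<^sub>R v) - F x) / h - l\<bar> = \<bar>F (x + h *\<^sub>R v) - F x - h * l\<bar> / h"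
    proof -
      have "(F (x + h *\<^sub>R v) - F x) / h - l = (F (x + h *\<^sub>R v) - F x - h * l) / h"
        using h(1) by (simp add: field_simps)
      then show ?thesis using h(1) by (simp add: abs_divide)
    qed
    ultimately show ?thesis by linarith
  qed
  then show "\<forall>\<^sub>F h in at_right 0. dist ((F (x + h *\<^sub>R v) - F x) / h) (dlim F v x) < e"
    using d by (auto simp: eventually_at_right_field dist_real_def l_def)
qed

lemma integral_box_zero_imp_AE_zero:
  fixes d :: "'a::euclidean_space => real"
  assumes int: "!!a b. (d has_integral 0) (cbox a b)"
  shows "AE x in lborel. d x = 0"
proof -
  have "d integrable_on cbox a b" for a b using int by blast
  then obtain N where N: "negligible N" and
    NN: "!!x e. x \<notin> N ==> 0 < e ==> \<exists>t>0. \<forall>h. 0 < h \<and> h < t -->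
        norm (integral (cbox x (x + h *\<^sub>R One)) d /\<^sub>R h ^ DIM('a) - d x) < e"
    using integrable_ccontinuous_explicit[of d] by blast
  have "d x = 0" if xN: "x \<notin> N" for x
  proof (rule ccontr)
    assume "d x \<noteq> 0"
    then obtain t where "t > 0" and t: "!!h. 0 < h ==> h < t ==>
        norm (integral (cbox x (x + h *\<^sub>R One)) d /\<^sub>R h ^ DIM('a) - d x) < \<bar>d x\<bar>"
      using NN[OF xN, of "\<bar>d x\<bar>"] by auto
    have "integral (cbox x (x + (t/2) *\<^sub>R One)) d = 0" using int by (rule integral_unique)
    then show False using t[of "t/2"] \<open>t > 0\<close> by simp
  qed
  then have "AE x in lebesgue. d x = 0"
    using N by (auto simp: negligible_iff_null_sets intro!: AE_I'[of N])
  then show ?thesis by (simp add: AE_completion_iff)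
qed

lemma AE_not_frontier_cbox: "AE x in lborel. x \<notin> frontier (cbox a (b::'a::euclidean_space))"
proof -
  have "negligible (frontier (cbox a b))" by (simp add: negligible_convex_frontier)
  then have "AE x in lebesgue. x \<notin> frontier (cbox a b)"
    by (auto simp: negligible_iff_null_sets intro!: AE_I'[of "frontier (cbox a b)"])
  then show ?thesis by (simp add: AE_completion_iff)
qed

text \<open>
  Additivity is not a pointwise fact.  It holds almost everywhere because the integral of a difference
  quotient over a box depends linearly on the direction in the limit, and a function whose integral over every
  box vanishes is zero almost everywhere.
\<close>

lemma dlim_add:
  fixes F :: "'a::euclidean_space => real"
  assumes lip: "L-lipschitz_on UNIV F"
  shows "AE x in lborel. dlim F (v + w) x = dlim F v x + dlim F w x"
proof -
  note AEc = lipschitz_directional_derivative_ae[OF lip]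
  have [measurable]: "dquot F u n \<in> borel_measurable borel" "dlim F u \<in> borel_measurable borel" for u n
    using dquot_measurable[OF lip] dlim_measurable[OF lip] by auto
  have L0: "L >= 0" using lipschitz_on_nonneg[OF lip] .
  define d where "d x = dlim F (v + w) x - dlim F v x - dlim F w x" for x
  have "(d has_integral 0) (cbox a b)" for a b
  proof -
    define ind where "ind = (indicator (cbox a b) :: 'a => real)"
    have [measurable]: "ind \<in> borel_measurable borel" by (simp add: ind_def)
    have iint: "integrable lborel ind" by (simp add: ind_def emeasure_lborel_cbox_eq)
    have dom: "(\<lambda>n. \<integral>x. ind x * dquot F u n x \<partial>lborel) \<longlonglongrightarrow> (\<integral>x. ind x * dlim F u x \<partial>lborel)"
      "integrable lborel (\<lambda>x. ind x * dlim F u x)" "!!n. integrable lborel (\<lambda>x. ind x * dquot F u n x)" for u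
    proof -
      have w: "integrable lborel (\<lambda>x. ind x * (L * norm u))" using iint by simp
      have l: "AE x in lborel. (\<lambda>n. ind x * dquot F u n x) \<longlonglongrightarrow> ind x * dlim F u x"
        using AEc[of u] by eventually_elim (intro tendsto_mult tendsto_const dquot_tendsto_dlim)
      have b: "!!n. AE x in lborel. norm (ind x * dquot F u n x) <= ind x * (L * norm u)"
        using dquot_bound[OF lip] by (intro AE_I2) (auto simp: ind_def indicator_def)
      show "(\<lambda>n. \<integral>x. ind x * dquot F u n x \<partial>lborel) \<longlonglongrightarrow> (\<integral>x. ind x * dlim F u x \<partial>lborel)"
        by (rule integral_dominated_convergence[OF _ _ w l b]) auto
      show "integrable lborel (\<lambda>x. ind x * dlim F u x)"
        by (rule integrable_dominated_convergence[OF _ _ w l b]) auto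
      show "integrable lborel (\<lambda>x. ind x * dquot F u n x)" for n
      proof (rule Bochner_Integration.integrable_bound[OF w])
        show "AE x in lborel. norm (ind x * dquot F u n x) <= norm (ind x * (L * norm u))"
          using b[of n] by eventually_elim auto
      qed measurable
    qed
    define sh where "sh n = v /\<^sub>R real (Suc n)" for n
    have sh0: "sh \<longlonglongrightarrow> 0"
      unfolding sh_def using tendsto_scaleR[OF LIMSEQ_inverse_real_of_nat tendsto_const, of v] by simp
    have shn: "norm (sh n) <= norm v" for n
    proof -
      have "norm v * 1 <= norm v * (1 + real n)" by (intro mult_left_mono) auto
      then show ?thesis by (simp add: sh_def field_simps)
    qed
    obtain R where R: "!!x. x \<in> cbox a b ==> norm x <= R"
      using bounded_cbox[of a b] unfolding bounded_iff by blast
    define big where "big = (indicator (cball 0 (R + norm v)) :: 'a => real)"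
    have sub: "ind (y - sh n) <= big y" for y n
    proof -
      have "y \<in> cball 0 (R + norm v)" if m: "y - sh n \<in> cbox a b"
      proof -
        have "norm (y - sh n) <= R" using R[OF m] .
        then show ?thesis using shn[of n] norm_triangle_ineq[of "y - sh n" "sh n"] by simp
      qed
      then show ?thesis by (auto simp: ind_def big_def indicator_def)
    qed
    have lim2: "(\<lambda>n. \<integral>y. ind (y - sh n) * dquot F w n y \<partial>lborel) \<longlonglongrightarrow> (\<integral>y. ind y * dlim F w y \<partial>lborel)"
    proof (rule integral_dominated_convergence[where w="\<lambda>y. big y * (L * norm w)"])
      show "integrable lborel (\<lambda>y. big y * (L * norm w))"
        unfolding big_def by (intro integrable_mult_left integrable_real_indicator emeasure_lborel_cball_finite) auto
      show "AE y in lborel. (\<lambda>n. ind (y - sh n) * dquot F w n y) \<longlonglongrightarrow> ind y * dlim F w y"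
        using AEc[of w] AE_not_frontier_cbox[of a b]
      proof eventually_elim
        fix y assume y: "convergent (\<lambda>n. dquot F w n y)" "y \<notin> frontier (cbox a b)"
        have "(\<lambda>n. y - sh n) \<longlonglongrightarrow> y" using tendsto_diff[OF tendsto_const sh0, of y] by simp
        moreover have "y \<in> interior (cbox a b) \<or> y \<in> - closure (cbox a b)"
          using y(2) by (auto simp: frontier_def)
        ultimately have "\<forall>\<^sub>F n in sequentially. ind (y - sh n) = ind y"
        proof (elim disjE)
          assume i: "y \<in> interior (cbox a b)" and l: "(\<lambda>n. y - sh n) \<longlonglongrightarrow> y"
          have "\<forall>\<^sub>F n in sequentially. y - sh n \<in> interior (cbox a b)"
            using topological_tendstoD[OF l open_interior i] .
          then show ?thesis
            by eventually_elim (use i interior_subset[of "cbox a b"] in \<open>auto simp: ind_def indicator_def\<close>)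
        next
          assume i: "y \<in> - closure (cbox a b)" and l: "(\<lambda>n. y - sh n) \<longlonglongrightarrow> y"
          have "\<forall>\<^sub>F n in sequentially. y - sh n \<in> - closure (cbox a b)"
            using topological_tendstoD[OF l _ i] by auto
          then show ?thesis
            by eventually_elim (use i in \<open>auto simp: ind_def indicator_def\<close>)
        qed
        then have "(\<lambda>n. ind (y - sh n)) \<longlonglongrightarrow> ind y" by (rule tendsto_eventually)
        then show "(\<lambda>n. ind (y - sh n) * dquot F w n y) \<longlonglongrightarrow> ind y * dlim F w y"
          by (intro tendsto_mult dquot_tendsto_dlim y)
      qed
      show "AE y in lborel. norm (ind (y - sh n) * dquot F w n y) <= big y * (L * norm w)" for n
      proof (intro AE_I2)
        fix y
        have "\<bar>ind (y - sh n)\<bar> * \<bar>dquot F w n y\<bar> <= big y * (L * norm w)"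
          using sub[where y=y and n=n] dquot_bound[OF lip, of w n y]
          by (intro mult_mono) (auto simp: ind_def big_def indicator_def)
        then show "norm (ind (y - sh n) * dquot F w n y) <= big y * (L * norm w)" by (simp add: abs_mult)
      qed
    qed auto
    have eq: "(\<integral>x. ind x * dquot F (v + w) n x \<partial>lborel)
       = (\<integral>y. ind (y - sh n) * dquot F w n y \<partial>lborel) + (\<integral>x. ind x * dquot F v n x \<partial>lborel)" for n
    proof -
      have "(\<integral>y. ind (y - sh n) * dquot F w n y \<partial>lborel) = (\<integral>x. ind x * dquot F w n (x + sh n) \<partial>lborel)"
        by (subst lborel_distr_plus[of "sh n", symmetric], subst integral_distr) (auto simp: add.commute)
      moreover have "integrable lborel (\<lambda>x. ind x * dquot F w n (x + sh n))"
      proof (rule Bochner_Integration.integrable_bound)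
        show "integrable lborel (\<lambda>x. ind x * (L * norm w))" using iint by simp
        show "AE x in lborel. norm (ind x * dquot F w n (x + sh n)) <= norm (ind x * (L * norm w))"
          using dquot_bound[OF lip, of w n] L0 by (intro AE_I2) (auto simp: ind_def indicator_def)
      qed measurable
      moreover have "ind x * dquot F (v + w) n x = ind x * dquot F w n (x + sh n) + ind x * dquot F v n x" for x
      proof -
        have "dquot F (v + w) n x = dquot F w n (x + sh n) + dquot F v n x"
          by (simp add: dquot_def sh_def scaleR_add_right algebra_simps)
        then show ?thesis by (simp add: algebra_simps)
      qed
      ultimately show ?thesis using dom(3)[of v n] by (simp add: Bochner_Integration.integral_add)
    qed
    have "(\<lambda>n. \<integral>x. ind x * dquot F (v + w) n x \<partial>lborel) \<longlonglongrightarrow>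
        (\<integral>y. ind y * dlim F w y \<partial>lborel) + (\<integral>x. ind x * dlim F v x \<partial>lborel)"
      unfolding eq by (intro tendsto_add lim2 dom(1))
    then have tot: "(\<integral>x. ind x * dlim F (v+w) x \<partial>lborel) =
        (\<integral>y. ind y * dlim F w y \<partial>lborel) + (\<integral>x. ind x * dlim F v x \<partial>lborel)"
      using LIMSEQ_unique dom(1)[of "v+w"] by blast
    have "integrable lborel (\<lambda>x. ind x * d x)"
      unfolding d_def right_diff_distrib by (intro Bochner_Integration.integrable_diff dom(2))
    moreover have "(\<integral>x. ind x * d x \<partial>lborel) = 0"
      unfolding d_def right_diff_distrib using tot dom(2) by (simp add: Bochner_Integration.integral_diff)
    ultimately have "((\<lambda>x. ind x * d x) has_integral 0) UNIV"
      using has_integral_integral_lborel[of "\<lambda>x. ind x * d x"] by simp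
    then have "((\<lambda>x. if x \<in> cbox a b then d x else 0) has_integral 0) UNIV"
      by (rule has_integral_eq[rotated]) (auto simp: ind_def indicator_def)
    then show ?thesis using has_integral_restrict_UNIV by blast
  qed
  from integral_box_zero_imp_AE_zero[OF this] show ?thesis
    by eventually_elim (simp add: d_def)
qed

lemma dlim_scaleR_pos:
  fixes F :: "'a::euclidean_space => real"
  assumes lip: "L-lipschitz_on UNIV F" and c: "c > 0"
    and conv: "convergent (\<lambda>n. dquot F v n x)" "convergent (\<lambda>n. dquot F (c *\<^sub>R v) n x)"
  shows "dlim F (c *\<^sub>R v) x = c * dlim F v x"
proof -
  have f: "filterlim (\<lambda>h. h * c) (at_right 0) (at_right (0::real))"
  proof -
    have "((\<lambda>h. h * c) \<longlongrightarrow> 0) (at_right (0::real))"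
      by (rule tendsto_eq_intros refl | simp)+
    moreover have "\<forall>\<^sub>F h in at_right (0::real). h * c > 0"
      using c by (auto simp: eventually_at_right_field)
    ultimately show ?thesis by (rule tendsto_imp_filterlim_at_right)
  qed
  have "((\<lambda>h. c * ((F (x + (h * c) *\<^sub>R v) - F x) / (h * c))) \<longlongrightarrow> c * dlim F v x) (at_right 0)"
    by (intro tendsto_mult tendsto_const filterlim_compose[OF dlim_right_limit[OF lip conv(1)] f])
  then have "((\<lambda>h. (F (x + h *\<^sub>R c *\<^sub>R v) - F x) / h) \<longlongrightarrow> c * dlim F v x) (at_right 0)"
    using c by simp
  then show ?thesis
    using tendsto_unique[OF _ dlim_right_limit[OF lip conv(2)]] by force
qed

lemma dlim_zero: "dlim F 0 x = 0"
  by (simp add: dlim_def dquot_def)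

lemma dlim_scaleR:
  fixes F :: "'a::euclidean_space => real"
  assumes lip: "L-lipschitz_on UNIV F"
  shows "AE x in lborel. dlim F (c *\<^sub>R v) x = c * dlim F v x"
proof -
  note AEc = lipschitz_directional_derivative_ae[OF lip]
  have neg: "AE x in lborel. dlim F (- v) x = - dlim F v x" for v
    using dlim_add[OF lip, of v "- v"] by eventually_elim (simp add: dlim_zero)
  consider "c = 0" | "c > 0" | "c < 0" by linarith
  then show ?thesis
  proof cases
    case 1 then show ?thesis by (simp add: dlim_zero)
  next
    case 2
    show ?thesis using AEc[of v] AEc[of "c *\<^sub>R v"]
      by eventually_elim (rule dlim_scaleR_pos[OF lip 2])
  next
    case 3
    then have "- c > 0" by simp
    show ?thesis using AEc[of v] AEc[of "(- c) *\<^sub>R v"] neg[of "(-c) *\<^sub>R v"]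
    proof eventually_elim
      case (elim x)
      then show ?case using dlim_scaleR_pos[OF lip \<open>- c > 0\<close> elim(1,2)] by simp
    qed
  qed
qed

lemma dlim_linear_ae:
  fixes F :: "'a::euclidean_space => real"
  assumes lip: "L-lipschitz_on UNIV F"
  shows "AE x in lborel. dlim F v x = (\<Sum>i\<in>Basis. (v \<bullet> i) * dlim F i x)"
proof -
  have "AE x in lborel. dlim F (\<Sum>i\<in>A. (v \<bullet> i) *\<^sub>R i) x = (\<Sum>i\<in>A. (v \<bullet> i) * dlim F i x)"
    if "finite A" for A using that
  proof induction
    case empty then show ?case by (simp add: dlim_zero)
  next
    case (insert a A)
    show ?case using insert.IH dlim_scaleR[OF lip, of "v \<bullet> a" a]
        dlim_add[OF lip, of "(v \<bullet> a) *\<^sub>R a" "\<Sum>i\<in>A. (v \<bullet> i) *\<^sub>R i"]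
      by eventually_elim (simp add: insert.hyps)
  qed
  from this[OF finite_Basis] show ?thesis by (simp add: euclidean_representation)
qed

text \<open>
  Directional derivatives are linear in the direction at almost every point; for a countable dense set of
  directions this holds simultaneously, and the Lipschitz bound passes from these to all directions uniformly.
\<close>

theorem rademacher:
  fixes F :: "'a::euclidean_space => real"
  assumes lip: "L-lipschitz_on UNIV F"
  shows "AE x in lborel. \<exists>T. \<forall>e>0. \<exists>d>0. \<forall>h. norm h < d --> \<bar>F (x + h) - F x - T \<bullet> h\<bar> <= e * norm h"
proof -
  have L0: "L >= 0" using lipschitz_on_nonneg[OF lip] .
  obtain V :: "'a set" where V: "countable V" "UNIV \<subseteq> closure V" using separable[of UNIV] by auto
  have "AE x in lborel. \<forall>v\<in>V. convergent (\<lambda>n. dquot F v n x)"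
    using V(1) lipschitz_directional_derivative_ae[OF lip] by (simp add: AE_ball_countable)
  moreover have "AE x in lborel. \<forall>v\<in>V. dlim F v x = (\<Sum>i\<in>Basis. (v \<bullet> i) * dlim F i x)"
    using V(1) dlim_linear_ae[OF lip] by (simp add: AE_ball_countable)
  ultimately show ?thesis
  proof eventually_elim
    fix x assume cv: "\<forall>v\<in>V. convergent (\<lambda>n. dquot F v n x)"
      and lin: "\<forall>v\<in>V. dlim F v x = (\<Sum>i\<in>Basis. (v \<bullet> i) * dlim F i x)"
    define T where "T = (\<Sum>i\<in>Basis. dlim F i x *\<^sub>R i)"
    have Tv: "dlim F v x = T \<bullet> v" if "v \<in> V" for v
    proof -
      have "T \<bullet> v = (\<Sum>i\<in>Basis. dlim F i x * (i \<bullet> v))" by (simp add: T_def inner_sum_left)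
      also have "\<dots> = (\<Sum>i\<in>Basis. (v \<bullet> i) * dlim F i x)" by (simp add: inner_commute mult.commute)
      finally show ?thesis using lin that by simp
    qed
    show "\<exists>T. \<forall>e>0. \<exists>d>0. \<forall>h. norm h < d --> \<bar>F (x + h) - F x - T \<bullet> h\<bar> <= e * norm h"
    proof (intro exI[of _ T] allI impI)
      fix e :: real assume e: "e > 0"
      define c where "c = e / (2 * (L + norm T + 1))"
      have c: "c > 0" using e L0 by (simp add: c_def add_nonneg_pos)
      have "sphere (0::'a) 1 \<subseteq> (\<Union>v\<in>V. ball v c)"
      proof
        fix u :: 'a
        have "u \<in> closure V" using V(2) by auto
        then obtain v where "v \<in> V" "dist v u < c" using c unfolding closure_approachable by blast
        then show "u \<in> (\<Union>v\<in>V. ball v c)" by auto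
      qed
      then obtain W where W: "W \<subseteq> V" "finite W" "sphere (0::'a) 1 \<subseteq> (\<Union>v\<in>W. ball v c)"
        using compactE_image[OF compact_sphere, of V "\<lambda>v. ball v c" 0 1] by auto
      have "\<forall>\<^sub>F h in at_right 0. dist ((F (x + h *\<^sub>R v) - F x) / h) (T \<bullet> v) < e / 2" if "v \<in> W" for v
        using dlim_right_limit[OF lip] cv Tv W(1) that e by (intro tendstoD) (auto simp flip: Tv)
      then have "\<forall>\<^sub>F h in at_right 0. \<forall>v\<in>W. dist ((F (x + h *\<^sub>R v) - F x) / h) (T \<bullet> v) < e / 2"
        using W(2) by (simp add: eventually_ball_finite)
      then obtain d where d: "d > 0" "!!h v. 0 < h ==> h < d ==> v \<in> W ==>
          dist ((F (x + h *\<^sub>R v) - F x) / h) (T \<bullet> v) < e / 2"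
        by (auto simp: eventually_at_right_field)
      show "\<exists>d>0. \<forall>h. norm h < d --> \<bar>F (x + h) - F x - T \<bullet> h\<bar> <= e * norm h"
      proof (intro exI[of _ d] conjI d(1) allI impI)
        fix h :: 'a assume hd: "norm h < d"
        show "\<bar>F (x + h) - F x - T \<bullet> h\<bar> <= e * norm h"
        proof (cases "h = 0")
          case True then show ?thesis by simp
        next
          case False
          define s where "s = norm h"
          have s: "s > 0" "s < d" using False hd by (auto simp: s_def)
          have "h /\<^sub>R s \<in> sphere 0 1" using s by (simp add: s_def)
          then have "h /\<^sub>R s \<in> (\<Union>v\<in>W. ball v c)" by (rule subsetD[OF W(3)])
          then obtain v where v: "v \<in> W" "dist v (h /\<^sub>R s) < c" by auto
          have hv: "norm (h - s *\<^sub>R v) <= s * c"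
          proof -
            have "h - s *\<^sub>R v = s *\<^sub>R (h /\<^sub>R s - v)" using s by (simp add: algebra_simps)
            then have "norm (h - s *\<^sub>R v) = s * dist v (h /\<^sub>R s)" using s by (simp add: dist_norm norm_minus_commute)
            then show ?thesis using v(2) s by simp
          qed
          have "dist ((F (x + s *\<^sub>R v) - F x) / s) (T \<bullet> v) < e / 2" using d(2) s v by blast
          then have "\<bar>(F (x + s *\<^sub>R v) - F x) / s - T \<bullet> v\<bar> * s <= e / 2 * s"
            using s by (intro mult_right_mono) (auto simp: dist_real_def)
          moreover have "\<bar>(F (x + s *\<^sub>R v) - F x) / s - T \<bullet> v\<bar> * s = \<bar>F (x + s *\<^sub>R v) - F x - s * (T \<bullet> v)\<bar>"
          proof -
            have "\<bar>(F (x + s *\<^sub>R v) - F x) / s - T \<bullet> v\<bar> * s = \<bar>((F (x + s *\<^sub>R v) - F x) / s - T \<bullet> v) * s\<bar>"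
              using s by (simp add: abs_mult)
            also have "((F (x + s *\<^sub>R v) - F x) / s - T \<bullet> v) * s = F (x + s *\<^sub>R v) - F x - s * (T \<bullet> v)"
              using s by (simp add: field_simps)
            finally show ?thesis .
          qed
          ultimately have 1: "\<bar>F (x + s *\<^sub>R v) - F x - s * (T \<bullet> v)\<bar> <= e / 2 * s" by simp
          have 2: "\<bar>F (x + h) - F (x + s *\<^sub>R v)\<bar> <= L * norm (h - s *\<^sub>R v)"
            using lipschitz_onD[OF lip, of "x + h" "x + s *\<^sub>R v"] by (simp add: dist_norm)
          have 3: "\<bar>T \<bullet> h - s * (T \<bullet> v)\<bar> <= norm T * norm (h - s *\<^sub>R v)"
            using Cauchy_Schwarz_ineq2[of T "h - s *\<^sub>R v"] by (simp add: inner_diff_right)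
          have 4: "\<bar>F (x + h) - F x - T \<bullet> h\<bar> <= e / 2 * s + (L + norm T) * norm (h - s *\<^sub>R v)"
            using 1 2 3 unfolding distrib_right by linarith
          have "(L + norm T) * norm (h - s *\<^sub>R v) <= (L + norm T) * (s * c)"
            using hv L0 by (intro mult_left_mono) auto
          also have "\<dots> <= (L + norm T + 1) * (s * c)" using s c by (intro mult_right_mono) auto
          also have "\<dots> = e / 2 * s"
          proof -
            define m where "m = L + norm T + 1"
            have "m > 0" using L0 by (simp add: m_def add_nonneg_pos)
            then show ?thesis unfolding c_def m_def[symmetric] by (simp add: field_simps)
          qed
          finally show ?thesis using 4 by (simp add: s_def)
        qed
      qed
    qed
  qed
qed

section \<open>Second-order expansions at maxima of sums of semiconvex functions\<close>

definition peano2 :: "('a::real_inner => real) => 'a => 'a => ('a => 'a) => bool" where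
  "peano2 f z p B \<longleftrightarrow>
     (\<forall>e>0. \<exists>d>0. \<forall>h. norm h < d --> \<bar>f (z + h) - f z - p \<bullet> h - (1/2) * (h \<bullet> B h)\<bar> <= e * (norm h)\<^sup>2)"

text \<open>
  Affine control with a quadratic error from both sides: the pointwise form of a \<open>C\<^sup>1\<^sup>,\<^sup>1\<close> bound.
\<close>

definition pinched :: "'a set => real => ('a::real_inner => real) => 'a => 'a => bool" where
  "pinched D C f z p \<longleftrightarrow> (\<forall>w\<in>D. \<bar>f w - f z - p \<bullet> (w - z)\<bar> <= C * (norm (w - z))\<^sup>2)"

lemma affine_le_quadratic_imp_zero:
  fixes p :: "'a::real_inner"
  assumes "r > 0" and le: "!!h. norm h <= r ==> p \<bullet> h <= C * (norm h)\<^sup>2"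
  shows "p = 0"
proof (rule ccontr)
  assume p: "p \<noteq> 0"
  have np: "norm p > 0" using p by simp
  define s where "s = min (r / norm p) (1 / (2 * (\<bar>C\<bar> + 1)))"
  have s: "s > 0" using assms(1) np by (simp add: s_def add_nonneg_pos)
  have "s * norm p <= r / norm p * norm p" unfolding s_def using np by (intro mult_right_mono) auto
  then have "norm (s *\<^sub>R p) <= r" using s np by simp
  from le[OF this] have "s * (norm p)\<^sup>2 <= (C * s) * (s * (norm p)\<^sup>2)"
    by (simp add: power_mult_distrib power2_norm_eq_inner power2_eq_square[of s] mult.assoc mult.left_commute)
  moreover have "s * (norm p)\<^sup>2 > 0" using s np by simp
  ultimately have "1 <= C * s" by (simp add: mult_le_cancel_right1)
  moreover have "C * s <= \<bar>C\<bar> * (1 / (2 * (\<bar>C\<bar> + 1)))"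
    using s by (intro mult_mono) (auto simp: s_def)
  moreover have "\<bar>C\<bar> * (1 / (2 * (\<bar>C\<bar> + 1))) < 1" by (simp add: field_simps add_nonneg_pos)
  ultimately show False by linarith
qed

text \<open>
  Comparing the two affine approximations at a point of the sphere about \<open>w\<close> in the direction
  \<open>p' - p\<close> turns quadratic errors into a linear bound for the slopes.
\<close>

lemma pinched_slope_lipschitz:
  fixes p p' :: "'a::real_inner"
  assumes z: "pinched D C f z p" and w: "pinched D C f w p'"
    and sub: "cball w (norm (z - w)) \<subseteq> D" and zw: "z \<noteq> w"
  shows "norm (p' - p) <= 6 * C * norm (z - w)"
proof (cases "p' = p")
  case True
  have "w \<in> D" using sub by auto
  then have "0 <= C * (norm (w - z))\<^sup>2" using z unfolding pinched_def by (meson abs_ge_zero order_trans)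
  then have "C >= 0" using zw by (simp add: zero_le_mult_iff)
  then show ?thesis using True by simp
next
  case False
  define r where "r = norm (z - w)"
  have r: "r > 0" using zw by (simp add: r_def)
  define u where "u = (r / norm (p' - p)) *\<^sub>R (p' - p)"
  have nu: "norm u = r" using False r by (simp add: u_def)
  have wu: "w + u \<in> D" and wD: "w \<in> D" using sub nu by (auto simp: r_def dist_norm)
  have C: "C >= 0"
  proof -
    have "0 <= C * (norm (w - z))\<^sup>2" using z wD unfolding pinched_def by (meson abs_ge_zero order_trans)
    then show ?thesis using zw by (simp add: zero_le_mult_iff)
  qed
  have 1: "\<bar>f (w + u) - f w - p' \<bullet> u\<bar> <= C * r\<^sup>2"
    using w wu nu unfolding pinched_def by force
  have 2: "\<bar>f w - f z - p \<bullet> (w - z)\<bar> <= C * r\<^sup>2"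
    using z wD unfolding pinched_def r_def by (simp add: norm_minus_commute)
  have n2: "norm (w + u - z) <= 2 * r"
    using norm_triangle_ineq[of "w - z" u] nu by (simp add: r_def norm_minus_commute algebra_simps)
  have "\<bar>f (w + u) - f z - p \<bullet> (w + u - z)\<bar> <= C * (norm (w + u - z))\<^sup>2"
    using z wu unfolding pinched_def by blast
  also have "\<dots> <= C * (2 * r)\<^sup>2" using n2 C by (intro mult_left_mono power_mono) auto
  finally have 3: "\<bar>f (w + u) - f z - p \<bullet> (w + u - z)\<bar> <= 4 * (C * r\<^sup>2)" by (simp add: power_mult_distrib)
  have "(p' - p) \<bullet> u = (p' \<bullet> u - (f (w + u) - f w)) + (f (w + u) - f z - p \<bullet> (w + u - z))
        - (f w - f z - p \<bullet> (w - z))"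
    by (simp add: inner_diff_left inner_diff_right inner_add_right)
  then have "(p' - p) \<bullet> u <= 6 * (C * r\<^sup>2)" using 1 2 3 by linarith
  moreover have "(p' - p) \<bullet> u = r * norm (p' - p)"
    using False by (simp add: u_def power2_norm_eq_inner[symmetric] power2_eq_square)
  ultimately have "r * norm (p' - p) <= r * (6 * C * r)" by (simp add: power2_eq_square algebra_simps)
  then show ?thesis using r by (simp add: r_def)
qed

text \<open>
  Needed because slopes are known only on the contact set, while Rademacher's theorem speaks of functions
  on the whole space.
\<close>

lemma mcshane_extension:
  fixes f :: "'a::metric_space => real"
  assumes lip: "!!x y. x \<in> K ==> y \<in> K ==> \<bar>f x - f y\<bar> <= M * dist x y" and M: "M >= 0" and ne: "K \<noteq> {}"
  obtains F where "M-lipschitz_on UNIV F" "!!x. x \<in> K ==> F x = f x"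
proof -
  define F where "F x = (INF w\<in>K. f w + M * dist x w)" for x
  obtain w0 where w0: "w0 \<in> K" using ne by blast
  have bdd: "bdd_below ((\<lambda>w. f w + M * dist x w) ` K)" for x
  proof (rule bdd_belowI2)
    fix w assume w: "w \<in> K"
    have "f w0 - f w <= M * dist w0 w" using lip[OF w0 w] by linarith
    also have "\<dots> <= M * (dist x w0 + dist x w)"
      using M by (intro mult_left_mono) (metis dist_commute dist_triangle)
    finally show "f w0 - M * dist x w0 <= f w + M * dist x w" by (simp add: algebra_simps)
  qed
  have le: "F x <= F y + M * dist x y" for x y
  proof -
    have "F x - M * dist x y <= f w + M * dist y w" if "w \<in> K" for w
    proof -
      have "F x <= f w + M * dist x w" unfolding F_def by (rule cINF_lower[OF bdd that])
      also have "M * dist x w <= M * (dist x y + dist y w)" using M by (intro mult_left_mono dist_triangle)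
      finally show ?thesis by (simp add: algebra_simps)
    qed
    then have "F x - M * dist x y <= F y" unfolding F_def[of y] using ne by (intro cINF_greatest) auto
    then show ?thesis by simp
  qed
  show ?thesis
  proof (rule that)
    show "M-lipschitz_on UNIV F"
    proof (rule lipschitz_onI[OF _ M])
      fix x y show "dist (F x) (F y) <= M * dist x y"
        using le[of x y] le[of y x] by (simp add: dist_real_def dist_commute abs_le_iff)
    qed
    fix x assume x: "x \<in> K"
    have "F x <= f x + M * dist x x" unfolding F_def by (rule cINF_lower[OF bdd x])
    moreover have "f x <= F x" unfolding F_def
      using lip[OF x] by (intro cINF_greatest ne) (auto simp: abs_le_iff algebra_simps)
    ultimately show "F x = f x" by simp
  qed
qed

text \<open>The segment from \<open>z\<close> to \<open>z + h\<close> is divided into \<open>N\<close> steps.  Near each node there is a point of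
  \<open>K\<close>, whose slope is \<open>P z + B\<close> of the displacement up to a small error, and pinching turns slopes into
  increments of \<open>f\<close>; the increments form a Riemann sum for the second-order expansion.\<close>

lemma peano2_of_pinched_slopes:
  fixes f :: "'a::euclidean_space => real" and P :: "'a => 'a"
  assumes pin: "!!w. w \<in> K ==> pinched D C f w (P w)" and C: "C >= 0"
    and lin: "linear B"
    and ball: "ball z r0 \<subseteq> D" "r0 > 0" and zK: "z \<in> K"
    and der: "!!e. e > 0 ==> \<exists>d>0. \<forall>w\<in>K. norm (w - z) < d --> norm (P w - P z - B (w - z)) <= e * norm (w - z)"
    and dens: "!!e. e > 0 ==> \<exists>d>0. \<forall>h. norm h < d --> (\<exists>w\<in>K. norm (z + h - w) <= e * norm h)"
  shows "peano2 f z (P z) B"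
  unfolding peano2_def
proof (intro allI impI)
  fix e0 :: real assume e0: "e0 > 0"
  obtain \<beta> where \<beta>: "\<beta> > 0" "!!v. norm (B v) <= norm v * \<beta>"
    using linear_conv_bounded_linear[THEN iffD1, OF lin] bounded_linear.pos_bounded by blast
  obtain N :: nat where N: "real N > (2 * \<beta> + 2 + 10 * C) / e0" "N > 0"
  proof -
    obtain n :: nat where "real n > (2 * \<beta> + 2 + 10 * C) / e0" using reals_Archimedean2 by blast
    then show ?thesis using that[of "Suc n"] by simp
  qed
  define n where "n = real N"
  have n1: "n >= 1" using N(2) by (simp add: n_def)
  define e where "e = 1 / n\<^sup>2"
  define \<epsilon> where "\<epsilon> = 1 / n"
  have ep: "e > 0" "\<epsilon> > 0" "e <= 1" using n1 by (auto simp: e_def \<epsilon>_def)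
  obtain d1 where d1: "d1 > 0"
    "!!w. w \<in> K ==> norm (w - z) < d1 ==> norm (P w - P z - B (w - z)) <= \<epsilon> * norm (w - z)"
    using der[OF ep(2)] by blast
  obtain d2 where d2: "d2 > 0" "!!h. norm h < d2 ==> (\<exists>w\<in>K. norm (z + h - w) <= e * norm h)"
    using dens[OF ep(1)] by blast
  define d where "d = min (d1 / 2) (min d2 r0)"
  have d: "d > 0" using d1 d2 ball by (simp add: d_def)
  show "\<exists>d>0. \<forall>h. norm h < d --> \<bar>f (z + h) - f z - P z \<bullet> h - (1/2) * (h \<bullet> B h)\<bar> <= e0 * (norm h)\<^sup>2"
  proof (intro exI[of _ d] conjI d allI impI)
    fix h :: 'a assume h: "norm h < d"
    define H where "H = norm h"
    have H0: "H >= 0" by (simp add: H_def)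
    define t where "t i = real i / n" for i :: nat
    define q where "q = h \<bullet> B h"
    have step: "\<bar>f (z + t (Suc i) *\<^sub>R h) - f (z + t i *\<^sub>R h) - (1/n) * (P z \<bullet> h + t i * q)\<bar>
        <= H\<^sup>2 * ((\<beta> * e + 2 * \<epsilon>) / n + C * (2 * e\<^sup>2 + 2 * e / n + 1 / n\<^sup>2))" if i: "i < N" for i
    proof -
      define T where "T = t i"
      have T: "0 <= T" "T <= 1" "t (Suc i) = T + 1 / n" "T + 1 / n <= 1"
        using i n1 by (auto simp: T_def t_def n_def field_simps)
      have nT: "norm (T *\<^sub>R h) <= H" "norm ((T + 1/n) *\<^sub>R h) <= H"
        using T H0 n1 by (auto simp: H_def mult_left_le_one_le)
      obtain w where w: "w \<in> K" "norm (z + T *\<^sub>R h - w) <= e * norm (T *\<^sub>R h)"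
        using d2(2)[of "T *\<^sub>R h"] nT h by (auto simp: H_def d_def)
      have \<eta>: "norm (z + T *\<^sub>R h - w) <= e * H" using w(2) nT(1) ep by (meson mult_left_mono less_imp_le order_trans)
      have wz: "norm (w - z) <= 2 * H"
      proof -
        have "norm (w - z) <= norm (T *\<^sub>R h) + norm (z + T *\<^sub>R h - w)"
          using norm_triangle_ineq4[of "T *\<^sub>R h" "z + T *\<^sub>R h - w"] by simp
        also have "\<dots> <= H + e * H" using nT \<eta> by simp
        also have "\<dots> <= H + 1 * H" using ep H0 by (intro add_left_mono mult_right_mono) auto
        finally show ?thesis by simp
      qed
      have Dm: "z + T *\<^sub>R h \<in> D" "z + (T + 1/n) *\<^sub>R h \<in> D"
        using ball nT h by (auto simp: subset_eq dist_norm H_def d_def)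
      have pw: "\<bar>f y - f w - P w \<bullet> (y - w)\<bar> <= C * (norm (y - w))\<^sup>2" if "y \<in> D" for y
        using pin[OF w(1)] that unfolding pinched_def by blast
      have A: "\<bar>f (z + T *\<^sub>R h) - f w - P w \<bullet> (z + T *\<^sub>R h - w)\<bar> <= C * (e * H)\<^sup>2"
        using pw[OF Dm(1)] \<eta> C by (meson mult_left_mono norm_ge_zero order_trans power_mono)
      have "norm (z + (T + 1/n) *\<^sub>R h - w) <= e * H + H / n"
        using norm_triangle_ineq[of "z + T *\<^sub>R h - w" "(1/n) *\<^sub>R h"] \<eta> n1 by (simp add: H_def algebra_simps)
      then have B1: "\<bar>f (z + (T + 1/n) *\<^sub>R h) - f w - P w \<bullet> (z + (T + 1/n) *\<^sub>R h - w)\<bar> <= C * (e * H + H / n)\<^sup>2"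
        using pw[OF Dm(2)] C by (meson mult_left_mono norm_ge_zero order_trans power_mono)
      have AB: "\<bar>f (z + (T + 1/n) *\<^sub>R h) - f (z + T *\<^sub>R h) - (1/n) * (P w \<bullet> h)\<bar> <= C * (e * H)\<^sup>2 + C * (e * H + H / n)\<^sup>2"
      proof -
        have "P w \<bullet> (z + (T + 1/n) *\<^sub>R h - w) - P w \<bullet> (z + T *\<^sub>R h - w) = (1/n) * (P w \<bullet> h)"
          by (simp add: inner_diff_right inner_add_right scaleR_add_left)
        then show ?thesis using A B1 by linarith
      qed
      have Pn: "norm (P w - P z - T *\<^sub>R B h) <= (\<beta> * e + 2 * \<epsilon>) * H"
      proof -
        have "norm (w - z) < d1" using wz h by (simp add: H_def d_def)
        then have a: "norm (P w - P z - B (w - z)) <= \<epsilon> * norm (w - z)" by (rule d1(2)[OF w(1)])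
        have "B (w - z) - T *\<^sub>R B h = B (w - z - T *\<^sub>R h)"
          by (simp add: linear_diff[OF lin] linear_scale[OF lin])
        then have "norm (B (w - z) - T *\<^sub>R B h) <= norm (w - z - T *\<^sub>R h) * \<beta>" using \<beta>(2) by metis
        also have "norm (w - z - T *\<^sub>R h) = norm (z + T *\<^sub>R h - w)"
          using norm_minus_commute[of "z + T *\<^sub>R h" w] by (simp add: algebra_simps)
        also have "norm (z + T *\<^sub>R h - w) * \<beta> <= (e * H) * \<beta>" using \<eta> \<beta>(1) by (intro mult_right_mono) auto
        finally have b: "norm (B (w - z) - T *\<^sub>R B h) <= (e * H) * \<beta>" .
        have eq: "P w - P z - T *\<^sub>R B h = (P w - P z - B (w - z)) + (B (w - z) - T *\<^sub>R B h)" by simp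
        have "norm (P w - P z - T *\<^sub>R B h) <= \<epsilon> * norm (w - z) + (e * H) * \<beta>"
          by (subst eq) (use a b norm_triangle_ineq[of "P w - P z - B (w - z)" "B (w - z) - T *\<^sub>R B h"] in linarith)
        also have "\<epsilon> * norm (w - z) <= \<epsilon> * (2 * H)" using wz ep by (intro mult_left_mono) auto
        finally show ?thesis by (simp add: algebra_simps)
      qed
      have "\<bar>P w \<bullet> h - (P z \<bullet> h + T * q)\<bar> <= (\<beta> * e + 2 * \<epsilon>) * H * H"
      proof -
        have "P w \<bullet> h - (P z \<bullet> h + T * q) = (P w - P z - T *\<^sub>R B h) \<bullet> h"
          by (simp add: q_def inner_diff_left inner_diff_right inner_commute)
        also have "\<bar>\<dots>\<bar> <= norm (P w - P z - T *\<^sub>R B h) * H" unfolding H_def by (rule Cauchy_Schwarz_ineq2)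
        also have "\<dots> <= (\<beta> * e + 2 * \<epsilon>) * H * H" using Pn H0 by (intro mult_right_mono)
        finally show ?thesis .
      qed
      then have "(1/n) * \<bar>P w \<bullet> h - (P z \<bullet> h + T * q)\<bar> <= (1/n) * ((\<beta> * e + 2 * \<epsilon>) * H * H)"
        using n1 by (intro mult_left_mono) auto
      then have "\<bar>(1/n) * (P w \<bullet> h) - (1/n) * (P z \<bullet> h + T * q)\<bar> <= (1/n) * ((\<beta> * e + 2 * \<epsilon>) * H * H)"
        using n1 by (simp add: abs_divide diff_divide_distrib[symmetric])
      then have "\<bar>f (z + (T + 1/n) *\<^sub>R h) - f (z + T *\<^sub>R h) - (1/n) * (P z \<bullet> h + T * q)\<bar>
          <= (1/n) * ((\<beta> * e + 2 * \<epsilon>) * H * H) + (C * (e * H)\<^sup>2 + C * (e * H + H / n)\<^sup>2)"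
        using AB by linarith
      also have "\<dots> = H\<^sup>2 * ((\<beta> * e + 2 * \<epsilon>) / n + C * (2 * e\<^sup>2 + 2 * e / n + 1 / n\<^sup>2))"
        by (simp add: power2_eq_square algebra_simps add_divide_distrib)
      finally show ?thesis using T(3) by (simp add: T_def)
    qed
    define E where "E = H\<^sup>2 * ((\<beta> * e + 2 * \<epsilon>) / n + C * (2 * e\<^sup>2 + 2 * e / n + 1 / n\<^sup>2))"
    have tot: "\<bar>f (z + t i *\<^sub>R h) - f z - (real i / n) * (P z \<bullet> h) - (real i * (real i - 1) / (2 * n\<^sup>2)) * q\<bar> <= real i * E"
      if "i <= N" for i using that
    proof (induction i)
      case 0 then show ?case by (simp add: t_def)
    next
      case (Suc i)
      have a: "(real (Suc i) / n) * (P z \<bullet> h) + (real (Suc i) * (real (Suc i) - 1) / (2 * n\<^sup>2)) * q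
         = (real i / n) * (P z \<bullet> h) + (real i * (real i - 1) / (2 * n\<^sup>2)) * q + (1/n) * (P z \<bullet> h + t i * q)"
        using n1 by (simp add: t_def power2_eq_square field_simps)
      have st: "\<bar>f (z + t (Suc i) *\<^sub>R h) - f (z + t i *\<^sub>R h) - (1/n) * (P z \<bullet> h + t i * q)\<bar> <= E"
        using step[of i] Suc.prems by (simp add: E_def)
      have "real (Suc i) * E = real i * E + E" by (simp add: distrib_right)
      then show ?case using Suc.IH[OF Suc_leD[OF Suc.prems]] st a by linarith
    qed
    have tN: "t N = 1" using n1 by (simp add: t_def n_def)
    have "\<bar>f (z + h) - f z - P z \<bullet> h - (n * (n - 1) / (2 * n\<^sup>2)) * q\<bar> <= n * E"
      using tot[of N] n1 by (simp add: tN n_def[symmetric])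
    moreover have "(n * (n - 1) / (2 * n\<^sup>2)) * q = (1/2) * q - q / (2 * n)"
      using n1 by (simp add: power2_eq_square field_simps)
    moreover have "\<bar>q / (2 * n)\<bar> <= \<beta> * H\<^sup>2 / (2 * n)"
    proof -
      have "\<bar>q\<bar> <= H * (H * \<beta>)"
        unfolding q_def H_def by (meson Cauchy_Schwarz_ineq2 \<beta>(2) mult_left_mono norm_ge_zero order_trans)
      then show ?thesis using n1 by (simp add: abs_divide power2_eq_square divide_right_mono algebra_simps)
    qed
    moreover have "n * E <= H\<^sup>2 * ((\<beta> + 2 + 10 * C) / n)"
    proof -
      have i: "1 / n\<^sup>2 <= 1 / n" "1 / n ^ 3 <= 1 / n"
        using n1 by (auto intro!: divide_left_mono simp: power2_eq_square power3_eq_cube mult_le_cancel_left1 mult_ge1_I)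
      have "n * ((\<beta> * e + 2 * \<epsilon>) / n + C * (2 * e\<^sup>2 + 2 * e / n + 1 / n\<^sup>2))
          = \<beta> * (1 / n\<^sup>2) + 2 * (1/n) + C * (2 * (1 / n ^ 3) + 2 * (1 / n\<^sup>2) + 1 / n)"
        using n1 by (simp add: e_def \<epsilon>_def power2_eq_square power3_eq_cube field_simps)
      also have "\<dots> <= \<beta> * (1 / n) + 2 * (1/n) + C * (2 * (1 / n) + 2 * (1 / n) + 1 / n)"
        using i \<beta>(1) C by (intro add_mono mult_left_mono) auto
      also have "\<dots> <= (\<beta> + 2 + 10 * C) / n" using n1 C by (simp add: field_simps)
      finally show ?thesis unfolding E_def
        by (metis mult.left_commute mult_left_mono zero_le_power2)
    qed
    ultimately have "\<bar>f (z + h) - f z - P z \<bullet> h - (1/2) * q\<bar> <= H\<^sup>2 * ((\<beta> + 2 + 10 * C) / n) + \<beta> * H\<^sup>2 / (2 * n)"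
      by linarith
    also have "\<dots> <= H\<^sup>2 * ((2 * \<beta> + 2 + 10 * C) / n)" using \<beta>(1) n1 by (simp add: field_simps)
    also have "\<dots> <= H\<^sup>2 * e0"
      using N(1) n1 e0 by (intro mult_left_mono) (auto simp: n_def field_simps)
    finally show "\<bar>f (z + h) - f z - P z \<bullet> h - (1/2) * (h \<bullet> B h)\<bar> <= e0 * (norm h)\<^sup>2"
      by (simp add: q_def H_def mult.commute)
  qed
qed

text \<open>
  Each summand is bounded below by a paraboloid; since the sum is touched from above, each is also
  bounded above by one.
\<close>

lemma jensen_pinched:
  fixes f g k :: "'a::real_inner => real"
  assumes z: "ball z r \<subseteq> D" "r > 0" and C: "C >= 0"
    and pf: "!!w. w \<in> D ==> f w >= f z + p1 \<bullet> (w - z) - C * (norm (w - z))\<^sup>2"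
    and pg: "!!w. w \<in> D ==> g w >= g z + p2 \<bullet> (w - z) - C * (norm (w - z))\<^sup>2"
    and pk: "!!w. w \<in> D ==> k w >= k z + p3 \<bullet> (w - z) - C * (norm (w - z))\<^sup>2"
    and max: "!!w. w \<in> D ==> f w + g w + k w <= f z + g z + k z + q \<bullet> (w - z)"
  shows "p1 + p2 + p3 = q" "pinched D (2 * C) f z p1" "pinched D (2 * C) g z p2" "pinched D (2 * C) k z p3"
proof -
  have "p1 + p2 + p3 - q = 0"
  proof (rule affine_le_quadratic_imp_zero[of "r/2" _ "3 * C"])
    fix h :: 'a assume h: "norm h <= r / 2"
    then have "norm h < r" using z(2) by linarith
    then have D: "z + h \<in> D" using z(1) by (auto simp: subset_eq dist_norm)
    have "(p1 \<bullet> h + p2 \<bullet> h + p3 \<bullet> h) - 3 * (C * (norm h)\<^sup>2) <= q \<bullet> h"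
      using pf[OF D] pg[OF D] pk[OF D] max[OF D] by simp
    then show "(p1 + p2 + p3 - q) \<bullet> h <= 3 * C * (norm h)\<^sup>2"
      by (simp add: inner_add_left inner_diff_left)
  qed (use z in auto)
  then show q: "p1 + p2 + p3 = q" by simp
  have qd: "q \<bullet> (w - z) = p1 \<bullet> (w - z) + p2 \<bullet> (w - z) + p3 \<bullet> (w - z)" for w
    by (simp add: q[symmetric] inner_add_left)
  have nn: "C * (norm (w - z))\<^sup>2 >= 0" for w using C by simp
  show "pinched D (2 * C) f z p1" unfolding pinched_def
  proof
    fix w assume w: "w \<in> D"
    show "\<bar>f w - f z - p1 \<bullet> (w - z)\<bar> <= 2 * C * (norm (w - z))\<^sup>2"
      using pf[OF w] pg[OF w] pk[OF w] max[OF w] qd[of w] nn[of w] by (simp add: abs_le_iff)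
  qed
  show "pinched D (2 * C) g z p2" unfolding pinched_def
  proof
    fix w assume w: "w \<in> D"
    show "\<bar>g w - g z - p2 \<bullet> (w - z)\<bar> <= 2 * C * (norm (w - z))\<^sup>2"
      using pf[OF w] pg[OF w] pk[OF w] max[OF w] qd[of w] nn[of w] by (simp add: abs_le_iff)
  qed
  show "pinched D (2 * C) k z p3" unfolding pinched_def
  proof
    fix w assume w: "w \<in> D"
    show "\<bar>k w - k z - p3 \<bullet> (w - z)\<bar> <= 2 * C * (norm (w - z))\<^sup>2"
      using pf[OF w] pg[OF w] pk[OF w] max[OF w] qd[of w] nn[of w] by (simp add: abs_le_iff)
  qed
qed

text \<open>Almost every point of a closed set is a point of full density, in the weak sense that the
  set has no holes of size proportional to the distance: the distance function is differentiable
  there, and it has a minimum.\<close>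

lemma infdist_no_holes_ae:
  fixes K :: "'a::euclidean_space set"
  assumes "closed K" "K \<noteq> {}"
  shows "AE z in lborel. z \<in> K -->
     (\<forall>e>0. \<exists>d>0. \<forall>h. norm h < d --> (\<exists>w\<in>K. norm (z + h - w) <= e * norm h))"
proof -
  have lip: "1-lipschitz_on UNIV (\<lambda>x. infdist x K)"
  proof (rule lipschitz_onI)
    fix x y :: 'a
    show "dist (infdist x K) (infdist y K) <= 1 * dist x y"
      using infdist_triangle[of x K y] infdist_triangle[of y K x]
      by (simp add: dist_real_def abs_le_iff dist_commute)
  qed simp
  show ?thesis using rademacher[OF lip]
  proof (eventually_elim, intro impI)
    fix z assume zK: "z \<in> K"
      and "\<exists>T. \<forall>e>0. \<exists>d>0. \<forall>h. norm h < d --> \<bar>infdist (z + h) K - infdist z K - T \<bullet> h\<bar> <= e * norm h"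
    then obtain T where T: "!!e. e > 0 ==> \<exists>d>0. \<forall>h. norm h < d --> \<bar>infdist (z + h) K - infdist z K - T \<bullet> h\<bar> <= e * norm h"
      by blast
    have z0: "infdist z K = 0" using zK by simp
    have "T = 0"
    proof (rule ccontr)
      assume T0: "T \<noteq> 0"
      then obtain d where d: "d > 0" "!!h. norm h < d ==> \<bar>infdist (z + h) K - infdist z K - T \<bullet> h\<bar> <= (norm T / 2) * norm h"
        using T[of "norm T / 2"] by auto
      define h where "h = - (d / (2 * norm T)) *\<^sub>R T"
      have nh: "norm h = d / 2" using T0 d(1) by (simp add: h_def)
      have "T \<bullet> h = - (norm T * (d / 2))"
        using T0 by (simp add: h_def power2_norm_eq_inner[symmetric] power2_eq_square field_simps)
      moreover have "norm h < d" using nh d(1) by simp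
      then have "infdist (z + h) K - infdist z K - T \<bullet> h <= (norm T / 2) * norm h"
        using d(2)[of h] by linarith
      ultimately have "norm T * (d / 2) <= norm T / 2 * (d / 2)"
        unfolding z0 nh using infdist_nonneg[of "z + h" K] by linarith
      moreover have "0 < d * norm T" using T0 d(1) by simp
      ultimately show False by (simp add: mult.commute)
    qed
    show "\<forall>e>0. \<exists>d>0. \<forall>h. norm h < d --> (\<exists>w\<in>K. norm (z + h - w) <= e * norm h)"
    proof (intro allI impI)
      fix e :: real assume "e > 0"
      then obtain d where d: "d > 0" "!!h. norm h < d ==> \<bar>infdist (z + h) K\<bar> <= e * norm h"
        using T[of e] z0 \<open>T = 0\<close> by auto
      show "\<exists>d>0. \<forall>h. norm h < d --> (\<exists>w\<in>K. norm (z + h - w) <= e * norm h)"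
      proof (intro exI[of _ d] conjI d(1) allI impI)
        fix h :: 'a assume h: "norm h < d"
        obtain w where "w \<in> K" "infdist (z + h) K = dist (z + h) w"
          using infdist_attains_inf[OF assms] by blast
        then show "\<exists>w\<in>K. norm (z + h - w) <= e * norm h"
          using d(2)[OF h] by (auto simp: dist_norm)
      qed
    qed
  qed
qed

text \<open>Each component is extended to the whole space, and Rademacher's theorem applies to the extensions.\<close>

lemma lipschitz_on_set_differentiable_ae:
  fixes P :: "'a::euclidean_space => 'a"
  assumes lip: "!!x y. x \<in> K ==> y \<in> K ==> norm (P x - P y) <= M * norm (x - y)" and M: "M >= 0"
    and ne: "K \<noteq> {}"
  shows "AE z in lborel. z \<in> K --> (\<exists>B. linear B \<and>
     (\<forall>e>0. \<exists>d>0. \<forall>w\<in>K. norm (w - z) < d --> norm (P w - P z - B (w - z)) <= e * norm (w - z)))"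
proof -
  have "\<exists>F. M-lipschitz_on UNIV F \<and> (\<forall>x\<in>K. F x = P x \<bullet> b)" if b: "b \<in> Basis" for b
  proof -
    have "\<bar>P x \<bullet> b - P y \<bullet> b\<bar> <= M * dist x y" if "x \<in> K" "y \<in> K" for x y
      using Basis_le_norm[OF b, of "P x - P y"] lip[OF that] by (simp add: inner_diff_left dist_norm)
    then show ?thesis using mcshane_extension[of K "\<lambda>x. P x \<bullet> b" M] M ne by metis
  qed
  then obtain F where F: "!!b. b \<in> Basis ==> M-lipschitz_on UNIV (F b)"
      "!!b x. b \<in> Basis ==> x \<in> K ==> F b x = P x \<bullet> b" by metis
  have "AE z in lborel. \<forall>b\<in>Basis. \<exists>T. \<forall>e>0. \<exists>d>0. \<forall>h. norm h < d -->
      \<bar>F b (z + h) - F b z - T \<bullet> h\<bar> <= e * norm h"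
    using rademacher[OF F(1)] by (simp add: AE_ball_countable countable_finite)
  then show ?thesis
  proof (eventually_elim, intro impI)
    fix z assume zK: "z \<in> K" and "\<forall>b\<in>Basis. \<exists>T. \<forall>e>0. \<exists>d>0. \<forall>h. norm h < d -->
      \<bar>F b (z + h) - F b z - T \<bullet> h\<bar> <= e * norm h"
    then obtain T where T: "!!b e. b \<in> Basis ==> e > 0 ==> \<exists>d>0. \<forall>h. norm h < d -->
      \<bar>F b (z + h) - F b z - T b \<bullet> h\<bar> <= e * norm h" by metis
    define B where "B h = (\<Sum>b\<in>Basis. (T b \<bullet> h) *\<^sub>R b)" for h
    have "linear B" unfolding B_def
      by (intro linear_compose_sum ballI linearI) (auto simp: inner_add_right scaleR_add_left)
    moreover have "\<exists>d>0. \<forall>w\<in>K. norm (w - z) < d --> norm (P w - P z - B (w - z)) <= e * norm (w - z)"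
      if e: "e > 0" for e
    proof -
      define e' where "e' = e / real DIM('a)"
      have e': "e' > 0" using e by (simp add: e'_def)
      have "\<forall>b\<in>Basis. \<forall>\<^sub>F d in at_right 0. \<forall>h. norm h < d --> \<bar>F b (z + h) - F b z - T b \<bullet> h\<bar> <= e' * norm h"
      proof
        fix b :: 'a assume "b \<in> Basis"
        then obtain d where "d > 0" "!!h. norm h < d ==> \<bar>F b (z + h) - F b z - T b \<bullet> h\<bar> <= e' * norm h"
          using T e' by blast
        then show "\<forall>\<^sub>F d in at_right 0. \<forall>h. norm h < d --> \<bar>F b (z + h) - F b z - T b \<bullet> h\<bar> <= e' * norm h"
          by (auto simp: eventually_at_right_field intro!: exI[of _ d])
      qed
      then have "\<forall>\<^sub>F d in at_right 0. \<forall>b\<in>Basis. \<forall>h. norm h < d --> \<bar>F b (z + h) - F b z - T b \<bullet> h\<bar> <= e' * norm h"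
        by (simp add: eventually_ball_finite)
      then obtain d0 where "d0 > 0" and d0: "!!d. 0 < d ==> d < d0 ==> \<forall>b\<in>Basis. \<forall>h. norm h < d --> \<bar>F b (z + h) - F b z - T b \<bullet> h\<bar> <= e' * norm h"
        by (auto simp: eventually_at_right_field)
      have d: "!!b h. b \<in> Basis ==> norm h < d0 / 2 ==> \<bar>F b (z + h) - F b z - T b \<bullet> h\<bar> <= e' * norm h"
        using d0[of "d0/2"] \<open>d0 > 0\<close> by auto
      show ?thesis
      proof (intro exI[of _ "d0/2"] conjI ballI impI)
        fix w assume w: "w \<in> K" "norm (w - z) < d0 / 2"
        define v where "v = P w - P z - B (w - z)"
        have "\<bar>v \<bullet> b\<bar> <= e' * norm (w - z)" if b: "b \<in> Basis" for b
        proof -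
          have "v \<bullet> b = F b (z + (w - z)) - F b z - T b \<bullet> (w - z)"
            using b w(1) zK by (simp add: v_def F(2) inner_diff_left B_def inner_sum_left inner_Basis if_distrib cong: if_cong)
          then show ?thesis using d[OF b w(2)] by simp
        qed
        then have "(\<Sum>b\<in>Basis. \<bar>v \<bullet> b\<bar>) <= of_nat (card (Basis :: 'a set)) * (e' * norm (w - z))"
          by (rule sum_bounded_above)
        then show "norm (P w - P z - B (w - z)) <= e * norm (w - z)"
          using norm_le_l1[of v] by (simp add: v_def e'_def)
      qed (use \<open>d0 > 0\<close> in auto)
    qed
    ultimately show "\<exists>B. linear B \<and> (\<forall>e>0. \<exists>d>0. \<forall>w\<in>K. norm (w - z) < d -->
        norm (P w - P z - B (w - z)) <= e * norm (w - z))" by blast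
  qed
qed

text \<open>
  Jensen's lemma combined with Alexandrov's theorem, but without the latter for general convex
  functions: tilting the sum by every small \<open>q\<close> gives a set of contact points that cannot be negligible,
  because the slopes there form a ball and depend on the point in a Lipschitz way.  On the contact set all summands are
  pinched, so their slopes are Lipschitz and differentiable almost everywhere along the set, and at a point of
  density this is a second-order expansion.
\<close>

theorem jensen_alexandrov:
  fixes f g k :: "'a::euclidean_space => real"
  assumes D: "compact D" and C: "C >= 0" and z0: "z0 \<in> D" and \<delta>: "\<delta> > 0"
    and cont: "continuous_on D (\<lambda>z. f z + g z + k z)"
    and sf: "!!z. z \<in> D ==> \<exists>p. \<forall>w\<in>D. f w >= f z + p \<bullet> (w - z) - C * (norm (w - z))\<^sup>2"
    and sg: "!!z. z \<in> D ==> \<exists>p. \<forall>w\<in>D. g w >= g z + p \<bullet> (w - z) - C * (norm (w - z))\<^sup>2"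
    and sk: "!!z. z \<in> D ==> \<exists>p. \<forall>w\<in>D. k w >= k z + p \<bullet> (w - z) - C * (norm (w - z))\<^sup>2"
    and gap: "\<gamma> > 0" "!!z. z \<in> frontier D ==> f z + g z + k z <= f z0 + g z0 + k z0 - \<gamma>"
  shows "\<exists>z\<in>interior D. \<exists>q p1 B1 p2 B2. norm q <= \<delta> \<and>
     (\<forall>w\<in>D. f w + g w + k w <= f z + g z + k z + q \<bullet> (w - z)) \<and>
     f z0 + g z0 + k z0 - \<gamma> <= f z + g z + k z \<and>
     linear B1 \<and> peano2 f z p1 B1 \<and> linear B2 \<and> peano2 g z p2 B2"
proof -
  define \<Phi> where "\<Phi> z = f z + g z + k z" for z
  have c\<Phi>: "continuous_on D \<Phi>" using cont by (simp add: \<Phi>_def[abs_def])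
  obtain R where R: "R > 0" "!!z. z \<in> D ==> norm z <= R"
    using compact_imp_bounded[OF D] bounded_pos by blast
  define \<delta>' where "\<delta>' = min \<delta> (\<gamma> / (4 * R))"
  have \<delta>': "\<delta>' > 0" "\<delta>' <= \<delta>" "\<delta>' * (2 * R) < \<gamma>"
  proof -
    show "\<delta>' > 0" "\<delta>' <= \<delta>" using \<delta> gap(1) R(1) by (auto simp: \<delta>'_def)
    have "\<delta>' * (2 * R) <= \<gamma> / (4 * R) * (2 * R)" using R(1) by (intro mult_right_mono) (auto simp: \<delta>'_def)
    also have "\<dots> = \<gamma> / 2" using R(1) by simp
    finally show "\<delta>' * (2 * R) < \<gamma>" using gap(1) by simp
  qed
  define touch where "touch z q \<longleftrightarrow> norm q <= \<delta>' \<and> (\<forall>w\<in>D. \<Phi> w <= \<Phi> z + q \<bullet> (w - z))" for z q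
  define K where "K = {z\<in>D. \<exists>q. touch z q}"
  have qb: "\<bar>q \<bullet> (w - z)\<bar> < \<gamma>" if "norm q <= \<delta>'" "z \<in> D" "w \<in> D" for q z w
  proof -
    have "norm (w - z) <= 2 * R" using R(2)[OF that(2)] R(2)[OF that(3)] norm_triangle_ineq4[of w z] by linarith
    then have "norm q * norm (w - z) <= \<delta>' * (2 * R)" using that(1) \<delta>'(1) by (intro mult_mono) auto
    then show ?thesis using Cauchy_Schwarz_ineq2[of q "w - z"] \<delta>'(3) by linarith
  qed
  have valgap: "\<Phi> z0 - \<gamma> < \<Phi> z" if "z \<in> D" "touch z q" for z q
    using that qb[of q z z0] z0 unfolding touch_def by (auto simp: abs_less_iff)
  have Kint: "z \<in> interior D" if zK: "z \<in> K" for z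
  proof (rule ccontr)
    assume "z \<notin> interior D"
    then have "z \<in> frontier D" using zK compact_imp_closed[OF D] by (auto simp: K_def frontier_def)
    moreover obtain q where "touch z q" using zK by (auto simp: K_def)
    ultimately show False using valgap[of z q] gap(2)[of z] zK by (auto simp: \<Phi>_def K_def)
  qed
  have Ksur: "\<exists>z\<in>K. touch z q" if q: "norm q <= \<delta>'" for q
  proof -
    have "continuous_on D (\<lambda>z. \<Phi> z - q \<bullet> z)" by (intro continuous_intros c\<Phi>)
    then obtain z where z: "z \<in> D" "!!w. w \<in> D ==> \<Phi> w - q \<bullet> w <= \<Phi> z - q \<bullet> z"
      using continuous_attains_sup[OF D _ , of "\<lambda>z. \<Phi> z - q \<bullet> z"] z0 by blast
    then have "touch z q" using q unfolding touch_def by (auto simp: inner_diff_right algebra_simps)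
    then show ?thesis using z(1) by (auto simp: K_def)
  qed
  have Kcl: "closed K"
    unfolding closed_sequential_limits
  proof (intro allI impI, elim conjE)
    fix x l assume x: "\<forall>n. x n \<in> K" and l: "x \<longlonglongrightarrow> l"
    then obtain q where q: "!!n. touch (x n) (q n)" unfolding K_def by (auto; metis)
    have xD: "x n \<in> D" for n using x by (auto simp: K_def)
    have lD: "l \<in> D" using compact_imp_closed[OF D] xD l closed_sequentially by blast
    have "\<forall>n. q n \<in> cball 0 \<delta>'" using q by (auto simp: touch_def)
    then obtain q0 \<sigma> where q0: "q0 \<in> cball 0 \<delta>'" and \<sigma>: "strict_mono (\<sigma> :: nat => nat)" and ql: "(q \<circ> \<sigma>) \<longlonglongrightarrow> q0"
      using compact_cball[of "0::'a" \<delta>'] unfolding compact_def by metis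
    have xl: "(x \<circ> \<sigma>) \<longlonglongrightarrow> l" using l \<sigma> by (rule LIMSEQ_subseq_LIMSEQ)
    have "\<Phi> w <= \<Phi> l + q0 \<bullet> (w - l)" if w: "w \<in> D" for w
    proof (rule LIMSEQ_le_const)
      have "(\<lambda>n. \<Phi> ((x \<circ> \<sigma>) n)) \<longlonglongrightarrow> \<Phi> l"
        by (rule continuous_on_tendsto_compose[OF c\<Phi> xl lD]) (simp add: xD)
      then show "(\<lambda>n. \<Phi> ((x \<circ> \<sigma>) n) + (q \<circ> \<sigma>) n \<bullet> (w - (x \<circ> \<sigma>) n)) \<longlonglongrightarrow> \<Phi> l + q0 \<bullet> (w - l)"
        by (intro tendsto_intros ql xl)
      show "\<exists>N. \<forall>n\<ge>N. \<Phi> w <= \<Phi> ((x \<circ> \<sigma>) n) + (q \<circ> \<sigma>) n \<bullet> (w - (x \<circ> \<sigma>) n)"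
        using q w unfolding touch_def by auto
    qed
    then have "touch l q0" using q0 by (auto simp: touch_def)
    then show "l \<in> K" using lD by (auto simp: K_def)
  qed
  have Kcomp: "compact K"
    using Kcl compact_imp_bounded[OF D] bounded_subset[of D K] by (auto simp: compact_eq_bounded_closed K_def)
  have Kne: "K \<noteq> {}" using Ksur[of 0] \<delta>'(1) by auto
  define slopes where "slopes z p1 p2 p3 \<longleftrightarrow> touch z (p1 + p2 + p3) \<and> pinched D (2*C) f z p1 \<and> pinched D (2*C) g z p2
     \<and> pinched D (2*C) k z p3 \<and> (\<forall>q. touch z q --> q = p1 + p2 + p3)" for z p1 p2 p3
  have "\<exists>p1 p2 p3. slopes z p1 p2 p3" if z: "z \<in> K" for z
  proof -
    have zD: "z \<in> D" using z by (auto simp: K_def)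
    obtain r where r: "r > 0" "ball z r \<subseteq> D" using Kint[OF z] mem_interior by blast
    obtain p1 p2 p3 where p:
      "!!w. w \<in> D ==> f w >= f z + p1 \<bullet> (w - z) - C * (norm (w - z))\<^sup>2"
      "!!w. w \<in> D ==> g w >= g z + p2 \<bullet> (w - z) - C * (norm (w - z))\<^sup>2"
      "!!w. w \<in> D ==> k w >= k z + p3 \<bullet> (w - z) - C * (norm (w - z))\<^sup>2"
      using sf[OF zD] sg[OF zD] sk[OF zD] by blast
    have u: "p1 + p2 + p3 = q" "pinched D (2 * C) f z p1" "pinched D (2 * C) g z p2" "pinched D (2 * C) k z p3"
      if "touch z q" for q
      using jensen_pinched[OF r(2,1) C p, of q] that unfolding touch_def \<Phi>_def by auto
    obtain q where "touch z q" using z by (auto simp: K_def)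
    then show ?thesis using u unfolding slopes_def by blast
  qed
  then obtain P1 P2 P3 where "!!z. z \<in> K ==> slopes z (P1 z) (P2 z) (P3 z)" by metis
  then have P: "!!z. z \<in> K ==> touch z (P1 z + P2 z + P3 z)"
    "!!z. z \<in> K ==> pinched D (2*C) f z (P1 z)" "!!z. z \<in> K ==> pinched D (2*C) g z (P2 z)"
    "!!z. z \<in> K ==> pinched D (2*C) k z (P3 z)"
    "!!z q. z \<in> K ==> touch z q ==> q = P1 z + P2 z + P3 z"
    unfolding slopes_def by blast+
  have "K \<subseteq> interior D" using Kint by blast
  then obtain \<rho> where \<rho>: "\<rho> > 0" "(\<Union>x\<in>K. cball x \<rho>) \<subseteq> interior D"
    using compact_subset_open_imp_cball_epsilon_subset[OF Kcomp open_interior] by blast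
  have lip: "norm (P w - P z) <= (12 * C) * norm (w - z)"
    if pin: "!!z. z \<in> K ==> pinched D (2*C) F z (P z)" and zw: "z \<in> K" "w \<in> K" "norm (w - z) <= \<rho>" for F P z w
  proof (cases "z = w")
    case False
    have "cball w (norm (z - w)) \<subseteq> D"
      using \<rho>(2) zw interior_subset[of D] by (force simp: norm_minus_commute subset_eq)
    from pinched_slope_lipschitz[OF pin[OF zw(1)] pin[OF zw(2)] this False]
    show ?thesis by (simp add: norm_minus_commute)
  qed simp
  have nneg: "\<not> negligible K"
  proof
    assume "negligible K"
    then have "negligible ((\<lambda>z. P1 z + P2 z + P3 z) ` K)"
    proof (rule negligible_locally_Lipschitz_image[OF order_refl])
      fix z assume z: "z \<in> K"
      show "\<exists>T B. open T \<and> z \<in> T \<and> (\<forall>y\<in>K \<inter> T. norm (P1 y + P2 y + P3 y - (P1 z + P2 z + P3 z)) <= B * norm (y - z))"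
      proof (intro exI[of _ "ball z \<rho>"] exI[of _ "36 * C"] conjI ballI)
        fix y assume "y \<in> K \<inter> ball z \<rho>"
        then have y: "y \<in> K" "norm (y - z) <= \<rho>" by (auto simp: dist_norm norm_minus_commute)
        have "norm (P1 y + P2 y + P3 y - (P1 z + P2 z + P3 z)) <= norm (P1 y - P1 z) + norm (P2 y - P2 z) + norm (P3 y - P3 z)"
        proof -
          have eq: "P1 y + P2 y + P3 y - (P1 z + P2 z + P3 z) = (P1 y - P1 z) + (P2 y - P2 z) + (P3 y - P3 z)" by simp
          show ?thesis unfolding eq
            using norm_triangle_ineq[of "(P1 y - P1 z) + (P2 y - P2 z)" "P3 y - P3 z"]
              norm_triangle_ineq[of "P1 y - P1 z" "P2 y - P2 z"] by linarith
        qed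
        then show "norm (P1 y + P2 y + P3 y - (P1 z + P2 z + P3 z)) <= 36 * C * norm (y - z)"
          using lip[OF P(2) z y] lip[OF P(3) z y] lip[OF P(4) z y] by linarith
      qed (use \<rho> in auto)
    qed
    moreover have "cball 0 \<delta>' \<subseteq> (\<lambda>z. P1 z + P2 z + P3 z) ` K"
    proof
      fix q :: 'a assume "q \<in> cball 0 \<delta>'"
      then obtain z where "z \<in> K" "touch z q" using Ksur[of q] by auto
      then show "q \<in> (\<lambda>z. P1 z + P2 z + P3 z) ` K" using P(5) by blast
    qed
    ultimately have "negligible (cball (0::'a) \<delta>')" by (rule negligible_subset)
    then have "negligible (ball (0::'a) \<delta>')" by (rule negligible_subset) auto
    then show False using \<delta>'(1) open_not_negligible[OF open_ball, of "0::'a" \<delta>'] by auto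
  qed
  \<comment> \<open>Localise to a piece of diameter at most \<open>\<rho>\<close>, on which the slopes are Lipschitz.\<close>
  obtain S where S: "finite S" "S \<subseteq> K" "K \<subseteq> (\<Union>c\<in>S. ball c (\<rho> / 2))"
  proof (rule compactE_image[OF Kcomp, of K "\<lambda>c. ball c (\<rho> / 2)"])
    show "K \<subseteq> (\<Union>c\<in>K. ball c (\<rho> / 2))" using \<rho>(1) by force
  qed (use that in auto)
  have "\<exists>c\<in>S. \<not> negligible (K \<inter> cball c (\<rho> / 2))"
  proof (rule ccontr)
    assume "\<not> ?thesis"
    then have "negligible (\<Union>c\<in>S. K \<inter> cball c (\<rho> / 2))" using S(1) by (intro negligible_Union) (auto simp del: UN_simps)
    moreover have "K \<subseteq> (\<Union>c\<in>S. K \<inter> cball c (\<rho> / 2))" using S(3) by force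
    ultimately show False using nneg negligible_subset by blast
  qed
  then obtain c where c: "\<not> negligible (K \<inter> cball c (\<rho> / 2))" by blast
  define K' where "K' = K \<inter> cball c (\<rho> / 2)"
  have K': "closed K'" "K' \<noteq> {}" "K' \<subseteq> K" using c Kcl by (auto simp: K'_def)
  have dK': "norm (w - z) <= \<rho>" if "z \<in> K'" "w \<in> K'" for z w
    using that dist_triangle2[of w z c] by (auto simp: K'_def dist_norm dist_commute norm_minus_commute)
  have lip': "norm (P w - P z) <= (12 * C) * norm (w - z)"
    if "!!z. z \<in> K ==> pinched D (2*C) F z (P z)" "w \<in> K'" "z \<in> K'" for F P z w
    using lip[of F P z w] that dK' K'(3) by blast
  define good where "good P z \<longleftrightarrow> (\<exists>B. linear B \<and>
     (\<forall>e>0. \<exists>d>0. \<forall>w\<in>K'. norm (w - z) < d --> norm (P w - P z - B (w - z)) <= e * norm (w - z)))" for P :: "'a => 'a" and z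
  define dns where "dns z \<longleftrightarrow> (\<forall>e>0. \<exists>d>0. \<forall>h. norm h < d --> (\<exists>w\<in>K'. norm (z + h - w) <= e * norm h))" for z
  have "AE z in lborel. z \<in> K' --> good P1 z" "AE z in lborel. z \<in> K' --> good P2 z"
    unfolding good_def
    using C by (auto intro!: lipschitz_on_set_differentiable_ae[where M="12 * C"] K' lip'[OF P(2)] lip'[OF P(3)])
  moreover have "AE z in lborel. z \<in> K' --> dns z"
    unfolding dns_def by (rule infdist_no_holes_ae[OF K'(1,2)])
  ultimately have "AE z in lborel. z \<in> K' --> good P1 z \<and> good P2 z \<and> dns z"
    by eventually_elim blast
  then have "AE z in lebesgue. z \<in> K' --> good P1 z \<and> good P2 z \<and> dns z" by (rule AE_completion)
  then obtain N where N: "N \<in> null_sets lebesgue" "{z. \<not> (z \<in> K' --> good P1 z \<and> good P2 z \<and> dns z)} \<subseteq> N"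
    unfolding eventually_ae_filter by auto
  have "negligible N" using N(1) by (simp add: negligible_iff_null_sets)
  then obtain z where z: "z \<in> K'" "z \<notin> N" using c negligible_subset unfolding K'_def by blast
  then have zg: "good P1 z" "good P2 z" "dns z" using N(2) by auto
  have zK: "z \<in> K" using z K'(3) by blast
  obtain r where r: "r > 0" "ball z r \<subseteq> D" using Kint[OF zK] mem_interior by blast
  obtain B1 where B1: "linear B1" "!!e. e > 0 ==> \<exists>d>0. \<forall>w\<in>K'. norm (w - z) < d --> norm (P1 w - P1 z - B1 (w - z)) <= e * norm (w - z)"
    using zg(1) unfolding good_def by blast
  obtain B2 where B2: "linear B2" "!!e. e > 0 ==> \<exists>d>0. \<forall>w\<in>K'. norm (w - z) < d --> norm (P2 w - P2 z - B2 (w - z)) <= e * norm (w - z)"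
    using zg(2) unfolding good_def by blast
  have dz: "!!e. e > 0 ==> \<exists>d>0. \<forall>h. norm h < d --> (\<exists>w\<in>K'. norm (z + h - w) <= e * norm h)"
    using zg(3) unfolding dns_def by blast
  have C2: "2 * C >= 0" using C by simp
  have p1: "peano2 f z (P1 z) B1"
    by (rule peano2_of_pinched_slopes[OF _ C2 B1(1) r(2,1) z(1) B1(2) dz]) (use P(2) K'(3) in auto)
  have p2: "peano2 g z (P2 z) B2"
    by (rule peano2_of_pinched_slopes[OF _ C2 B2(1) r(2,1) z(1) B2(2) dz]) (use P(3) K'(3) in auto)
  have t: "touch z (P1 z + P2 z + P3 z)" by (rule P(1)[OF zK])
  have zD: "z \<in> D" using zK by (simp add: K_def)
  show ?thesis
    apply (rule bexI[OF _ Kint[OF zK]])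
    apply (rule exI[of _ "P1 z + P2 z + P3 z"], rule exI[of _ "P1 z"], rule exI[of _ B1], rule exI[of _ "P2 z"], rule exI[of _ B2])
    using t valgap[OF zD t] \<delta>'(2) p1 p2 B1(1) B2(1) unfolding touch_def \<Phi>_def by (auto intro: less_imp_le)
qed

section \<open>The normalised operator on quadratic forms and its envelopes\<close>

text \<open>
  The trace of \<open>A(\<xi>) X\<close> in terms of the quadratic form \<open>q(k) = \<langle>X k, k\<rangle>\<close> only.
\<close>

definition TrA :: "ereal => real^'n => (real^'n => real) => real" where
  "TrA p \<xi> q = recip p * (\<Sum>i\<in>Basis. q i) + (1 - 2 * recip p) * (q \<xi> / (norm \<xi>)\<^sup>2)"

text \<open>
  The trace of \<open>A(\<xi>)\<close>, which is the same for every \<open>\<xi>\<close>.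
\<close>

definition trace_const :: "ereal => 'n itself => real" where
  "trace_const p _ = recip p * real CARD('n) + (1 - 2 * recip p)"

lemma recip_bounds:
  assumes "1 < p" shows "0 <= recip p" "recip p < 1"
proof -
  have "0 <= recip p \<and> recip p < 1"
  proof (cases p)
    case (real r) then show ?thesis using assms by (auto simp: recip_def one_ereal_def)
  qed (use assms in \<open>auto simp: recip_def\<close>)
  then show "0 <= recip p" "recip p < 1" by auto
qed

lemma sum_Basis_vec: "(\<Sum>i\<in>(Basis :: (real^'n) set). q i) = (\<Sum>i\<in>UNIV. q (axis i 1))"
proof -
  have B: "(Basis :: (real^'n) set) = (\<lambda>i. axis i 1) ` UNIV" by (auto simp: Basis_vec_def)
  have "inj (\<lambda>i. axis i (1::real) :: real^'n)" by (auto simp: inj_on_def axis_eq_axis)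
  then show ?thesis unfolding B by (subst sum.reindex) auto
qed

lemma axis_quadratic: "axis i 1 \<bullet> (X *v axis j 1) = (X :: real^'n^'n) $ i $ j"
  by (simp add: matrix_vector_mult_basis inner_axis' column_def)

lemma quadratic_expand: "k \<bullet> ((X::real^'n^'n) *v k) = (\<Sum>i\<in>UNIV. \<Sum>j\<in>UNIV. k $ i * (X $ i $ j * k $ j))"
  by (simp add: inner_vec_def matrix_vector_mult_def sum_distrib_left)

lemma op_F_eq_TrA:
  fixes X :: "real^'n^'n"
  shows "op_F p \<xi> X = - TrA p \<xi> (\<lambda>k. k \<bullet> (X *v k))"
proof -
  have "trace (coeff_A p \<xi> ** X) = (\<Sum>i\<in>UNIV. \<Sum>j\<in>UNIV. coeff_A p \<xi> $ i $ j * X $ j $ i)"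
    by (simp add: trace_def matrix_matrix_mult_def)
  also have "\<dots> = (\<Sum>i\<in>UNIV. \<Sum>j\<in>UNIV. (recip p * (if i = j then 1 else 0)) * X $ j $ i
       + ((1 - 2 * recip p) / (norm \<xi>)\<^sup>2) * (\<xi> $ j * (X $ j $ i * \<xi> $ i)))"
    by (intro sum.cong refl) (simp add: coeff_A_def outer_def mat_def algebra_simps)
  also have "\<dots> = recip p * (\<Sum>i\<in>UNIV. X $ i $ i) + ((1 - 2 * recip p) / (norm \<xi>)\<^sup>2) *
        (\<Sum>i\<in>UNIV. \<Sum>j\<in>UNIV. \<xi> $ j * (X $ j $ i * \<xi> $ i))"
    unfolding sum.distrib by (simp add: sum_distrib_left if_distrib if_distribR mult.assoc cong: if_cong)
  also have "(\<Sum>i\<in>UNIV. \<Sum>j\<in>UNIV. \<xi> $ j * (X $ j $ i * \<xi> $ i)) = \<xi> \<bullet> (X *v \<xi>)"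
    unfolding quadratic_expand by (rule sum.swap)
  finally show ?thesis by (simp add: op_F_def TrA_def sum_Basis_vec axis_quadratic)
qed

lemma TrA_add: "TrA p \<xi> (\<lambda>k. q k + q' k) = TrA p \<xi> q + TrA p \<xi> q'"
  by (simp add: TrA_def sum.distrib add_divide_distrib algebra_simps)

lemma TrA_cmul: "TrA p \<xi> (\<lambda>k. c * q k) = c * TrA p \<xi> q"
  by (simp add: TrA_def sum_distrib_left algebra_simps)

lemma TrA_normsq:
  assumes "\<xi> \<noteq> (0::real^'n)" shows "TrA p \<xi> (\<lambda>k. (norm k)\<^sup>2) = trace_const p TYPE('n)"
  using assms by (simp add: TrA_def trace_const_def)

text \<open>
  The symmetric square root of \<open>A(\<nu>)\<close> for a unit vector \<open>\<nu>\<close>.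
\<close>

definition sqA :: "ereal => real^'n => real^'n => real^'n" where
  "sqA p \<nu> v = sqrt (recip p) *\<^sub>R v + ((sqrt (1 - recip p) - sqrt (recip p)) * (\<nu> \<bullet> v)) *\<^sub>R \<nu>"

text \<open>
  Writing the trace through the square root turns the operator into a sum of values of the form at vectors that
  depend on the direction in a Lipschitz way; matrix inequalities for doubled variables can be applied to them.
\<close>

lemma TrA_eq_sum_sqA:
  fixes X :: "real^'n^'n"
  assumes p: "1 < p" and \<xi>: "\<xi> \<noteq> 0" and sym: "transpose X = X"
  shows "TrA p \<xi> (\<lambda>k. k \<bullet> (X *v k)) =
     (\<Sum>i\<in>Basis. sqA p (\<xi> /\<^sub>R norm \<xi>) i \<bullet> (X *v sqA p (\<xi> /\<^sub>R norm \<xi>) i))"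
proof -
  define \<nu> where "\<nu> = \<xi> /\<^sub>R norm \<xi>"
  define \<alpha> where "\<alpha> = sqrt (recip p)"
  define g where "g = sqrt (1 - recip p) - \<alpha>"
  have r: "0 <= recip p" "recip p < 1" using recip_bounds[OF p] by auto
  have a2: "\<alpha> * \<alpha> = recip p" using r by (simp add: \<alpha>_def)
  have ag: "2 * \<alpha> * g + g * g = 1 - 2 * recip p"
  proof -
    have "(\<alpha> + g) * (\<alpha> + g) = 1 - recip p" using r by (simp add: g_def)
    then show ?thesis using a2 by (simp add: algebra_simps)
  qed
  have n\<nu>: "norm \<nu> = 1" using \<xi> by (simp add: \<nu>_def)
  have s: "v \<bullet> (X *v w) = w \<bullet> (X *v v)" for v w
    by (metis dot_lmul_matrix inner_commute sym transpose_matrix_vector)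
  have exp: "sqA p \<nu> i \<bullet> (X *v sqA p \<nu> i) = \<alpha> * \<alpha> * (i \<bullet> (X *v i))
      + 2 * \<alpha> * g * ((\<nu> \<bullet> i) * (\<nu> \<bullet> (X *v i))) + g * g * ((\<nu> \<bullet> i) * (\<nu> \<bullet> i)) * (\<nu> \<bullet> (X *v \<nu>))" for i
    unfolding sqA_def \<alpha>_def[symmetric] g_def[symmetric]
    by (simp add: matrix_vector_right_distrib matrix_vector_mult_scaleR inner_add_left inner_add_right s[of i \<nu>] algebra_simps)
  have e1: "(\<Sum>i\<in>Basis. (\<nu> \<bullet> i) * (\<nu> \<bullet> (X *v i))) = \<nu> \<bullet> (X *v \<nu>)"
  proof -
    have "\<nu> \<bullet> (X *v \<nu>) = (X *v \<nu>) \<bullet> \<nu>" by (simp add: inner_commute)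
    also have "\<dots> = (\<Sum>i\<in>Basis. ((X *v \<nu>) \<bullet> i) * (\<nu> \<bullet> i))" by (rule euclidean_inner)
    also have "\<dots> = (\<Sum>i\<in>Basis. (\<nu> \<bullet> i) * (\<nu> \<bullet> (X *v i)))"
      by (intro sum.cong refl) (use s in \<open>simp add: inner_commute mult.commute\<close>)
    finally show ?thesis by simp
  qed
  have e2: "(\<Sum>i\<in>Basis. (\<nu> \<bullet> i) * (\<nu> \<bullet> i)) = 1"
    using euclidean_inner[of \<nu> \<nu>] n\<nu> by (simp flip: power2_norm_eq_inner)
  have "(\<Sum>i\<in>Basis. sqA p \<nu> i \<bullet> (X *v sqA p \<nu> i)) = \<alpha> * \<alpha> * (\<Sum>i\<in>Basis. i \<bullet> (X *v i))
      + 2 * \<alpha> * g * (\<nu> \<bullet> (X *v \<nu>)) + g * g * (\<nu> \<bullet> (X *v \<nu>))"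
    unfolding exp sum.distrib e1[symmetric] e2[symmetric]
    by (simp add: sum_distrib_left[symmetric] sum_distrib_right[symmetric]) (simp add: e1 e2)
  also have "\<dots> = recip p * (\<Sum>i\<in>Basis. i \<bullet> (X *v i)) + (2 * \<alpha> * g + g * g) * (\<nu> \<bullet> (X *v \<nu>))"
    by (simp add: a2 algebra_simps)
  also have "\<nu> \<bullet> (X *v \<nu>) = \<xi> \<bullet> (X *v \<xi>) / (norm \<xi>)\<^sup>2"
    by (simp add: \<nu>_def matrix_vector_mult_scaleR power2_eq_square divide_inverse)
  finally show ?thesis by (simp add: TrA_def ag \<nu>_def)
qed

lemma TrA_mono_le_const:
  fixes X :: "real^'n^'n"
  assumes p: "1 < p" and \<xi>: "\<xi> \<noteq> 0" and sym: "transpose X = X"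
    and le: "!!k. k \<bullet> (X *v k) <= c * (norm k)\<^sup>2"
  shows "TrA p \<xi> (\<lambda>k. k \<bullet> (X *v k)) <= c * trace_const p TYPE('n)"
proof -
  have one: "k \<bullet> (mat 1 *v k) = (norm k)\<^sup>2" for k :: "real^'n" by (simp add: power2_norm_eq_inner)
  have "TrA p \<xi> (\<lambda>k. k \<bullet> (X *v k)) <= (\<Sum>i\<in>Basis. c * (norm (sqA p (\<xi> /\<^sub>R norm \<xi>) i))\<^sup>2)"
    unfolding TrA_eq_sum_sqA[OF p \<xi> sym] by (intro sum_mono le)
  also have "\<dots> = c * TrA p \<xi> (\<lambda>k. k \<bullet> (mat 1 *v k))"
    unfolding TrA_eq_sum_sqA[OF p \<xi> transpose_mat] by (simp add: sum_distrib_left power2_norm_eq_inner)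
  also have "\<dots> = c * trace_const p TYPE('n)" unfolding one by (simp add: TrA_normsq[OF \<xi>])
  finally show ?thesis .
qed

lemma entry_le_norm: "\<bar>(X :: real^'n^'m) $ i $ j\<bar> <= norm X"
  by (rule order_trans[OF component_le_norm_cart Finite_Cartesian_Product.norm_nth_le])

lemma quadratic_abs_le: "\<bar>k \<bullet> ((X::real^'n^'n) *v k)\<bar> <= (real CARD('n))\<^sup>2 * norm X * (norm k)\<^sup>2"
proof -
  have "\<bar>k \<bullet> (X *v k)\<bar> <= (\<Sum>i\<in>(UNIV::'n set). \<Sum>j\<in>(UNIV::'n set). norm X * (norm k)\<^sup>2)"
    unfolding quadratic_expand
  proof (intro order_trans[OF sum_abs] sum_mono)
    fix i j
    have "\<bar>k $ i * (X $ i $ j * k $ j)\<bar> = \<bar>X $ i $ j\<bar> * (\<bar>k $ i\<bar> * \<bar>k $ j\<bar>)" by (simp add: abs_mult)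
    also have "\<dots> <= norm X * (norm k * norm k)"
      by (intro mult_mono entry_le_norm component_le_norm_cart mult_nonneg_nonneg) auto
    finally show "\<bar>k $ i * (X $ i $ j * k $ j)\<bar> <= norm X * (norm k)\<^sup>2" by (simp add: power2_eq_square)
  qed
  then show ?thesis by (simp add: power2_eq_square)
qed

lemma TrA_abs_le:
  fixes X :: "real^'n^'n"
  assumes p: "1 < p" and \<xi>: "\<xi> \<noteq> 0"
  shows "\<bar>TrA p \<xi> (\<lambda>k. k \<bullet> (X *v k))\<bar> <= (real CARD('n) ^ 3 + (real CARD('n))\<^sup>2) * norm X"
proof -
  define n where "n = real CARD('n)"
  have r: "0 <= recip p" "recip p < 1" using recip_bounds[OF p] by auto
  have "\<bar>\<Sum>i\<in>(Basis :: (real^'n) set). i \<bullet> (X *v i)\<bar> <= (\<Sum>i\<in>(Basis :: (real^'n) set). n\<^sup>2 * norm X)"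
  proof (intro order_trans[OF sum_abs] sum_mono)
    fix i :: "real^'n" assume "i \<in> Basis"
    then show "\<bar>i \<bullet> (X *v i)\<bar> <= n\<^sup>2 * norm X" using quadratic_abs_le[of i X] by (simp add: n_def)
  qed
  also have "\<dots> = n ^ 3 * norm X" by (simp add: n_def power2_eq_square power3_eq_cube)
  finally have 1: "\<bar>recip p * (\<Sum>i\<in>Basis. i \<bullet> (X *v i))\<bar> <= 1 * (n ^ 3 * norm X)"
    unfolding abs_mult using r by (intro mult_mono) auto
  have "\<bar>\<xi> \<bullet> (X *v \<xi>) / (norm \<xi>)\<^sup>2\<bar> <= n\<^sup>2 * norm X"
    using quadratic_abs_le[of \<xi> X] \<xi> by (simp add: n_def abs_divide divide_le_eq)
  then have 2: "\<bar>(1 - 2 * recip p) * (\<xi> \<bullet> (X *v \<xi>) / (norm \<xi>)\<^sup>2)\<bar> <= 1 * (n\<^sup>2 * norm X)"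
    unfolding abs_mult using r by (intro mult_mono) (auto simp: abs_le_iff)
  show ?thesis using 1 2 unfolding TrA_def n_def[symmetric] distrib_right by linarith
qed

text \<open>
  The envelope is a limit of infima that increase as \<open>\<delta>\<close> decreases, so it is bounded below by any bound
  valid for one \<open>\<delta>\<close>.
\<close>

lemma lower_envelope_ge:
  fixes X :: "real^'n^'n"
  assumes p: "1 < p" and sym: "transpose X = X" and d: "d0 > 0"
    and low: "!!\<eta> Y. \<eta> \<noteq> 0 ==> transpose Y = Y ==> norm (\<eta> - \<xi>) < d0 ==> norm (Y - X) < d0 ==> op_F p \<eta> Y >= L0"
  shows "lower_envelope (op_F p) \<xi> X >= L0"
proof -
  define S where "S \<delta> = {op_F p \<eta> Y | \<eta> Y. \<eta> \<noteq> 0 \<and> transpose Y = Y \<and> norm (\<eta> - \<xi>) < \<delta> \<and> norm (Y - X) < \<delta>}" for \<delta>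
  define C where "C = (real CARD('n) ^ 3 + (real CARD('n))\<^sup>2) * (norm X + 1)"
  have ne: "\<exists>s. s \<in> S \<delta>" if \<delta>: "\<delta> > 0" for \<delta>
  proof -
    obtain \<eta> :: "real^'n" where "\<eta> \<noteq> 0" "norm (\<eta> - \<xi>) < \<delta>"
    proof (cases "\<xi> = 0")
      case True
      obtain i :: 'n where True by simp
      have "(\<delta>/2) *\<^sub>R axis i (1::real) \<noteq> 0" using \<delta> by (simp add: axis_eq_0_iff)
      then show ?thesis using that[of "(\<delta>/2) *\<^sub>R axis i 1"] \<delta> True by simp
    qed (use that[of \<xi>] \<delta> in auto)
    then show ?thesis unfolding S_def using sym \<delta> by force
  qed
  have bd: "\<bar>s\<bar> <= C" if sS: "s \<in> S \<delta>" "\<delta> <= 1" for s \<delta>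
  proof -
    obtain \<eta> Y where s: "s = op_F p \<eta> Y" "\<eta> \<noteq> 0" "norm (Y - X) < \<delta>" using sS by (auto simp: S_def)
    have "norm Y <= norm X + 1" using norm_triangle_ineq2[of Y X] s(3) sS(2) by linarith
    then have "(real CARD('n) ^ 3 + (real CARD('n))\<^sup>2) * norm Y <= C" unfolding C_def by (intro mult_left_mono) auto
    then show ?thesis using TrA_abs_le[OF p s(2), of Y] by (simp add: s(1) op_F_eq_TrA)
  qed
  have bdd: "bdd_below (S \<delta>)" if "\<delta> <= 1" for \<delta>
    using bd[OF _ that] by (intro bdd_belowI[of _ "- C"]) (auto simp: abs_le_iff minus_le_iff)
  define f where "f \<delta> = Inf (S \<delta>)" for \<delta>
  have fC: "f \<delta> <= C" if "0 < \<delta>" "\<delta> <= 1" for \<delta>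
  proof -
    obtain s where "s \<in> S \<delta>" using ne \<open>0 < \<delta>\<close> by blast
    then show ?thesis using cInf_lower[OF _ bdd[OF that(2)], of s] bd[of s \<delta>] that(2) unfolding f_def by linarith
  qed
  have fm: "f \<delta>' <= f \<delta>" if "0 < \<delta>" "\<delta> <= \<delta>'" "\<delta>' <= 1" for \<delta> \<delta>'
    unfolding f_def
  proof (rule cInf_superset_mono)
    show "S \<delta> \<noteq> {}" using ne[OF that(1)] by blast
    show "S \<delta> \<subseteq> S \<delta>'" using that(2) unfolding S_def by force
  qed (rule bdd[OF that(3)])
  define l where "l = (SUP \<delta>\<in>{0<..1}. f \<delta>)"
  have bdf: "bdd_above (f ` {0<..1})" using fC by (intro bdd_aboveI2[of _ _ C]) auto
  have "(f \<longlongrightarrow> l) (at_right 0)"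
  proof (rule order_tendstoI)
    fix a assume "a < l"
    then obtain \<delta>' where \<delta>': "\<delta>' \<in> {0<..1}" "a < f \<delta>'" unfolding l_def
      using less_cSUP_iff[OF _ bdf, of a] by auto
    show "\<forall>\<^sub>F \<delta> in at_right 0. a < f \<delta>"
      unfolding eventually_at_right_field
    proof (intro exI[of _ \<delta>'] conjI allI impI)
      fix \<delta> assume "0 < \<delta>" "\<delta> < \<delta>'"
      then show "a < f \<delta>" using fm[of \<delta> \<delta>'] \<delta>' by auto
    qed (use \<delta>' in auto)
  next
    fix a assume "l < a"
    show "\<forall>\<^sub>F \<delta> in at_right 0. f \<delta> < a"
      unfolding eventually_at_right_field
    proof (intro exI[of _ 1] conjI allI impI)
      fix \<delta> :: real assume "0 < \<delta>" "\<delta> < 1"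
      then have "f \<delta> <= l" unfolding l_def by (intro cSUP_upper bdf) auto
      then show "f \<delta> < a" using \<open>l < a\<close> by simp
    qed simp
  qed
  then have "lower_envelope (op_F p) \<xi> X = l"
    unfolding lower_envelope_def f_def[abs_def] S_def by (intro tendsto_Lim trivial_limit_at_right_real)
  moreover have "L0 <= l"
  proof -
    define \<delta> where "\<delta> = min d0 1"
    have \<delta>: "0 < \<delta>" "\<delta> <= 1" "\<delta> <= d0" using d by (auto simp: \<delta>_def)
    have "L0 <= f \<delta>" unfolding f_def
    proof (rule cInf_greatest)
      show "S \<delta> \<noteq> {}" using ne[OF \<delta>(1)] by blast
      fix s assume "s \<in> S \<delta>"
      then show "L0 <= s" using low \<delta>(3) by (fastforce simp: S_def)
    qed
    also have "f \<delta> <= l" unfolding l_def using \<delta> by (intro cSUP_upper bdf) auto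
    finally show ?thesis .
  qed
  ultimately show ?thesis by simp
qed

lemma lower_envelope_ge_TrA:
  fixes X :: "real^'n^'n"
  assumes p: "1 < p" and sym: "transpose X = X" and \<xi>: "\<xi> \<noteq> 0"
  shows "lower_envelope (op_F p) \<xi> X >= - TrA p \<xi> (\<lambda>k. k \<bullet> (X *v k))"
proof (rule field_le_epsilon)
  fix e :: real assume e: "e > 0"
  define \<Psi> where "\<Psi> z = op_F p (fst z) (snd z)" for z :: "(real^'n) \<times> (real^'n^'n)"
  have "isCont \<Psi> (\<xi>, X)"
    unfolding \<Psi>_def op_F_eq_TrA TrA_def quadratic_expand
    using \<xi> by (intro continuous_intros) auto
  then have "\<forall>\<^sub>F z in at (\<xi>, X). dist (\<Psi> z) (\<Psi> (\<xi>, X)) < e"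
    using e by (simp add: isCont_def tendstoD)
  then obtain d where d: "d > 0" "!!z. dist z (\<xi>, X) < d ==> dist (\<Psi> z) (\<Psi> (\<xi>, X)) < e"
    using e by (auto simp: eventually_at) (metis dist_self)
  have "lower_envelope (op_F p) \<xi> X >= op_F p \<xi> X - e"
  proof (rule lower_envelope_ge[OF p sym, of "d/2"])
    fix \<eta> Y assume "norm (\<eta> - \<xi>) < d / 2" "norm (Y - X) < d / 2"
    then have "dist (\<eta>, Y) (\<xi>, X) < d"
      using dist_Pair_Pair[of \<eta> Y \<xi> X] sqrt_sum_squares_le_sum[of "dist \<eta> \<xi>" "dist Y X"]
      by (simp add: dist_norm)
    from d(2)[OF this] show "op_F p \<xi> X - e <= op_F p \<eta> Y" by (simp add: \<Psi>_def dist_real_def)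
  qed (use d in auto)
  then show "- TrA p \<xi> (\<lambda>k. k \<bullet> (X *v k)) <= lower_envelope (op_F p) \<xi> X + e" by (simp add: op_F_eq_TrA)
qed

lemma trace_const_pos: "1 < p ==> trace_const p TYPE('n::finite) > 0"
proof -
  assume p: "1 < p"
  have "CARD('n) > 0" by (simp add: card_gt_0_iff)
  then have n: "real CARD('n) >= 1" by linarith
  have "recip p * 1 <= recip p * real CARD('n)" using recip_bounds[OF p] n by (intro mult_left_mono) auto
  then show ?thesis using recip_bounds[OF p] unfolding trace_const_def by linarith
qed

lemma lower_envelope_ge_const:
  fixes X :: "real^'n^'n"
  assumes p: "1 < p" and sym: "transpose X = X" and le: "!!k. k \<bullet> (X *v k) <= c * (norm k)\<^sup>2"
  shows "lower_envelope (op_F p) \<xi> X >= - (c * trace_const p TYPE('n))"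
proof (rule field_le_epsilon)
  fix e :: real assume e: "e > 0"
  define t where "t = trace_const p TYPE('n)"
  define n2 where "n2 = (real CARD('n))\<^sup>2"
  have t: "t > 0" "n2 > 0" using trace_const_pos[OF p] by (auto simp: t_def n2_def)
  have "lower_envelope (op_F p) \<xi> X >= - ((c + e / t) * t)"
  proof (rule lower_envelope_ge[OF p sym, of "e / (t * n2)"])
    fix \<eta> :: "real^'n" and Y :: "real^'n^'n"
    assume h: "\<eta> \<noteq> 0" "transpose Y = Y" "norm (Y - X) < e / (t * n2)"
    have "k \<bullet> (Y *v k) <= (c + e / t) * (norm k)\<^sup>2" for k
    proof -
      have "k \<bullet> (Y *v k) = k \<bullet> (X *v k) + k \<bullet> ((Y - X) *v k)"
        by (simp add: matrix_vector_mult_diff_rdistrib inner_diff_right)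
      also have "k \<bullet> ((Y - X) *v k) <= n2 * norm (Y - X) * (norm k)\<^sup>2"
        using quadratic_abs_le[of k "Y - X"] by (simp add: n2_def)
      also have "\<dots> <= n2 * (e / (t * n2)) * (norm k)\<^sup>2"
        using h(3) t by (intro mult_right_mono mult_left_mono) auto
      also have "\<dots> = e / t * (norm k)\<^sup>2" using t by simp
      finally show ?thesis using le[of k] by (simp add: algebra_simps)
    qed
    from TrA_mono_le_const[OF p h(1,2) this]
    show "- ((c + e / t) * t) <= op_F p \<eta> Y" by (simp add: op_F_eq_TrA t_def)
  qed (use e t in auto)
  then show "- (c * trace_const p TYPE('n)) <= lower_envelope (op_F p) \<xi> X + e"
    using t by (simp add: t_def[symmetric] algebra_simps)
qed

section \<open>Viscosity solutions and second-order jets\<close>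

definition qform :: "('a::real_inner => real) => bool" where
  "qform Q \<longleftrightarrow> (\<exists>B. linear B \<and> Q = (\<lambda>h. h \<bullet> B h))"

definition upper_jet :: "('a::real_inner => real) => 'a => 'a => ('a => real) => bool" where
  "upper_jet f z p Q \<longleftrightarrow>
     (\<forall>e>0. \<exists>d>0. \<forall>h. norm h < d --> f (z + h) <= f z + p \<bullet> h + (1/2) * Q h + e * (norm h)\<^sup>2)"

text \<open>
  It suffices to exhibit the gradient as a differentiable vector field.
\<close>

lemma C2_on_gradient:
  fixes \<phi> :: "'a::real_inner => real"
  assumes "!!z. z \<in> S ==> (\<phi> has_derivative (\<lambda>k. G z \<bullet> k)) (at z)"
    and "!!z. z \<in> S ==> (G has_derivative blinfun_apply (DG z)) (at z)"
    and "continuous_on S DG"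
  shows "C2_on S \<phi>"
  unfolding C2_on_def
proof (intro exI conjI ballI)
  define J where "J = Blinfun (blinfun_inner_right :: 'a => 'a \<Rightarrow>\<^sub>L real)"
  have J: "blinfun_apply J v = blinfun_inner_right v" for v
    unfolding J_def by (simp add: bounded_linear_Blinfun_apply bounded_linear_blinfun_inner_right)
  show "(\<phi> has_derivative blinfun_apply (blinfun_inner_right (G z))) (at z)" if "z \<in> S" for z
    using assms(1)[OF that] by simp
  show "((\<lambda>z. blinfun_inner_right (G z)) has_derivative blinfun_apply (J o\<^sub>L DG z)) (at z)" if "z \<in> S" for z
  proof -
    have "((\<lambda>z. blinfun_inner_right (G z)) has_derivative (\<lambda>k. blinfun_inner_right (DG z k))) (at z)"
      by (rule bounded_linear.has_derivative[OF bounded_linear_blinfun_inner_right assms(2)[OF that]])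
    moreover have "blinfun_apply (J o\<^sub>L DG z) = (\<lambda>k. blinfun_inner_right (DG z k))" by (auto simp: J)
    ultimately show ?thesis by simp
  qed
  show "continuous_on S (\<lambda>z. J o\<^sub>L DG z)" using assms(3) by (intro continuous_intros)
qed

text \<open>The quartic term makes a one-sided expansion at \<open>z\<close> of a bounded function into a global inequality.\<close>

definition test_poly :: "'a::euclidean_space => 'a => ('a => 'a) => real => 'a => real" where
  "test_poly z p B K w = p \<bullet> (w - z) + (1/2) * ((w - z) \<bullet> B (w - z)) + K * ((w - z) \<bullet> (w - z))\<^sup>2"

definition test_grad :: "'a::euclidean_space => 'a => ('a => 'a) => real => 'a => 'a" where
  "test_grad z p B K w = p + B (w - z) + (4 * K * ((w - z) \<bullet> (w - z))) *\<^sub>R (w - z)"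

lemma test_poly_derivative:
  fixes B :: "'a::euclidean_space => 'a"
  assumes lin: "linear B" and sym: "!!v w. v \<bullet> B w = w \<bullet> B v"
  shows "(test_poly z p B K has_derivative (\<lambda>k. test_grad z p B K w \<bullet> k)) (at w)"
proof -
  have bl: "bounded_linear B" using lin by (simp add: linear_conv_bounded_linear)
  define v where "v = w - z"
  have d1: "((\<lambda>v. v \<bullet> B v) has_derivative (\<lambda>k. v \<bullet> B k + k \<bullet> B v)) (at v)"
    by (rule has_derivative_inner[OF has_derivative_ident bounded_linear.has_derivative[OF bl has_derivative_ident]])
  have d2: "((\<lambda>v. v \<bullet> v) has_derivative (\<lambda>k. v \<bullet> k + k \<bullet> v)) (at v)"
    by (rule has_derivative_inner[OF has_derivative_ident has_derivative_ident])
  have d3: "((\<lambda>v. (v \<bullet> v)\<^sup>2) has_derivative (\<lambda>k. 2 * (v \<bullet> k + k \<bullet> v) * (v \<bullet> v))) (at v)"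
    using has_derivative_power[OF d2, of 2] by (simp add: mult.assoc)
  have d4: "((\<lambda>v. p \<bullet> v) has_derivative (\<lambda>k. p \<bullet> k)) (at v)"
    by (rule has_derivative_inner_right[OF has_derivative_ident])
  have "((\<lambda>v. p \<bullet> v + (1/2) * (v \<bullet> B v) + K * (v \<bullet> v)\<^sup>2) has_derivative
      (\<lambda>k. p \<bullet> k + (1/2) * (v \<bullet> B k + k \<bullet> B v) + K * (2 * (v \<bullet> k + k \<bullet> v) * (v \<bullet> v)))) (at v)"
    by (intro has_derivative_add has_derivative_mult_right d1 d3 d4)
  moreover have "p \<bullet> k + (1/2) * (v \<bullet> B k + k \<bullet> B v) + K * (2 * (v \<bullet> k + k \<bullet> v) * (v \<bullet> v))
      = (p + B v + (4 * K * (v \<bullet> v)) *\<^sub>R v) \<bullet> k" for k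
  proof -
    have "v \<bullet> B k = B v \<bullet> k" "k \<bullet> B v = B v \<bullet> k" "k \<bullet> v = v \<bullet> k"
      using sym[of v k] inner_commute[of k "B v"] inner_commute[of k v] by simp_all
    then show ?thesis by (simp only: inner_add_left inner_scaleR_left) (simp add: algebra_simps)
  qed
  ultimately have "((\<lambda>v. p \<bullet> v + (1/2) * (v \<bullet> B v) + K * (v \<bullet> v)\<^sup>2) has_derivative
      (\<lambda>k. (p + B v + (4 * K * (v \<bullet> v)) *\<^sub>R v) \<bullet> k)) (at v)" by (simp only:)
  then have "((\<lambda>v. p \<bullet> v + (1/2) * (v \<bullet> B v) + K * (v \<bullet> v)\<^sup>2) has_derivative
      (\<lambda>k. (p + B v + (4 * K * (v \<bullet> v)) *\<^sub>R v) \<bullet> k)) (at (w - z))" by (simp add: v_def)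
  moreover have "((\<lambda>w. w - z) has_derivative (\<lambda>k. k)) (at w)"
    by (auto intro!: derivative_eq_intros)
  ultimately have "((\<lambda>w. p \<bullet> (w - z) + (1/2) * ((w - z) \<bullet> B (w - z)) + K * ((w - z) \<bullet> (w - z))\<^sup>2) has_derivative
      (\<lambda>k. (p + B v + (4 * K * (v \<bullet> v)) *\<^sub>R v) \<bullet> k)) (at w)"
    using has_derivative_compose[of "\<lambda>w. w - z"] by blast
  then show ?thesis by (simp add: test_poly_def[abs_def] test_grad_def v_def)
qed

lemma test_grad_derivative:
  fixes B :: "'a::euclidean_space => 'a" and z p w :: 'a and K :: real
  assumes lin: "linear B"
  defines "DG \<equiv> \<lambda>w. Blinfun B + (8 * K) *\<^sub>R (blinfun_scaleR_left (w - z) o\<^sub>L blinfun_inner_right (w - z))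
      + (4 * K * ((w - z) \<bullet> (w - z))) *\<^sub>R id_blinfun"
  shows "(test_grad z p B K has_derivative blinfun_apply (DG w)) (at w)" "continuous_on S DG"
    "blinfun_apply (DG z) = B"
proof -
  have bl: "bounded_linear B" using lin by (simp add: linear_conv_bounded_linear)
  note [derivative_intros] = bounded_linear.has_derivative[OF bl]
  have DGa: "blinfun_apply (DG w) = (\<lambda>k. B k + ((8 * K) * ((w - z) \<bullet> k)) *\<^sub>R (w - z) + (4 * K * ((w - z) \<bullet> (w - z))) *\<^sub>R k)" for w
    by (auto simp: DG_def blinfun.bilinear_simps bounded_linear_Blinfun_apply[OF bl])
  show "(test_grad z p B K has_derivative blinfun_apply (DG w)) (at w)"
    unfolding DGa test_grad_def
    by (rule derivative_eq_intros refl)+ (auto simp: inner_commute algebra_simps)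
  show "continuous_on S DG" unfolding DG_def
    by (intro continuous_intros bounded_linear.continuous_on[OF bounded_linear_blinfun_scaleR_left]
        bounded_linear.continuous_on[OF bounded_linear_blinfun_inner_right])
  show "blinfun_apply (DG z) = B" by (auto simp: DGa)
qed

lemma test_poly_partials:
  fixes B :: "(real^'n) \<times> real => (real^'n) \<times> real"
  assumes lin: "linear B" and sym: "!!v w. v \<bullet> B w = w \<bullet> B v"
  shows "gradient (\<lambda>y. test_poly (x, t) (\<xi>, a) B K (y, t)) x = \<xi>"
    "hessian (\<lambda>y. test_poly (x, t) (\<xi>, a) B K (y, t)) x = (\<chi> i j. (axis j 1, 0) \<bullet> B (axis i 1, 0))"
    "deriv (\<lambda>s. test_poly (x, t) (\<xi>, a) B K (x, s)) t = a"
proof -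
  define P where "P = test_poly (x, t) (\<xi>, a) B K"
  define G where "G = test_grad (x, t) (\<xi>, a) B K"
  have dP: "(P has_derivative (\<lambda>k. G w \<bullet> k)) (at w)" for w
    unfolding P_def G_def by (rule test_poly_derivative[OF lin sym])
  have dG: "(G has_derivative B) (at (x, t))"
    using test_grad_derivative(1)[OF lin, of "(x,t)" "(\<xi>,a)" K "(x,t)"]
    unfolding G_def test_grad_derivative(3)[OF lin] .
  have line: "((\<lambda>h. (y + h *\<^sub>R axis i 1, t)) has_derivative (\<lambda>h. h *\<^sub>R (axis i 1 :: real^'n, 0))) (at 0)" for y i
    by (auto intro!: derivative_eq_intros)
  have part: "partial i (\<lambda>y. P (y, t)) y = G (y, t) \<bullet> (axis i 1, 0)" for i y
  proof -
    have "((\<lambda>h. P (y + h *\<^sub>R axis i 1, t)) has_derivative (\<lambda>h. G (y, t) \<bullet> (h *\<^sub>R (axis i 1, 0)))) (at 0)"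
      using has_derivative_compose[OF line, of P "\<lambda>k. G (y, t) \<bullet> k" y i] dP[of "(y, t)"] by simp
    then have "((\<lambda>h. P (y + h *\<^sub>R axis i 1, t)) has_field_derivative (G (y, t) \<bullet> (axis i 1, 0))) (at 0)"
      by (rule has_derivative_imp_has_field_derivative) (simp del: scaleR_Pair)
    then show ?thesis unfolding partial_def by (rule DERIV_imp_deriv)
  qed
  have Gx: "G (x, t) = (\<xi>, a)" by (simp add: G_def test_grad_def linear_0[OF lin] zero_prod_def[symmetric])
  show "gradient (\<lambda>y. test_poly (x, t) (\<xi>, a) B K (y, t)) x = \<xi>"
    unfolding gradient_def P_def[symmetric] part Gx by (simp add: inner_axis vec_eq_iff)
  show "hessian (\<lambda>y. test_poly (x, t) (\<xi>, a) B K (y, t)) x = (\<chi> i j. (axis j 1, 0) \<bullet> B (axis i 1, 0))"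
  proof -
    have "partial i (\<lambda>y. G (y, t) \<bullet> (axis j 1, 0)) x = (axis j 1, 0) \<bullet> B (axis i 1, 0)" for i j
    proof -
      have "((\<lambda>h. G (x + h *\<^sub>R axis i 1, t)) has_derivative (\<lambda>h. B (h *\<^sub>R (axis i 1, 0)))) (at 0)"
        using has_derivative_compose[OF line, of G B x i] dG by simp
      then have "((\<lambda>h. G (x + h *\<^sub>R axis i 1, t) \<bullet> (axis j 1, 0)) has_derivative (\<lambda>h. B (h *\<^sub>R (axis i 1, 0)) \<bullet> (axis j 1, 0))) (at 0)"
        by (rule has_derivative_inner_left)
      then have "((\<lambda>h. G (x + h *\<^sub>R axis i 1, t) \<bullet> (axis j 1, 0)) has_field_derivative ((axis j 1, 0) \<bullet> B (axis i 1, 0))) (at 0)"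
        by (rule has_derivative_imp_has_field_derivative) (simp add: linear_scale[OF lin] inner_commute del: scaleR_Pair)
      then show ?thesis unfolding partial_def by (rule DERIV_imp_deriv)
    qed
    then show ?thesis unfolding hessian_def P_def[symmetric] part by simp
  qed
  show "deriv (\<lambda>s. test_poly (x, t) (\<xi>, a) B K (x, s)) t = a"
  proof -
    have "((\<lambda>s. (x, s)) has_derivative (\<lambda>h. h *\<^sub>R (0 :: real^'n, 1))) (at t)"
      by (auto intro!: derivative_eq_intros)
    then have "((\<lambda>s. P (x, s)) has_derivative (\<lambda>h. G (x, t) \<bullet> (h *\<^sub>R (0, 1)))) (at t)"
      using has_derivative_compose[of "\<lambda>s. (x, s)" _ t UNIV P "\<lambda>k. G (x, t) \<bullet> k"] dP[of "(x, t)"] by simp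
    then have "((\<lambda>s. P (x, s)) has_field_derivative a) (at t)"
      by (rule has_derivative_imp_has_field_derivative) (simp add: Gx)
    then show ?thesis unfolding P_def by (rule DERIV_imp_deriv)
  qed
qed

text \<open>A small increase of the Hessian absorbs the error of the expansion near \<open>z\<close>, and a large
  coefficient of the quartic term dominates the function away from \<open>z\<close>.\<close>

lemma upper_jet_test_poly:
  fixes f :: "'a::euclidean_space => real"
  assumes jet: "upper_jet f z p (\<lambda>h. h \<bullet> B h)" and lin: "linear B" and e: "e > 0"
    and bd: "!!w. w \<in> S ==> \<bar>f w\<bar> <= M" and zS: "z \<in> S"
  obtains K where "!!w. w \<in> S ==> f w - test_poly z p (\<lambda>h. B h + e *\<^sub>R h) K w <= f z - test_poly z p (\<lambda>h. B h + e *\<^sub>R h) K z"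
proof -
  obtain d where d: "d > 0" "!!h. norm h < d ==> f (z + h) <= f z + p \<bullet> h + (1/2) * (h \<bullet> B h) + (e/2) * (norm h)\<^sup>2"
  proof -
    have "e / 2 > 0" using e by simp
    then show ?thesis using jet that unfolding upper_jet_def by blast
  qed
  obtain \<beta> where \<beta>: "\<beta> > 0" "!!v. norm (B v) <= norm v * \<beta>"
    using linear_conv_bounded_linear[THEN iffD1, OF lin] bounded_linear.pos_bounded by blast
  define K where "K = 2 * \<bar>M\<bar> / d ^ 4 + norm p / d ^ 3 + \<beta> / d\<^sup>2"
  have K0: "K >= 0" using d(1) \<beta>(1) by (simp add: K_def)
  have b0: "B 0 = 0" by (rule linear_0[OF lin])
  show ?thesis
  proof (rule that[of K])
    fix w assume w: "w \<in> S"
    define h where "h = w - z"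
    have hh: "h \<bullet> h = (norm h)\<^sup>2" by (simp add: power2_norm_eq_inner)
    have T: "test_poly z p (\<lambda>h. B h + e *\<^sub>R h) K w = p \<bullet> h + (1/2) * (h \<bullet> B h) + (e/2) * (norm h)\<^sup>2 + K * (norm h) ^ 4"
      by (simp add: test_poly_def h_def[symmetric] inner_add_right hh)
    have T0: "test_poly z p (\<lambda>h. B h + e *\<^sub>R h) K z = 0" by (simp add: test_poly_def)
    have "f w <= f z + (p \<bullet> h + (1/2) * (h \<bullet> B h) + (e/2) * (norm h)\<^sup>2 + K * (norm h) ^ 4)"
    proof (cases "norm h < d")
      case True
      have "K * norm h ^ 4 >= 0" using K0 by simp
      moreover have "z + h = w" by (simp add: h_def)
      ultimately show ?thesis using d(2)[OF True] by simp
    next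
      case False
      define r where "r = norm h"
      have r: "r >= d" "r > 0" using False d(1) by (auto simp: r_def)
      have pw: "d ^ 4 <= r ^ 4" "d ^ 3 * r <= r ^ 4" "d\<^sup>2 * r\<^sup>2 <= r ^ 4"
      proof -
        show "d ^ 4 <= r ^ 4" using r d(1) by (intro power_mono) auto
        have "d ^ 3 * r <= r ^ 3 * r" using r d(1) by (intro mult_right_mono power_mono) auto
        then show "d ^ 3 * r <= r ^ 4" by (simp add: power3_eq_cube power4_eq_xxxx)
        have "d\<^sup>2 * r\<^sup>2 <= r\<^sup>2 * r\<^sup>2" using r d(1) by (intro mult_right_mono power_mono) auto
        then show "d\<^sup>2 * r\<^sup>2 <= r ^ 4" by (simp add: power2_eq_square power4_eq_xxxx)
      qed
      have "2 * \<bar>M\<bar> + norm p * r + \<beta> * r\<^sup>2 <= K * r ^ 4"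
      proof -
        have "2 * \<bar>M\<bar> / d ^ 4 * d ^ 4 <= 2 * \<bar>M\<bar> / d ^ 4 * r ^ 4" using pw d(1) by (intro mult_left_mono) auto
        moreover have "norm p / d ^ 3 * (d ^ 3 * r) <= norm p / d ^ 3 * r ^ 4" using pw d(1) by (intro mult_left_mono) auto
        moreover have "\<beta> / d\<^sup>2 * (d\<^sup>2 * r\<^sup>2) <= \<beta> / d\<^sup>2 * r ^ 4" using pw d(1) \<beta>(1) by (intro mult_left_mono) auto
        ultimately show ?thesis using d(1) by (simp add: K_def distrib_right)
      qed
      moreover have "\<bar>p \<bullet> h\<bar> <= norm p * r" unfolding r_def by (rule Cauchy_Schwarz_ineq2)
      moreover have "\<bar>h \<bullet> B h\<bar> <= \<beta> * r\<^sup>2"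
      proof -
        have "\<bar>h \<bullet> B h\<bar> <= norm h * norm (B h)" by (rule Cauchy_Schwarz_ineq2)
        also have "\<dots> <= norm h * (norm h * \<beta>)" using \<beta>(2) by (intro mult_left_mono) auto
        finally show ?thesis by (simp add: r_def power2_eq_square mult.commute mult.left_commute)
      qed
      moreover have "\<beta> * r\<^sup>2 >= 0" "(e/2) * r\<^sup>2 >= 0" using \<beta>(1) e by auto
      ultimately show ?thesis using bd[OF w] bd[OF zS] unfolding r_def[symmetric] by linarith
    qed
    then show "f w - test_poly z p (\<lambda>h. B h + e *\<^sub>R h) K w <= f z - test_poly z p (\<lambda>h. B h + e *\<^sub>R h) K z"
      unfolding T T0 by simp
  qed
qed

lemma op_F_uminus: "op_F p (- \<xi>) (- X) = - op_F p \<xi> (X :: real^'n^'n)"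
proof -
  have "(- X) *v k = - (X *v k)" "X *v (- k) = - (X *v k)" for k
    by (simp_all add: matrix_vector_mult_def vec_eq_iff sum_negf)
  then show ?thesis by (simp add: op_F_eq_TrA TrA_def sum_negf)
qed

text \<open>
  The operator is odd, so \<open>- u\<close> is a subsolution whenever \<open>u\<close> is a supersolution.
\<close>

lemma upper_envelope_op_F:
  "upper_envelope (op_F p) (- \<xi>) (- X) = - lower_envelope (op_F p) \<xi> (X :: real^'n^'n)"
proof -
  have "{- op_F p \<eta> Y |\<eta> Y. \<eta> \<noteq> 0 \<and> transpose Y = Y \<and> norm (\<eta> - - \<xi>) < \<delta> \<and> norm (Y - - X) < \<delta>}
      = {op_F p \<eta> Y |\<eta> Y. \<eta> \<noteq> 0 \<and> transpose Y = Y \<and> norm (\<eta> - \<xi>) < \<delta> \<and> norm (Y - X) < \<delta>}" (is "?L = ?R") for \<delta>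
  proof
    have tm: "transpose (- Y) = - Y" if "transpose Y = Y" for Y :: "real^'n^'n"
      using that by (simp add: transpose_def vec_eq_iff)
    show "?L \<subseteq> ?R"
    proof (clarify)
      fix \<eta> Y assume h: "\<eta> \<noteq> (0::real^'n)" "transpose Y = (Y::real^'n^'n)" "norm (\<eta> - - \<xi>) < \<delta>" "norm (Y - - X) < \<delta>"
      have "norm (- \<eta> - \<xi>) = norm (\<eta> - - \<xi>)" "norm (- Y - X) = norm (Y - - X)"
        using norm_minus_cancel[of "\<eta> + \<xi>"] norm_minus_cancel[of "Y + X"] by simp_all
      then show "\<exists>\<eta>' Y'. - op_F p \<eta> Y = op_F p \<eta>' Y' \<and> \<eta>' \<noteq> 0 \<and> transpose Y' = Y' \<and> norm (\<eta>' - \<xi>) < \<delta> \<and> norm (Y' - X) < \<delta>"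
        using h tm[OF h(2)] by (intro exI[of _ "- \<eta>"] exI[of _ "- Y"]) (simp add: op_F_uminus)
    qed
    show "?R \<subseteq> ?L"
    proof (clarify)
      fix \<eta> Y assume h: "\<eta> \<noteq> (0::real^'n)" "transpose Y = (Y::real^'n^'n)" "norm (\<eta> - \<xi>) < \<delta>" "norm (Y - X) < \<delta>"
      have "norm (- \<eta> - - \<xi>) = norm (\<eta> - \<xi>)" "norm (- Y - - X) = norm (Y - X)"
        by (simp_all add: norm_minus_commute)
      then show "\<exists>\<eta>' Y'. op_F p \<eta> Y = - op_F p \<eta>' Y' \<and> \<eta>' \<noteq> 0 \<and> transpose Y' = Y' \<and> norm (\<eta>' - - \<xi>) < \<delta> \<and> norm (Y' - - X) < \<delta>"
        using h tm[OF h(2)] by (intro exI[of _ "- \<eta>"] exI[of _ "- Y"]) (simp add: op_F_uminus)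
    qed
  qed
  then show ?thesis unfolding upper_envelope_def lower_envelope_def by simp
qed

text \<open>
  The subsolution property in terms of jets.  At a vanishing gradient the operator is replaced by its bound for forms
  below a multiple of the identity; this clause is imposed for every gradient, so that small gradients need no separate
  limit.
\<close>

definition subsol_jets :: "ereal => (real^'n) set => ((real^'n) \<times> real => real) => bool" where
  "subsol_jets p \<Omega> f \<longleftrightarrow> (\<forall>x\<in>\<Omega>. \<forall>t>0. \<forall>\<xi> a Q. qform Q --> upper_jet f (x, t) (\<xi>, a) Q -->
     (\<xi> \<noteq> 0 --> a <= TrA p \<xi> (\<lambda>k. Q (k, 0))) \<and>
     (\<forall>c. (\<forall>k. Q (k, 0) <= c * (norm k)\<^sup>2) --> a <= c * trace_const p TYPE('n)))"

lemma spatial_hessian: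
  fixes B :: "(real^'n) \<times> real => (real^'n) \<times> real"
  assumes lin: "linear B" and sym: "!!v w. v \<bullet> B w = w \<bullet> B v"
  defines "X \<equiv> (\<chi> i j. (axis j 1, 0) \<bullet> B (axis i 1, 0)) :: real^'n^'n"
  shows "transpose X = X" "k \<bullet> (X *v k) = (k, 0) \<bullet> B (k, 0)"
proof -
  show tr: "transpose X = X" by (simp add: X_def transpose_def vec_eq_iff sym)
  define L where "L k = fst (B (k, 0))" for k
  have linL: "linear L"
  proof (rule linearI)
    fix u v :: "real^'n" and c :: real
    show "L (u + v) = L u + L v" using linear_add[OF lin, of "(u, 0)" "(v, 0)"] by (simp add: L_def)
    show "L (c *\<^sub>R u) = c *\<^sub>R L u" using linear_scale[OF lin, of c "(u, 0)"] by (simp add: L_def)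
  qed
  have "matrix L = X"
  proof -
    have "matrix L $ i $ j = X $ i $ j" for i j
    proof -
      have "matrix L $ i $ j = (axis i 1, 0) \<bullet> B (axis j 1, 0)"
        by (simp add: matrix_def L_def inner_prod_def inner_axis')
      then show ?thesis using sym by (simp add: X_def)
    qed
    then show ?thesis by (simp add: vec_eq_iff)
  qed
  then have "X *v k = L k" using linL by (metis matrix_vector_mul(2))
  then show "k \<bullet> (X *v k) = (k, 0) \<bullet> B (k, 0)" by (simp add: L_def inner_prod_def)
qed

lemma qform_symmetric:
  fixes Q :: "'a::euclidean_space => real"
  assumes "qform Q"
  obtains B where "linear B" "!!v w. v \<bullet> B w = w \<bullet> B v" "Q = (\<lambda>h. h \<bullet> B h)"
proof -
  obtain B0 where B0: "linear B0" "Q = (\<lambda>h. h \<bullet> B0 h)" using assms by (auto simp: qform_def)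
  define B where "B h = (1/2) *\<^sub>R (B0 h + adjoint B0 h)" for h
  have adj: "v \<bullet> adjoint B0 w = B0 v \<bullet> w" for v w by (rule adjoint_works[OF B0(1)])
  show ?thesis
  proof (rule that)
    show "linear B" unfolding B_def
      by (intro linear_compose_scale_right linear_compose_add B0(1) adjoint_linear)
    show "v \<bullet> B w = w \<bullet> B v" for v w
      by (simp add: B_def inner_add_right adj inner_commute add.commute)
    show "Q = (\<lambda>h. h \<bullet> B h)" by (simp add: B_def B0(2) inner_add_right adj inner_commute)
  qed
qed

lemma subsol_jetsI:
  fixes f :: "(real^'n) \<times> real => real"
  assumes p: "1 < p" and bd: "!!w. w \<in> \<Omega> \<times> {0<..} ==> \<bar>f w\<bar> <= M"
    and visc: "!!x t \<xi> a B K. x \<in> \<Omega> ==> t > 0 ==> linear B ==> (!!v w. v \<bullet> B w = w \<bullet> B v) ==>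
        (!!w. w \<in> \<Omega> \<times> {0<..} ==> f w - test_poly (x, t) (\<xi>, a) B K w <= f (x, t) - test_poly (x, t) (\<xi>, a) B K (x, t)) ==>
        a + lower_envelope (op_F p) \<xi> (\<chi> i j. (axis j 1, 0) \<bullet> B (axis i 1, 0)) <= 0"
  shows "subsol_jets p \<Omega> f"
  unfolding subsol_jets_def
proof (intro ballI allI impI)
  fix x t \<xi> a Q assume x: "x \<in> \<Omega>" and t: "(t::real) > 0" and Q: "qform Q" and jet: "upper_jet f (x, t) (\<xi>, a) Q"
  obtain B where B: "linear B" "!!v w. v \<bullet> B w = w \<bullet> B v" "Q = (\<lambda>h. h \<bullet> B h)" using qform_symmetric[OF Q] by blast
  have nk: "(k, 0::real) \<bullet> (c *\<^sub>R k, 0) = c * (norm k)\<^sup>2" for k :: "real^'n" and c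
    by (simp add: power2_norm_eq_inner)
  have key: "\<exists>X. transpose X = X \<and> (\<forall>k. k \<bullet> (X *v k) = Q (k, 0) + e * (norm k)\<^sup>2) \<and>
      a + lower_envelope (op_F p) \<xi> X <= 0" if e: "e > 0" for e
  proof -
    define Be where "Be h = B h + e *\<^sub>R h" for h
    have Be: "linear Be" "!!v w. v \<bullet> Be w = w \<bullet> Be v"
    proof -
      show "linear Be" unfolding Be_def by (intro linear_compose_add B(1) linear_scaleR)
      show "!!v w. v \<bullet> Be w = w \<bullet> Be v" using B(2) by (simp add: Be_def inner_add_right inner_commute)
    qed
    have xt: "(x, t) \<in> \<Omega> \<times> {0<..}" using x t by simp
    obtain K where K: "!!w. w \<in> \<Omega> \<times> {0<..} ==>
        f w - test_poly (x, t) (\<xi>, a) Be K w <= f (x, t) - test_poly (x, t) (\<xi>, a) Be K (x, t)"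
      using upper_jet_test_poly[OF jet[unfolded B(3)] B(1) e bd xt] unfolding Be_def by blast
    from visc[OF x t Be K] spatial_hessian[OF Be]
    show ?thesis
      by (intro exI[of _ "\<chi> i j. (axis j 1, 0) \<bullet> Be (axis i 1, 0)"])
        (simp add: B(3) Be_def inner_add_right nk del: inner_Pair)
  qed
  have tc: "trace_const p TYPE('n) > 0" by (rule trace_const_pos[OF p])
  show "(\<xi> \<noteq> 0 --> a <= TrA p \<xi> (\<lambda>k. Q (k, 0))) \<and>
     (\<forall>c. (\<forall>k. Q (k, 0) <= c * (norm k)\<^sup>2) --> a <= c * trace_const p TYPE('n))"
  proof (intro conjI impI allI)
    assume \<xi>: "\<xi> \<noteq> 0"
    show "a <= TrA p \<xi> (\<lambda>k. Q (k, 0))"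
    proof (rule field_le_epsilon)
      fix e :: real assume e: "e > 0"
      define e' where "e' = e / trace_const p TYPE('n)"
      have "e' > 0" using e tc by (simp add: e'_def)
      then obtain X where X: "transpose X = X" "!!k. k \<bullet> (X *v k) = Q (k, 0) + e' * (norm k)\<^sup>2"
        "a + lower_envelope (op_F p) \<xi> X <= 0" using key by blast
      have "a <= TrA p \<xi> (\<lambda>k. k \<bullet> (X *v k))" using lower_envelope_ge_TrA[OF p X(1) \<xi>] X(3) by linarith
      also have "\<dots> = TrA p \<xi> (\<lambda>k. Q (k, 0)) + e' * trace_const p TYPE('n)"
        unfolding X(2) TrA_add TrA_cmul TrA_normsq[OF \<xi>] ..
      finally show "a <= TrA p \<xi> (\<lambda>k. Q (k, 0)) + e" using tc by (simp add: e'_def)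
    qed
  next
    fix c assume c: "\<forall>k. Q (k, 0) <= c * (norm k)\<^sup>2"
    show "a <= c * trace_const p TYPE('n)"
    proof (rule field_le_epsilon)
      fix e :: real assume e: "e > 0"
      define e' where "e' = e / trace_const p TYPE('n)"
      have "e' > 0" using e tc by (simp add: e'_def)
      then obtain X where X: "transpose X = X" "!!k. k \<bullet> (X *v k) = Q (k, 0) + e' * (norm k)\<^sup>2"
        "a + lower_envelope (op_F p) \<xi> X <= 0" using key by blast
      have "k \<bullet> (X *v k) <= (c + e') * (norm k)\<^sup>2" for k using c X(2)[of k] by (simp add: distrib_right)
      from lower_envelope_ge_const[OF p X(1) this, of \<xi>] X(3)
      have "a <= (c + e') * trace_const p TYPE('n)" by linarith
      then show "a <= c * trace_const p TYPE('n) + e" using tc by (simp add: e'_def algebra_simps)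
    qed
  qed
qed

lemma C2_on_test_poly:
  assumes "linear B" "!!v w. v \<bullet> B w = w \<bullet> B v"
  shows "C2_on S (test_poly z p B K)"
  by (rule C2_on_gradient[OF test_poly_derivative[OF assms] test_grad_derivative(1)[OF assms(1)] test_grad_derivative(2)[OF assms(1)]])

text \<open>
  A jet is realised by a quartic polynomial touching from above globally, since the solution is bounded;
  letting the added multiple of the identity tend to zero gives the inequality for the jet itself.
\<close>

lemma viscosity_solution_jets:
  fixes u :: "(real^'n) \<times> real => real"
  assumes p: "1 < p" and v: "viscosity_solution p \<Omega> u" and bd: "!!w. w \<in> \<Omega> \<times> {0<..} ==> \<bar>u w\<bar> <= M"
  shows "subsol_jets p \<Omega> u" "subsol_jets p \<Omega> (\<lambda>w. - u w)"
proof -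
  show "subsol_jets p \<Omega> u"
  proof (rule subsol_jetsI[OF p bd])
    fix x t \<xi> a B K
    assume x: "x \<in> \<Omega>" and t: "(t::real) > 0" and B: "linear B" "!!v w. v \<bullet> B w = w \<bullet> B v"
      and max: "!!w. w \<in> \<Omega> \<times> {0<..} ==> u w - test_poly (x, t) (\<xi>, a) B K w <= u (x, t) - test_poly (x, t) (\<xi>, a) B K (x, t)"
    have "viscosity_subsolution p \<Omega> u" using v by (simp add: viscosity_solution_def)
    then have "\<forall>\<phi> x t. C2_on (\<Omega> \<times> {0<..}) \<phi> --> x \<in> \<Omega> --> t > 0 -->
        (\<forall>z \<in> \<Omega> \<times> {0<..}. u z - \<phi> z <= u (x, t) - \<phi> (x, t)) -->
        deriv (\<lambda>s. \<phi> (x, s)) t +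
          lower_envelope (op_F p) (gradient (\<lambda>y. \<phi> (y, t)) x) (hessian (\<lambda>y. \<phi> (y, t)) x) <= 0"
      unfolding viscosity_subsolution_def by blast
    from this[rule_format, OF C2_on_test_poly[OF B] x t max]
    show "a + lower_envelope (op_F p) \<xi> (\<chi> i j. (axis j 1, 0) \<bullet> B (axis i 1, 0)) <= 0"
      unfolding test_poly_partials[OF B] .
  qed
  show "subsol_jets p \<Omega> (\<lambda>w. - u w)"
  proof (rule subsol_jetsI[OF p, where M = M])
    show "\<bar>- u w\<bar> <= M" if "w \<in> \<Omega> \<times> {0<..}" for w using bd[OF that] by simp
    fix x t \<xi> a B K
    assume x: "x \<in> \<Omega>" and t: "(t::real) > 0" and B: "linear B" "!!v w. v \<bullet> B w = w \<bullet> B v"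
      and max: "!!w. w \<in> \<Omega> \<times> {0<..} ==> - u w - test_poly (x, t) (\<xi>, a) B K w <= - u (x, t) - test_poly (x, t) (\<xi>, a) B K (x, t)"
    define B' where "B' h = - B h" for h
    have B': "linear B'" "!!v w. v \<bullet> B' w = w \<bullet> B' v"
      using B by (auto simp: B'_def[abs_def] linear_compose_neg)
    have tp: "test_poly (x, t) (- \<xi>, - a) B' (- K) w = - test_poly (x, t) (\<xi>, a) B K w" for w
    proof -
      have e: "(- \<xi>, - a) = - (\<xi>, a)" by simp
      show ?thesis unfolding e test_poly_def B'_def inner_minus_left inner_minus_right by linarith
    qed
    have max': "u (x, t) - test_poly (x, t) (- \<xi>, - a) B' (- K) (x, t) <= u w - test_poly (x, t) (- \<xi>, - a) B' (- K) w"
      if "w \<in> \<Omega> \<times> {0<..}" for w using max[OF that] unfolding tp by simp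
    have "viscosity_supersolution p \<Omega> u" using v by (simp add: viscosity_solution_def)
    then have "\<forall>\<psi> x t. C2_on (\<Omega> \<times> {0<..}) \<psi> --> x \<in> \<Omega> --> t > 0 -->
        (\<forall>z \<in> \<Omega> \<times> {0<..}. u z - \<psi> z >= u (x, t) - \<psi> (x, t)) -->
        deriv (\<lambda>s. \<psi> (x, s)) t +
          upper_envelope (op_F p) (gradient (\<lambda>y. \<psi> (y, t)) x) (hessian (\<lambda>y. \<psi> (y, t)) x) >= 0"
      unfolding viscosity_supersolution_def by blast
    from this[rule_format, OF C2_on_test_poly[OF B'] x t max']
    have "- a + upper_envelope (op_F p) (- \<xi>) (\<chi> i j. (axis j 1, 0) \<bullet> B' (axis i 1, 0)) >= 0"
      unfolding test_poly_partials[OF B'] .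
    moreover have "(\<chi> i j. (axis j 1, 0) \<bullet> B' (axis i 1, 0)) = - (\<chi> i j. (axis j 1, 0) \<bullet> B (axis i 1, 0) :: real^'n^'n)"
      by (simp add: vec_eq_iff B'_def inner_prod_def)
    ultimately show "a + lower_envelope (op_F p) \<xi> (\<chi> i j. (axis j 1, 0) \<bullet> B (axis i 1, 0)) <= 0"
      by (simp add: upper_envelope_op_F)
  qed
qed

section \<open>Calculus of jets\<close>

lemma qform_bound:
  fixes Q :: "'a::euclidean_space => real"
  assumes "qform Q"
  obtains \<beta> where "\<beta> >= 0" "!!h. \<bar>Q h\<bar> <= \<beta> * (norm h)\<^sup>2"
proof -
  obtain B where B: "linear B" "Q = (\<lambda>h. h \<bullet> B h)" using assms by (auto simp: qform_def)
  obtain \<beta> where \<beta>: "\<beta> > 0" "!!v. norm (B v) <= norm v * \<beta>"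
    using linear_conv_bounded_linear[THEN iffD1, OF B(1)] bounded_linear.pos_bounded by blast
  have "\<bar>Q h\<bar> <= \<beta> * (norm h)\<^sup>2" for h
  proof -
    have "\<bar>Q h\<bar> <= norm h * norm (B h)" unfolding B(2) by (rule Cauchy_Schwarz_ineq2)
    also have "\<dots> <= norm h * (norm h * \<beta>)" using \<beta>(2) by (intro mult_left_mono) auto
    finally show ?thesis by (simp add: power2_eq_square mult.commute mult.left_commute)
  qed
  then show ?thesis using that[of \<beta>] \<beta>(1) by simp
qed

lemma qformI: "linear B ==> (!!h. Q h = h \<bullet> B h) ==> qform Q"
  unfolding qform_def by blast

lemma qformE:
  assumes "qform Q" obtains B where "linear B" "!!h. Q h = h \<bullet> B h"
  using assms unfolding qform_def by auto

lemma qform_add: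
  assumes "qform Q" "qform Q'" shows "qform (\<lambda>h. Q h + Q' h)"
proof -
  obtain B where B: "linear B" "!!h. Q h = h \<bullet> B h" using qformE[OF assms(1)] by metis
  obtain B' where B': "linear B'" "!!h. Q' h = h \<bullet> B' h" using qformE[OF assms(2)] by metis
  show ?thesis by (rule qformI[OF linear_compose_add[OF B(1) B'(1)]]) (simp add: B B' inner_add_right)
qed

lemma qform_cmul:
  assumes "qform Q" shows "qform (\<lambda>h. c * Q h)"
proof -
  obtain B where B: "linear B" "!!h. Q h = h \<bullet> B h" using qformE[OF assms] by metis
  show ?thesis by (rule qformI[OF linear_compose_scale_right[OF B(1), of c]]) (simp add: B)
qed

lemma qform_inner_sq: "qform (\<lambda>h. (p \<bullet> h)\<^sup>2)"
  unfolding qform_def by (intro exI[of _ "\<lambda>h. (p \<bullet> h) *\<^sub>R p"])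
    (auto intro!: linearI simp: inner_add_right scaleR_add_left power2_eq_square inner_commute)

lemma qform_norm_fst: "qform (\<lambda>h :: 'a::real_inner \<times> real. (norm (fst h))\<^sup>2)"
  unfolding qform_def by (intro exI[of _ "\<lambda>h. (fst h, 0)"])
    (auto intro!: linearI simp: power2_norm_eq_inner inner_prod_def)

lemma upper_jet_dominated:
  fixes f :: "'a::real_inner => real"
  assumes "upper_jet \<phi> z p Q" and "d0 > 0"
    and "!!h. norm h < d0 ==> f (z + h) - f z <= \<phi> (z + h) - \<phi> z"
  shows "upper_jet f z p Q"
  unfolding upper_jet_def
proof (intro allI impI)
  fix e :: real assume "e > 0"
  then obtain d where d: "d > 0" "!!h. norm h < d ==> \<phi> (z + h) <= \<phi> z + p \<bullet> h + (1/2) * Q h + e * (norm h)\<^sup>2"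
    using assms(1) unfolding upper_jet_def by blast
  show "\<exists>d>0. \<forall>h. norm h < d --> f (z + h) <= f z + p \<bullet> h + (1/2) * Q h + e * (norm h)\<^sup>2"
  proof (intro exI[of _ "min d d0"] conjI allI impI)
    fix h :: 'a assume "norm h < min d d0"
    then show "f (z + h) <= f z + p \<bullet> h + (1/2) * Q h + e * (norm h)\<^sup>2"
      using d(2)[of h] assms(3)[of h] by simp
  qed (use d(1) assms(2) in auto)
qed

lemma upper_jet_add:
  fixes f :: "'a::real_inner => real"
  assumes "upper_jet f z p Q" "upper_jet g z p' Q'"
  shows "upper_jet (\<lambda>w. f w + g w) z (p + p') (\<lambda>h. Q h + Q' h)"
  unfolding upper_jet_def
proof (intro allI impI)
  fix e :: real assume "e > 0"
  then have e2: "e / 2 > 0" by simp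
  obtain d where d: "d > 0" "!!h. norm h < d ==> f (z + h) <= f z + p \<bullet> h + (1/2) * Q h + (e/2) * (norm h)\<^sup>2"
    using assms(1) e2 unfolding upper_jet_def by blast
  obtain d' where d': "d' > 0" "!!h. norm h < d' ==> g (z + h) <= g z + p' \<bullet> h + (1/2) * Q' h + (e/2) * (norm h)\<^sup>2"
    using assms(2) e2 unfolding upper_jet_def by blast
  show "\<exists>d>0. \<forall>h. norm h < d --> f (z + h) + g (z + h) <= f z + g z + (p + p') \<bullet> h + (1/2) * (Q h + Q' h) + e * (norm h)\<^sup>2"
  proof (intro exI[of _ "min d d'"] conjI allI impI)
    fix h :: 'a assume "norm h < min d d'"
    then show "f (z + h) + g (z + h) <= f z + g z + (p + p') \<bullet> h + (1/2) * (Q h + Q' h) + e * (norm h)\<^sup>2"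
      using d(2)[of h] d'(2)[of h] by (simp add: inner_add_left distrib_left)
  qed (use d(1) d'(1) in auto)
qed

definition real_peano :: "(real => real) => real => real => real => bool" where
  "real_peano \<psi> r0 d1 d2 \<longleftrightarrow>
     (\<forall>e>0. \<exists>d>0. \<forall>s. \<bar>s\<bar> < d --> \<bar>\<psi> (r0 + s) - \<psi> r0 - d1 * s - (1/2) * d2 * s\<^sup>2\<bar> <= e * s\<^sup>2)"

lemma real_peanoI:
  assumes \<eta>: "\<eta> > 0" and der: "!!r. \<bar>r - r0\<bar> < \<eta> ==> (\<psi> has_real_derivative \<psi>' r) (at r)"
    and der2: "(\<psi>' has_real_derivative d2) (at r0)"
  shows "real_peano \<psi> r0 (\<psi>' r0) d2"
  unfolding real_peano_def
proof (intro allI impI)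
  fix e :: real assume e: "e > 0"
  have "(\<lambda>h. (\<psi>' (r0 + h) - \<psi>' r0) / h) \<midarrow>0\<rightarrow> d2" using der2 by (simp add: DERIV_def)
  then obtain \<delta> where \<delta>: "\<delta> > 0" "!!h. h \<noteq> 0 ==> \<bar>h\<bar> < \<delta> ==> \<bar>(\<psi>' (r0 + h) - \<psi>' r0) / h - d2\<bar> < e"
    using e LIM_D[of "\<lambda>h. (\<psi>' (r0 + h) - \<psi>' r0) / h" d2 0 e] by auto
  have small: "\<bar>\<psi>' (r0 + h) - \<psi>' r0 - d2 * h\<bar> <= e * \<bar>h\<bar>" if "\<bar>h\<bar> < \<delta>" for h
  proof (cases "h = 0")
    case False
    have "\<bar>(\<psi>' (r0 + h) - \<psi>' r0) / h - d2\<bar> * \<bar>h\<bar> <= e * \<bar>h\<bar>"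
      using \<delta>(2)[OF False that] by (intro mult_right_mono) auto
    moreover have "\<bar>(\<psi>' (r0 + h) - \<psi>' r0) / h - d2\<bar> * \<bar>h\<bar> = \<bar>\<psi>' (r0 + h) - \<psi>' r0 - d2 * h\<bar>"
    proof -
      have "((\<psi>' (r0 + h) - \<psi>' r0) / h - d2) * h = \<psi>' (r0 + h) - \<psi>' r0 - d2 * h"
        using False by (simp add: field_simps)
      then show ?thesis by (simp flip: abs_mult)
    qed
    ultimately show ?thesis by simp
  qed simp
  show "\<exists>d>0. \<forall>s. \<bar>s\<bar> < d --> \<bar>\<psi> (r0 + s) - \<psi> r0 - \<psi>' r0 * s - (1/2) * d2 * s\<^sup>2\<bar> <= e * s\<^sup>2"
  proof (intro exI[of _ "min \<delta> \<eta>"] conjI allI impI)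
    fix s :: real assume s: "\<bar>s\<bar> < min \<delta> \<eta>"
    define g where "g x = \<psi> (r0 + x) - \<psi>' r0 * x - (1/2) * d2 * x\<^sup>2" for x
    have g': "(g has_real_derivative (\<psi>' (r0 + x) - \<psi>' r0 - d2 * x)) (at x)" if "\<bar>x\<bar> < \<eta>" for x
    proof -
      have "(\<psi> has_real_derivative \<psi>' (r0 + x)) (at (x + r0))"
        using der[of "r0 + x"] that by (simp add: add.commute)
      then have "((\<lambda>x. \<psi> (x + r0)) has_real_derivative \<psi>' (r0 + x)) (at x)" by (rule iffD1[OF DERIV_shift])
      moreover have "(\<lambda>x. \<psi> (x + r0)) = (\<lambda>x. \<psi> (r0 + x))" by (intro ext) (simp add: add.commute)
      ultimately have A: "((\<lambda>x. \<psi> (r0 + x)) has_real_derivative \<psi>' (r0 + x)) (at x)" by simp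
      have B: "((\<lambda>x. \<psi>' r0 * x) has_real_derivative \<psi>' r0) (at x)" by (auto intro!: derivative_eq_intros)
      have C: "((\<lambda>x. (1/2) * d2 * x\<^sup>2) has_real_derivative d2 * x) (at x)" by (auto intro!: derivative_eq_intros)
      show ?thesis unfolding g_def by (rule DERIV_diff[OF DERIV_diff[OF A B] C])
    qed
    have "norm (g s - g 0) <= (e * \<bar>s\<bar>) * norm (s - 0)"
    proof (rule field_differentiable_bound[where S="{-\<bar>s\<bar>..\<bar>s\<bar>}" and f'="\<lambda>x. \<psi>' (r0 + x) - \<psi>' r0 - d2 * x"])
      fix x assume x: "x \<in> {-\<bar>s\<bar>..\<bar>s\<bar>}"
      then have xs: "\<bar>x\<bar> <= \<bar>s\<bar>" by auto
      show "(g has_field_derivative \<psi>' (r0 + x) - \<psi>' r0 - d2 * x) (at x within {- \<bar>s\<bar>..\<bar>s\<bar>})"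
        by (rule has_field_derivative_at_within[OF g']) (use xs s in linarith)
      have "\<bar>\<psi>' (r0 + x) - \<psi>' r0 - d2 * x\<bar> <= e * \<bar>x\<bar>" using small[of x] xs s by simp
      also have "\<dots> <= e * \<bar>s\<bar>" using xs e by (intro mult_left_mono) auto
      finally show "norm (\<psi>' (r0 + x) - \<psi>' r0 - d2 * x) <= e * \<bar>s\<bar>" by simp
    qed auto
    then show "\<bar>\<psi> (r0 + s) - \<psi> r0 - \<psi>' r0 * s - (1/2) * d2 * s\<^sup>2\<bar> <= e * s\<^sup>2"
      by (simp add: g_def power2_eq_square algebra_simps)
  qed (use \<delta>(1) \<eta> in auto)
qed

text \<open>
  The chain rule to second order; monotonicity of \<open>\<psi>\<close> suffices to keep the expansion one-sided.
\<close>

lemma upper_jet_compose: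
  fixes f :: "'a::euclidean_space => real"
  assumes jet: "upper_jet f z p Q" and Q: "qform Q" and pe: "real_peano \<psi> (f z) \<psi>1 \<psi>2" and \<psi>1: "\<psi>1 >= 0"
    and \<eta>: "\<eta> > 0" and mono: "!!h r. norm h < \<eta> ==> f (z + h) <= r ==> \<bar>r - f z\<bar> < \<eta> ==> \<psi> (f (z + h)) <= \<psi> r"
  shows "upper_jet (\<lambda>w. \<psi> (f w)) z (\<psi>1 *\<^sub>R p) (\<lambda>h. \<psi>1 * Q h + \<psi>2 * (p \<bullet> h)\<^sup>2)"
  unfolding upper_jet_def
proof (intro allI impI)
  fix e :: real assume e: "e > 0"
  obtain \<beta> where \<beta>: "\<beta> >= 0" "!!h. \<bar>Q h\<bar> <= \<beta> * (norm h)\<^sup>2" using qform_bound[OF Q] by blast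
  define C where "C = norm p + \<beta> + 1"
  have C: "C >= 1" using \<beta>(1) by (simp add: C_def)
  define e1 where "e1 = min 1 (e / (3 * (\<psi>1 + 1)))"
  define e2 where "e2 = e / (3 * C\<^sup>2)"
  have e12: "e1 > 0" "e1 <= 1" "e2 > 0" using e \<psi>1 C by (auto simp: e1_def e2_def)
  have e1b: "\<psi>1 * e1 <= e / 3"
  proof -
    have "\<psi>1 * e1 <= \<psi>1 * (e / (3 * (\<psi>1 + 1)))" using \<psi>1 by (intro mult_left_mono) (auto simp: e1_def)
    also have "\<dots> = (\<psi>1 / (\<psi>1 + 1)) * (e / 3)" using \<psi>1 by simp
    also have "\<dots> <= 1 * (e / 3)" using \<psi>1 e by (intro mult_right_mono) auto
    finally show ?thesis by simp
  qed
  obtain d1 where d1: "d1 > 0" "!!h. norm h < d1 ==> f (z + h) <= f z + p \<bullet> h + (1/2) * Q h + e1 * (norm h)\<^sup>2"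
    using jet e12 unfolding upper_jet_def by blast
  obtain d2 where d2: "d2 > 0" "!!s. \<bar>s\<bar> < d2 ==> \<bar>\<psi> (f z + s) - \<psi> (f z) - \<psi>1 * s - (1/2) * \<psi>2 * s\<^sup>2\<bar> <= e2 * s\<^sup>2"
    using pe e12 unfolding real_peano_def by blast
  define d where "d = min (min d1 \<eta>) (min (min 1 (min d2 \<eta> / C)) (e / (3 * C * 2 * C * (\<bar>\<psi>2\<bar> + 1))))"
  have d: "d > 0" using d1(1) d2(1) \<eta> C e by (simp add: d_def)
  show "\<exists>d>0. \<forall>h. norm h < d --> \<psi> (f (z + h)) <= \<psi> (f z) + \<psi>1 *\<^sub>R p \<bullet> h + (1/2) * (\<psi>1 * Q h + \<psi>2 * (p \<bullet> h)\<^sup>2) + e * (norm h)\<^sup>2"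
  proof (intro exI[of _ d] conjI d allI impI)
    fix h :: 'a assume h: "norm h < d"
    define n where "n = norm h"
    have n: "n >= 0" "n < d1" "n < \<eta>" "n <= 1" "n < min d2 \<eta> / C" "n <= e / (3 * C * 2 * C * (\<bar>\<psi>2\<bar> + 1))"
      using h by (auto simp: n_def d_def)
    define T where "T = (1/2) * Q h + e1 * n\<^sup>2"
    define S where "S = p \<bullet> h + T"
    have Tb: "\<bar>T\<bar> <= (\<beta> + 1) * n\<^sup>2"
    proof -
      have "e1 * n\<^sup>2 >= 0" using e12 by simp
      then have "\<bar>T\<bar> <= \<bar>Q h\<bar> + e1 * n\<^sup>2" unfolding T_def by linarith
      also have "\<dots> <= \<beta> * n\<^sup>2 + 1 * n\<^sup>2" using \<beta>(1) \<beta>(2)[of h] e12 by (intro add_mono mult_right_mono) (auto simp: n_def)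
      finally show ?thesis by (simp add: distrib_right)
    qed
    have n2n: "n\<^sup>2 <= n" using n by (simp add: power2_eq_square mult_left_le_one_le)
    have ph: "\<bar>p \<bullet> h\<bar> <= norm p * n" unfolding n_def by (rule Cauchy_Schwarz_ineq2)
    have Tn: "\<bar>T\<bar> <= (\<beta> + 1) * n" using Tb mult_left_mono[OF n2n, of "\<beta> + 1"] \<beta>(1) by linarith
    have Sb: "\<bar>S\<bar> <= C * n" using ph Tn by (simp add: S_def C_def algebra_simps)
    have "C * n < min d2 \<eta>" using n(5) C by (simp add: less_divide_eq mult.commute)
    then have S2: "\<bar>S\<bar> < d2" "\<bar>S\<bar> < \<eta>" using Sb by auto
    have "f (z + h) <= f z + S" using d1(2)[of h] n by (simp add: S_def T_def n_def)
    then have "\<psi> (f (z + h)) <= \<psi> (f z + S)" by (intro mono) (use n S2 in \<open>auto simp: n_def\<close>)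
    moreover have "\<psi> (f z + S) <= \<psi> (f z) + \<psi>1 * S + (1/2) * \<psi>2 * S\<^sup>2 + e2 * S\<^sup>2" using d2(2)[OF S2(1)] by linarith
    moreover have "\<psi>1 * S <= \<psi>1 * (p \<bullet> h) + \<psi>1 * ((1/2) * Q h) + (e/3) * n\<^sup>2"
      using mult_right_mono[OF e1b, of "n\<^sup>2"] by (simp add: S_def T_def algebra_simps)
    moreover have "e2 * S\<^sup>2 <= (e/3) * n\<^sup>2"
    proof -
      have "S\<^sup>2 <= (C * n)\<^sup>2" using Sb by (metis abs_ge_zero power2_abs power_mono)
      then have "e2 * S\<^sup>2 <= e2 * (C * n)\<^sup>2" using e12 by (intro mult_left_mono) auto
      also have "\<dots> = (e/3) * n\<^sup>2" using C by (simp add: e2_def power_mult_distrib)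
      finally show ?thesis .
    qed
    moreover have "(1/2) * \<psi>2 * S\<^sup>2 <= (1/2) * (\<psi>2 * (p \<bullet> h)\<^sup>2) + (e/3) * n\<^sup>2"
    proof -
      have "S\<^sup>2 - (p \<bullet> h)\<^sup>2 = T * (S + p \<bullet> h)" by (simp add: S_def power2_eq_square algebra_simps)
      then have "\<bar>S\<^sup>2 - (p \<bullet> h)\<^sup>2\<bar> = \<bar>T\<bar> * \<bar>S + p \<bullet> h\<bar>" by (simp add: abs_mult)
      also have "\<dots> <= (C * n\<^sup>2) * (2 * C * n)"
      proof (intro mult_mono)
        show "\<bar>T\<bar> <= C * n\<^sup>2" using Tb mult_right_mono[of "\<beta> + 1" C "n\<^sup>2"] by (simp add: C_def)
        have "norm p * n <= C * n" using n(1) \<beta>(1) by (intro mult_right_mono) (auto simp: C_def)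
        then show "\<bar>S + p \<bullet> h\<bar> <= 2 * C * n" using Sb ph by linarith
      qed (use C n in auto)
      finally have D: "\<bar>S\<^sup>2 - (p \<bullet> h)\<^sup>2\<bar> <= (2 * C * C * n) * n\<^sup>2" by (simp add: algebra_simps)
      have "\<psi>2 * S\<^sup>2 - \<psi>2 * (p \<bullet> h)\<^sup>2 <= \<bar>\<psi>2\<bar> * \<bar>S\<^sup>2 - (p \<bullet> h)\<^sup>2\<bar>"
        by (metis abs_ge_self abs_mult right_diff_distrib)
      also have "\<dots> <= (\<bar>\<psi>2\<bar> + 1) * ((2 * C * C * n) * n\<^sup>2)" using D by (intro mult_mono) auto
      also have "\<dots> = ((\<bar>\<psi>2\<bar> + 1) * (2 * C * C * n)) * n\<^sup>2" by simp
      also have "\<dots> <= (e/3) * n\<^sup>2"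
      proof (intro mult_right_mono)
        have pos: "3 * C * 2 * C * (\<bar>\<psi>2\<bar> + 1) > 0" using C by simp
        have "n * (3 * C * 2 * C * (\<bar>\<psi>2\<bar> + 1)) <= e" using n(6) pos by (simp add: le_divide_eq)
        then show "(\<bar>\<psi>2\<bar> + 1) * (2 * C * C * n) <= e / 3" by (simp add: algebra_simps)
      qed simp
      finally have "\<psi>2 * S\<^sup>2 - \<psi>2 * (p \<bullet> h)\<^sup>2 <= (e/3) * n\<^sup>2" .
      moreover have "(e/3) * n\<^sup>2 >= 0" using e by simp
      ultimately show ?thesis by linarith
    qed
    moreover have "\<psi>1 *\<^sub>R p \<bullet> h = \<psi>1 * (p \<bullet> h)" by simp
    moreover have "e * (norm h)\<^sup>2 = (e/3) * n\<^sup>2 + (e/3) * n\<^sup>2 + (e/3) * n\<^sup>2" by (simp add: n_def)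
    moreover have "(1/2) * (\<psi>1 * Q h + \<psi>2 * (p \<bullet> h)\<^sup>2) = \<psi>1 * ((1/2) * Q h) + (1/2) * (\<psi>2 * (p \<bullet> h)\<^sup>2)"
      by (simp add: algebra_simps)
    ultimately show "\<psi> (f (z + h)) <= \<psi> (f z) + \<psi>1 *\<^sub>R p \<bullet> h + (1/2) * (\<psi>1 * Q h + \<psi>2 * (p \<bullet> h)\<^sup>2) + e * (norm h)\<^sup>2"
      by linarith
  qed
qed

lemma upper_jet_normsq:
  fixes x c :: "'a::euclidean_space"
  shows "upper_jet (\<lambda>w. (norm (fst w - c))\<^sup>2) (x, t::real) (2 *\<^sub>R (x - c), 0) (\<lambda>h. 2 * (norm (fst h))\<^sup>2)"
  unfolding upper_jet_def
proof (intro allI impI exI[of _ 1] conjI)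
  fix e :: real and h :: "'a \<times> real" assume e: "e > 0"
  have "(norm (x + fst h - c))\<^sup>2 = (norm (x - c))\<^sup>2 + 2 * ((x - c) \<bullet> fst h) + (norm (fst h))\<^sup>2"
    by (simp add: power2_norm_eq_inner inner_diff_left inner_diff_right inner_add_left inner_add_right inner_commute)
  moreover have "e * (norm h)\<^sup>2 >= 0" using e by simp
  ultimately show "(norm (fst ((x, t) + h) - c))\<^sup>2 <= (norm (fst (x, t) - c))\<^sup>2 + (2 *\<^sub>R (x - c), 0) \<bullet> h +
      (1/2) * (2 * (norm (fst h))\<^sup>2) + e * (norm h)\<^sup>2"
    by (cases h) simp
qed simp

lemma upper_jet_time:
  fixes x :: "'a::euclidean_space"
  assumes "real_peano \<tau> t d1 d2"
  shows "upper_jet (\<lambda>w. \<tau> (snd w)) (x, t) (0, d1) (\<lambda>h. d2 * ((0, 1) \<bullet> h)\<^sup>2)"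
  unfolding upper_jet_def
proof (intro allI impI)
  fix e :: real assume e: "e > 0"
  then obtain d where d: "d > 0" "!!s. \<bar>s\<bar> < d ==> \<bar>\<tau> (t + s) - \<tau> t - d1 * s - (1/2) * d2 * s\<^sup>2\<bar> <= e * s\<^sup>2"
    using assms unfolding real_peano_def by blast
  show "\<exists>d>0. \<forall>h. norm h < d --> \<tau> (snd ((x, t) + h)) <= \<tau> (snd (x, t)) + (0, d1) \<bullet> h + (1/2) * (d2 * ((0::'a, 1::real) \<bullet> h)\<^sup>2) + e * (norm h)\<^sup>2"
  proof (intro exI[of _ d] conjI d allI impI)
    fix h :: "'a \<times> real" assume h: "norm h < d"
    have s: "\<bar>snd h\<bar> <= norm h" using norm_snd_le[of "snd h" "fst h"] by simp
    have "(snd h)\<^sup>2 <= (norm h)\<^sup>2" using s by (metis abs_ge_zero power2_abs power_mono)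
    then have "e * (snd h)\<^sup>2 <= e * (norm h)\<^sup>2" using e by simp
    then show "\<tau> (snd ((x, t) + h)) <= \<tau> (snd (x, t)) + (0, d1) \<bullet> h + (1/2) * (d2 * ((0::'a, 1::real) \<bullet> h)\<^sup>2) + e * (norm h)\<^sup>2"
      using d(2)[of "snd h"] s h by (cases h) simp
  qed
qed

text \<open>A minimising sequence stays in the bounded set where the function is negative; it cannot approach a point
  outside \<open>D\<close>, where the lower limits are not negative.\<close>

lemma negative_min_attained:
  fixes f :: "'a::heine_borel => real"
  assumes lsc: "!!z c. z \<in> D ==> c < f z ==> \<forall>\<^sub>F w in at z within D. c < f w"
    and bdd: "bounded {z\<in>D. f z < 0}" and low: "!!z. z \<in> D ==> f z >= -B"
    and bdry: "!!z \<eta>. z \<in> closure D - D ==> \<eta> > 0 ==> \<forall>\<^sub>F w in at z within D. f w > -\<eta>"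
    and z1: "z1 \<in> D" "f z1 < 0"
  obtains z where "z \<in> D" "f z < 0" "!!w. w \<in> D ==> f z <= f w"
proof -
  define m where "m = (INF z\<in>D. f z)"
  have bb: "bdd_below (f ` D)" using low by (intro bdd_belowI2)
  have mle: "m <= f z" if "z \<in> D" for z unfolding m_def by (rule cINF_lower[OF bb that])
  have m0: "m < 0" using mle[OF z1(1)] z1(2) by simp
  have "\<exists>z\<in>D. f z < m + min (1 / Suc n) (- m / 2)" for n :: nat
  proof -
    have "Inf (f ` D) < m + min (1 / Suc n) (- m / 2)" using m0 unfolding m_def[symmetric] by simp
    then show ?thesis using cInf_lessD[of "f ` D"] z1(1) by blast
  qed
  then obtain Z where Z: "!!n::nat. Z n \<in> D" "!!n. f (Z n) < m + min (1 / Suc n) (- m / 2)" by metis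
  have Z1: "f (Z n) < m + 1 / Suc n" "f (Z n) < m / 2" for n using Z(2)[of n] by (auto simp: min_def split: if_splits)
  have "bounded (range Z)"
  proof (rule bounded_subset[OF bdd])
    show "range Z \<subseteq> {z\<in>D. f z < 0}" using Z(1) Z1(2) m0 by (auto intro: less_trans[OF Z1(2)])
  qed
  then obtain l \<sigma> where \<sigma>: "strict_mono (\<sigma> :: nat => nat)" and l: "(Z \<circ> \<sigma>) \<longlonglongrightarrow> l"
    using bounded_imp_convergent_subsequence by blast
  have lcl: "l \<in> closure D" unfolding closure_sequential
    using l Z(1) by (intro exI[of _ "Z \<circ> \<sigma>"]) (simp add: o_def)
  have freq: "\<exists>n. Z (\<sigma> n) = l \<or> P (Z (\<sigma> n)) \<and> n >= n0" if ev: "\<forall>\<^sub>F w in at l within D. P w" for P n0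
  proof -
    obtain S where S: "open S" "l \<in> S" "!!x. x \<in> S ==> x \<noteq> l ==> x \<in> D ==> P x"
      using ev unfolding eventually_at_topological by blast
    have "\<forall>\<^sub>F n in sequentially. (Z \<circ> \<sigma>) n \<in> S" using topological_tendstoD[OF l S(1,2)] .
    then obtain N where "!!n. n >= N ==> (Z \<circ> \<sigma>) n \<in> S" by (auto simp: eventually_sequentially)
    then have "Z (\<sigma> (max N n0)) \<in> S" by (simp add: o_def)
    then have "Z (\<sigma> (max N n0)) = l \<or> P (Z (\<sigma> (max N n0)))" using S(3) Z(1) by blast
    then show ?thesis by (intro exI[of _ "max N n0"]) auto
  qed
  have lD: "l \<in> D"
  proof (rule ccontr)
    assume nl: "l \<notin> D"
    have "\<forall>\<^sub>F w in at l within D. f w > -(- m / 2)" by (rule bdry) (use lcl nl m0 in auto)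
    from freq[OF this, of 0] obtain n where "Z (\<sigma> n) = l \<or> f (Z (\<sigma> n)) > m / 2" by auto
    then show False using Z(1) nl Z1(2)[of "\<sigma> n"] by auto
  qed
  have "f l <= m"
  proof (rule ccontr)
    assume "\<not> f l <= m"
    then obtain c where c: "m < c" "c < f l" using dense[of m "f l"] by auto
    obtain n0 :: nat where n0: "1 / real (Suc n0) < c - m" using nat_approx_posE[of "c - m"] c(1) by auto
    show False
    proof (cases "\<exists>n\<ge>n0. Z (\<sigma> n) = l")
      case True
      then obtain n where n: "n >= n0" "Z (\<sigma> n) = l" by blast
      have "1 / real (Suc (\<sigma> n)) <= 1 / real (Suc n0)"
        using n(1) seq_suble[OF \<sigma>, of n] by (intro divide_left_mono) auto
      then show False using Z1(1)[of "\<sigma> n"] n(2) c n0 by simp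
    next
      case False
      have "\<forall>\<^sub>F w in at l within D. c < f w" by (rule lsc[OF lD c(2)])
      then obtain S where S: "open S" "l \<in> S" "!!x. x \<in> S ==> x \<noteq> l ==> x \<in> D ==> c < f x"
        unfolding eventually_at_topological by blast
      obtain N where N: "!!n. n >= N ==> (Z \<circ> \<sigma>) n \<in> S"
        using topological_tendstoD[OF l S(1,2)] by (auto simp: eventually_sequentially)
      define n where "n = max N n0"
      have "c < f (Z (\<sigma> n))" using S(3) N[of n] False Z(1) by (auto simp: n_def o_def)
      moreover have "1 / real (Suc (\<sigma> n)) <= 1 / real (Suc n0)"
        using seq_suble[OF \<sigma>, of n] by (intro divide_left_mono) (auto simp: n_def)
      ultimately show False using Z1(1)[of "\<sigma> n"] n0 by simp
    qed
  qed
  then show ?thesis using that[OF lD] m0 mle by force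
qed

section \<open>Comparison with radial barriers\<close>

text \<open>
  A touching point replaces the comparison principle for explicit barriers: it suffices that no value above the barrier is
  approached at the boundary.
\<close>

lemma comparison_touch:
  fixes f \<phi> :: "'a::heine_borel => real"
  assumes usc: "usc_on D f" and cont: "continuous_on D \<phi>"
    and bdd: "bounded {z\<in>D. \<phi> z < f z}" and up: "!!z. z \<in> D ==> f z - \<phi> z <= B"
    and bdry: "!!z \<eta>. z \<in> closure D - D ==> \<eta> > 0 ==> \<forall>\<^sub>F w in at z within D. f w - \<phi> w < \<eta>"
    and z1: "z1 \<in> D" "\<phi> z1 < f z1"
  obtains z where "z \<in> D" "\<phi> z < f z" "!!w. w \<in> D ==> f w - \<phi> w <= f z - \<phi> z"
proof (rule negative_min_attained[of D "\<lambda>z. \<phi> z - f z" B z1])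
  fix z c assume z: "z \<in> D" and c: "c < \<phi> z - f z"
  define e where "e = (\<phi> z - f z - c) / 2"
  have e: "e > 0" using c by (simp add: e_def)
  have "\<forall>\<^sub>F w in at z within D. f w < f z + e" using usc z e unfolding usc_on_def by simp
  moreover have "\<forall>\<^sub>F w in at z within D. \<phi> z - e < \<phi> w"
    using cont z e unfolding continuous_on_def by (intro order_tendstoD(1)) auto
  ultimately show "\<forall>\<^sub>F w in at z within D. c < \<phi> w - f w"
    by eventually_elim (simp add: e_def field_simps)
next
  show "bounded {z \<in> D. \<phi> z - f z < 0}" using bdd by simp
next
  fix z assume "z \<in> D" then show "- B <= \<phi> z - f z" using up[of z] by simp
next
  fix z \<eta> assume "z \<in> closure D - D" "(\<eta>::real) > 0"
  then show "\<forall>\<^sub>F w in at z within D. - \<eta> < \<phi> w - f w" using bdry[of z \<eta>]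
    by (auto elim!: eventually_mono)
next
  fix z assume "z \<in> D" "\<phi> z - f z < 0" "!!w. w \<in> D ==> \<phi> z - f z <= \<phi> w - f w"
  then show thesis using that[of z] by force
qed (use z1 in auto)

lemma open_touch_jet:
  fixes f \<phi> :: "(real^'n) \<times> real => real"
  assumes "open \<Omega>" "x \<in> \<Omega>" "t > 0" and jet: "upper_jet \<phi> (x, t) p Q"
    and max: "!!w. w \<in> \<Omega> \<times> {0<..} ==> f w - \<phi> w <= f (x, t) - \<phi> (x, t)"
  shows "upper_jet f (x, t) p Q"
proof -
  have "open (\<Omega> \<times> {0::real<..})" using assms(1) by (intro open_Times) auto
  then obtain d where d: "d > 0" "ball (x, t) d \<subseteq> \<Omega> \<times> {0<..}"
    using assms(2,3) by (meson SigmaI greaterThan_iff open_contains_ball)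
  show ?thesis
  proof (rule upper_jet_dominated[OF jet d(1)])
    fix h :: "(real^'n) \<times> real" assume "norm h < d"
    then have "(x, t) + h \<in> ball (x, t) d" by (simp add: dist_norm)
    then have "(x, t) + h \<in> \<Omega> \<times> {0<..}" using d(2) by blast
    from max[OF this] show "f ((x, t) + h) - f (x, t) <= \<phi> ((x, t) + h) - \<phi> (x, t)" by simp
  qed
qed

text \<open>
  The equation on radial functions of \<open>\<bar>x - c\<bar>\<^sup>2\<close> with derivatives \<open>g1\<close> and \<open>g2\<close>; the
  coefficient \<open>1 - 1/p\<close> of the radial second derivative is \<open>1/p'\<close>.
\<close>

lemma radial_jet_ineq:
  fixes f :: "(real^'n) \<times> real => real"
  assumes p: "1 < p" and sj: "subsol_jets p \<Omega> f" and x: "x \<in> \<Omega>" "t > 0" and Q: "qform Q"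
    and jet: "upper_jet f (x, t) ((2 * g1) *\<^sub>R (x - c), a) Q"
    and Qk: "!!k. Q (k, 0) = 2 * g1 * (norm k)\<^sup>2 + 4 * g2 * ((x - c) \<bullet> k)\<^sup>2" and g1: "g1 > 0"
  shows "a <= 2 * g1 * trace_const p TYPE('n) + 4 * g2 * (1 - recip p) * (norm (x - c))\<^sup>2"
proof (cases "x = c")
  case True
  have "\<forall>k. Q (k, 0) <= (2 * g1) * (norm k)\<^sup>2" using Qk True by simp
  then have "a <= (2 * g1) * trace_const p TYPE('n)"
    using sj x Q jet unfolding subsol_jets_def by blast
  then show ?thesis using True by simp
next
  case False
  define y where "y = x - c"
  define \<xi> where "\<xi> = (2 * g1) *\<^sub>R y"
  have y: "norm y > 0" using False by (simp add: y_def)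
  have \<xi>: "\<xi> \<noteq> 0" using y g1 by (auto simp: \<xi>_def)
  have "a <= TrA p \<xi> (\<lambda>k. Q (k, 0))"
    using sj x Q jet \<xi> unfolding subsol_jets_def \<xi>_def y_def by blast
  also have "TrA p \<xi> (\<lambda>k. Q (k, 0)) = (2 * g1) * TrA p \<xi> (\<lambda>k. (norm k)\<^sup>2) + (4 * g2) * TrA p \<xi> (\<lambda>k. (y \<bullet> k)\<^sup>2)"
    unfolding Qk y_def[symmetric] TrA_add TrA_cmul ..
  also have "TrA p \<xi> (\<lambda>k. (norm k)\<^sup>2) = trace_const p TYPE('n)" by (rule TrA_normsq[OF \<xi>])
  also have "TrA p \<xi> (\<lambda>k. (y \<bullet> k)\<^sup>2) = (1 - recip p) * (norm y)\<^sup>2"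
  proof -
    have "(\<Sum>i\<in>Basis. (y \<bullet> i)\<^sup>2) = (norm y)\<^sup>2"
      using euclidean_inner[of y y] by (simp add: power2_eq_square flip: power2_norm_eq_inner)
    moreover have "(y \<bullet> \<xi>)\<^sup>2 / (norm \<xi>)\<^sup>2 = (norm y)\<^sup>2"
      using y g1 by (simp add: \<xi>_def power_mult_distrib dot_square_norm power2_eq_square)
    ultimately show ?thesis by (simp add: TrA_def algebra_simps)
  qed
  finally show ?thesis by (simp add: y_def algebra_simps)
qed

lemma barrier_polynomial_ineq:
  fixes m A Y :: real
  assumes m: "m > 0" and A: "A >= m\<^sup>2 + 2 * m" "A >= 2 * m" and Y: "Y >= A"
  shows "m * (Y - m) * Y\<^sup>2 + (Y\<^sup>2 - A\<^sup>2) * ((2 * m - Y) + (Y - m)\<^sup>2) <= Y ^ 4"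
proof -
  have Y0: "Y > 0" "A > 0" using m A Y by auto
  have "(2 * m - Y) + (Y - m)\<^sup>2 <= Y\<^sup>2 - 2 * m * Y" using A Y by (simp add: power2_eq_square algebra_simps)
  moreover have AY: "Y\<^sup>2 - A\<^sup>2 >= 0" using Y Y0 by (simp add: power_mono)
  ultimately have "(Y\<^sup>2 - A\<^sup>2) * ((2 * m - Y) + (Y - m)\<^sup>2) <= (Y\<^sup>2 - A\<^sup>2) * (Y\<^sup>2 - 2 * m * Y)"
    by (rule mult_left_mono)
  also have "\<dots> <= Y\<^sup>2 * (Y\<^sup>2 - 2 * m * Y)"
  proof (rule mult_right_mono)
    have "2 * m * Y <= Y * Y" using A Y Y0 by (intro mult_right_mono) auto
    then show "0 <= Y\<^sup>2 - 2 * m * Y" by (simp add: power2_eq_square)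
  qed simp
  finally have 1: "(Y\<^sup>2 - A\<^sup>2) * ((2 * m - Y) + (Y - m)\<^sup>2) <= Y\<^sup>2 * (Y\<^sup>2 - 2 * m * Y)" .
  have "m * (Y - m) * Y\<^sup>2 + Y\<^sup>2 * (Y\<^sup>2 - 2 * m * Y) = Y ^ 4 - m * Y ^ 3 - m\<^sup>2 * Y\<^sup>2"
    by (simp add: power2_eq_square power3_eq_cube power4_eq_xxxx algebra_simps)
  moreover have "m * Y ^ 3 >= 0" "m\<^sup>2 * Y\<^sup>2 >= 0" using m Y0 by auto
  ultimately show ?thesis using 1 by linarith
qed

text \<open>
  The rate of growth \<open>b \<kappa>\<^sup>2\<close> bounds the spatial operator on \<open>q\<^sup>-\<^sup>m exp (\<kappa> q)\<close>.  The
  factor \<open>q\<^sup>-\<^sup>m\<close> contributes \<open>- 2 b m \<kappa> / q\<close>, which outweighs the curvature term \<open>b m \<kappa> / q\<close>,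
  and \<open>\<kappa> q \<ge> A\<close> controls the terms of higher order in \<open>1 / (\<kappa> q)\<close>.
\<close>

lemma barrier_ineq:
  fixes m A \<kappa> q b :: real
  assumes m: "m > 0" and A: "A >= m\<^sup>2 + 2 * m" "A >= 2 * m" and \<kappa>: "\<kappa> > 0" and q: "\<kappa> * q >= A" and b: "b > 0"
  defines "P1 \<equiv> \<kappa> / (2 * q) - m / (2 * q\<^sup>2)" and "P2 \<equiv> m / (2 * q ^ 4) - \<kappa> / (4 * q ^ 3)"
  shows "2 * P1 * (b * m) + 4 * (P2 + P1\<^sup>2) * b * (q\<^sup>2 - (A / \<kappa>)\<^sup>2) <= b * \<kappa>\<^sup>2" "P1 > 0"
proof -
  define Y where "Y = \<kappa> * q"
  have Y: "Y >= A" "Y > 0" "A > 0" "Y > m" using q m A by (auto simp: Y_def)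
  have q0: "q > 0" using Y(2) \<kappa> by (simp add: Y_def zero_less_mult_iff)
  have qY: "q = Y / \<kappa>" using \<kappa> by (simp add: Y_def)
  have P1: "P1 = \<kappa>\<^sup>2 * (Y - m) / (2 * Y\<^sup>2)"
    unfolding P1_def qY using \<kappa> Y(2) by (simp add: field_simps power2_eq_square)
  have P2: "P2 = \<kappa> ^ 4 * (2 * m - Y) / (4 * Y ^ 4)"
    unfolding P2_def qY using \<kappa> Y(2) by (simp add: field_simps power2_eq_square power3_eq_cube power4_eq_xxxx)
  show "P1 > 0" unfolding P1 using \<kappa> Y by simp
  have r: "q\<^sup>2 - (A / \<kappa>)\<^sup>2 = (Y\<^sup>2 - A\<^sup>2) / \<kappa>\<^sup>2" unfolding qY by (simp add: power_divide diff_divide_distrib)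
  have P12: "P2 + P1\<^sup>2 = \<kappa> ^ 4 * ((2 * m - Y) + (Y - m)\<^sup>2) / (4 * Y ^ 4)"
    unfolding P1 P2 using Y(2) by (simp add: field_simps power2_eq_square power4_eq_xxxx)
  have "2 * P1 * (b * m) + 4 * (P2 + P1\<^sup>2) * b * (q\<^sup>2 - (A / \<kappa>)\<^sup>2)
     = b * \<kappa>\<^sup>2 * ((m * (Y - m) * Y\<^sup>2 + (Y\<^sup>2 - A\<^sup>2) * ((2 * m - Y) + (Y - m)\<^sup>2)) / Y ^ 4)"
    unfolding P12 r unfolding P1 using \<kappa> Y(2) by (simp add: field_simps power2_eq_square power4_eq_xxxx)
  also have "\<dots> <= b * \<kappa>\<^sup>2 * 1"
    using barrier_polynomial_ineq[OF m A Y(1)] Y(2) b by (intro mult_left_mono) (auto simp: divide_le_eq)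
  finally show "2 * P1 * (b * m) + 4 * (P2 + P1\<^sup>2) * b * (q\<^sup>2 - (A / \<kappa>)\<^sup>2) <= b * \<kappa>\<^sup>2" by simp
qed

lemma barrier_profile_derivatives:
  fixes \<kappa> m i2 \<rho> :: real
  assumes "i2 > 0" "\<rho> >= 0"
  defines "P \<equiv> \<lambda>\<rho>. \<kappa> * sqrt (\<rho> + i2) - (m / 2) * ln (\<rho> + i2)"
  defines "q \<equiv> sqrt (\<rho> + i2)"
  shows "real_peano P \<rho> (\<kappa> / (2 * q) - m / (2 * q\<^sup>2)) (m / (2 * q ^ 4) - \<kappa> / (4 * q ^ 3))"
proof -
  define P' where "P' \<rho> = \<kappa> * (inverse (sqrt (\<rho> + i2)) / 2) - (m / 2) * (1 / (\<rho> + i2))" for \<rho>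
  have q: "q > 0" "q\<^sup>2 = \<rho> + i2" using assms(1,2) by (auto simp: q_def)
  have q4: "q ^ 4 = (\<rho> + i2)\<^sup>2" "q ^ 3 = q * (\<rho> + i2)" using q(2) by (auto simp: power4_eq_xxxx power3_eq_cube power2_eq_square)
  have d1: "(P has_real_derivative P' r) (at r)" if "\<bar>r - \<rho>\<bar> < i2" for r
  proof -
    have "r + i2 > 0" using that assms(2) by linarith
    then have s: "((\<lambda>\<rho>. sqrt (\<rho> + i2)) has_real_derivative inverse (sqrt (r + i2)) / 2) (at r)"
      and l: "((\<lambda>\<rho>. ln (\<rho> + i2)) has_real_derivative 1 / (r + i2)) (at r)"
      by (auto intro!: derivative_eq_intros)
    show ?thesis unfolding P_def P'_def by (intro DERIV_diff DERIV_cmult s l)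
  qed
  have pos: "\<rho> + i2 > 0" using assms(1,2) by linarith
  have s0: "((\<lambda>\<rho>. sqrt (\<rho> + i2)) has_real_derivative inverse q / 2) (at \<rho>)"
    using pos by (auto intro!: derivative_eq_intros simp: q_def)
  have A: "((\<lambda>\<rho>. inverse (sqrt (\<rho> + i2)) / 2) has_real_derivative - (1 / (4 * q ^ 3))) (at \<rho>)"
  proof -
    have "((\<lambda>\<rho>. inverse (sqrt (\<rho> + i2))) has_real_derivative - (inverse q * (inverse q / 2) * inverse q)) (at \<rho>)"
      using DERIV_inverse'[OF s0] q(1) by (simp add: q_def[symmetric])
    from DERIV_cdivide[OF this, of 2] show ?thesis
      using q(1) by (simp add: power3_eq_cube field_simps)
  qed
  have B: "((\<lambda>\<rho>. 1 / (\<rho> + i2)) has_real_derivative - (1 / q ^ 4)) (at \<rho>)"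
  proof -
    have n: "\<rho> + i2 \<noteq> 0" using assms(1,2) by linarith
    have "((\<lambda>\<rho>. \<rho> + i2) has_real_derivative 1) (at \<rho>)" by (auto intro!: derivative_eq_intros)
    from DERIV_inverse'[OF this n] show ?thesis
      unfolding q4(1) by (simp add: inverse_eq_divide power2_eq_square)
  qed
  have "(P' has_real_derivative (\<kappa> * - (1 / (4 * q ^ 3)) - (m / 2) * - (1 / q ^ 4))) (at \<rho>)"
    unfolding P'_def by (intro DERIV_diff DERIV_cmult A B)
  then have "(P' has_real_derivative (m / (2 * q ^ 4) - \<kappa> / (4 * q ^ 3))) (at \<rho>)" by (simp add: algebra_simps)
  from real_peanoI[OF assms(1) d1 this]
  show ?thesis using q by (simp add: P'_def q_def[symmetric] inverse_eq_divide mult.commute)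
qed

lemma real_peano_exp: "real_peano exp r (exp r) (exp r)"
  using real_peanoI[of 1 r exp exp "exp r"] by (auto intro: DERIV_exp)

lemma real_peano_affine: "real_peano (\<lambda>s. \<alpha> * s + \<beta>) r \<alpha> 0"
  unfolding real_peano_def by (auto intro!: exI[of _ 1] simp: algebra_simps)

text \<open>
  The barrier \<open>M exp (\<Lambda> t + P(\<bar>x - x0\<bar>\<^sup>2) - P(d\<^sup>2))\<close> exceeds \<open>M\<close> at distance \<open>d\<close> from
  \<open>x0\<close> and beyond, so its behaviour at \<open>\<Gamma>\<close> and at the corners is irrelevant.  The choice
  \<open>\<kappa> = d / (2 b t0)\<close> minimises \<open>b \<kappa>\<^sup>2 t0 - \<kappa> d\<close>.  With the unit added to \<open>b \<kappa>\<^sup>2\<close> in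
  \<open>\<Lambda>\<close> the barrier is a strict supersolution.
\<close>

lemma gaussian_upper_bound:
  fixes f :: "(real^'n) \<times> real => real"
  assumes p: "1 < p" and sj: "subsol_jets p \<Omega> f" and op: "open \<Omega>" and \<Gamma>: "frontier \<Omega> \<noteq> {}"
    and M: "M > 0" "!!w. w \<in> \<Omega> \<times> {0<..} ==> f w <= M" and usc: "usc_on (\<Omega> \<times> {0<..}) f"
    and init: "!!x \<eta>. x \<in> \<Omega> ==> \<eta> > 0 ==> \<forall>\<^sub>F w in at (x, 0) within \<Omega> \<times> {0<..}. f w < \<eta>"
    and x0: "x0 \<in> \<Omega>" and t0: "t0 > 0"
  defines "b \<equiv> 1 - recip p" and "m \<equiv> trace_const p TYPE('n) / (1 - recip p)"
  defines "A \<equiv> m\<^sup>2 + 2 * m" and "d \<equiv> infdist x0 (frontier \<Omega>)"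
  shows "f (x0, t0) <= M * exp (t0 + A - d\<^sup>2 / (4 * b * t0) + (m / 2) * ln (1 + (d\<^sup>2 / (2 * b * A * t0))\<^sup>2))"
proof (rule ccontr)
  assume contra: "\<not> ?thesis"
  have b: "b > 0" using recip_bounds[OF p] by (simp add: b_def)
  have m: "m > 0" using trace_const_pos[OF p, where 'n='n] b unfolding m_def b_def by simp
  have A0: "A > 0" unfolding A_def using m by (intro add_nonneg_pos) auto
  have A: "A >= m\<^sup>2 + 2 * m" "A >= 2 * m" "A > 0" using A0 by (auto simp: A_def)
  have d: "d > 0"
  proof -
    have "x0 \<notin> frontier \<Omega>" using op x0 by (simp add: frontier_def interior_open)
    then show ?thesis unfolding d_def using \<Gamma> by (simp add: infdist_pos_not_in_closed)
  qed
  define \<kappa> where "\<kappa> = d / (2 * b * t0)"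
  have \<kappa>: "\<kappa> > 0" using d b t0 by (simp add: \<kappa>_def)
  define i2 where "i2 = (A / \<kappa>)\<^sup>2"
  have i2: "i2 > 0" using A \<kappa> by (simp add: i2_def)
  have si2: "sqrt i2 = A / \<kappa>" using A \<kappa> by (simp add: i2_def)
  define P where "P \<rho> = \<kappa> * sqrt (\<rho> + i2) - (m / 2) * ln (\<rho> + i2)" for \<rho>
  define \<Lambda> where "\<Lambda> = b * \<kappa>\<^sup>2 + 1"
  define E where "E w = P ((norm (fst w - x0))\<^sup>2) + (\<Lambda> * snd w + (ln M - P (d\<^sup>2)))" for w :: "(real^'n) \<times> real"
  define \<phi> where "\<phi> w = exp (E w)" for w
  have qk: "\<kappa> * sqrt (\<rho> + i2) >= A" if "\<rho> >= 0" for \<rho>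
  proof -
    have "A / \<kappa> <= sqrt (\<rho> + i2)" using si2 that real_sqrt_le_mono[of i2 "\<rho> + i2"] by simp
    then show ?thesis using \<kappa> by (simp add: divide_le_eq mult.commute)
  qed
  have Pmono: "P r <= P s" if rs: "0 <= r" "r <= s" for r s
  proof (rule DERIV_nonneg_imp_nondecreasing[OF rs(2)])
    fix x assume x: "r <= x" "x <= s"
    define q where "q = sqrt (x + i2)"
    have "real_peano P x (\<kappa> / (2 * q) - m / (2 * q\<^sup>2)) (m / (2 * q ^ 4) - \<kappa> / (4 * q ^ 3))"
      unfolding P_def[abs_def] q_def using x rs i2 by (intro barrier_profile_derivatives) auto
    have x0: "x + i2 > 0" using x rs i2 by linarith
    have "(P has_real_derivative (\<kappa> * (inverse (sqrt (x + i2)) / 2) - (m / 2) * (1 / (x + i2)))) (at x)"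
    proof -
      have s: "((\<lambda>\<rho>. sqrt (\<rho> + i2)) has_real_derivative inverse (sqrt (x + i2)) / 2) (at x)"
        and l: "((\<lambda>\<rho>. ln (\<rho> + i2)) has_real_derivative 1 / (x + i2)) (at x)"
        using x0 by (auto intro!: derivative_eq_intros)
      show ?thesis unfolding P_def by (intro DERIV_diff DERIV_cmult s l)
    qed
    moreover have "\<kappa> * (inverse (sqrt (x + i2)) / 2) - (m / 2) * (1 / (x + i2)) = \<kappa> / (2 * q) - m / (2 * q\<^sup>2)"
      using x0 by (simp add: q_def inverse_eq_divide)
    moreover have "\<kappa> / (2 * q) - m / (2 * q\<^sup>2) > 0"
      using barrier_ineq(2)[OF m A(1,2) \<kappa> _ b, of q] qk[of x] x rs by (simp add: q_def)
    ultimately show "\<exists>y. (P has_real_derivative y) (at x) \<and> 0 <= y" by (metis less_imp_le)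
  qed
  have Pcont: "continuous_on UNIV (\<lambda>x. P ((norm (x - x0))\<^sup>2))"
  proof -
    have "(norm (x - x0))\<^sup>2 + i2 \<noteq> 0" for x using i2 zero_le_power2[of "norm (x - x0)"] by linarith
    then show ?thesis unfolding P_def by (intro continuous_intros) auto
  qed
  have \<phi>cont: "continuous_on UNIV \<phi>"
  proof -
    have "continuous_on UNIV (\<lambda>w::(real^'n) \<times> real. P ((norm (fst w - x0))\<^sup>2))"
      by (rule continuous_on_compose2[OF Pcont, of UNIV fst]) (auto intro!: continuous_intros)
    then show ?thesis unfolding \<phi>_def E_def by (intro continuous_intros) auto
  qed
  have \<phi>val: "\<phi> (x0, t0) <= M * exp (t0 + A - d\<^sup>2 / (4 * b * t0) + (m / 2) * ln (1 + (d\<^sup>2 / (2 * b * A * t0))\<^sup>2))"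
  proof -
    have l1: "ln (d\<^sup>2 + i2) = ln (1 + (d\<^sup>2 / (2 * b * A * t0))\<^sup>2) + ln i2"
    proof -
      have "d\<^sup>2 + i2 = (1 + (d\<^sup>2 / (2 * b * A * t0))\<^sup>2) * i2"
        using d b t0 A by (simp add: i2_def \<kappa>_def field_simps power2_eq_square)
      moreover have "1 + (d\<^sup>2 / (2 * b * A * t0))\<^sup>2 > 0" by (intro add_pos_nonneg) auto
      ultimately show ?thesis using i2 by (simp only: ln_mult_pos)
    qed
    have l2: "\<kappa> * sqrt (d\<^sup>2 + i2) >= \<kappa> * d"
    proof -
      have "d <= sqrt (d\<^sup>2 + i2)" using i2 d by (intro real_le_rsqrt) auto
      then show ?thesis using \<kappa> by simp
    qed
    have l3: "b * \<kappa>\<^sup>2 * t0 - \<kappa> * d = - (d\<^sup>2 / (4 * b * t0))"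
      using b t0 by (simp add: \<kappa>_def field_simps power2_eq_square)
    have "\<kappa> * sqrt i2 = A" using \<kappa> by (simp add: si2)
    then have "E (x0, t0) <= ln M + (t0 + A - d\<^sup>2 / (4 * b * t0) + (m / 2) * ln (1 + (d\<^sup>2 / (2 * b * A * t0))\<^sup>2))"
      using l1 l2 l3 by (simp add: E_def P_def \<Lambda>_def algebra_simps)
    then have "\<phi> (x0, t0) <= exp (ln M + (t0 + A - d\<^sup>2 / (4 * b * t0) + (m / 2) * ln (1 + (d\<^sup>2 / (2 * b * A * t0))\<^sup>2)))"
      by (simp add: \<phi>_def)
    then show ?thesis using M(1) by (simp add: exp_add)
  qed
  have far: "\<phi> w >= M" if "norm (fst w - x0) >= d" "snd w >= 0" for w
  proof -
    have "P (d\<^sup>2) <= P ((norm (fst w - x0))\<^sup>2)" using that d by (intro Pmono power_mono) auto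
    moreover have "\<Lambda> * snd w >= 0" using that b by (simp add: \<Lambda>_def)
    ultimately have "ln M <= E w" by (simp add: E_def)
    then have "exp (ln M) <= \<phi> w" by (simp add: \<phi>_def)
    then show ?thesis using M(1) by simp
  qed
  obtain z where z: "z \<in> \<Omega> \<times> {0<..}" "!!w. w \<in> \<Omega> \<times> {0<..} ==> f w - \<phi> w <= f z - \<phi> z"
  proof (rule comparison_touch[of "\<Omega> \<times> {0<..}" f \<phi> M "(x0, t0)"])
    show "continuous_on (\<Omega> \<times> {0<..}) \<phi>" using \<phi>cont continuous_on_subset by blast
    show "(x0, t0) \<in> \<Omega> \<times> {0<..}" using x0 t0 by simp
    show "\<phi> (x0, t0) < f (x0, t0)" using contra \<phi>val by linarith
    show "f z - \<phi> z <= M" if "z \<in> \<Omega> \<times> {0<..}" for z using M(2)[OF that] exp_ge_zero[of "E z"] unfolding \<phi>_def by linarith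
    show "bounded {z \<in> \<Omega> \<times> {0<..}. \<phi> z < f z}"
    proof (rule bounded_subset)
      define T where "T = (P (d\<^sup>2) - P 0) / \<Lambda>"
      have \<Lambda>: "\<Lambda> > 0" using b by (simp add: \<Lambda>_def add_nonneg_pos)
      show "bounded (cball x0 d \<times> {0..T})" by (intro bounded_Times) auto
      show "{z \<in> \<Omega> \<times> {0<..}. \<phi> z < f z} \<subseteq> cball x0 d \<times> {0..T}"
      proof
        fix z assume zz: "z \<in> {z \<in> \<Omega> \<times> {0<..}. \<phi> z < f z}"
        then have lt: "\<phi> z < M" and s: "snd z > 0" using M(2)[of z] by auto
        have 1: "norm (fst z - x0) < d" using far[of z] lt s by force
        have "P 0 <= P ((norm (fst z - x0))\<^sup>2)" by (intro Pmono) auto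
        moreover have "E z < ln M" using lt M(1) by (simp add: \<phi>_def) (metis exp_less_cancel_iff exp_ln)
        ultimately have "\<Lambda> * snd z <= P (d\<^sup>2) - P 0" by (simp add: E_def)
        then have "snd z <= T" using \<Lambda> by (simp add: T_def le_divide_eq mult.commute)
        then show "z \<in> cball x0 d \<times> {0..T}" using 1 s by (cases z) (auto simp: dist_norm norm_minus_commute)
      qed
    qed
    show "\<forall>\<^sub>F w in at z within \<Omega> \<times> {0<..}. f w - \<phi> w < \<eta>" if zc: "z \<in> closure (\<Omega> \<times> {0<..}) - \<Omega> \<times> {0<..}" and \<eta>: "\<eta> > 0" for z \<eta>
    proof (cases "fst z \<in> \<Omega>")
      case True
      then have "z = (fst z, 0)" using zc by (cases z) (auto simp: closure_Times)
      then have "\<forall>\<^sub>F w in at z within \<Omega> \<times> {0<..}. f w < \<eta>" using init[OF True \<eta>] by simp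
      then show ?thesis
      proof eventually_elim
        case (elim w)
        then show ?case using exp_gt_zero[of "E w"] unfolding \<phi>_def by linarith
      qed
    next
      case False
      have zz: "fst z \<in> frontier \<Omega>" "snd z >= 0"
        using False zc op by (cases z; auto simp: closure_Times frontier_def interior_open)+
      have "d <= dist x0 (fst z)" unfolding d_def by (rule infdist_le[OF zz(1)])
      then have "\<phi> z >= M" using far[of z] zz(2) by (simp add: dist_norm norm_minus_commute)
      have "isCont \<phi> z" using \<phi>cont continuous_on_eq_continuous_at[OF open_UNIV, of \<phi>] by blast
      then have "(\<phi> \<longlongrightarrow> \<phi> z) (at z within \<Omega> \<times> {0<..})"
        using continuous_at_imp_continuous_at_within continuous_within by blast
      then have "\<forall>\<^sub>F w in at z within \<Omega> \<times> {0<..}. \<phi> z - \<eta> < \<phi> w" using \<eta> by (intro order_tendstoD(1)) auto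
      moreover have "\<forall>\<^sub>F w in at z within \<Omega> \<times> {0<..}. w \<in> \<Omega> \<times> {0<..}" by (simp add: eventually_at_topological) auto
      ultimately show ?thesis
      proof eventually_elim
        case (elim w)
        then show ?case using M(2)[of w] \<open>\<phi> z >= M\<close> by linarith
      qed
    qed
  qed (use usc that in auto)
  obtain x t where xt: "z = (x, t)" "x \<in> \<Omega>" "t > 0" using z(1) by auto
  define \<rho> where "\<rho> = (norm (x - x0))\<^sup>2"
  define q where "q = sqrt (\<rho> + i2)"
  define P1 where "P1 = \<kappa> / (2 * q) - m / (2 * q\<^sup>2)"
  define P2 where "P2 = m / (2 * q ^ 4) - \<kappa> / (4 * q ^ 3)"
  have \<rho>0: "\<rho> >= 0" by (simp add: \<rho>_def)
  have pk: "real_peano P \<rho> P1 P2"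
    unfolding P_def[abs_def] P1_def P2_def q_def by (rule barrier_profile_derivatives[OF i2 \<rho>0])
  have bi: "2 * P1 * (b * m) + 4 * (P2 + P1\<^sup>2) * b * (q\<^sup>2 - (A / \<kappa>)\<^sup>2) <= b * \<kappa>\<^sup>2" "P1 > 0"
    unfolding P1_def P2_def using barrier_ineq[OF m A(1,2) \<kappa> _ b, of q] qk[OF \<rho>0] by (auto simp: q_def)
  have q2: "q\<^sup>2 - (A / \<kappa>)\<^sup>2 = \<rho>" using \<rho>0 i2 by (simp add: q_def i2_def[symmetric])
  define \<Phi> where "\<Phi> = \<phi> (x, t)"
  have \<Phi>0: "\<Phi> > 0" by (simp add: \<Phi>_def \<phi>_def)
  have j1: "upper_jet (\<lambda>w. P ((norm (fst w - x0))\<^sup>2)) (x, t) (P1 *\<^sub>R (2 *\<^sub>R (x - x0), 0))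
      (\<lambda>h. P1 * (2 * (norm (fst h))\<^sup>2) + P2 * ((2 *\<^sub>R (x - x0), 0) \<bullet> h)\<^sup>2)"
  proof (rule upper_jet_compose[OF upper_jet_normsq])
    show "qform (\<lambda>h :: (real^'n) \<times> real. 2 * (norm (fst h))\<^sup>2)" by (intro qform_cmul qform_norm_fst)
    show "real_peano P ((norm (fst (x, t) - x0))\<^sup>2) P1 P2" using pk by (simp add: \<rho>_def)
    show "P ((norm (fst ((x, t) + h) - x0))\<^sup>2) <= P r"
      if "(norm (fst ((x, t) + h) - x0))\<^sup>2 <= r" for h r by (rule Pmono) (use that in auto)
  qed (use bi(2) zero_less_one in auto)
  have j2: "upper_jet (\<lambda>w. \<Lambda> * snd w + (ln M - P (d\<^sup>2))) (x, t) (0, \<Lambda>) (\<lambda>h. 0 * ((0, 1) \<bullet> h)\<^sup>2)"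
    by (rule upper_jet_time[OF real_peano_affine])
  have j3: "upper_jet E (x, t) (P1 *\<^sub>R (2 *\<^sub>R (x - x0), 0) + (0, \<Lambda>))
      (\<lambda>h. P1 * (2 * (norm (fst h))\<^sup>2) + P2 * ((2 *\<^sub>R (x - x0), 0) \<bullet> h)\<^sup>2 + 0 * ((0, 1) \<bullet> h)\<^sup>2)"
    using upper_jet_add[OF j1 j2] unfolding E_def[abs_def] .
  define QE where "QE = (\<lambda>h :: (real^'n) \<times> real. P1 * (2 * (norm (fst h))\<^sup>2) + P2 * ((2 *\<^sub>R (x - x0), 0) \<bullet> h)\<^sup>2 + 0 * ((0, 1) \<bullet> h)\<^sup>2)"
  have qE: "qform QE" unfolding QE_def
    by (intro qform_add qform_cmul qform_norm_fst qform_inner_sq)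
  define pE where "pE = P1 *\<^sub>R (2 *\<^sub>R (x - x0), 0::real) + (0, \<Lambda>)"
  have j4: "upper_jet \<phi> (x, t) (\<Phi> *\<^sub>R pE) (\<lambda>h. \<Phi> * QE h + \<Phi> * (pE \<bullet> h)\<^sup>2)"
    unfolding \<phi>_def[abs_def] \<Phi>_def
    by (rule upper_jet_compose[OF j3[folded QE_def pE_def] qE real_peano_exp, where \<eta>=1]) auto
  define Q where "Q = (\<lambda>h. \<Phi> * QE h + \<Phi> * (pE \<bullet> h)\<^sup>2)"
  have qQ: "qform Q" unfolding Q_def by (intro qform_add qform_cmul qE qform_inner_sq)
  have j5: "upper_jet f (x, t) ((2 * (\<Phi> * P1)) *\<^sub>R (x - x0), \<Phi> * \<Lambda>) Q"
  proof -
    have "upper_jet f (x, t) (\<Phi> *\<^sub>R pE) Q"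
      by (rule open_touch_jet[OF op xt(2,3) j4[folded Q_def]]) (use z(2) xt(1) in auto)
    moreover have "\<Phi> *\<^sub>R pE = ((2 * (\<Phi> * P1)) *\<^sub>R (x - x0), \<Phi> * \<Lambda>)" by (simp add: pE_def)
    ultimately show ?thesis by simp
  qed
  have Qk: "Q (k, 0) = 2 * (\<Phi> * P1) * (norm k)\<^sup>2 + 4 * (\<Phi> * (P2 + P1\<^sup>2)) * ((x - x0) \<bullet> k)\<^sup>2" for k
    by (simp add: Q_def QE_def pE_def power2_eq_square algebra_simps)
  have "\<Phi> * \<Lambda> <= 2 * (\<Phi> * P1) * trace_const p TYPE('n) + 4 * (\<Phi> * (P2 + P1\<^sup>2)) * (1 - recip p) * (norm (x - x0))\<^sup>2"
    by (rule radial_jet_ineq[OF p sj xt(2,3) qQ j5 Qk]) (use \<Phi>0 bi(2) in simp)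
  also have "\<dots> = \<Phi> * (2 * P1 * (b * m) + 4 * (P2 + P1\<^sup>2) * b * \<rho>)"
  proof -
    have bm: "trace_const p TYPE('n) = b * m" using b by (simp add: m_def b_def)
    show ?thesis unfolding bm b_def \<rho>_def by (simp add: algebra_simps)
  qed
  also have "\<dots> <= \<Phi> * (b * \<kappa>\<^sup>2)" using bi(1) \<Phi>0 unfolding q2 by (intro mult_left_mono) auto
  finally show False using \<Phi>0 by (simp add: \<Lambda>_def)
qed

text \<open>
  The quadratic barrier \<open>\<epsilon> (\<bar>x\<bar>\<^sup>2 + C t + 1)\<close> deals with unbounded domains.
\<close>

lemma max_principle_zero:
  fixes f :: "(real^'n) \<times> real => real"
  assumes p: "1 < p" and sj: "subsol_jets p \<Omega> f" and op: "open \<Omega>"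
    and M: "!!w. w \<in> \<Omega> \<times> {0<..} ==> f w <= M" and usc: "usc_on (\<Omega> \<times> {0<..}) f"
    and bdry: "!!z \<eta>. z \<in> closure (\<Omega> \<times> {0<..}) - \<Omega> \<times> {0<..} ==> \<eta> > 0 ==>
                \<forall>\<^sub>F w in at z within \<Omega> \<times> {0<..}. f w < \<eta>"
    and w1: "w1 \<in> \<Omega> \<times> {0<..}"
  shows "f w1 <= 0"
proof (rule ccontr)
  assume contra: "\<not> ?thesis"
  define cp where "cp = trace_const p TYPE('n)"
  define C where "C = 2 * cp + 1"
  have C: "C > 0" using trace_const_pos[OF p, where 'n='n] by (simp add: C_def cp_def)
  define G where "G w = (norm (fst w - 0))\<^sup>2 + (C * snd w + 1)" for w :: "(real^'n) \<times> real"
  have G1: "G w >= 1" if "snd w >= 0" for w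
    using that C zero_le_power2[of "norm (fst w - 0)"] mult_nonneg_nonneg[of C "snd w"] unfolding G_def by linarith
  have s1: "snd w1 > 0" using w1 by auto
  define \<epsilon> where "\<epsilon> = f w1 / (2 * G w1)"
  have \<epsilon>: "\<epsilon> > 0" using contra G1[of w1] s1 by (simp add: \<epsilon>_def)
  obtain z where z: "z \<in> \<Omega> \<times> {0<..}" "!!w. w \<in> \<Omega> \<times> {0<..} ==> f w - \<epsilon> * G w <= f z - \<epsilon> * G z"
  proof (rule comparison_touch[of "\<Omega> \<times> {0<..}" f "\<lambda>w. \<epsilon> * G w" M w1])
    show "continuous_on (\<Omega> \<times> {0<..}) (\<lambda>w. \<epsilon> * G w)" unfolding G_def by (intro continuous_intros)
    show "f z - \<epsilon> * G z <= M" if "z \<in> \<Omega> \<times> {0<..}" for z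
    proof -
      have "G z >= 1" using G1[of z] that by auto
      then have "\<epsilon> * G z >= 0" using \<epsilon> by simp
      then show ?thesis using M[OF that] by linarith
    qed
    show "bounded {z \<in> \<Omega> \<times> {0<..}. \<epsilon> * G z < f z}"
    proof (rule bounded_subset)
      show "bounded (cball (0::real^'n) (sqrt (M / \<epsilon>)) \<times> {0..M / \<epsilon> / C})" by (intro bounded_Times) auto
      show "{z \<in> \<Omega> \<times> {0<..}. \<epsilon> * G z < f z} \<subseteq> cball 0 (sqrt (M / \<epsilon>)) \<times> {0..M / \<epsilon> / C}"
      proof
        fix z assume zz: "z \<in> {z \<in> \<Omega> \<times> {0<..}. \<epsilon> * G z < f z}"
        then have "\<epsilon> * G z < M" using M[of z] by auto
        then have lt: "G z < M / \<epsilon>" using \<epsilon> by (simp add: less_divide_eq mult.commute)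
        have s: "snd z > 0" using zz by auto
        have "C * snd z > 0" using C s by simp
        then have "(norm (fst z))\<^sup>2 <= M / \<epsilon>" "C * snd z <= M / \<epsilon>" using lt unfolding G_def
          by (simp_all add: add_increasing2) (use zero_le_power2[of "norm (fst z)"] in linarith)+
        then have "norm (fst z) <= sqrt (M / \<epsilon>)" "snd z <= M / \<epsilon> / C"
          using pos_le_divide_eq[OF C, of "snd z" "M / \<epsilon>"] by (simp_all add: mult.commute real_le_rsqrt)
        then show "z \<in> cball 0 (sqrt (M / \<epsilon>)) \<times> {0..M / \<epsilon> / C}" using s
          by (simp add: mem_Times_iff)
      qed
    qed
    show "\<epsilon> * G w1 < f w1" using contra G1[of w1] s1 by (simp add: \<epsilon>_def)
    show "\<forall>\<^sub>F w in at z within \<Omega> \<times> {0<..}. f w - \<epsilon> * G w < \<eta>"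
      if zc: "z \<in> closure (\<Omega> \<times> {0<..}) - \<Omega> \<times> {0<..}" "\<eta> > 0" for z \<eta>
    proof -
      have "\<forall>\<^sub>F w in at z within \<Omega> \<times> {0<..}. w \<in> \<Omega> \<times> {0<..}" by (simp add: eventually_at_topological) auto
      with bdry[OF zc] show ?thesis
      proof eventually_elim
        case (elim w)
        then have "G w >= 1" using G1[of w] by auto
        then have "\<epsilon> * G w >= 0" using \<epsilon> by simp
        then show ?case using elim by linarith
      qed
    qed
  qed (use usc w1 that in auto)
  obtain x t where xt: "z = (x, t)" "x \<in> \<Omega>" "t > 0" using z(1) by auto
  have jG: "upper_jet G (x, t) ((2 *\<^sub>R (x - 0), 0) + (0, C)) (\<lambda>h. 2 * (norm (fst h))\<^sup>2 + 0 * ((0, 1) \<bullet> h)\<^sup>2)"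
    using upper_jet_add[OF upper_jet_normsq[of 0 x t] upper_jet_time[OF real_peano_affine[of C 1 t], of x]]
    unfolding G_def[abs_def] .
  have qG: "qform (\<lambda>h :: (real^'n) \<times> real. 2 * (norm (fst h))\<^sup>2 + 0 * ((0, 1) \<bullet> h)\<^sup>2)"
    by (intro qform_add qform_cmul qform_norm_fst qform_inner_sq)
  define Q where "Q = (\<lambda>h :: (real^'n) \<times> real. \<epsilon> * (2 * (norm (fst h))\<^sup>2 + 0 * ((0, 1) \<bullet> h)\<^sup>2)
       + 0 * (((2 *\<^sub>R (x - 0), 0) + (0, C)) \<bullet> h)\<^sup>2)"
  have "upper_jet (\<lambda>w. (\<lambda>s. \<epsilon> * s + 0) (G w)) (x, t) (\<epsilon> *\<^sub>R ((2 *\<^sub>R (x - 0), 0) + (0, C))) Q"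
    unfolding Q_def by (rule upper_jet_compose[OF jG qG real_peano_affine, where \<eta>=1]) (use \<epsilon> in auto)
  then have j: "upper_jet (\<lambda>w. \<epsilon> * G w) (x, t) ((2 * \<epsilon>) *\<^sub>R (x - 0), \<epsilon> * C) Q" by (simp add: mult.commute)
  have jf: "upper_jet f (x, t) ((2 * \<epsilon>) *\<^sub>R (x - 0), \<epsilon> * C) Q"
    by (rule open_touch_jet[OF op xt(2,3) j]) (use z(2) xt(1) in auto)
  have qQ: "qform Q" unfolding Q_def by (intro qform_add qform_cmul qform_norm_fst qform_inner_sq)
  have "\<epsilon> * C <= 2 * \<epsilon> * trace_const p TYPE('n) + 4 * 0 * (1 - recip p) * (norm (x - 0))\<^sup>2"
    by (rule radial_jet_ineq[OF p sj xt(2,3) qQ jf _ \<epsilon>]) (simp add: Q_def)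
  then have "\<epsilon> * C <= \<epsilon> * (2 * cp)" by (simp add: cp_def)
  then show False using \<epsilon> by (simp add: C_def)
qed

lemma real_peano_ln:
  assumes "r > 0" shows "real_peano ln r (1 / r) (- (1 / r\<^sup>2))"
proof (rule real_peanoI[of r])
  show "(ln has_real_derivative 1 / s) (at s)" if "\<bar>s - r\<bar> < r" for s
    using that assms by (intro DERIV_ln_divide) linarith
  show "((\<lambda>s. 1 / s) has_real_derivative - (1 / r\<^sup>2)) (at r)"
    using assms by (auto intro!: derivative_eq_intros simp: power2_eq_square)
qed (use assms in auto)

lemma real_peano_affine_comp:
  assumes "real_peano \<psi> r d1 d2" shows "real_peano (\<lambda>s. \<alpha> * \<psi> s + \<beta>) r (\<alpha> * d1) (\<alpha> * d2)"
  unfolding real_peano_def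
proof (intro allI impI)
  fix e :: real assume e: "e > 0"
  define e' where "e' = e / (\<bar>\<alpha>\<bar> + 1)"
  have e': "e' > 0" "\<bar>\<alpha>\<bar> * e' <= e" using e by (auto simp: e'_def field_simps)
  obtain d where d: "d > 0" "!!s. \<bar>s\<bar> < d ==> \<bar>\<psi> (r + s) - \<psi> r - d1 * s - (1/2) * d2 * s\<^sup>2\<bar> <= e' * s\<^sup>2"
    using assms e'(1) unfolding real_peano_def by blast
  show "\<exists>d>0. \<forall>s. \<bar>s\<bar> < d --> \<bar>\<alpha> * \<psi> (r + s) + \<beta> - (\<alpha> * \<psi> r + \<beta>) - \<alpha> * d1 * s - (1/2) * (\<alpha> * d2) * s\<^sup>2\<bar> <= e * s\<^sup>2"
  proof (intro exI[of _ d] conjI allI impI)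
    fix s :: real assume s: "\<bar>s\<bar> < d"
    have "\<alpha> * \<psi> (r + s) + \<beta> - (\<alpha> * \<psi> r + \<beta>) - \<alpha> * d1 * s - (1/2) * (\<alpha> * d2) * s\<^sup>2
         = \<alpha> * (\<psi> (r + s) - \<psi> r - d1 * s - (1/2) * d2 * s\<^sup>2)" by (simp add: algebra_simps)
    moreover have "\<bar>\<alpha> * (\<psi> (r + s) - \<psi> r - d1 * s - (1/2) * d2 * s\<^sup>2)\<bar> <= \<bar>\<alpha>\<bar> * (e' * s\<^sup>2)"
      unfolding abs_mult using d(2)[OF s] by (rule mult_left_mono) simp
    moreover have "\<bar>\<alpha>\<bar> * (e' * s\<^sup>2) <= e * s\<^sup>2"
      using e'(2) mult_right_mono[of "\<bar>\<alpha>\<bar> * e'" e "s\<^sup>2"] by (simp add: mult.assoc)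
    ultimately show "\<bar>\<alpha> * \<psi> (r + s) + \<beta> - (\<alpha> * \<psi> r + \<beta>) - \<alpha> * d1 * s - (1/2) * (\<alpha> * d2) * s\<^sup>2\<bar> <= e * s\<^sup>2"
      by linarith
  qed (use d(1) in auto)
qed

text \<open>
  On the complement of the ball \<open>ln y \<le> y - 1\<close> shows that the barrier is at most \<open>1\<close>, and
  \<open>ln y \<le> y / 2\<close> that it tends to zero with \<open>t\<close> uniformly, which takes care of the corners.  Lowering
  the barrier by a constant \<open>\<eta>0\<close> makes the set where it exceeds \<open>u\<close> bounded.
\<close>

lemma exterior_ball_lower:
  fixes u :: "(real^'n) \<times> real => real"
  assumes p: "1 < p" and sj: "subsol_jets p \<Omega> (\<lambda>w. - u w)" and op: "open \<Omega>"
    and usc: "usc_on (\<Omega> \<times> {0<..}) (\<lambda>w. - u w)"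
    and nonneg: "!!w. w \<in> \<Omega> \<times> {0<..} ==> 0 <= u w"
    and bd: "!!y s \<eta>. y \<in> frontier \<Omega> ==> s > 0 ==> \<eta> > 0 ==> \<forall>\<^sub>F w in at (y, s) within \<Omega> \<times> {0<..}. 1 - \<eta> < u w"
    and R: "R > 0" "!!y. y \<in> \<Omega> ==> R <= norm (y - z0)"
    and \<beta>: "\<beta> > trace_const p TYPE('n) / (2 * (1 - recip p))"
    and x0: "x0 \<in> \<Omega>" and t0: "t0 > 0"
  shows "exp (\<beta> * ln (R\<^sup>2 / (4 * (1 - recip p) * \<beta> * t0)) - (norm (x0 - z0))\<^sup>2 / (4 * (1 - recip p) * t0)) <= u (x0, t0)"
proof (rule ccontr)
  assume contra: "\<not> ?thesis"
  define b where "b = 1 - recip p"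
  define cp where "cp = trace_const p TYPE('n)"
  have b: "b > 0" using recip_bounds[OF p] by (simp add: b_def)
  have cp: "cp > 0" using trace_const_pos[OF p, where 'n='n] by (simp add: cp_def)
  have \<beta>0: "\<beta> > 0" using \<beta> cp b divide_pos_pos[of cp "2 * b"] unfolding cp_def[symmetric] b_def[symmetric] by linarith
  define D where "D = \<Omega> \<times> {0::real<..}"
  define C0 where "C0 = \<beta> * ln (R\<^sup>2 / (4 * b * \<beta>))"
  define H where "H w = exp (ln ((norm (fst w - z0))\<^sup>2) + ((-1) * ln (snd w) + (- ln (4 * b)))) + (\<beta> * ln (snd w) + (- C0))"
    for w :: "(real^'n) \<times> real"
  define v where "v w = exp (- H w)" for w
  define \<rho> where "\<rho> w = (norm (fst w - z0))\<^sup>2" for w :: "(real^'n) \<times> real"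
  have \<rho>R: "\<rho> w >= R\<^sup>2" "\<rho> w > 0" "snd w > 0" if "w \<in> D" for w
  proof -
    have wD: "fst w \<in> \<Omega>" "snd w > 0" using that unfolding D_def by (metis SigmaE fst_conv, metis SigmaE snd_conv greaterThan_iff)
    show "\<rho> w >= R\<^sup>2" unfolding \<rho>_def by (rule power_mono[OF R(2)[OF wD(1)] less_imp_le[OF R(1)]])
    moreover have "R\<^sup>2 > 0" using R(1) by simp
    ultimately show "\<rho> w > 0" by linarith
    show "snd w > 0" by (rule wD(2))
  qed
  have H: "- H w = \<beta> * ln (R\<^sup>2 / (4 * b * \<beta> * snd w)) - \<rho> w / (4 * b * snd w)" if "w \<in> D" for w
  proof -
    have 1: "exp (ln (\<rho> w) + ((-1) * ln (snd w) + (- ln (4 * b)))) = \<rho> w / (4 * b * snd w)"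
    proof -
      have "exp (ln (\<rho> w)) = \<rho> w" "exp (ln (snd w)) = snd w" "exp (ln (4 * b)) = 4 * b"
        using \<rho>R(2,3)[OF that] b by simp_all
      then show ?thesis unfolding exp_add mult_minus1 exp_minus by (simp add: field_simps)
    qed
    have 2: "ln (R\<^sup>2 / (4 * b * \<beta> * snd w)) = ln (R\<^sup>2 / (4 * b * \<beta>)) - ln (snd w)"
    proof -
      have "R\<^sup>2 / (4 * b * \<beta> * snd w) = (R\<^sup>2 / (4 * b * \<beta>)) / snd w" by simp
      also have "ln \<dots> = ln (R\<^sup>2 / (4 * b * \<beta>)) - ln (snd w)"
        using R(1) b \<beta>0 \<rho>R(3)[OF that] by (intro ln_divide_pos) auto
      finally show ?thesis .
    qed
    have 3: "H w = exp (ln (\<rho> w) + ((-1) * ln (snd w) + (- ln (4 * b)))) + (\<beta> * ln (snd w) + (- (\<beta> * ln (R\<^sup>2 / (4 * b * \<beta>)))))"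
      unfolding H_def \<rho>_def C0_def ..
    have "- h = \<beta> * l - q" if "e = q" "l = l0 - ls" "h = e + (\<beta> * ls + (- (\<beta> * l0)))" for e q l l0 ls h
      using that by (simp add: right_diff_distrib)
    from this[OF 1 2 3] show ?thesis .
  qed
  have decay: "v w <= exp (- (\<rho> w / (8 * b * snd w)))" if "w \<in> D" for w
  proof -
    define y where "y = R\<^sup>2 / (4 * b * \<beta> * snd w)"
    have y: "y > 0" using R(1) b \<beta>0 \<rho>R(3)[OF that] by (simp add: y_def)
    have "ln (y / 2) <= y / 2 - 1" using y by (intro ln_le_minus_one) simp
    moreover have "ln (y / 2) = ln y - ln 2" using y by (simp add: ln_div)
    moreover have "ln (2::real) <= 1" using ln_2_less_1 by simp
    ultimately have "ln y <= y / 2" by linarith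
    then have "\<beta> * ln y <= \<beta> * (y / 2)" using \<beta>0 by simp
    also have "\<beta> * (y / 2) = R\<^sup>2 / (8 * b * snd w)" using \<beta>0 by (simp add: y_def)
    also have "\<dots> <= \<rho> w / (8 * b * snd w)" using \<rho>R[OF that] b by (intro divide_right_mono) auto
    finally have "- H w <= \<rho> w / (8 * b * snd w) - \<rho> w / (4 * b * snd w)" using H[OF that] by (simp add: y_def)
    also have "\<dots> = - (\<rho> w / (8 * b * snd w))" by (simp add: field_simps)
    finally show ?thesis by (simp add: v_def)
  qed
  have v1: "v w <= 1" if "w \<in> D" for w
  proof -
    have "\<rho> w / (8 * b * snd w) >= 0" using \<rho>R[OF that] b by simp
    then show ?thesis using decay[OF that] by (meson exp_le_one_iff neg_le_0_iff_le order_trans)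
  qed
  have w0: "(x0, t0) \<in> D" using x0 t0 by (simp add: D_def)
  have vx0: "v (x0, t0) > u (x0, t0)" using contra H[OF w0] by (simp add: v_def b_def \<rho>_def)
  define \<eta>0 where "\<eta>0 = (v (x0, t0) - u (x0, t0)) / 2"
  have \<eta>0: "\<eta>0 > 0" "\<eta>0 < 1" using vx0 v1[OF w0] nonneg[of "(x0,t0)"] w0 by (auto simp: \<eta>0_def D_def)
  define L where "L = - ln \<eta>0"
  have L: "L > 0" "\<eta>0 = exp (- L)" using \<eta>0 by (auto simp: L_def)
  obtain w where w: "w \<in> D" "!!w'. w' \<in> D ==> (- u w') - (- v w' + \<eta>0) <= (- u w) - (- v w + \<eta>0)"
  proof (rule comparison_touch[of D "\<lambda>w. - u w" "\<lambda>w. - v w + \<eta>0" 1 "(x0, t0)"])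
    show "usc_on D (\<lambda>w. - u w)" using usc by (simp add: D_def)
    have "continuous_on D H" unfolding H_def
    proof (intro continuous_intros ballI)
      fix w assume "w \<in> D"
      then show "(norm (fst w - z0))\<^sup>2 \<noteq> 0" "snd w \<noteq> 0" "snd w \<noteq> 0" using \<rho>R(2,3)[of w] by (auto simp: \<rho>_def)
    qed
    then show "continuous_on D (\<lambda>w. - v w + \<eta>0)" unfolding v_def by (intro continuous_intros)
    show "- u z - (- v z + \<eta>0) <= 1" if "z \<in> D" for z
      using v1[OF that] nonneg[of z] that \<eta>0 by (simp add: D_def)
    show "- v (x0, t0) + \<eta>0 < - u (x0, t0)" using vx0 by (simp add: \<eta>0_def field_simps)
    show "bounded {z \<in> D. - v z + \<eta>0 < - u z}"
    proof (rule bounded_subset)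
      define S where "S = R\<^sup>2 / (4 * b * \<beta>) * exp (L / \<beta>)"
      show "bounded (cball z0 (sqrt (L * (8 * b * S))) \<times> {0..S})" by (intro bounded_Times) auto
      show "{z \<in> D. - v z + \<eta>0 < - u z} \<subseteq> cball z0 (sqrt (L * (8 * b * S))) \<times> {0..S}"
      proof
        fix z assume zz: "z \<in> {z \<in> D. - v z + \<eta>0 < - u z}"
        then have zD: "z \<in> D" and "v z > \<eta>0" using nonneg[of z] by (auto simp: D_def)
        have s: "snd z > 0" using \<rho>R(3)[OF zD] .
        have HL: "- H z > - L" using \<open>v z > \<eta>0\<close> unfolding v_def L(2) by simp
        have "exp (- L) < exp (- (\<rho> z / (8 * b * snd z)))" using decay[OF zD] \<open>v z > \<eta>0\<close> L(2) by linarith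
        then have "\<rho> z / (8 * b * snd z) < L" by simp
        then have \<rho>L: "\<rho> z < L * (8 * b * snd z)" using s b by (simp add: divide_less_eq)
        have "\<rho> z / (4 * b * snd z) >= 0" using \<rho>R[OF zD] b by simp
        then have "\<beta> * ln (R\<^sup>2 / (4 * b * \<beta> * snd z)) > - L" using H[OF zD] HL by linarith
        then have "ln (R\<^sup>2 / (4 * b * \<beta> * snd z)) > - (L / \<beta>)" using \<beta>0 by (simp add: field_simps)
        then have "exp (- (L / \<beta>)) < R\<^sup>2 / (4 * b * \<beta> * snd z)"
          using R(1) b \<beta>0 s by (subst (asm) exp_less_cancel_iff[symmetric]) (simp add: exp_ln)
        moreover have "R\<^sup>2 / (4 * b * \<beta> * snd z) = (R\<^sup>2 / (4 * b * \<beta>)) / snd z" by simp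
        ultimately have "exp (- (L / \<beta>)) < (R\<^sup>2 / (4 * b * \<beta>)) / snd z" by (simp only:)
        then have "exp (- (L / \<beta>)) * snd z < R\<^sup>2 / (4 * b * \<beta>)" by (rule pos_less_divide_eq[OF s, THEN iffD1])
        then have "exp (L / \<beta>) * (exp (- (L / \<beta>)) * snd z) < exp (L / \<beta>) * (R\<^sup>2 / (4 * b * \<beta>))"
          by (intro mult_strict_left_mono) auto
        moreover have "exp (L / \<beta>) * (exp (- (L / \<beta>)) * snd z) = snd z"
          by (simp add: mult.assoc[symmetric] exp_add[symmetric])
        ultimately have "snd z < exp (L / \<beta>) * (R\<^sup>2 / (4 * b * \<beta>))" by (simp only:)
        then have sS: "snd z < S" unfolding S_def by (simp only: mult.commute)
        have "\<rho> z <= L * (8 * b * S)"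
        proof -
          have "L * (8 * b * snd z) <= L * (8 * b * S)" using sS L b by (intro mult_left_mono) auto
          then show ?thesis using \<rho>L by linarith
        qed
        then have "norm (fst z - z0) <= sqrt (L * (8 * b * S))" unfolding \<rho>_def by (rule real_le_rsqrt)
        then show "z \<in> cball z0 (sqrt (L * (8 * b * S))) \<times> {0..S}" using s sS
          by (cases z) (auto simp: dist_norm norm_minus_commute)
      qed
    qed
    show "\<forall>\<^sub>F w in at z within D. - u w - (- v w + \<eta>0) < \<eta>" if zc: "z \<in> closure D - D" "\<eta> > 0" for z \<eta>
    proof -
      have inD: "\<forall>\<^sub>F w in at z within D. w \<in> D" by (simp add: eventually_at_topological) auto
      have sn: "snd z >= 0" "fst z \<in> closure \<Omega>" using zc(1) by (cases z; auto simp: D_def closure_Times)+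
      show ?thesis
      proof (cases "snd z = 0")
        case True
        have "((\<lambda>w. snd w) \<longlongrightarrow> snd z) (at z within D)" by (intro tendsto_intros)
        moreover have "R\<^sup>2 / (8 * b * L) > snd z" using True R(1) b L by simp
        ultimately have "\<forall>\<^sub>F w in at z within D. snd w < R\<^sup>2 / (8 * b * L)" by (rule order_tendstoD(2))
        with inD show ?thesis
        proof eventually_elim
          case (elim w)
          have s: "snd w > 0" using \<rho>R(3) elim by auto
          have "snd w * (8 * b * L) < R\<^sup>2" using elim b L by (simp add: less_divide_eq)
          then have "L * (8 * b * snd w) <= \<rho> w" using \<rho>R(1)[of w] elim by (simp add: mult_ac)
          then have "L <= \<rho> w / (8 * b * snd w)" using s b by (simp add: le_divide_eq)
          then have "v w <= \<eta>0" using decay[of w] elim L(2) by (meson exp_le_cancel_iff neg_le_iff_le order_trans)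
          then show ?case using nonneg[of w] elim that(2) by (simp add: D_def)
        qed
      next
        case False
        then have "fst z \<notin> \<Omega>" using zc(1) sn by (cases z) (auto simp: D_def)
        then have "fst z \<in> frontier \<Omega>" using sn op by (simp add: frontier_def interior_open)
        then have "\<forall>\<^sub>F w in at z within D. 1 - \<eta> < u w"
          using bd[of "fst z" "snd z" \<eta>] False sn zc(2) by (simp add: D_def)
        with inD show ?thesis
        proof eventually_elim
          case (elim w)
          then show ?case using v1[of w] \<eta>0 by simp
        qed
      qed
    qed
  qed (use w0 that in auto)
  obtain x t where xt: "w = (x, t)" "x \<in> \<Omega>" "t > 0" using w(1) by (auto simp: D_def)
  define y where "y = x - z0"
  define r0 where "r0 = (norm y)\<^sup>2"
  have r0: "r0 > 0" using \<rho>R(2)[OF w(1)] by (simp add: r0_def y_def \<rho>_def xt)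
  define B0 where "B0 = r0 / (4 * b * t)"
  have yn: "norm y > 0" using r0 by (simp add: r0_def)
  have j1: "upper_jet (\<lambda>w. ln ((norm (fst w - z0))\<^sup>2)) (x, t) ((1 / r0) *\<^sub>R (2 *\<^sub>R y, 0))
      (\<lambda>h. 1 / r0 * (2 * (norm (fst h))\<^sup>2) + (- (1 / r0\<^sup>2)) * ((2 *\<^sub>R y, 0) \<bullet> h)\<^sup>2)"
    unfolding y_def
  proof (rule upper_jet_compose[OF upper_jet_normsq])
    show "qform (\<lambda>h :: (real^'n) \<times> real. 2 * (norm (fst h))\<^sup>2)" by (intro qform_cmul qform_norm_fst)
    show "real_peano ln ((norm (fst (x, t) - z0))\<^sup>2) (1 / r0) (- (1 / r0\<^sup>2))"
      using real_peano_ln[OF r0] by (simp add: r0_def y_def)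
    show "0 < min r0 (norm y)" using r0 yn by simp
    show "ln ((norm (fst ((x, t) + h) - z0))\<^sup>2) <= ln r"
      if hh: "norm h < min r0 (norm y)" "(norm (fst ((x, t) + h) - z0))\<^sup>2 <= r" for h r
    proof -
      have "norm (fst h) <= norm h" by (metis norm_fst_le prod.collapse)
      then have "norm (fst h) < norm y" using hh by simp
      then have "y + fst h \<noteq> 0" by (metis add_eq_0_iff norm_minus_cancel order_less_irrefl)
      then have "(norm (fst ((x, t) + h) - z0))\<^sup>2 > 0" by (simp add: y_def algebra_simps)
      then show ?thesis using hh(2) by (intro ln_mono) auto
    qed
  qed (use r0 in auto)
  have j2: "upper_jet (\<lambda>w. (-1) * ln (snd w) + (- ln (4 * b))) (x, t) (0, (-1) * (1 / t)) (\<lambda>h. (-1) * (- (1 / t\<^sup>2)) * ((0, 1) \<bullet> h)\<^sup>2)"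
    by (rule upper_jet_time[OF real_peano_affine_comp[OF real_peano_ln[OF xt(3)]]])
  have j5': "upper_jet (\<lambda>w. \<beta> * ln (snd w) + (- C0)) (x, t) (0, \<beta> * (1 / t)) (\<lambda>h. \<beta> * (- (1 / t\<^sup>2)) * ((0, 1) \<bullet> h)\<^sup>2)"
    by (rule upper_jet_time[OF real_peano_affine_comp[OF real_peano_ln[OF xt(3)]]])
  define p3 where "p3 = (1 / r0) *\<^sub>R (2 *\<^sub>R y, 0::real) + (0, (-1) * (1 / t))"
  define Q3 where "Q3 = (\<lambda>h :: (real^'n) \<times> real. (1 / r0 * (2 * (norm (fst h))\<^sup>2) + (- (1 / r0\<^sup>2)) * ((2 *\<^sub>R y, 0) \<bullet> h)\<^sup>2)
      + (-1) * (- (1 / t\<^sup>2)) * ((0, 1) \<bullet> h)\<^sup>2)"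
  have q3: "qform Q3" unfolding Q3_def by (intro qform_add qform_cmul qform_norm_fst qform_inner_sq)
  have ex: "exp (ln ((norm (fst (x, t) - z0))\<^sup>2) + ((-1) * ln (snd (x, t)) + (- ln (4 * b)))) = B0"
  proof -
    have "exp (ln ((norm (fst (x, t) - z0))\<^sup>2)) = r0" "exp (ln (snd (x, t))) = t" "exp (ln (4 * b)) = 4 * b"
      using r0 xt(3) b by (simp_all add: r0_def y_def)
    then show ?thesis unfolding exp_add mult_minus1 exp_minus B0_def by (simp add: field_simps)
  qed
  have pe4: "real_peano exp (ln ((norm (fst (x, t) - z0))\<^sup>2) + ((-1) * ln (snd (x, t)) + (- ln (4 * b)))) B0 B0"
    using real_peano_exp[of "ln ((norm (fst (x, t) - z0))\<^sup>2) + ((-1) * ln (snd (x, t)) + (- ln (4 * b)))"] unfolding ex .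
  have B0: "B0 > 0" using r0 b xt(3) by (simp add: B0_def)
  have j4: "upper_jet (\<lambda>w. exp (ln ((norm (fst w - z0))\<^sup>2) + ((-1) * ln (snd w) + (- ln (4 * b))))) (x, t)
      (B0 *\<^sub>R p3) (\<lambda>h. B0 * Q3 h + B0 * (p3 \<bullet> h)\<^sup>2)"
    unfolding p3_def Q3_def
    by (rule upper_jet_compose[OF upper_jet_add[OF j1 j2] q3[unfolded Q3_def] pe4, where \<eta>=1]) (use B0 in auto)
  define pH where "pH = B0 *\<^sub>R p3 + (0, \<beta> * (1 / t))"
  define QH where "QH = (\<lambda>h. (B0 * Q3 h + B0 * (p3 \<bullet> h)\<^sup>2) + \<beta> * (- (1 / t\<^sup>2)) * ((0, 1) \<bullet> h)\<^sup>2)"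
  have jH: "upper_jet H (x, t) pH QH"
    using upper_jet_add[OF j4 j5'] unfolding H_def[abs_def] pH_def QH_def .
  have qH: "qform QH" unfolding QH_def by (intro qform_add qform_cmul qform_inner_sq q3)
  define V where "V = v (x, t)"
  have V: "V > 0" by (simp add: V_def v_def)
  have pe6: "real_peano (\<lambda>r. - exp (- r)) (H (x, t)) V (- V)"
    unfolding V_def v_def
    by (rule real_peanoI[of 1]) (auto intro!: derivative_eq_intros)
  define Q6 where "Q6 = (\<lambda>h. V * QH h + (- V) * (pH \<bullet> h)\<^sup>2)"
  have j6: "upper_jet (\<lambda>w. - exp (- H w)) (x, t) (V *\<^sub>R pH) Q6" unfolding Q6_def
    by (rule upper_jet_compose[OF jH qH pe6, where \<eta>=1]) (use V in auto)
  define \<tau> where "\<tau> = 1 / (4 * b * t)"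
  have B0\<tau>: "B0 = \<tau> * r0" by (simp add: B0_def \<tau>_def)
  have \<tau>: "\<tau> > 0" using b xt(3) by (simp add: \<tau>_def)
  have "upper_jet (\<lambda>w. - u w) (x, t) (V *\<^sub>R pH) Q6"
    by (rule open_touch_jet[OF op xt(2,3) j6]) (use w(2) xt(1) in \<open>auto simp: D_def v_def\<close>)
  moreover have "V *\<^sub>R pH = ((2 * (V * \<tau>)) *\<^sub>R (x - z0), V * ((\<beta> - B0) / t))"
    using r0 by (simp add: pH_def p3_def B0\<tau> y_def diff_divide_distrib)
  ultimately have j7: "upper_jet (\<lambda>w. - u w) (x, t) ((2 * (V * \<tau>)) *\<^sub>R (x - z0), V * ((\<beta> - B0) / t)) Q6" by simp
  have q6: "qform Q6" unfolding Q6_def by (intro qform_add qform_cmul qform_inner_sq qH)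
  have Qk: "Q6 (k, 0) = 2 * (V * \<tau>) * (norm k)\<^sup>2 + 4 * (- (V * \<tau>\<^sup>2)) * ((x - z0) \<bullet> k)\<^sup>2" for k
    unfolding y_def[symmetric] using r0
    by (simp add: Q6_def QH_def Q3_def pH_def p3_def B0\<tau> power2_eq_square field_simps)
  have "V * ((\<beta> - B0) / t) <= 2 * (V * \<tau>) * trace_const p TYPE('n) + 4 * (- (V * \<tau>\<^sup>2)) * (1 - recip p) * (norm (x - z0))\<^sup>2"
    by (rule radial_jet_ineq[OF p sj xt(2,3) q6 j7 Qk]) (use V \<tau> in simp)
  then have "V * ((\<beta> - B0) / t) <= V * (2 * \<tau> * cp - 4 * \<tau>\<^sup>2 * b * r0)"
    by (simp add: cp_def b_def r0_def y_def algebra_simps)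
  then have "(\<beta> - B0) / t <= 2 * \<tau> * cp - 4 * \<tau>\<^sup>2 * b * r0" using V by (rule mult_left_le_imp_le)
  moreover have "4 * \<tau>\<^sup>2 * b * r0 = B0 / t" using b xt(3) by (simp add: \<tau>_def B0_def power2_eq_square)
  moreover have "2 * \<tau> * cp = (cp / (2 * b)) / t" using b xt(3) by (simp add: \<tau>_def)
  ultimately have "\<beta> / t <= (cp / (2 * b)) / t" by (simp add: diff_divide_distrib)
  then have "\<beta> <= cp / (2 * b)" using xt(3) unfolding divide_le_cancel by blast
  then show False using \<beta> by (simp add: cp_def b_def)
qed

section \<open>Sup-convolutions\<close>

definition sup_conv :: "'a::real_inner set => real => ('a => real) => 'a => real" where
  "sup_conv S \<iota> f z = (SUP w\<in>S. f w - (norm (z - w))\<^sup>2 / (2 * \<iota>))"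

lemma usc_compact_attains_max:
  fixes f :: "'a::heine_borel => real"
  assumes S: "compact S" "S \<noteq> {}" and usc: "usc_on S f" and bd: "!!z. z \<in> S ==> f z <= M"
  obtains z where "z \<in> S" "!!w. w \<in> S ==> f w <= f z"
proof -
  obtain z1 where z1: "z1 \<in> S" using S(2) by auto
  define F where "F z = f z1 - 1 - f z" for z
  have *: "\<exists>z\<in>S. \<forall>w\<in>S. F z <= F w"
  proof (rule negative_min_attained[of S F "M - f z1 + 1" z1])
    fix z c assume z: "z \<in> S" "c < F z"
    then have "f z < f z1 - 1 - c" by (simp add: F_def)
    then have "\<forall>\<^sub>F w in at z within S. f w < f z1 - 1 - c" using usc z(1) unfolding usc_on_def by blast
    then show "\<forall>\<^sub>F w in at z within S. c < F w" by eventually_elim (simp add: F_def)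
  next
    show "bounded {z \<in> S. F z < 0}" using compact_imp_bounded[OF S(1)] by (rule bounded_subset) auto
  next
    fix z assume "z \<in> S" then show "- (M - f z1 + 1) <= F z" using bd[of z] by (simp add: F_def)
  next
    fix z and \<eta> :: real assume "z \<in> closure S - S"
    then show "\<forall>\<^sub>F w in at z within S. - \<eta> < F w" using closure_closed[OF compact_imp_closed[OF S(1)]] by simp
  next
    fix z assume "z \<in> S" "!!w. w \<in> S ==> F z <= F w"
    then show ?thesis by blast
  qed (use z1 in \<open>auto simp: F_def\<close>)
  then show thesis using that by (auto simp: F_def)
qed

definition sup_conv_data :: "'a::euclidean_space set => real => ('a => real) => real => bool" where
  "sup_conv_data S \<iota> f M \<longleftrightarrow> compact S \<and> S \<noteq> {} \<and> usc_on S f \<and> (\<forall>z\<in>S. f z <= M) \<and> \<iota> > 0"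

lemma sup_conv_attained:
  assumes "sup_conv_data S \<iota> f M"
  obtains w where "w \<in> S" "sup_conv S \<iota> f z = f w - (norm (z - w))\<^sup>2 / (2 * \<iota>)"
proof -
  have S: "compact S" "S \<noteq> {}" and usc: "usc_on S f" and bd: "!!z. z \<in> S ==> f z <= M" and \<iota>: "\<iota> > 0"
    using assms by (auto simp: sup_conv_data_def)
  define G where "G w = f w - (norm (z - w))\<^sup>2 / (2 * \<iota>)" for w
  obtain w where w: "w \<in> S" "!!w'. w' \<in> S ==> G w' <= G w"
  proof (rule usc_compact_attains_max[OF S, of G M])
    show "usc_on S G" unfolding usc_on_def
    proof (intro ballI allI impI)
      fix v c assume v: "v \<in> S" and c: "G v < c"
      define e where "e = (c - G v) / 2"
      have e: "e > 0" using c by (simp add: e_def)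
      have "\<forall>\<^sub>F w in at v within S. f w < f v + e" using usc v e unfolding usc_on_def by simp
      moreover have "((\<lambda>w. (norm (z - w))\<^sup>2 / (2 * \<iota>)) \<longlongrightarrow> (norm (z - v))\<^sup>2 / (2 * \<iota>)) (at v within S)"
        using \<iota> by (intro tendsto_intros) auto
      then have "\<forall>\<^sub>F w in at v within S. (norm (z - v))\<^sup>2 / (2 * \<iota>) - e < (norm (z - w))\<^sup>2 / (2 * \<iota>)"
        by (rule order_tendstoD(1)) (use e in simp)
      ultimately show "\<forall>\<^sub>F w in at v within S. G w < c"
      proof eventually_elim
        case (elim w)
        have "c = G v + 2 * e" by (simp add: e_def field_simps)
        then show ?case using elim by (simp add: G_def)
      qed
    qed
    show "G w <= M" if "w \<in> S" for w
    proof -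
      have "(norm (z - w))\<^sup>2 / (2 * \<iota>) >= 0" using \<iota> by simp
      then show ?thesis using bd[OF that] unfolding G_def by linarith
    qed
  qed (rule that)
  have "sup_conv S \<iota> f z = G w" unfolding sup_conv_def G_def[symmetric]
    by (rule cSup_eq_maximum) (use w in auto)
  then show ?thesis using that[OF w(1)] by (simp add: G_def)
qed

lemma sup_conv_ge:
  assumes "sup_conv_data S \<iota> f M" and w: "w \<in> S"
  shows "f w - (norm (z - w))\<^sup>2 / (2 * \<iota>) <= sup_conv S \<iota> f z"
proof -
  have bd: "!!z. z \<in> S ==> f z <= M" and \<iota>: "\<iota> > 0" using assms by (auto simp: sup_conv_data_def)
  have "f w' - (norm (z - w'))\<^sup>2 / (2 * \<iota>) <= M" if "w' \<in> S" for w'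
  proof -
    have "(norm (z - w'))\<^sup>2 / (2 * \<iota>) >= 0" using \<iota> by simp
    then show ?thesis using bd[OF that] by linarith
  qed
  then show ?thesis unfolding sup_conv_def by (intro cSUP_upper[OF w] bdd_aboveI2) auto
qed

lemma sup_conv_semiconvex:
  fixes f :: "'a::euclidean_space => real"
  assumes d: "sup_conv_data S \<iota> f M" and R: "!!w. w \<in> S ==> norm w <= R"
  shows "\<exists>p. norm p <= (norm z + R) / \<iota> \<and>
    (\<forall>w. sup_conv S \<iota> f w >= sup_conv S \<iota> f z + p \<bullet> (w - z) - 1 / (2 * \<iota>) * (norm (w - z))\<^sup>2)"
proof -
  have \<iota>: "\<iota> > 0" using d by (auto simp: sup_conv_data_def)
  obtain v where v: "v \<in> S" "sup_conv S \<iota> f z = f v - (norm (z - v))\<^sup>2 / (2 * \<iota>)"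
    using sup_conv_attained[OF d] by metis
  define p where "p = - ((1 / \<iota>) *\<^sub>R (z - v))"
  have "norm p <= (norm z + R) / \<iota>"
  proof -
    have "norm (z - v) <= norm z + R" using norm_triangle_ineq4[of z v] R[OF v(1)] by linarith
    then show ?thesis using \<iota> by (simp add: p_def divide_right_mono)
  qed
  moreover have "sup_conv S \<iota> f w >= sup_conv S \<iota> f z + p \<bullet> (w - z) - 1 / (2 * \<iota>) * (norm (w - z))\<^sup>2" for w
  proof -
    have "(norm (w - v))\<^sup>2 = (norm (z - v))\<^sup>2 + 2 * ((z - v) \<bullet> (w - z)) + (norm (w - z))\<^sup>2"
      by (simp add: power2_norm_eq_inner inner_diff_left inner_diff_right inner_commute)
    then have "f v - (norm (w - v))\<^sup>2 / (2 * \<iota>) = sup_conv S \<iota> f z + p \<bullet> (w - z) - 1 / (2 * \<iota>) * (norm (w - z))\<^sup>2"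
    proof -
      have "p \<bullet> (w - z) = - ((z - v) \<bullet> (w - z) / \<iota>)" by (simp add: p_def)
      moreover have "a - b / (2 * \<iota>) = a - b1 / (2 * \<iota>) + m - 1 / (2 * \<iota>) * c"
        if "b = b1 + 2 * k + c" "m = - (k / \<iota>)" for a b b1 k c m
        using that by (simp add: add_divide_distrib)
      ultimately show ?thesis using \<open>(norm (w - v))\<^sup>2 = _\<close> unfolding v(2) by blast
    qed
    then show ?thesis using sup_conv_ge[OF d v(1), of w] by simp
  qed
  ultimately show ?thesis by blast
qed

lemma sup_conv_continuous:
  fixes f :: "'a::euclidean_space => real"
  assumes d: "sup_conv_data S \<iota> f M"
  shows "continuous_on UNIV (sup_conv S \<iota> f)"
proof -
  have \<iota>: "\<iota> > 0" and S: "compact S" using d by (auto simp: sup_conv_data_def)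
  obtain R where R: "R > 0" "!!w. w \<in> S ==> norm w <= R"
    using compact_imp_bounded[OF S] bounded_pos by blast
  show ?thesis unfolding continuous_on_iff
  proof (intro ballI allI impI)
    fix z :: 'a and e :: real assume e: "e > 0"
    define L where "L = (norm z + 1 + R) / \<iota> + 1 / (2 * \<iota>)"
    have L: "L > 0" using \<iota> R(1) unfolding L_def by (intro add_nonneg_pos divide_nonneg_pos divide_pos_pos) auto
    have lb: "sup_conv S \<iota> f y >= sup_conv S \<iota> f x - L * norm (y - x)"
      if x: "norm x <= norm z + 1" and yx: "norm (y - x) <= 1" for x y
    proof -
      obtain p where p: "norm p <= (norm x + R) / \<iota>"
        "!!w. sup_conv S \<iota> f w >= sup_conv S \<iota> f x + p \<bullet> (w - x) - 1 / (2 * \<iota>) * (norm (w - x))\<^sup>2"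
        using sup_conv_semiconvex[OF d R(2), of x] by metis
      have "(norm x + R) / \<iota> <= (norm z + 1 + R) / \<iota>" using x \<iota> by (intro divide_right_mono) auto
      then have np: "norm p <= (norm z + 1 + R) / \<iota>" using p(1) by linarith
      have "p \<bullet> (y - x) >= - (norm p * norm (y - x))" using Cauchy_Schwarz_ineq2[of p "y - x"] by linarith
      moreover have "norm p * norm (y - x) <= (norm z + 1 + R) / \<iota> * norm (y - x)" using np by (intro mult_right_mono) auto
      moreover have "1 / (2 * \<iota>) * (norm (y - x))\<^sup>2 <= 1 / (2 * \<iota>) * norm (y - x)"
        using yx \<iota> mult_left_mono[OF yx norm_ge_zero[of "y - x"]] by (intro mult_left_mono) (auto simp: power2_eq_square)
      ultimately have "sup_conv S \<iota> f y >= sup_conv S \<iota> f x - ((norm z + 1 + R) / \<iota> * norm (y - x) + 1 / (2 * \<iota>) * norm (y - x))"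
        using p(2)[of y] by linarith
      then show ?thesis by (simp only: L_def distrib_right)
    qed
    show "\<exists>d>0. \<forall>x'\<in>UNIV. dist x' z < d --> dist (sup_conv S \<iota> f x') (sup_conv S \<iota> f z) < e"
    proof (intro exI[of _ "min 1 (e / L)"] conjI ballI impI)
      show "0 < min 1 (e / L)" using e L by simp
      fix y assume "dist y z < min 1 (e / L)"
      then have y: "norm (y - z) < 1" "norm (y - z) < e / L" by (auto simp: dist_norm)
      have "norm y <= norm z + 1" using y(1) norm_triangle_ineq2[of y z] by linarith
      then have "sup_conv S \<iota> f z >= sup_conv S \<iota> f y - L * norm (y - z)"
        using lb[of y z] y(1) by (simp add: norm_minus_commute)
      moreover have "sup_conv S \<iota> f y >= sup_conv S \<iota> f z - L * norm (y - z)" using lb[of z y] y(1) by simp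
      moreover have "L * norm (y - z) < e" using y(2) L by (simp add: less_divide_eq mult.commute)
      ultimately show "dist (sup_conv S \<iota> f y) (sup_conv S \<iota> f z) < e" unfolding dist_real_def by linarith
    qed
  qed
qed

text \<open>
  A jet of the regularisation at \<open>z\<close> is a jet of the function itself at the point where the supremum for
  \<open>z\<close> is attained.
\<close>

lemma sup_conv_jet:
  fixes f :: "'a::euclidean_space => real"
  assumes d: "sup_conv_data S \<iota> f M" and jet: "upper_jet (sup_conv S \<iota> f) z p Q"
    and w: "w \<in> interior S" "sup_conv S \<iota> f z = f w - (norm (z - w))\<^sup>2 / (2 * \<iota>)"
  shows "upper_jet f w p Q"
  unfolding upper_jet_def
proof (intro allI impI)
  fix e :: real assume "e > 0"
  then obtain d1 where d1: "d1 > 0" "!!h. norm h < d1 ==>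
      sup_conv S \<iota> f (z + h) <= sup_conv S \<iota> f z + p \<bullet> h + (1/2) * Q h + e * (norm h)\<^sup>2"
    using jet unfolding upper_jet_def by blast
  obtain d2 where d2: "d2 > 0" "ball w d2 \<subseteq> S" using w(1) mem_interior by blast
  show "\<exists>d>0. \<forall>h. norm h < d --> f (w + h) <= f w + p \<bullet> h + (1/2) * Q h + e * (norm h)\<^sup>2"
  proof (intro exI[of _ "min d1 d2"] conjI allI impI)
    fix h :: 'a assume h: "norm h < min d1 d2"
    then have "w + h \<in> ball w d2" by (simp add: dist_norm)
    then have "w + h \<in> S" using d2(2) by blast
    from sup_conv_ge[OF d this, of "z + h"]
    have "f (w + h) - (norm (z - w))\<^sup>2 / (2 * \<iota>) <= sup_conv S \<iota> f (z + h)" by simp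
    then show "f (w + h) <= f w + p \<bullet> h + (1/2) * Q h + e * (norm h)\<^sup>2" using d1(2)[of h] h w(2) by simp
  qed (use d1(1) d2(1) in auto)
qed

lemma sup_conv_close:
  fixes f :: "'a::euclidean_space => real"
  assumes d: "sup_conv_data S \<iota> f M" and z: "z \<in> S" and low: "!!w. w \<in> S ==> f w >= m"
    and w: "w \<in> S" "sup_conv S \<iota> f z = f w - (norm (z - w))\<^sup>2 / (2 * \<iota>)"
  shows "(norm (z - w))\<^sup>2 <= 2 * \<iota> * (M - m)" "f z <= sup_conv S \<iota> f z" "sup_conv S \<iota> f z <= f w"
proof -
  have \<iota>: "\<iota> > 0" and up: "f w <= M" using d w(1) by (auto simp: sup_conv_data_def)
  show 1: "f z <= sup_conv S \<iota> f z" using sup_conv_ge[OF d z, of z] by simp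
  show "sup_conv S \<iota> f z <= f w" using w(2) \<iota> by simp
  have "(norm (z - w))\<^sup>2 / (2 * \<iota>) <= M - m" using 1 w(2) low[OF z] up by linarith
  then show "(norm (z - w))\<^sup>2 <= 2 * \<iota> * (M - m)" using \<iota> by (simp add: divide_le_eq mult.commute)
qed

lemma peano2_lower:
  fixes F :: "'a::euclidean_space => real"
  assumes "peano2 F z p B" "linear B"
  obtains C d where "d > 0" "C >= 0" "!!h. norm h < d ==> F (z + h) - F z >= p \<bullet> h - C * (norm h)\<^sup>2"
proof -
  obtain C where C: "C >= 0" "!!h. \<bar>h \<bullet> B h\<bar> <= C * (norm h)\<^sup>2"
    using qform_bound[OF qformI[OF assms(2) refl]] by metis
  obtain d where d: "d > 0" "!!h. norm h < d ==> \<bar>F (z + h) - F z - p \<bullet> h - (1/2) * (h \<bullet> B h)\<bar> <= 1 * (norm h)\<^sup>2"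
    using assms(1) unfolding peano2_def using zero_less_one by blast
  show thesis
  proof (rule that[OF d(1), of "C + 1"])
    fix h :: 'a assume h: "norm h < d"
    have "F (z + h) - F z >= p \<bullet> h - (C * (norm h)\<^sup>2 + 1 * (norm h)\<^sup>2)"
      using d(2)[OF h] C(2)[of h] mult_nonneg_nonneg[OF C(1), of "(norm h)\<^sup>2"] by (simp add: abs_le_iff)
    then show "F (z + h) - F z >= p \<bullet> h - (C + 1) * (norm h)\<^sup>2" by (simp only: distrib_right)
  qed (use C in auto)
qed

lemma peano2_upper_jet:
  fixes F :: "'a::real_inner => real"
  assumes "peano2 F z p B" shows "upper_jet F z p (\<lambda>h. h \<bullet> B h)"
  unfolding upper_jet_def
proof (intro allI impI)
  fix e :: real assume "e > 0"
  then obtain d where d: "d > 0" "!!h. norm h < d ==> \<bar>F (z + h) - F z - p \<bullet> h - (1/2) * (h \<bullet> B h)\<bar> <= e * (norm h)\<^sup>2"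
    using assms unfolding peano2_def by blast
  show "\<exists>d>0. \<forall>h. norm h < d --> F (z + h) <= F z + p \<bullet> h + (1/2) * (h \<bullet> B h) + e * (norm h)\<^sup>2"
  proof (intro exI[of _ d] conjI allI impI)
    fix h :: 'a assume "norm h < d"
    from d(2)[OF this] show "F (z + h) <= F z + p \<bullet> h + (1/2) * (h \<bullet> B h) + e * (norm h)\<^sup>2" by linarith
  qed (rule d(1))
qed

text \<open>
  Restriction of a second-order expansion to the variables on which the function depends.
\<close>

lemma peano2_section:
  fixes F :: "'a::euclidean_space => real" and L :: "'a => 'b::euclidean_space" and Ls :: "'b => 'a"
  assumes pe: "peano2 (\<lambda>w. F (Ls w)) Z p B" and B: "linear B" and lin: "linear L" "linear Ls"
    and LL: "!!h. Ls (L h) = h" "!!h. norm (L h) = norm h" "!!h k. L h \<bullet> k = h \<bullet> Ls k"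
  shows "peano2 F (Ls Z) (Ls p) (\<lambda>h. Ls (B (L h)))" "linear (\<lambda>h. Ls (B (L h)))"
proof -
  show "linear (\<lambda>h. Ls (B (L h)))"
    using linear_compose[OF linear_compose[OF lin(1) B] lin(2)] by (simp add: o_def)
  show "peano2 F (Ls Z) (Ls p) (\<lambda>h. Ls (B (L h)))"
    unfolding peano2_def
  proof (intro allI impI)
    fix e :: real assume "e > 0"
    then obtain d where d: "d > 0" "!!h. norm h < d ==> \<bar>F (Ls (Z + h)) - F (Ls Z) - p \<bullet> h - (1/2) * (h \<bullet> B h)\<bar> <= e * (norm h)\<^sup>2"
      using pe unfolding peano2_def by blast
    show "\<exists>d>0. \<forall>h. norm h < d --> \<bar>F (Ls Z + h) - F (Ls Z) - Ls p \<bullet> h - (1/2) * (h \<bullet> Ls (B (L h)))\<bar> <= e * (norm h)\<^sup>2"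
    proof (intro exI[of _ d] conjI allI impI)
      fix h :: 'a assume h: "norm h < d"
      have "Ls (Z + L h) = Ls Z + h" using linear_add[OF lin(2), of Z "L h"] LL(1) by simp
      moreover have "p \<bullet> L h = Ls p \<bullet> h" using LL(3)[of h p] by (simp add: inner_commute)
      ultimately show "\<bar>F (Ls Z + h) - F (Ls Z) - Ls p \<bullet> h - (1/2) * (h \<bullet> Ls (B (L h)))\<bar> <= e * (norm h)\<^sup>2"
        using d(2)[of "L h"] h by (simp add: LL)
    qed (rule d(1))
  qed
qed

section \<open>Doubling of variables\<close>

lemma quartic_expansion_bound:
  fixes \<zeta> v :: "'a::real_inner"
  assumes "norm \<zeta> <= \<rho>" "norm (\<zeta> + v) <= \<rho>"
  shows "\<bar>norm (\<zeta> + v) ^ 4 - norm \<zeta> ^ 4 - 4 * (norm \<zeta>)\<^sup>2 * (\<zeta> \<bullet> v)\<bar> <= 18 * \<rho>\<^sup>2 * (norm v)\<^sup>2"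
proof -
  have \<rho>: "\<rho> >= 0" using assms(1) norm_ge_zero order_trans by blast
  have v: "norm v <= 2 * \<rho>" using norm_triangle_ineq4[of "\<zeta> + v" \<zeta>] assms by simp
  have sq: "(norm (\<zeta> + v))\<^sup>2 = (norm \<zeta>)\<^sup>2 + 2 * (\<zeta> \<bullet> v) + (norm v)\<^sup>2"
    by (simp add: power2_norm_eq_inner inner_add_left inner_add_right inner_commute)
  have p4: "norm x ^ 4 = ((norm x)\<^sup>2)\<^sup>2" for x :: 'a by simp
  have e: "norm (\<zeta> + v) ^ 4 - norm \<zeta> ^ 4 - 4 * (norm \<zeta>)\<^sup>2 * (\<zeta> \<bullet> v)
      = (2 * (\<zeta> \<bullet> v) + (norm v)\<^sup>2)\<^sup>2 + 2 * (norm \<zeta>)\<^sup>2 * (norm v)\<^sup>2"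
    unfolding p4 sq by (simp add: power2_eq_square algebra_simps)
  have "\<bar>2 * (\<zeta> \<bullet> v) + (norm v)\<^sup>2\<bar> <= 4 * \<rho> * norm v"
  proof -
    have "\<bar>\<zeta> \<bullet> v\<bar> <= \<rho> * norm v"
      using Cauchy_Schwarz_ineq2[of \<zeta> v] mult_right_mono[OF assms(1) norm_ge_zero[of v]] by linarith
    moreover have "(norm v)\<^sup>2 <= 2 * \<rho> * norm v" using mult_right_mono[OF v norm_ge_zero[of v]] by (simp add: power2_eq_square)
    moreover have "(norm v)\<^sup>2 >= 0" by simp
    ultimately show ?thesis by linarith
  qed
  then have "(2 * (\<zeta> \<bullet> v) + (norm v)\<^sup>2)\<^sup>2 <= (4 * \<rho> * norm v)\<^sup>2" using \<rho> by (intro abs_le_square_iff[THEN iffD1]) simp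
  moreover have "2 * (norm \<zeta>)\<^sup>2 * (norm v)\<^sup>2 <= 2 * \<rho>\<^sup>2 * (norm v)\<^sup>2"
    using assms(1) by (intro mult_right_mono mult_left_mono power_mono) auto
  moreover have "(4 * \<rho> * norm v)\<^sup>2 = 16 * \<rho>\<^sup>2 * (norm v)\<^sup>2" by (simp add: power_mult_distrib)
  moreover have "0 <= (2 * (\<zeta> \<bullet> v) + (norm v)\<^sup>2)\<^sup>2 + 2 * (norm \<zeta>)\<^sup>2 * (norm v)\<^sup>2" by simp
  ultimately show ?thesis unfolding e by linarith
qed

definition doubling_penalty :: "(real => real) => real => 'a::real_inner => (real => real) => ('a \<times> 'a) \<times> real => real" where
  "doubling_penalty lam \<Lambda> y0 mu w =
     lam (snd w) * norm (fst (fst w) - snd (fst w)) ^ 4 + \<Lambda> * (norm (fst (fst w) - y0))\<^sup>2 + mu (snd w)"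

text \<open>
  The penalty is semiconcave on compact sets, with its gradient given explicitly; only this is needed for
  Jensen's lemma.
\<close>

lemma doubling_penalty_expansion:
  fixes y0 :: "'a::real_inner" and lam mu lam' mu' :: "real => real"
  assumes lam: "!!s t. s \<in> T ==> t \<in> T ==> \<bar>lam t - lam s - lam' s * (t - s)\<bar> <= K * (t - s)\<^sup>2"
    and mu: "!!s t. s \<in> T ==> t \<in> T ==> \<bar>mu t - mu s - mu' s * (t - s)\<bar> <= K * (t - s)\<^sup>2"
    and lamb: "!!t. t \<in> T ==> \<bar>lam t\<bar> <= K" "!!t. t \<in> T ==> \<bar>lam' t\<bar> <= K"
    and lamL: "!!s t. s \<in> T ==> t \<in> T ==> \<bar>lam t - lam s\<bar> <= K * \<bar>t - s\<bar>"
    and D: "!!w. w \<in> D ==> snd w \<in> T \<and> norm (fst (fst w) - snd (fst w)) <= \<rho>"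
    and K: "K >= 0" "\<Lambda> >= 0" "\<rho> >= 0"
  obtains C where "C >= 0" "!!z w. z \<in> D ==> w \<in> D ==>
     doubling_penalty lam \<Lambda> y0 mu w <= doubling_penalty lam \<Lambda> y0 mu z
       + (((4 * lam (snd z) * (norm (fst (fst z) - snd (fst z)))\<^sup>2) *\<^sub>R (fst (fst z) - snd (fst z)) + (2 * \<Lambda>) *\<^sub>R (fst (fst z) - y0),
           - ((4 * lam (snd z) * (norm (fst (fst z) - snd (fst z)))\<^sup>2) *\<^sub>R (fst (fst z) - snd (fst z)))),
          lam' (snd z) * norm (fst (fst z) - snd (fst z)) ^ 4 + mu' (snd z)) \<bullet> (w - z) + C * (norm (w - z))\<^sup>2"
proof -
  define C1 where "C1 = K * \<rho> ^ 4 + K * (4 * \<rho> ^ 3 + 36 * \<rho> ^ 3) * 2 + K * 18 * \<rho>\<^sup>2 * 4"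
  define C where "C = C1 + \<Lambda> + K"
  have C1: "C1 >= 0" using K by (simp add: C1_def)
  show thesis
  proof (rule that[of C])
    show "C >= 0" using C1 K by (simp add: C_def)
    fix z w assume zD: "z \<in> D" and wD: "w \<in> D"
    define \<zeta> where "\<zeta> = fst (fst z) - snd (fst z)"
    define h1 where "h1 = fst (fst w) - fst (fst z)"
    define h2 where "h2 = snd (fst w) - snd (fst z)"
    define \<tau> where "\<tau> = snd w - snd z"
    define v where "v = h1 - h2"
    define s where "s = snd z"
    have hz: "w - z = ((h1, h2), \<tau>)" by (simp add: prod_eq_iff h1_def h2_def \<tau>_def)
    define H where "H = norm (w - z)"
    have H2: "H\<^sup>2 = (norm h1)\<^sup>2 + (norm h2)\<^sup>2 + \<tau>\<^sup>2" unfolding H_def hz by (simp add: norm_prod_def)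
    have n1: "norm h1 <= H" "norm h2 <= H" "\<bar>\<tau>\<bar> <= H" unfolding H_def hz
      by (metis norm_fst_le norm_snd_le order_trans, metis norm_fst_le norm_snd_le order_trans, metis norm_snd_le real_norm_def)
    have vH: "norm v <= 2 * H" using norm_triangle_ineq4[of h1 h2] n1 unfolding v_def by linarith
    have H0: "H >= 0" by (simp add: H_def)
    have wv: "fst (fst w) - snd (fst w) = \<zeta> + v" "fst (fst w) - y0 = (fst (fst z) - y0) + h1" "snd w = s + \<tau>"
      by (simp_all add: \<zeta>_def v_def h1_def h2_def \<tau>_def s_def)
    have b: "norm \<zeta> <= \<rho>" "norm (\<zeta> + v) <= \<rho>" "s \<in> T" "s + \<tau> \<in> T"
      using D[OF zD] D[OF wD] wv by (auto simp: \<zeta>_def s_def)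
    define E where "E = norm (\<zeta> + v) ^ 4 - norm \<zeta> ^ 4 - 4 * (norm \<zeta>)\<^sup>2 * (\<zeta> \<bullet> v)"
    define E2 where "E2 = lam (s + \<tau>) - lam s - lam' s * \<tau>"
    have E: "\<bar>E\<bar> <= 18 * \<rho>\<^sup>2 * (norm v)\<^sup>2" unfolding E_def by (rule quartic_expansion_bound[OF b(1,2)])
    have E2: "\<bar>E2\<bar> <= K * \<tau>\<^sup>2" using lam[OF b(3,4)] by (simp add: E2_def)
    define X where "X = 4 * (norm \<zeta>)\<^sup>2 * (\<zeta> \<bullet> v)"
    have X: "\<bar>X\<bar> <= 4 * \<rho> ^ 3 * norm v"
    proof -
      have "\<bar>\<zeta> \<bullet> v\<bar> <= \<rho> * norm v"
        using Cauchy_Schwarz_ineq2[of \<zeta> v] mult_right_mono[OF b(1) norm_ge_zero[of v]] by linarith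
      then have "(norm \<zeta>)\<^sup>2 * \<bar>\<zeta> \<bullet> v\<bar> <= \<rho>\<^sup>2 * (\<rho> * norm v)"
        using b(1) by (intro mult_mono power_mono) auto
      then show ?thesis by (simp add: X_def abs_mult power2_eq_square power3_eq_cube)
    qed
    have v2: "norm v <= 2 * \<rho>" using norm_triangle_ineq4[of "\<zeta> + v" \<zeta>] b(1,2) by simp
    have XE: "\<bar>X + E\<bar> <= (4 * \<rho> ^ 3 + 36 * \<rho> ^ 3) * norm v"
    proof -
      have "18 * \<rho>\<^sup>2 * (norm v)\<^sup>2 <= 18 * \<rho>\<^sup>2 * (2 * \<rho> * norm v)"
        using mult_right_mono[OF v2 norm_ge_zero[of v]] by (intro mult_left_mono) (auto simp: power2_eq_square)
      also have "\<dots> = 36 * \<rho> ^ 3 * norm v" by (simp add: power2_eq_square power3_eq_cube)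
      finally show ?thesis using X E unfolding distrib_right by linarith
    qed
    have id: "lam (s + \<tau>) * norm (\<zeta> + v) ^ 4 - lam s * norm \<zeta> ^ 4 - lam s * X - lam' s * norm \<zeta> ^ 4 * \<tau>
       = E2 * norm \<zeta> ^ 4 + (lam (s + \<tau>) - lam s) * (X + E) + lam s * E"
      by (simp add: E_def E2_def X_def algebra_simps)
    have t1: "E2 * norm \<zeta> ^ 4 <= K * \<rho> ^ 4 * H\<^sup>2"
    proof -
      have "\<bar>E2\<bar> * norm \<zeta> ^ 4 <= (K * \<tau>\<^sup>2) * \<rho> ^ 4" using E2 b(1) K by (intro mult_mono power_mono) auto
      also have "\<dots> <= (K * H\<^sup>2) * \<rho> ^ 4" using n1(3) K H0 by (intro mult_right_mono mult_left_mono) (auto simp: abs_le_square_iff[symmetric])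
      finally have "\<bar>E2 * norm \<zeta> ^ 4\<bar> <= K * \<rho> ^ 4 * H\<^sup>2" by (simp add: abs_mult mult_ac)
      then show ?thesis by linarith
    qed
    have t2: "(lam (s + \<tau>) - lam s) * (X + E) <= K * (4 * \<rho> ^ 3 + 36 * \<rho> ^ 3) * 2 * H\<^sup>2"
    proof -
      have "\<bar>lam (s + \<tau>) - lam s\<bar> * \<bar>X + E\<bar> <= (K * H) * ((4 * \<rho> ^ 3 + 36 * \<rho> ^ 3) * (2 * H))"
      proof (intro mult_mono)
        show "\<bar>lam (s + \<tau>) - lam s\<bar> <= K * H"
          using lamL[OF b(3,4)] mult_left_mono[OF n1(3) K(1)] by simp
        show "\<bar>X + E\<bar> <= (4 * \<rho> ^ 3 + 36 * \<rho> ^ 3) * (2 * H)"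
          by (rule order_trans[OF XE mult_left_mono[OF vH]]) (use K in simp)
      qed (use K H0 in auto)
      then have "\<bar>(lam (s + \<tau>) - lam s) * (X + E)\<bar> <= K * (4 * \<rho> ^ 3 + 36 * \<rho> ^ 3) * 2 * H\<^sup>2"
        by (simp only: abs_mult power2_eq_square mult_ac)
      then show ?thesis by linarith
    qed
    have t3: "lam s * E <= K * 18 * \<rho>\<^sup>2 * 4 * H\<^sup>2"
    proof -
      have "(norm v)\<^sup>2 <= (2 * H)\<^sup>2" using vH by (intro power_mono) auto
      then have "18 * \<rho>\<^sup>2 * (norm v)\<^sup>2 <= 18 * \<rho>\<^sup>2 * (2 * H)\<^sup>2" by (intro mult_left_mono) auto
      then have "\<bar>E\<bar> <= 18 * \<rho>\<^sup>2 * (2 * H)\<^sup>2" using E by linarith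
      then have "\<bar>lam s\<bar> * \<bar>E\<bar> <= K * (18 * \<rho>\<^sup>2 * (2 * H)\<^sup>2)" using lamb(1)[OF b(3)] K by (intro mult_mono) auto
      then have "\<bar>lam s * E\<bar> <= K * 18 * \<rho>\<^sup>2 * 4 * H\<^sup>2" by (simp add: abs_mult power_mult_distrib mult_ac)
      then show ?thesis by linarith
    qed
    have t4: "\<Lambda> * (norm h1)\<^sup>2 <= \<Lambda> * H\<^sup>2" using n1(1) K by (intro mult_left_mono power_mono) auto
    have t5: "mu (s + \<tau>) - mu s <= mu' s * \<tau> + K * H\<^sup>2"
    proof -
      have "\<tau>\<^sup>2 <= H\<^sup>2" using n1(3) H0 by (simp add: abs_le_square_iff[symmetric])
      then have "K * \<tau>\<^sup>2 <= K * H\<^sup>2" using K by (intro mult_left_mono) auto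
      then show ?thesis using mu[OF b(3,4)] by (simp add: abs_le_iff)
    qed
    define a where "a = fst (fst z) - y0"
    have sq: "(norm (a + h1))\<^sup>2 = (norm a)\<^sup>2 + 2 * (a \<bullet> h1) + (norm h1)\<^sup>2"
      by (simp add: power2_norm_eq_inner inner_add_left inner_add_right inner_commute)
    have Pw: "doubling_penalty lam \<Lambda> y0 mu w = lam (s + \<tau>) * norm (\<zeta> + v) ^ 4 + \<Lambda> * (norm (a + h1))\<^sup>2 + mu (s + \<tau>)"
      unfolding doubling_penalty_def wv a_def ..
    have Pz: "doubling_penalty lam \<Lambda> y0 mu z = lam s * norm \<zeta> ^ 4 + \<Lambda> * (norm a)\<^sup>2 + mu s"
      unfolding doubling_penalty_def \<zeta>_def a_def s_def ..
    have inn: "(((4 * lam s * (norm \<zeta>)\<^sup>2) *\<^sub>R \<zeta> + (2 * \<Lambda>) *\<^sub>R a, - ((4 * lam s * (norm \<zeta>)\<^sup>2) *\<^sub>R \<zeta>)),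
          lam' s * norm \<zeta> ^ 4 + mu' s) \<bullet> (w - z)
        = lam s * X + 2 * (\<Lambda> * (a \<bullet> h1)) + (lam' s * norm \<zeta> ^ 4 * \<tau> + mu' s * \<tau>)"
      unfolding hz X_def v_def by (simp add: inner_add_left inner_diff_right algebra_simps)
    have Lsq: "\<Lambda> * (norm (a + h1))\<^sup>2 = \<Lambda> * (norm a)\<^sup>2 + 2 * (\<Lambda> * (a \<bullet> h1)) + \<Lambda> * (norm h1)\<^sup>2"
      unfolding sq by (simp add: algebra_simps)
    have CH: "C * H\<^sup>2 = K * \<rho> ^ 4 * H\<^sup>2 + K * (4 * \<rho> ^ 3 + 36 * \<rho> ^ 3) * 2 * H\<^sup>2 + K * 18 * \<rho>\<^sup>2 * 4 * H\<^sup>2 + \<Lambda> * H\<^sup>2 + K * H\<^sup>2"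
      unfolding C_def C1_def by (simp only: distrib_right)
    show "doubling_penalty lam \<Lambda> y0 mu w <= doubling_penalty lam \<Lambda> y0 mu z
       + (((4 * lam (snd z) * (norm (fst (fst z) - snd (fst z)))\<^sup>2) *\<^sub>R (fst (fst z) - snd (fst z)) + (2 * \<Lambda>) *\<^sub>R (fst (fst z) - y0),
           - ((4 * lam (snd z) * (norm (fst (fst z) - snd (fst z)))\<^sup>2) *\<^sub>R (fst (fst z) - snd (fst z)))),
          lam' (snd z) * norm (fst (fst z) - snd (fst z)) ^ 4 + mu' (snd z)) \<bullet> (w - z) + C * (norm (w - z))\<^sup>2"
      unfolding \<zeta>_def[symmetric] a_def[symmetric] s_def[symmetric] H_def[symmetric] inn CH Pw Pz
      using id t1 t2 t3 t4 t5 Lsq by linarith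
  qed
qed

text \<open>
  The theorem on sums for this particular penalty.  Up to the unit perturbations from Jensen's lemma the gradients in
  \<open>x\<close> and \<open>y\<close> are opposite, and the sum of the time derivatives is that of the penalty.  The second-order
  inequality is obtained from the exact expansion of the quartic at fixed time.
\<close>

lemma doubling_jets:
  fixes f g :: "(real^'n) \<times> real => real" and y0 :: "real^'n" and lam mu lam' mu' :: "real => real"
  assumes lam: "!!s t. s \<in> T ==> t \<in> T ==> \<bar>lam t - lam s - lam' s * (t - s)\<bar> <= K * (t - s)\<^sup>2"
    and mu: "!!s t. s \<in> T ==> t \<in> T ==> \<bar>mu t - mu s - mu' s * (t - s)\<bar> <= K * (t - s)\<^sup>2"
    and lamb: "!!t. t \<in> T ==> 0 <= lam t \<and> lam t <= K" "!!t. t \<in> T ==> \<bar>lam' t\<bar> <= K"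
    and lamL: "!!s t. s \<in> T ==> t \<in> T ==> \<bar>lam t - lam s\<bar> <= K * \<bar>t - s\<bar>"
    and cont: "continuous_on T lam" "continuous_on T mu"
    and D: "compact D" "!!w. w \<in> D ==> snd w \<in> T \<and> norm (fst (fst w) - snd (fst w)) <= \<rho>"
    and K: "K >= 0" "\<Lambda> >= 0" "\<rho> >= 0"
    and fd: "sup_conv_data S1 \<iota> f M1" and gd: "sup_conv_data S2 \<iota> g M2"
  defines "F \<equiv> sup_conv S1 \<iota> f" and "G \<equiv> sup_conv S2 \<iota> g"
  defines "\<Phi> \<equiv> \<lambda>w. F (fst (fst w), snd w) + G (snd (fst w), snd w) - doubling_penalty lam \<Lambda> y0 mu w"
  assumes z0: "z0 \<in> D" and gap: "\<gamma> > 0" "!!z. z \<in> frontier D ==> \<Phi> z <= \<Phi> z0 - \<gamma>"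
  shows "\<exists>x y t \<xi>1 a1 B1 \<xi>2 a2 B2 q1 q2 q3. ((x, y), t) \<in> interior D \<and> \<Phi> z0 - \<gamma> <= \<Phi> ((x, y), t) \<and>
     linear B1 \<and> linear B2 \<and> peano2 F (x, t) (\<xi>1, a1) B1 \<and> peano2 G (y, t) (\<xi>2, a2) B2 \<and>
     norm q1 <= 1 \<and> norm q2 <= 1 \<and> \<bar>q3\<bar> <= 1 \<and>
     \<xi>1 = (4 * lam t * (norm (x - y))\<^sup>2) *\<^sub>R (x - y) + (2 * \<Lambda>) *\<^sub>R (x - y0) + q1 \<and>
     \<xi>2 = - ((4 * lam t * (norm (x - y))\<^sup>2) *\<^sub>R (x - y)) + q2 \<and>
     a1 + a2 = lam' t * norm (x - y) ^ 4 + mu' t + q3 \<and>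
     (\<forall>h1 h2. (h1, 0) \<bullet> B1 (h1, 0) + (h2, 0) \<bullet> B2 (h2, 0)
        <= 12 * lam t * (norm (x - y))\<^sup>2 * (norm (h1 - h2))\<^sup>2 + 2 * \<Lambda> * (norm h1)\<^sup>2)"
proof -
  define P where "P = doubling_penalty lam \<Lambda> y0 mu"
  have lamb': "!!t. t \<in> T ==> \<bar>lam t\<bar> <= K" using lamb(1) by force
  define gr where "gr z = (((4 * lam (snd z) * (norm (fst (fst z) - snd (fst z)))\<^sup>2) *\<^sub>R (fst (fst z) - snd (fst z)) + (2 * \<Lambda>) *\<^sub>R (fst (fst z) - y0),
           - ((4 * lam (snd z) * (norm (fst (fst z) - snd (fst z)))\<^sup>2) *\<^sub>R (fst (fst z) - snd (fst z)))),
          lam' (snd z) * norm (fst (fst z) - snd (fst z)) ^ 4 + mu' (snd z))" for z :: "((real^'n) \<times> (real^'n)) \<times> real"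
  obtain CP where CP: "CP >= 0" "!!z w. z \<in> D ==> w \<in> D ==> P w <= P z + gr z \<bullet> (w - z) + CP * (norm (w - z))\<^sup>2"
    unfolding P_def gr_def
    by (rule doubling_penalty_expansion[where ?y0.0=y0, OF lam mu lamb' lamb(2) lamL D(2) K]) auto
  have \<iota>: "\<iota> > 0" using fd by (simp add: sup_conv_data_def)
  define C where "C = max CP (1 / (2 * \<iota>))"
  have C: "C >= 0" "CP <= C" "1 / (2 * \<iota>) <= C" using CP by (auto simp: C_def)
  define Lx where "Lx h = ((fst h, 0::real^'n), snd h)" for h :: "(real^'n) \<times> real"
  define Ly where "Ly h = ((0::real^'n, fst h), snd h)" for h :: "(real^'n) \<times> real"
  define px where "px w = (fst (fst w), snd w)" for w :: "((real^'n) \<times> (real^'n)) \<times> real"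
  define py where "py w = (snd (fst w), snd w)" for w :: "((real^'n) \<times> (real^'n)) \<times> real"
  have lin: "linear Lx" "linear Ly" "linear px" "linear py"
    unfolding Lx_def[abs_def] Ly_def[abs_def] px_def[abs_def] py_def[abs_def] by (auto intro!: linearI simp: prod_eq_iff)
  have Lxp: "!!h. px (Lx h) = h" "!!h. norm (Lx h) = norm h" "!!h k. Lx h \<bullet> k = h \<bullet> px k"
    and Lyp: "!!h. py (Ly h) = h" "!!h. norm (Ly h) = norm h" "!!h k. Ly h \<bullet> k = h \<bullet> py k"
    by (simp_all add: Lx_def Ly_def px_def py_def norm_prod_def inner_prod_def)
  have npx: "norm (px h) <= norm h" "norm (py h) <= norm h" for h
  proof -
    have aux: "norm (a, s) <= norm (b, s)" if "norm a <= norm b" for a :: "real^'n" and b :: "(real^'n) \<times> (real^'n)" and s :: real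
      unfolding norm_Pair using that by (intro real_sqrt_le_mono add_right_mono power_mono) auto
    show "norm (px h) <= norm h" "norm (py h) <= norm h" unfolding px_def py_def
      using aux[OF norm_fst_le[of "fst (fst h)" "snd (fst h)"], of "snd h"] aux[OF norm_snd_le[of "snd (fst h)" "fst (fst h)"], of "snd h"]
      by simp_all
  qed
  have semi: "\<exists>p. \<forall>w\<in>D. sup_conv S \<iota> k (pr w) >= sup_conv S \<iota> k (pr z) + p \<bullet> (w - z) - C * (norm (w - z))\<^sup>2"
    if kd: "sup_conv_data S \<iota> k M" and L: "!!h k. L h \<bullet> k = h \<bullet> pr k" "linear pr" "!!h. norm (pr h) <= norm h"
    for S k M z and L :: "(real^'n) \<times> real => ((real^'n) \<times> (real^'n)) \<times> real" and pr
  proof -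
    obtain R where R: "!!w. w \<in> S ==> norm w <= R"
    proof -
      have "compact S" using kd by (simp add: sup_conv_data_def)
      then have "bounded S" by (rule compact_imp_bounded)
      then show ?thesis using that unfolding bounded_iff by auto
    qed
    obtain p where p: "\<forall>w. sup_conv S \<iota> k w >= sup_conv S \<iota> k (pr z) + p \<bullet> (w - pr z) - 1 / (2 * \<iota>) * (norm (w - pr z))\<^sup>2"
      using sup_conv_semiconvex[OF kd R, of "pr z"] by auto
    show ?thesis
    proof (intro exI[of _ "L p"] ballI)
      fix w assume "w \<in> D"
      have d: "pr w - pr z = pr (w - z)" by (simp add: linear_diff[OF L(2)])
      have "1 / (2 * \<iota>) * (norm (pr (w - z)))\<^sup>2 <= C * (norm (w - z))\<^sup>2"
        using C L(3)[of "w - z"] by (intro mult_mono power_mono) auto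
      then show "sup_conv S \<iota> k (pr w) >= sup_conv S \<iota> k (pr z) + L p \<bullet> (w - z) - C * (norm (w - z))\<^sup>2"
        using spec[OF p, of "pr w"] unfolding d L(1) by linarith
    qed
  qed
  have contP: "continuous_on D P"
  proof -
    have "continuous_on D (\<lambda>w. lam (snd w))" "continuous_on D (\<lambda>w. mu (snd w))"
      by (rule continuous_on_compose2[OF cont(1)] continuous_on_compose2[OF cont(2)]; use D(2) in \<open>auto intro!: continuous_intros\<close>)+
    then show ?thesis unfolding P_def doubling_penalty_def by (intro continuous_intros)
  qed
  have cF: "continuous_on D (\<lambda>w. F (px w))" "continuous_on D (\<lambda>w. G (py w))"
    unfolding F_def G_def px_def py_def
    by (rule continuous_on_compose2[OF sup_conv_continuous[OF fd]] continuous_on_compose2[OF sup_conv_continuous[OF gd]]; auto intro!: continuous_intros)+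
  have \<Phi>: "\<Phi> w = F (px w) + G (py w) + (- P w)" for w by (simp add: \<Phi>_def px_def py_def P_def)
  have "\<exists>z\<in>interior D. \<exists>q p1 B1 p2 B2. norm q <= 1 \<and>
     (\<forall>w\<in>D. F (px w) + G (py w) + (- P w) <= F (px z) + G (py z) + (- P z) + q \<bullet> (w - z)) \<and>
     F (px z0) + G (py z0) + (- P z0) - \<gamma> <= F (px z) + G (py z) + (- P z) \<and>
     linear B1 \<and> peano2 (\<lambda>w. F (px w)) z p1 B1 \<and> linear B2 \<and> peano2 (\<lambda>w. G (py w)) z p2 B2"
  proof (rule jensen_alexandrov[OF D(1) C(1) z0])
    show "continuous_on D (\<lambda>z. F (px z) + G (py z) + - P z)" by (intro continuous_intros cF contP)
    show "\<exists>p. \<forall>w\<in>D. F (px z) + p \<bullet> (w - z) - C * (norm (w - z))\<^sup>2 <= F (px w)" for z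
      unfolding F_def by (rule semi[OF fd Lxp(3) lin(3) npx(1)])
    show "\<exists>p. \<forall>w\<in>D. G (py z) + p \<bullet> (w - z) - C * (norm (w - z))\<^sup>2 <= G (py w)" for z
      unfolding G_def by (rule semi[OF gd Lyp(3) lin(4) npx(2)])
    show "\<exists>p. \<forall>w\<in>D. - P z + p \<bullet> (w - z) - C * (norm (w - z))\<^sup>2 <= - P w" if z: "z \<in> D" for z
    proof (intro exI[of _ "- gr z"] ballI)
      fix w assume w: "w \<in> D"
      have "CP * (norm (w - z))\<^sup>2 <= C * (norm (w - z))\<^sup>2" using C by (intro mult_right_mono) auto
      then show "- P z + (- gr z) \<bullet> (w - z) - C * (norm (w - z))\<^sup>2 <= - P w" using CP(2)[OF z w] by simp
    qed
    show "F (px z) + G (py z) + - P z <= F (px z0) + G (py z0) + - P z0 - \<gamma>" if "z \<in> frontier D" for z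
      using gap(2)[OF that] unfolding \<Phi> .
  qed (use gap(1) in auto)
  then obtain z q p1 B1' p2 B2' where zq: "z \<in> interior D" "norm q <= 1"
     "!!w. w \<in> D ==> F (px w) + G (py w) - P w <= F (px z) + G (py z) - P z + q \<bullet> (w - z)"
     "\<Phi> z0 - \<gamma> <= \<Phi> z" "linear B1'" "peano2 (\<lambda>w. F (px w)) z p1 B1'" "linear B2'" "peano2 (\<lambda>w. G (py w)) z p2 B2'"
    unfolding \<Phi> by fastforce
  define B1 where "B1 h = px (B1' (Lx h))" for h
  define B2 where "B2 h = py (B2' (Ly h))" for h
  have F2: "peano2 F (px z) (px p1) B1" "linear B1"
    using peano2_section[OF zq(6,5) lin(1,3) Lxp] unfolding B1_def[abs_def] by auto
  have G2: "peano2 G (py z) (py p2) B2" "linear B2"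
    using peano2_section[OF zq(8,7) lin(2,4) Lyp] unfolding B2_def[abs_def] by auto
  obtain x y t where z: "z = ((x, y), t)" by (metis prod.collapse)
  obtain d0 where d0: "d0 > 0" "ball z d0 \<subseteq> D" using zq(1) mem_interior by blast
  have zD: "z \<in> D" using zq(1) interior_subset by blast
  have tT: "t \<in> T" using D(2)[OF zD] z by simp
  have inD: "z + h \<in> D" if "norm h < d0" for h
    using d0(2) that by (auto simp: dist_norm)
  have max: "F (px z + px h) - F (px z) + (G (py z + py h) - G (py z)) <= P (z + h) - P z + q \<bullet> h" if "norm h < d0" for h
    using zq(3)[OF inD[OF that]] by (simp add: linear_add[OF lin(3)] linear_add[OF lin(4)])
  obtain C1 d1 where F1: "d1 > 0" "C1 >= 0" "!!h. norm h < d1 ==> F (px z + h) - F (px z) >= px p1 \<bullet> h - C1 * (norm h)\<^sup>2"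
    using peano2_lower[OF F2] by metis
  obtain C2 d2 where G1: "d2 > 0" "C2 >= 0" "!!h. norm h < d2 ==> G (py z + h) - G (py z) >= py p2 \<bullet> h - C2 * (norm h)\<^sup>2"
    using peano2_lower[OF G2] by metis
  define d where "d = min d0 (min d1 d2)"
  have d: "d > 0" "d <= d0" "d <= d1" "d <= d2" using d0 F1 G1 by (auto simp: d_def)
  have "Lx (px p1) + Ly (py p2) - gr z - q = 0"
  proof (rule affine_le_quadratic_imp_zero[of "d / 2" _ "C1 + C2 + CP"])
    fix h :: "((real^'n) \<times> (real^'n)) \<times> real" assume "norm h <= d / 2"
    then have h: "norm h < d" using d(1) by linarith
    have nx: "norm (px h) < d1" "norm (py h) < d2" "norm h < d0" using npx[of h] h d by linarith+
    have "C1 * (norm (px h))\<^sup>2 <= C1 * (norm h)\<^sup>2" "C2 * (norm (py h))\<^sup>2 <= C2 * (norm h)\<^sup>2"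
      using npx[of h] F1(2) G1(2) by (auto intro!: mult_left_mono power_mono)
    moreover have "P (z + h) <= P z + gr z \<bullet> h + CP * (norm h)\<^sup>2" using CP(2)[OF zD inD[OF nx(3)]] by simp
    ultimately have "px p1 \<bullet> px h + py p2 \<bullet> py h - gr z \<bullet> h - q \<bullet> h <= C1 * (norm h)\<^sup>2 + C2 * (norm h)\<^sup>2 + CP * (norm h)\<^sup>2"
      using F1(3)[OF nx(1)] G1(3)[OF nx(2)] max[OF nx(3)] by linarith
    then show "(Lx (px p1) + Ly (py p2) - gr z - q) \<bullet> h <= (C1 + C2 + CP) * (norm h)\<^sup>2"
      by (simp add: inner_add_left inner_diff_left Lxp(3) Lyp(3) distrib_right)
  qed (use d in auto)
  then have grad: "Lx (px p1) + Ly (py p2) = gr z + q" by (simp only: diff_diff_eq right_minus_eq)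
  obtain \<xi>1 a1 where p1: "px p1 = (\<xi>1, a1)" by (metis prod.collapse)
  obtain \<xi>2 a2 where p2: "py p2 = (\<xi>2, a2)" by (metis prod.collapse)
  obtain q1 q2 q3 where q: "q = ((q1, q2), q3)" by (metis prod.collapse)
  have nq: "norm q1 <= 1" "norm q2 <= 1" "\<bar>q3\<bar> <= 1"
  proof -
    have "norm (q1, q2) <= norm q" "norm q3 <= norm q" unfolding q by (rule norm_fst_le norm_snd_le)+
    moreover have "norm q1 <= norm (q1, q2)" "norm q2 <= norm (q1, q2)" by (rule norm_fst_le norm_snd_le)+
    ultimately show "norm q1 <= 1" "norm q2 <= 1" "\<bar>q3\<bar> <= 1" using zq(2) by auto
  qed
  define r where "r = norm (x - y)"
  have eqs: "\<xi>1 = (4 * lam t * r\<^sup>2) *\<^sub>R (x - y) + (2 * \<Lambda>) *\<^sub>R (x - y0) + q1"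
     "\<xi>2 = - ((4 * lam t * r\<^sup>2) *\<^sub>R (x - y)) + q2" "a1 + a2 = lam' t * r ^ 4 + mu' t + q3"
    using grad unfolding Lx_def Ly_def p1 p2 gr_def z q r_def by simp_all
  \<comment> \<open>The increments \<open>h = s (h1, h2, 0)\<close> cancel the first-order terms; dividing by \<open>s\<^sup>2\<close> leaves the forms.\<close>
  have mat: "(h1, 0) \<bullet> B1 (h1, 0) + (h2, 0) \<bullet> B2 (h2, 0)
        <= 12 * lam t * r\<^sup>2 * (norm (h1 - h2))\<^sup>2 + 2 * \<Lambda> * (norm h1)\<^sup>2" for h1 h2
  proof (rule field_le_epsilon)
    fix e :: real assume e: "e > 0"
    define v where "v = h1 - h2"
    define \<zeta> where "\<zeta> = x - y"
    define N where "N = (norm h1)\<^sup>2 + (norm h2)\<^sup>2 + 1"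
    have N: "N > 0" unfolding N_def by (intro add_nonneg_pos) auto
    define e1 where "e1 = e / (4 * N)"
    have e1: "e1 > 0" using e N by (simp add: e1_def)
    obtain b1 where b1: "b1 > 0" "!!h. norm h < b1 ==> \<bar>F (px z + h) - F (px z) - px p1 \<bullet> h - (1/2) * (h \<bullet> B1 h)\<bar> <= e1 * (norm h)\<^sup>2"
      using F2(1) e1 unfolding peano2_def by blast
    obtain b2 where b2: "b2 > 0" "!!h. norm h < b2 ==> \<bar>G (py z + h) - G (py z) - py p2 \<bullet> h - (1/2) * (h \<bullet> B2 h)\<bar> <= e1 * (norm h)\<^sup>2"
      using G2(1) e1 unfolding peano2_def by blast
    define X where "X = lam t * (4 * \<bar>\<zeta> \<bullet> v\<bar> * (norm v)\<^sup>2 + norm v ^ 4)"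
    have lt: "0 <= lam t" using lamb(1)[OF tT] by simp
    have X: "X >= 0" unfolding X_def using lt by (intro mult_nonneg_nonneg add_nonneg_nonneg) auto
    define Nh where "Nh = norm h1 + norm h2 + 1"
    have Nh: "Nh > 0" unfolding Nh_def by (intro add_nonneg_pos) auto
    define s where "s = min 1 (min (e / (4 * (X + 1))) (min b1 (min b2 d0) / (2 * Nh)))"
    have s: "s > 0" "s <= 1" "s <= e / (4 * (X + 1))" "s <= min b1 (min b2 d0) / (2 * Nh)"
      using e X b1(1) b2(1) d0(1) Nh by (auto simp: s_def add_nonneg_pos)
    have sN: "s * Nh < b1" "s * Nh < b2" "s * Nh < d0"
    proof -
      have "s * Nh <= min b1 (min b2 d0) / (2 * Nh) * Nh" using s(4) Nh by (intro mult_right_mono) auto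
      also have "\<dots> = min b1 (min b2 d0) / 2" using Nh by simp
      finally have le: "s * Nh <= min b1 (min b2 d0) / 2" .
      have "min b1 (min b2 d0) > 0" using b1(1) b2(1) d0(1) by simp
      then have "s * Nh < min b1 (min b2 d0)" using le by linarith
      then show "s * Nh < b1" "s * Nh < b2" "s * Nh < d0" by auto
    qed
    define h where "h = ((s *\<^sub>R h1, s *\<^sub>R h2), 0::real)"
    have ph: "px h = (s *\<^sub>R h1, 0)" "py h = (s *\<^sub>R h2, 0)" by (simp_all add: px_def py_def h_def)
    have n1: "norm (px h) = s * norm h1" "norm (py h) = s * norm h2" using s(1) by (simp_all add: ph norm_prod_def)
    have nh: "norm h <= s * norm h1 + s * norm h2"
    proof -
      have "norm h = norm (s *\<^sub>R h1, s *\<^sub>R h2)" by (simp add: h_def norm_prod_def)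
      also have "\<dots> <= norm (s *\<^sub>R h1) + norm (s *\<^sub>R h2)" by (rule norm_Pair_le)
      finally show ?thesis using s(1) by simp
    qed
    have sNe: "s * Nh = s * norm h1 + s * norm h2 + s" by (simp add: Nh_def distrib_left)
    have small: "norm (px h) < b1" "norm (py h) < b2" "norm h < d0"
    proof -
      have "s * norm h1 >= 0" "s * norm h2 >= 0" using s(1) by auto
      then show "norm (px h) < b1" "norm (py h) < b2" "norm h < d0" using sN sNe s(1) nh n1 by linarith+
    qed
    have B1s: "px h \<bullet> B1 (px h) = s\<^sup>2 * ((h1, 0) \<bullet> B1 (h1, 0))"
    proof -
      have "px h = s *\<^sub>R (h1, 0)" by (simp add: ph)
      then show ?thesis by (simp only: linear_scale[OF F2(2)] inner_scaleR_left inner_scaleR_right power2_eq_square mult.assoc)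
    qed
    have B2s: "py h \<bullet> B2 (py h) = s\<^sup>2 * ((h2, 0) \<bullet> B2 (h2, 0))"
    proof -
      have "py h = s *\<^sub>R (h2, 0)" by (simp add: ph)
      then show ?thesis by (simp only: linear_scale[OF G2(2)] inner_scaleR_left inner_scaleR_right power2_eq_square mult.assoc)
    qed
    have g1: "px p1 \<bullet> px h + py p2 \<bullet> py h = gr z \<bullet> h + q \<bullet> h"
      using arg_cong[OF grad, of "\<lambda>u. u \<bullet> h"] by (simp add: inner_add_left Lxp(3) Lyp(3))
    have sq: "(norm (\<zeta> + s *\<^sub>R v))\<^sup>2 = (norm \<zeta>)\<^sup>2 + s * (2 * (\<zeta> \<bullet> v) + s * (norm v)\<^sup>2)"
      by (simp add: power2_norm_eq_inner inner_add_left inner_add_right inner_commute algebra_simps)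
    define Y where "Y = 2 * (\<zeta> \<bullet> v) + s * (norm v)\<^sup>2"
    have p4: "norm u ^ 4 = ((norm u)\<^sup>2)\<^sup>2" for u :: "real^'n" by simp
    have sqg: "(norm (u + s *\<^sub>R k))\<^sup>2 = (norm u)\<^sup>2 + s * (2 * (u \<bullet> k)) + s\<^sup>2 * (norm k)\<^sup>2" for u k :: "real^'n"
      unfolding power2_norm_eq_inner power2_eq_square[of s]
      by (simp add: inner_add_left inner_add_right inner_commute algebra_simps)
    have PP: "P (z + h) - P z = gr z \<bullet> h + s\<^sup>2 * (lam t * (Y\<^sup>2 + 2 * (norm \<zeta>)\<^sup>2 * (norm v)\<^sup>2) + \<Lambda> * (norm h1)\<^sup>2)"
    proof -
      have a: "fst (fst (z + h)) - snd (fst (z + h)) = \<zeta> + s *\<^sub>R v" "snd (z + h) = t" "fst (fst (z + h)) - y0 = (x - y0) + s *\<^sub>R h1"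
        "fst (fst z) - snd (fst z) = \<zeta>" "snd z = t" "fst (fst z) - y0 = x - y0"
        by (simp_all add: z h_def \<zeta>_def v_def algebra_simps)
      have b: "gr z \<bullet> h = s * (4 * lam t * (norm \<zeta>)\<^sup>2 * (\<zeta> \<bullet> v)) + s * (2 * \<Lambda> * ((x - y0) \<bullet> h1))"
        unfolding gr_def a unfolding h_def v_def by (simp add: inner_add_left inner_diff_right algebra_simps)
      have c: "norm (\<zeta> + s *\<^sub>R v) ^ 4 - norm \<zeta> ^ 4 = s * (4 * (norm \<zeta>)\<^sup>2 * (\<zeta> \<bullet> v)) + s\<^sup>2 * (Y\<^sup>2 + 2 * (norm \<zeta>)\<^sup>2 * (norm v)\<^sup>2)"
        unfolding p4 sq Y_def[symmetric] unfolding Y_def by (simp add: power2_eq_square algebra_simps)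
      have e: "(norm ((x - y0) + s *\<^sub>R h1))\<^sup>2 - (norm (x - y0))\<^sup>2 = s * (2 * ((x - y0) \<bullet> h1)) + s\<^sup>2 * (norm h1)\<^sup>2"
        unfolding sqg by simp
      have "P (z + h) - P z = lam t * (norm (\<zeta> + s *\<^sub>R v) ^ 4 - norm \<zeta> ^ 4) + \<Lambda> * ((norm ((x - y0) + s *\<^sub>R h1))\<^sup>2 - (norm (x - y0))\<^sup>2)"
        unfolding P_def doubling_penalty_def a by (simp add: algebra_simps)
      then show ?thesis unfolding b c e by (simp add: algebra_simps)
    qed
    have "(1/2) * (s\<^sup>2 * ((h1, 0) \<bullet> B1 (h1, 0))) + (1/2) * (s\<^sup>2 * ((h2, 0) \<bullet> B2 (h2, 0)))
       <= s\<^sup>2 * (lam t * (Y\<^sup>2 + 2 * (norm \<zeta>)\<^sup>2 * (norm v)\<^sup>2) + \<Lambda> * (norm h1)\<^sup>2) + (e1 * (s * norm h1)\<^sup>2 + e1 * (s * norm h2)\<^sup>2)"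
      using b1(2)[OF small(1)] b2(2)[OF small(2)] max[OF small(3)] g1 PP
      unfolding B1s B2s n1 abs_le_iff by linarith
    then have "s\<^sup>2 * ((h1, 0) \<bullet> B1 (h1, 0) + (h2, 0) \<bullet> B2 (h2, 0))
       <= s\<^sup>2 * (2 * (lam t * (Y\<^sup>2 + 2 * (norm \<zeta>)\<^sup>2 * (norm v)\<^sup>2)) + 2 * \<Lambda> * (norm h1)\<^sup>2 + 2 * e1 * ((norm h1)\<^sup>2 + (norm h2)\<^sup>2))"
      by (simp add: power_mult_distrib algebra_simps)
    then have le: "(h1, 0) \<bullet> B1 (h1, 0) + (h2, 0) \<bullet> B2 (h2, 0)
       <= 2 * (lam t * (Y\<^sup>2 + 2 * (norm \<zeta>)\<^sup>2 * (norm v)\<^sup>2)) + 2 * \<Lambda> * (norm h1)\<^sup>2 + 2 * e1 * ((norm h1)\<^sup>2 + (norm h2)\<^sup>2)"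
      by (rule mult_left_le_imp_le) (use s(1) in simp)
    have Y2: "lam t * Y\<^sup>2 <= lam t * (4 * (norm \<zeta>)\<^sup>2 * (norm v)\<^sup>2) + s * X"
    proof -
      have "(\<zeta> \<bullet> v)\<^sup>2 <= (norm \<zeta>)\<^sup>2 * (norm v)\<^sup>2" using Cauchy_Schwarz_ineq[of \<zeta> v] by (simp add: power2_norm_eq_inner)
      moreover have "Y\<^sup>2 = 4 * (\<zeta> \<bullet> v)\<^sup>2 + s * (4 * (\<zeta> \<bullet> v) * (norm v)\<^sup>2) + s * (s * norm v ^ 4)"
        by (simp add: Y_def power2_eq_square power4_eq_xxxx algebra_simps)
      moreover have "s * (4 * (\<zeta> \<bullet> v) * (norm v)\<^sup>2) <= s * (4 * \<bar>\<zeta> \<bullet> v\<bar> * (norm v)\<^sup>2)"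
        using s(1) by (intro mult_left_mono mult_right_mono) auto
      moreover have "s * (s * norm v ^ 4) <= s * (1 * norm v ^ 4)" using s by (intro mult_left_mono mult_right_mono) auto
      ultimately have "Y\<^sup>2 <= 4 * (norm \<zeta>)\<^sup>2 * (norm v)\<^sup>2 + s * (4 * \<bar>\<zeta> \<bullet> v\<bar> * (norm v)\<^sup>2 + norm v ^ 4)"
        by (simp add: distrib_left)
      from mult_left_mono[OF this lt] show ?thesis by (simp add: X_def algebra_simps)
    qed
    have "s * X <= e / 4"
    proof -
      have "s * X <= e / (4 * (X + 1)) * X" using s(3) X by (intro mult_right_mono)
      also have "\<dots> <= e / 4" using X e by (simp add: field_simps)
      finally show ?thesis .
    qed
    moreover have "2 * e1 * ((norm h1)\<^sup>2 + (norm h2)\<^sup>2) <= e / 2"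
    proof -
      have "2 * e1 * ((norm h1)\<^sup>2 + (norm h2)\<^sup>2) <= 2 * e1 * N" using e1 by (intro mult_left_mono) (auto simp: N_def)
      also have "\<dots> = e / 2" using N by (simp add: e1_def)
      finally show ?thesis .
    qed
    moreover have "lam t * (Y\<^sup>2 + 2 * (norm \<zeta>)\<^sup>2 * (norm v)\<^sup>2) = lam t * Y\<^sup>2 + lam t * (2 * (norm \<zeta>)\<^sup>2 * (norm v)\<^sup>2)"
      by (rule distrib_left)
    moreover have "12 * lam t * r\<^sup>2 * (norm (h1 - h2))\<^sup>2 = 2 * (lam t * (4 * (norm \<zeta>)\<^sup>2 * (norm v)\<^sup>2)) + 2 * (lam t * (2 * (norm \<zeta>)\<^sup>2 * (norm v)\<^sup>2))"
      by (simp add: r_def \<zeta>_def v_def algebra_simps)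
    ultimately show "(h1, 0) \<bullet> B1 (h1, 0) + (h2, 0) \<bullet> B2 (h2, 0)
        <= 12 * lam t * r\<^sup>2 * (norm (h1 - h2))\<^sup>2 + 2 * \<Lambda> * (norm h1)\<^sup>2 + e" using le Y2 by linarith
  qed
  have "((x, y), t) \<in> interior D" "\<Phi> z0 - \<gamma> <= \<Phi> ((x, y), t)" "peano2 F (x, t) (\<xi>1, a1) B1" "peano2 G (y, t) (\<xi>2, a2) B2"
    using zq(1,4) F2(1) G2(1) unfolding z p1 p2 by (simp_all add: px_def py_def)
  then show ?thesis using F2(2) G2(2) nq eqs mat unfolding r_def by blast
qed

section \<open>Estimate of the coupled jets\<close>

lemma qform_scale:
  assumes "qform Q" shows "Q (c *\<^sub>R h) = c\<^sup>2 * Q h"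
proof -
  obtain B where B: "linear B" "!!h. Q h = h \<bullet> B h" using qformE[OF assms] by metis
  show ?thesis by (simp add: B(2) linear_scale[OF B(1)] power2_eq_square)
qed

lemma TrA_scale:
  assumes "c > 0" "q (c *\<^sub>R \<xi>) = c\<^sup>2 * q \<xi>"
  shows "TrA p (c *\<^sub>R \<xi>) q = TrA p \<xi> q"
  using assms by (simp add: TrA_def power_mult_distrib)

lemma qform_spatial_matrix:
  fixes Q :: "(real^'n) \<times> real => real"
  assumes "qform Q"
  obtains X :: "real^'n^'n" where "transpose X = X" "!!k. Q (k, 0) = k \<bullet> (X *v k)"
proof -
  obtain B where B: "linear B" "!!v w. v \<bullet> B w = w \<bullet> B v" "Q = (\<lambda>h. h \<bullet> B h)"
    using qform_symmetric[OF assms] by blast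
  show thesis using that spatial_hessian[OF B(1,2)] by (simp add: B(3))
qed

lemma TrA_qform_sum:
  fixes Q :: "(real^'n) \<times> real => real"
  assumes p: "1 < p" and \<xi>: "\<xi> \<noteq> 0" and Q: "qform Q"
  shows "TrA p \<xi> (\<lambda>k. Q (k, 0)) = (\<Sum>i\<in>Basis. Q (sqA p (\<xi> /\<^sub>R norm \<xi>) i, 0))"
proof -
  obtain X where X: "transpose X = X" "!!k. Q (k, 0) = k \<bullet> (X *v k)" using qform_spatial_matrix[OF Q] by metis
  show ?thesis unfolding X(2) by (rule TrA_eq_sum_sqA[OF p \<xi> X(1)])
qed

lemma sum_sqA_norm:
  fixes \<xi> :: "real^'n"
  assumes p: "1 < p" and \<xi>: "\<xi> \<noteq> 0"
  shows "(\<Sum>i\<in>Basis. (norm (sqA p (\<xi> /\<^sub>R norm \<xi>) i))\<^sup>2) = trace_const p TYPE('n)"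
proof -
  have "TrA p \<xi> (\<lambda>k. (norm k)\<^sup>2) = (\<Sum>i\<in>Basis. (norm (sqA p (\<xi> /\<^sub>R norm \<xi>) i))\<^sup>2)"
    using TrA_qform_sum[OF p \<xi> qform_norm_fst] by simp
  then show ?thesis by (simp add: TrA_normsq[OF \<xi>])
qed

lemma sqA_even: "sqA p (- \<nu>) v = sqA p \<nu> v"
  by (simp add: sqA_def)

lemma sqA_lipschitz:
  assumes p: "1 < p" and n: "norm \<mu> <= 1" "norm \<nu> <= 1" "norm v <= 1"
  shows "norm (sqA p \<mu> v - sqA p \<nu> v) <= 2 * norm (\<mu> - \<nu>)"
proof -
  define g where "g = sqrt (1 - recip p) - sqrt (recip p)"
  have "0 <= recip p" "recip p < 1" using recip_bounds[OF p] by auto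
  then have "sqrt (1 - recip p) <= 1" "sqrt (recip p) <= 1" "sqrt (1 - recip p) >= 0" "sqrt (recip p) >= 0" by auto
  then have g: "\<bar>g\<bar> <= 1" unfolding g_def by linarith
  have "sqA p \<mu> v - sqA p \<nu> v = g *\<^sub>R (((\<mu> - \<nu>) \<bullet> v) *\<^sub>R \<mu> + (\<nu> \<bullet> v) *\<^sub>R (\<mu> - \<nu>))"
    by (simp add: sqA_def g_def[symmetric] inner_diff_left algebra_simps)
  also have "norm \<dots> <= 1 * norm (((\<mu> - \<nu>) \<bullet> v) *\<^sub>R \<mu> + (\<nu> \<bullet> v) *\<^sub>R (\<mu> - \<nu>))"
    unfolding norm_scaleR using g by (intro mult_right_mono) auto
  also have "\<dots> <= norm (((\<mu> - \<nu>) \<bullet> v) *\<^sub>R \<mu>) + norm ((\<nu> \<bullet> v) *\<^sub>R (\<mu> - \<nu>))"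
    by (simp only: mult_1) (rule norm_triangle_ineq)
  also have "norm (((\<mu> - \<nu>) \<bullet> v) *\<^sub>R \<mu>) <= norm (\<mu> - \<nu>) * 1 * 1"
    unfolding norm_scaleR real_norm_def
  proof (intro mult_mono)
    show "\<bar>(\<mu> - \<nu>) \<bullet> v\<bar> <= norm (\<mu> - \<nu>) * 1"
      using Cauchy_Schwarz_ineq2[of "\<mu> - \<nu>" v] mult_left_mono[OF n(3) norm_ge_zero[of "\<mu> - \<nu>"]] by linarith
  qed (use n in auto)
  also have "norm ((\<nu> \<bullet> v) *\<^sub>R (\<mu> - \<nu>)) <= 1 * norm (\<mu> - \<nu>)"
    unfolding norm_scaleR real_norm_def
  proof (intro mult_right_mono)
    show "\<bar>\<nu> \<bullet> v\<bar> <= 1" using Cauchy_Schwarz_ineq2[of \<nu> v] mult_mono[OF n(2,3)] by simp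
  qed simp
  finally show ?thesis by simp
qed

lemma direction_difference:
  fixes u w :: "'a::real_normed_vector"
  assumes "u \<noteq> 0" "w \<noteq> 0"
  shows "norm (u /\<^sub>R norm u - w /\<^sub>R norm w) <= 2 * norm (u - w) / norm w"
proof -
  have n: "norm u > 0" "norm w > 0" using assms by auto
  have "u /\<^sub>R norm u - w /\<^sub>R norm w = (1 / norm w) *\<^sub>R (u - w) + (1 / norm u - 1 / norm w) *\<^sub>R u"
    by (simp add: scaleR_diff_right scaleR_diff_left inverse_eq_divide)
  then have "norm (u /\<^sub>R norm u - w /\<^sub>R norm w) <= norm ((1 / norm w) *\<^sub>R (u - w)) + norm ((1 / norm u - 1 / norm w) *\<^sub>R u)"
    using norm_triangle_ineq by metis
  also have "norm ((1 / norm u - 1 / norm w) *\<^sub>R u) = \<bar>norm w - norm u\<bar> / norm w"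
  proof -
    have "1 / norm u - 1 / norm w = (norm w - norm u) / (norm u * norm w)" using n by (simp add: field_simps)
    then show ?thesis using n by (simp add: abs_mult)
  qed
  also have "\<dots> <= norm (u - w) / norm w"
    using norm_triangle_ineq3[of u w] n by (intro divide_right_mono) auto
  also have "norm ((1 / norm w) *\<^sub>R (u - w)) = norm (u - w) / norm w" using n by simp
  finally show ?thesis by simp
qed

lemma cube_le_imp_le:
  fixes x y :: real
  assumes "x ^ 3 <= y ^ 3" "0 <= y" shows "x <= y"
proof (rule ccontr)
  assume "\<not> x <= y"
  then have "y ^ 3 < x ^ 3" using assms(2) by (intro power_strict_mono) auto
  then show False using assms(1) by simp
qed

text \<open>
  The inequalities for a jet of a subsolution, strengthened by a multiple of the squared gradient.
\<close>

definition pde_jet :: "ereal => real => real^'n => real => ((real^'n) \<times> real => real) => bool" where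
  "pde_jet p \<kappa> \<xi> \<alpha> Q \<longleftrightarrow>
     (\<xi> \<noteq> 0 --> \<alpha> <= TrA p \<xi> (\<lambda>k. Q (k, 0)) - \<kappa> * (norm \<xi>)\<^sup>2) \<and>
     (\<forall>c. (\<forall>k. Q (k, 0) <= c * (norm k)\<^sup>2) --> \<alpha> <= c * trace_const p TYPE('n))"

text \<open>
  Here \<open>j\<close> stands for \<open>t\<^sup>-\<^sup>1\<^sup>/\<^sup>6\<close>, so that the coefficient \<open>t\<^sup>-\<^sup>5\<^sup>/\<^sup>2\<close> of the quartic is
  \<open>j\<^sup>1\<^sup>5\<close> and its time derivative \<open>- (5/2) j\<^sup>2\<^sup>1\<close>.  If the gradient of the quartic does not exceed the
  perturbation \<open>\<eta>\<close>, then \<open>\<bar>\<zeta>\<bar>\<close> is at most of order \<open>t\<^sup>5\<^sup>/\<^sup>6\<close> and both jets are estimated separately.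
  Otherwise the two directions differ by at most a multiple of \<open>\<eta> / \<bar>\<xi>\<bar>\<close>, and the Lipschitz dependence
  of the square root of \<open>A\<close> makes the Hessians nearly cancel.  The term with \<open>j\<^sup>2\<^sup>1\<close> is absorbed by
  \<open>\<kappa> \<bar>\<xi>1\<bar>\<^sup>2\<close> unless \<open>\<bar>\<zeta>\<bar>\<close> is small compared with \<open>t\<^sup>3\<^sup>/\<^sup>4\<close>, and then it is small.
\<close>

lemma coupled_jets_estimate:
  fixes Q1 Q2 :: "(real^'n) \<times> real => real" and \<zeta> :: "real^'n"
  assumes p: "1 < p" and Q: "qform Q1" "qform Q2" and \<kappa>: "\<kappa> > 0"
    and j1: "pde_jet p \<kappa> \<xi>1 \<alpha>1 Q1" and j2: "pde_jet p 0 \<xi>2 \<alpha>2 Q2"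
    and j: "j >= 1" and \<eta>: "\<eta> >= 2" and \<Lambda>: "\<Lambda> >= 0"
    and \<xi>: "\<xi>1 = (4 * j ^ 15 * (norm \<zeta>)\<^sup>2) *\<^sub>R \<zeta> + e1" "\<xi>2 = - ((4 * j ^ 15 * (norm \<zeta>)\<^sup>2) *\<^sub>R \<zeta>) + e2"
    and e: "norm e1 <= \<eta>" "norm e2 <= \<eta>"
    and mat: "!!h1 h2. Q1 (h1, 0) + Q2 (h2, 0) <= 12 * j ^ 15 * (norm \<zeta>)\<^sup>2 * (norm (h1 - h2))\<^sup>2 + 2 * \<Lambda> * (norm h1)\<^sup>2"
  defines "cp \<equiv> trace_const p TYPE('n)"
  shows "\<alpha>1 + \<alpha>2 + (5/2) * (j ^ 21 * norm \<zeta> ^ 4)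
     <= (24 * \<eta>\<^sup>2 * cp + 2 * \<Lambda> * cp + (5/2) * \<eta> ^ 4 + 96 * real CARD('n) * \<eta> + (5/2) * (5 / (8 * \<kappa>))\<^sup>2) * j ^ 5"
proof -
  define r where "r = norm \<zeta>"
  define L where "L = j ^ 15"
  have r: "r >= 0" by (simp add: r_def)
  have cp: "cp > 0" using trace_const_pos[OF p, where 'n='n] by (simp add: cp_def)
  have L: "L > 0" using j by (simp add: L_def)
  have j5: "j ^ 5 >= 1" using j by simp
  define y where "y = j ^ 5 * r"
  have y0: "y >= 0" using j r by (simp add: y_def)
  have y3: "y ^ 3 = L * r ^ 3" by (simp add: y_def L_def power_mult_distrib flip: power_mult)
  have Q0: "Q1 (0, 0) = 0" "Q2 (0, 0) = 0"
    using qform_scale[OF Q(1), of 0 "(0,0)"] qform_scale[OF Q(2), of 0 "(0,0)"] by simp_all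
  have tot: "X <= (24 * \<eta>\<^sup>2 * cp + 2 * \<Lambda> * cp + (5/2) * \<eta> ^ 4 + 96 * real CARD('n) * \<eta> + (5/2) * (5 / (8 * \<kappa>))\<^sup>2) * j ^ 5"
    if "X <= (24 * \<eta>\<^sup>2 * cp + 2 * \<Lambda> * cp + (5/2) * \<eta> ^ 4) * j ^ 5 \<or> X <= (2 * \<Lambda> * cp + 96 * real CARD('n) * \<eta> + (5/2) * (5 / (8 * \<kappa>))\<^sup>2) * j ^ 5" for X
  proof -
    have "0 <= 24 * \<eta>\<^sup>2 * cp * j ^ 5" "0 <= (5/2) * \<eta> ^ 4 * j ^ 5" "0 <= 96 * real CARD('n) * \<eta> * j ^ 5" "0 <= (5/2) * (5 / (8 * \<kappa>))\<^sup>2 * j ^ 5"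
      using cp j \<eta> by auto
    then show ?thesis using that unfolding distrib_right by linarith
  qed
  show ?thesis
  proof (cases "4 * (L * r ^ 3) <= 2 * \<eta>")
    case True
    have "y ^ 3 <= \<eta> ^ 3"
    proof -
      have "y ^ 3 <= \<eta> ^ 1" using True \<eta> y3 by simp
      also have "\<eta> ^ 1 <= \<eta> ^ 3" using \<eta> by (intro power_increasing) auto
      finally show ?thesis .
    qed
    then have y\<eta>: "y <= \<eta>" by (rule cube_le_imp_le) (use \<eta> in auto)
    have Lr2: "L * r\<^sup>2 <= \<eta>\<^sup>2 * j ^ 5"
    proof -
      have "L * r\<^sup>2 = y\<^sup>2 * j ^ 5" by (simp add: y_def L_def power_mult_distrib flip: power_mult power_add)
      also have "\<dots> <= \<eta>\<^sup>2 * j ^ 5" using y\<eta> y0 j by (intro mult_right_mono power_mono) auto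
      finally show ?thesis .
    qed
    have r4: "j ^ 21 * r ^ 4 <= \<eta> ^ 4 * j ^ 5"
    proof -
      have "j ^ 21 * r ^ 4 = y ^ 4 * j" by (simp add: y_def power_mult_distrib flip: power_mult power_Suc2)
      also have "\<dots> <= \<eta> ^ 4 * j ^ 5"
      proof (rule mult_mono)
        have "j ^ 1 <= j ^ 5" using j by (intro power_increasing) auto
        then show "j <= j ^ 5" by simp
      qed (use y\<eta> y0 \<eta> j in \<open>auto intro: power_mono\<close>)
      finally show ?thesis .
    qed
    have "Q1 (k, 0) <= (12 * (L * r\<^sup>2) + 2 * \<Lambda>) * (norm k)\<^sup>2" for k
      using mat[of k 0] Q0 by (simp add: r_def L_def algebra_simps)
    then have a1: "\<alpha>1 <= (12 * (L * r\<^sup>2) + 2 * \<Lambda>) * cp" using j1 unfolding pde_jet_def cp_def by blast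
    have "Q2 (k, 0) <= (12 * (L * r\<^sup>2)) * (norm k)\<^sup>2" for k
      using mat[of 0 k] Q0 by (simp add: r_def L_def algebra_simps)
    then have a2: "\<alpha>2 <= (12 * (L * r\<^sup>2)) * cp" using j2 unfolding pde_jet_def cp_def by blast
    have "24 * (L * r\<^sup>2) * cp <= 24 * (\<eta>\<^sup>2 * j ^ 5) * cp" using Lr2 cp by (intro mult_right_mono mult_left_mono) auto
    moreover have "2 * \<Lambda> * cp * 1 <= 2 * \<Lambda> * cp * j ^ 5" using j5 \<Lambda> cp by (intro mult_left_mono) auto
    moreover have "24 * (\<eta>\<^sup>2 * j ^ 5) * cp = 24 * \<eta>\<^sup>2 * cp * j ^ 5" by simp
    moreover have "24 * (L * r\<^sup>2) * cp = 12 * (L * r\<^sup>2) * cp + 12 * (L * r\<^sup>2) * cp" by simp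
    ultimately have "\<alpha>1 + \<alpha>2 + (5/2) * (j ^ 21 * r ^ 4) <= (24 * \<eta>\<^sup>2 * cp + 2 * \<Lambda> * cp + (5/2) * \<eta> ^ 4) * j ^ 5"
      using a1 a2 r4 unfolding distrib_right by linarith
    then show ?thesis unfolding r_def[symmetric] by (intro tot) blast
  next
    case False
    then have big: "y ^ 3 > \<eta> / 2" using y3 by linarith
    then have "1 ^ 3 <= y ^ 3" using \<eta> by simp
    then have y1: "1 <= y" by (rule cube_le_imp_le[OF _ y0])
    have rpos: "r > 0" using y1 j unfolding y_def by (metis less_eq_real_def mult_zero_right not_one_le_zero r)
    define \<xi> where "\<xi> = (4 * j ^ 15 * (norm \<zeta>)\<^sup>2) *\<^sub>R \<zeta>"
    have n\<xi>: "norm \<xi> = 4 * (L * r ^ 3)" using j by (simp add: \<xi>_def L_def r_def power2_eq_square power3_eq_cube)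
    have \<xi>big: "norm \<xi> > 2 * \<eta>" using False n\<xi> by simp
    have \<xi>0: "\<xi> \<noteq> 0" using \<xi>big \<eta> by auto
    have d1: "norm (\<xi>1 - \<xi>) <= \<eta>" "norm (- \<xi>2 - \<xi>) <= \<eta>" using e \<xi> by (simp_all add: \<xi>_def)
    have n1: "norm \<xi>1 >= norm \<xi> / 2" "norm (- \<xi>2) >= norm \<xi> / 2"
      using norm_triangle_ineq2[of \<xi> \<xi>1] norm_triangle_ineq2[of \<xi> "- \<xi>2"] d1 \<xi>big
        norm_minus_commute[of \<xi> \<xi>1] norm_minus_commute[of \<xi> "- \<xi>2"] by linarith+
    have nz: "\<xi>1 \<noteq> 0" "- \<xi>2 \<noteq> 0" "\<xi>2 \<noteq> 0" using n1 \<xi>big \<eta> by auto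
    define \<nu>1 where "\<nu>1 = \<xi>1 /\<^sub>R norm \<xi>1"
    define \<nu>2 where "\<nu>2 = (- \<xi>2) /\<^sub>R norm (- \<xi>2)"
    have nn: "norm \<nu>1 = 1" "norm \<nu>2 = 1" using nz by (simp_all add: \<nu>1_def \<nu>2_def)
    have dn: "norm (\<nu>1 - \<nu>2) <= 4 * \<eta> / norm \<xi>"
    proof -
      have "norm (\<nu>1 - \<xi> /\<^sub>R norm \<xi>) <= 2 * norm (\<xi>1 - \<xi>) / norm \<xi>" unfolding \<nu>1_def by (rule direction_difference[OF nz(1) \<xi>0])
      also have "\<dots> <= 2 * \<eta> / norm \<xi>" using d1 by (intro divide_right_mono) auto
      finally have 1: "norm (\<nu>1 - \<xi> /\<^sub>R norm \<xi>) <= 2 * \<eta> / norm \<xi>" .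
      have "norm (\<nu>2 - \<xi> /\<^sub>R norm \<xi>) <= 2 * norm (- \<xi>2 - \<xi>) / norm \<xi>" unfolding \<nu>2_def by (rule direction_difference[OF nz(2) \<xi>0])
      also have "\<dots> <= 2 * \<eta> / norm \<xi>" using d1 by (intro divide_right_mono) auto
      finally have 2: "norm (\<nu>2 - \<xi> /\<^sub>R norm \<xi>) <= 2 * \<eta> / norm \<xi>" .
      have "norm (\<nu>1 - \<nu>2) <= norm (\<nu>1 - \<xi> /\<^sub>R norm \<xi>) + norm (\<nu>2 - \<xi> /\<^sub>R norm \<xi>)"
        using norm_triangle_ineq4[of "\<nu>1 - \<xi> /\<^sub>R norm \<xi>" "\<nu>2 - \<xi> /\<^sub>R norm \<xi>"] by simp
      then show ?thesis using 1 2 by (simp add: add_divide_distrib[symmetric])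
    qed
    have s2: "sqA p (\<xi>2 /\<^sub>R norm \<xi>2) i = sqA p \<nu>2 i" for i
      using sqA_even[of p "\<xi>2 /\<^sub>R norm \<xi>2" i] by (simp add: \<nu>2_def)
    have T1: "\<alpha>1 <= (\<Sum>i\<in>Basis. Q1 (sqA p \<nu>1 i, 0)) - \<kappa> * (norm \<xi>1)\<^sup>2"
      using j1 nz(1) unfolding pde_jet_def TrA_qform_sum[OF p nz(1) Q(1)] \<nu>1_def by blast
    have T2: "\<alpha>2 <= (\<Sum>i\<in>Basis. Q2 (sqA p \<nu>2 i, 0))"
      using j2 nz(3) unfolding pde_jet_def TrA_qform_sum[OF p nz(3) Q(2)] s2 by simp
    define d where "d = 2 * (4 * \<eta> / norm \<xi>)"
    have each: "Q1 (sqA p \<nu>1 i, 0) + Q2 (sqA p \<nu>2 i, 0) <= 12 * (L * r\<^sup>2) * d\<^sup>2 + 2 * \<Lambda> * (norm (sqA p \<nu>1 i))\<^sup>2"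
      if i: "i \<in> Basis" for i
    proof -
      have "norm (sqA p \<nu>1 i - sqA p \<nu>2 i) <= 2 * norm (\<nu>1 - \<nu>2)"
        by (rule sqA_lipschitz[OF p]) (use nn i in auto)
      then have "norm (sqA p \<nu>1 i - sqA p \<nu>2 i) <= d" using dn by (simp add: d_def)
      then have "12 * (L * r\<^sup>2) * (norm (sqA p \<nu>1 i - sqA p \<nu>2 i))\<^sup>2 <= 12 * (L * r\<^sup>2) * d\<^sup>2"
        using L by (intro mult_left_mono power_mono) auto
      then show ?thesis using mat[of "sqA p \<nu>1 i" "sqA p \<nu>2 i"] by (simp add: L_def r_def mult.assoc)
    qed
    have "(\<Sum>i\<in>Basis. Q1 (sqA p \<nu>1 i, 0)) + (\<Sum>i\<in>Basis. Q2 (sqA p \<nu>2 i, 0))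
       <= (\<Sum>i\<in>(Basis :: (real^'n) set). 12 * (L * r\<^sup>2) * d\<^sup>2 + 2 * \<Lambda> * (norm (sqA p \<nu>1 i))\<^sup>2)"
      unfolding sum.distrib[symmetric] by (intro sum_mono each)
    also have "\<dots> = real CARD('n) * (12 * (L * r\<^sup>2) * d\<^sup>2) + 2 * \<Lambda> * cp"
      using sum_sqA_norm[OF p nz(1)] by (simp add: sum.distrib sum_distrib_left[symmetric] \<nu>1_def cp_def)
    finally have S: "\<alpha>1 + \<alpha>2 <= real CARD('n) * (12 * (L * r\<^sup>2) * d\<^sup>2) + 2 * \<Lambda> * cp - \<kappa> * (norm \<xi>1)\<^sup>2" using T1 T2 by linarith
    have E: "12 * (L * r\<^sup>2) * d\<^sup>2 <= 96 * \<eta> * j ^ 5"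
    proof -
      have "12 * (L * r\<^sup>2) * d\<^sup>2 = 48 * \<eta>\<^sup>2 / (L * r ^ 4)"
        unfolding d_def n\<xi> using L rpos by (simp add: field_simps power2_eq_square power3_eq_cube power4_eq_xxxx)
      also have "\<dots> <= 96 * \<eta> * j ^ 5"
      proof -
        have "\<eta> / 2 * 1 <= y ^ 3 * y" using big y1 \<eta> by (intro mult_mono) auto
        also have "y ^ 3 * y = j ^ 5 * (L * r ^ 4)" unfolding y3 by (simp add: y_def power4_eq_xxxx power3_eq_cube)
        finally have "\<eta> <= 2 * (j ^ 5 * (L * r ^ 4))" by simp
        then have "48 * \<eta> * \<eta> <= 48 * \<eta> * (2 * (j ^ 5 * (L * r ^ 4)))" using \<eta> by (intro mult_left_mono) auto
        then have "48 * \<eta>\<^sup>2 <= 96 * \<eta> * j ^ 5 * (L * r ^ 4)" by (simp add: power2_eq_square mult_ac)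
        moreover have "L * r ^ 4 > 0" using L rpos by simp
        ultimately show ?thesis by (simp only: pos_divide_le_eq)
      qed
      finally show ?thesis .
    qed
    have gain: "(5/2) * (j ^ 21 * r ^ 4) - \<kappa> * (norm \<xi>1)\<^sup>2 <= (5/2) * (5 / (8 * \<kappa>))\<^sup>2 * j ^ 5"
    proof -
      define Y where "Y = r\<^sup>2 * j ^ 9"
      have Y0: "Y >= 0" using j by (simp add: Y_def)
      have e1: "j ^ 21 * r ^ 4 = Y\<^sup>2 * j ^ 3" by (simp add: Y_def power_mult_distrib flip: power_mult power_add)
      have "(norm \<xi> / 2)\<^sup>2 <= (norm \<xi>1)\<^sup>2" using n1(1) by (intro power_mono) auto
      moreover have "(norm \<xi> / 2)\<^sup>2 = 4 * (Y ^ 3 * j ^ 3)"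
        unfolding n\<xi> L_def by (simp add: Y_def power_mult_distrib flip: power_mult power_add)
      ultimately have "\<kappa> * (4 * (Y ^ 3 * j ^ 3)) <= \<kappa> * (norm \<xi>1)\<^sup>2" using \<kappa> by (intro mult_left_mono) auto
      then have "(5/2) * (j ^ 21 * r ^ 4) - \<kappa> * (norm \<xi>1)\<^sup>2 <= ((5/2) * Y\<^sup>2 - 4 * \<kappa> * Y ^ 3) * j ^ 3"
        unfolding e1 left_diff_distrib by (simp add: mult_ac)
      also have "\<dots> <= ((5/2) * (5 / (8 * \<kappa>))\<^sup>2) * j ^ 3"
      proof (rule mult_right_mono)
        show "(5/2) * Y\<^sup>2 - 4 * \<kappa> * Y ^ 3 <= (5/2) * (5 / (8 * \<kappa>))\<^sup>2"
        proof (cases "Y <= 5 / (8 * \<kappa>)")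
          case True
          then have "Y\<^sup>2 <= (5 / (8 * \<kappa>))\<^sup>2" using Y0 by (intro power_mono)
          moreover have "4 * \<kappa> * Y ^ 3 >= 0" using \<kappa> Y0 by simp
          ultimately show ?thesis by linarith
        next
          case False
          then have "5 / (8 * \<kappa>) < Y" by (simp only: not_le)
          then have "5 < Y * (8 * \<kappa>)" using pos_divide_less_eq[of "8 * \<kappa>" 5 Y] \<kappa> by linarith
          then have "8 * \<kappa> * Y >= 5" by (simp add: mult_ac)
          then have "5 * Y\<^sup>2 <= 8 * \<kappa> * Y * Y\<^sup>2" by (intro mult_right_mono) auto
          then have "(5/2) * Y\<^sup>2 - 4 * \<kappa> * Y ^ 3 <= 0" by (simp add: power2_eq_square power3_eq_cube mult_ac)
          moreover have "(5/2) * (5 / (8 * \<kappa>))\<^sup>2 >= 0" by simp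
          ultimately show ?thesis by linarith
        qed
      qed (use j in simp)
      also have "\<dots> <= ((5/2) * (5 / (8 * \<kappa>))\<^sup>2) * j ^ 5" using j by (intro mult_left_mono power_increasing) auto
      finally show ?thesis .
    qed
    have "real CARD('n) * (12 * (L * r\<^sup>2) * d\<^sup>2) <= real CARD('n) * (96 * \<eta> * j ^ 5)" using E by (intro mult_left_mono) auto
    moreover have "2 * \<Lambda> * cp * 1 <= 2 * \<Lambda> * cp * j ^ 5" using j5 \<Lambda> cp by (intro mult_left_mono) auto
    moreover have "real CARD('n) * (96 * \<eta> * j ^ 5) = 96 * real CARD('n) * \<eta> * j ^ 5" by simp
    ultimately have "\<alpha>1 + \<alpha>2 + (5/2) * (j ^ 21 * r ^ 4) <= (2 * \<Lambda> * cp + 96 * real CARD('n) * \<eta> + (5/2) * (5 / (8 * \<kappa>))\<^sup>2) * j ^ 5"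
      using S gain unfolding distrib_right by linarith
    then show ?thesis unfolding r_def[symmetric] by (intro tot) blast
  qed
qed

lemma upper_jet_shift:
  "upper_jet (\<lambda>w. F (w + c)) z p Q \<longleftrightarrow> upper_jet F (z + c) p Q"
  by (simp add: upper_jet_def add.assoc add.commute add.left_commute)

lemma real_peano_sqrt:
  assumes "r > 0" shows "real_peano sqrt r (inverse (sqrt r) / 2) (- (1 / (4 * r * sqrt r)))"
proof (rule real_peanoI[of r])
  show "(sqrt has_real_derivative inverse (sqrt s) / 2) (at s)" if "\<bar>s - r\<bar> < r" for s
    using that by (intro DERIV_real_sqrt) linarith
  have "((\<lambda>s. inverse (sqrt s)) has_real_derivative - (inverse (sqrt r) * (inverse (sqrt r) / 2) * inverse (sqrt r))) (at r)"
    by (rule DERIV_inverse'[OF DERIV_real_sqrt[OF assms]]) (use assms in simp)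
  from DERIV_cdivide[OF this, of 2]
  show "((\<lambda>s. inverse (sqrt s) / 2) has_real_derivative - (1 / (4 * r * sqrt r))) (at r)"
  proof (rule DERIV_cong)
    have "sqrt r * sqrt r = r" using assms by simp
    then show "- (inverse (sqrt r) * (inverse (sqrt r) / 2) * inverse (sqrt r)) / 2 = - (1 / (4 * r * sqrt r))"
      by (simp add: inverse_eq_divide)
  qed
qed (use assms in auto)

text \<open>
  The square root is concave, and its second derivative contributes a negative multiple of
  the squared derivative in the direction of the gradient, on which \<open>A\<close> has the eigenvalue \<open>1 - 1/p\<close>.
\<close>

lemma square_subsolution_jet:
  fixes W :: "(real^'n) \<times> real => real"
  assumes p: "1 < p" and sj: "subsol_jets p \<Omega> W" and op: "open \<Omega>" and xt: "x \<in> \<Omega>" "t > 0" and a: "a > 0"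
    and f: "!!y s. y \<in> \<Omega> ==> f (y, s) = (max (W (y, s)) 0 / a)\<^sup>2" and pos: "W (x, t) > 0"
    and Q: "qform Q" and jet: "upper_jet f (x, t) (\<xi>, \<alpha>) Q"
  shows "pde_jet p ((1 - recip p) / (2 * f (x, t))) \<xi> \<alpha> Q"
proof -
  define f0 where "f0 = f (x, t)"
  have f0: "f0 > 0" using pos a by (simp add: f0_def f[OF xt(1)])
  define c1 where "c1 = a * (inverse (sqrt f0) / 2)"
  define c2 where "c2 = a * (- (1 / (4 * f0 * sqrt f0)))"
  have c1: "c1 > 0" using a f0 by (simp add: c1_def)
  have c2: "c2 <= 0" "c2 = - (c1 / (2 * f0))" using a f0 by (simp_all add: c1_def c2_def inverse_eq_divide)
  have pk: "real_peano (\<lambda>s. a * sqrt s + 0) (f (x, t)) c1 c2"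
    unfolding c1_def c2_def f0_def[symmetric] by (rule real_peano_affine_comp[OF real_peano_sqrt[OF f0]])
  define Q' where "Q' = (\<lambda>h. c1 * Q h + c2 * ((\<xi>, \<alpha>) \<bullet> h)\<^sup>2)"
  have jw: "upper_jet (\<lambda>w. a * sqrt (f w) + 0) (x, t) (c1 *\<^sub>R (\<xi>, \<alpha>)) Q'"
    unfolding Q'_def by (rule upper_jet_compose[OF jet Q pk, where \<eta>=1]) (use c1 a in auto)
  obtain d where d: "d > 0" "ball x d \<subseteq> \<Omega>" using op xt(1) open_contains_ball by blast
  have sqf: "a * sqrt (f (y, s)) = max (W (y, s)) 0" if "y \<in> \<Omega>" for y s
    using f[OF that, of s] a by (simp add: real_sqrt_abs)
  have jW: "upper_jet W (x, t) (c1 *\<^sub>R \<xi>, c1 * \<alpha>) Q'"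
  proof (rule upper_jet_dominated[OF _ d(1)])
    show "upper_jet (\<lambda>w. a * sqrt (f w) + 0) (x, t) (c1 *\<^sub>R \<xi>, c1 * \<alpha>) Q'" using jw by simp
    fix h :: "(real^'n) \<times> real" assume h: "norm h < d"
    have "norm (fst h) <= norm h" by (metis norm_fst_le prod.collapse)
    then have "x + fst h \<in> ball x d" using h by (simp add: dist_norm)
    then have i: "x + fst h \<in> \<Omega>" using d(2) by blast
    have e: "(x, t) + h = (x + fst h, t + snd h)" by (simp add: prod_eq_iff)
    show "W ((x, t) + h) - W (x, t) <= a * sqrt (f ((x, t) + h)) + 0 - (a * sqrt (f (x, t)) + 0)"
      unfolding e sqf[OF i] sqf[OF xt(1)] using pos by simp
  qed
  have qQ: "qform Q'" unfolding Q'_def by (intro qform_add qform_cmul Q qform_inner_sq)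
  have Qk: "Q' (k, 0) = c1 * Q (k, 0) + c2 * (\<xi> \<bullet> k)\<^sup>2" for k by (simp add: Q'_def)
  show ?thesis unfolding pde_jet_def
  proof (intro conjI impI allI)
    assume \<xi>: "\<xi> \<noteq> 0"
    then have "c1 * \<alpha> <= TrA p (c1 *\<^sub>R \<xi>) (\<lambda>k. Q' (k, 0))"
      using sj xt qQ jW c1 unfolding subsol_jets_def by simp
    also have "\<dots> = TrA p \<xi> (\<lambda>k. Q' (k, 0))"
      using qform_scale[OF qQ, of c1 "(\<xi>, 0)"] by (intro TrA_scale c1) simp
    also have "\<dots> = c1 * TrA p \<xi> (\<lambda>k. Q (k, 0)) + c2 * TrA p \<xi> (\<lambda>k. (\<xi> \<bullet> k)\<^sup>2)"
      unfolding Qk TrA_add TrA_cmul ..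
    also have "TrA p \<xi> (\<lambda>k. (\<xi> \<bullet> k)\<^sup>2) = (1 - recip p) * (norm \<xi>)\<^sup>2"
    proof -
      have "(\<Sum>i\<in>Basis. (\<xi> \<bullet> i)\<^sup>2) = (norm \<xi>)\<^sup>2"
        using euclidean_inner[of \<xi> \<xi>] by (simp add: power2_eq_square flip: power2_norm_eq_inner)
      moreover have "(\<xi> \<bullet> \<xi>)\<^sup>2 / (norm \<xi>)\<^sup>2 = (norm \<xi>)\<^sup>2" using \<xi> by (simp add: dot_square_norm power2_eq_square)
      ultimately show ?thesis by (simp add: TrA_def algebra_simps)
    qed
    finally have "c1 * \<alpha> <= c1 * (TrA p \<xi> (\<lambda>k. Q (k, 0)) - (1 - recip p) / (2 * f0) * (norm \<xi>)\<^sup>2)"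
      unfolding c2(2) by (simp add: right_diff_distrib)
    then show "\<alpha> <= TrA p \<xi> (\<lambda>k. Q (k, 0)) - (1 - recip p) / (2 * f (x, t)) * (norm \<xi>)\<^sup>2"
      unfolding f0_def by (rule mult_left_le_imp_le) (rule c1)
  next
    fix c assume le: "\<forall>k. Q (k, 0) <= c * (norm k)\<^sup>2"
    have "Q' (k, 0) <= (c1 * c) * (norm k)\<^sup>2" for k
    proof -
      have "c1 * Q (k, 0) <= c1 * (c * (norm k)\<^sup>2)" using le c1 by (intro mult_left_mono) auto
      moreover have "c2 * (\<xi> \<bullet> k)\<^sup>2 <= 0" using c2(1) by (intro mult_nonpos_nonneg) auto
      ultimately show ?thesis unfolding Qk by (simp add: mult.assoc)
    qed
    then have "c1 * \<alpha> <= (c1 * c) * trace_const p TYPE('n)"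
      using sj xt qQ jW unfolding subsol_jets_def by blast
    then have "c1 * \<alpha> <= c1 * (c * trace_const p TYPE('n))" by (simp add: mult.assoc)
    then show "\<alpha> <= c * trace_const p TYPE('n)" by (rule mult_left_le_imp_le) (rule c1)
  qed
qed

lemma pde_jet_weaken:
  assumes "pde_jet p \<kappa> \<xi> \<alpha> Q" "\<kappa>' <= \<kappa>" shows "pde_jet p \<kappa>' \<xi> \<alpha> Q"
proof -
  have "\<kappa>' * (norm \<xi>)\<^sup>2 <= \<kappa> * (norm \<xi>)\<^sup>2" using assms(2) by (intro mult_right_mono) auto
  moreover have "\<xi> \<noteq> 0 --> \<alpha> <= TrA p \<xi> (\<lambda>k. Q (k, 0)) - \<kappa> * (norm \<xi>)\<^sup>2" using assms(1) unfolding pde_jet_def by blast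
  ultimately have "\<xi> \<noteq> 0 --> \<alpha> <= TrA p \<xi> (\<lambda>k. Q (k, 0)) - \<kappa>' * (norm \<xi>)\<^sup>2" by linarith
  then show ?thesis using assms(1) unfolding pde_jet_def by blast
qed

lemma truncated_shift_jet:
  fixes W :: "(real^'n) \<times> real => real"
  assumes p: "1 < p" and sj: "subsol_jets p \<Omega> W" and op: "open \<Omega>" and xt: "x + v \<in> \<Omega>" "t > 0" and \<beta>: "\<beta> > 0"
    and g: "!!y s. y + v \<in> \<Omega> ==> g (y, s) = \<beta> * (max (W (y + v, s)) m - a')" and pos: "W (x + v, t) > m"
    and Q: "qform Q" and jet: "upper_jet g (x, t) (\<xi>, \<alpha>) Q"
  shows "pde_jet p 0 \<xi> \<alpha> Q"
proof -
  define c where "c = 1 / \<beta>"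
  have c: "c > 0" using \<beta> by (simp add: c_def)
  define Q' where "Q' = (\<lambda>h. c * Q h + 0 * ((\<xi>, \<alpha>) \<bullet> h)\<^sup>2)"
  have jg: "upper_jet (\<lambda>w. c * g w + a') (x, t) (c *\<^sub>R (\<xi>, \<alpha>)) Q'"
    unfolding Q'_def by (rule upper_jet_compose[OF jet Q real_peano_affine, where \<eta>=1]) (use c in auto)
  obtain d where d: "d > 0" "ball (x + v) d \<subseteq> \<Omega>" using op xt(1) open_contains_ball by blast
  have gg: "c * g (y, s) + a' = max (W (y + v, s)) m" if "y + v \<in> \<Omega>" for y s
    using g[OF that, of s] \<beta> by (simp add: c_def)
  have "upper_jet (\<lambda>w. W (w + (v, 0))) (x, t) (c *\<^sub>R \<xi>, c * \<alpha>) Q'"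
  proof (rule upper_jet_dominated[OF _ d(1)])
    show "upper_jet (\<lambda>w. c * g w + a') (x, t) (c *\<^sub>R \<xi>, c * \<alpha>) Q'" using jg by simp
    fix h :: "(real^'n) \<times> real" assume h: "norm h < d"
    have "norm (fst h) <= norm h" by (metis norm_fst_le prod.collapse)
    then have "x + v + fst h \<in> ball (x + v) d" using h by (simp add: dist_norm)
    then have i: "(x + fst h) + v \<in> \<Omega>" using d(2) by (auto simp: algebra_simps)
    have e: "(x, t) + h = (x + fst h, t + snd h)" by (simp add: prod_eq_iff)
    show "W ((x, t) + h + (v, 0)) - W ((x, t) + (v, 0)) <= c * g ((x, t) + h) + a' - (c * g (x, t) + a')"
      unfolding e gg[OF i] gg[OF xt(1)] using pos by simp
  qed
  then have jW: "upper_jet W (x + v, t) (c *\<^sub>R \<xi>, c * \<alpha>) Q'" unfolding upper_jet_shift by simp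
  have qQ: "qform Q'" unfolding Q'_def by (intro qform_add qform_cmul Q qform_inner_sq)
  have Qk: "Q' (k, 0) = c * Q (k, 0)" for k by (simp add: Q'_def)
  show ?thesis unfolding pde_jet_def
  proof (intro conjI impI allI)
    assume \<xi>: "\<xi> \<noteq> 0"
    then have "c * \<alpha> <= TrA p (c *\<^sub>R \<xi>) (\<lambda>k. Q' (k, 0))"
      using sj xt qQ jW c unfolding subsol_jets_def by simp
    also have "\<dots> = TrA p \<xi> (\<lambda>k. Q' (k, 0))"
      using qform_scale[OF qQ, of c "(\<xi>, 0)"] by (intro TrA_scale c) simp
    also have "\<dots> = c * TrA p \<xi> (\<lambda>k. Q (k, 0))" unfolding Qk TrA_cmul ..
    finally show "\<alpha> <= TrA p \<xi> (\<lambda>k. Q (k, 0)) - 0 * (norm \<xi>)\<^sup>2" using c by simp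
  next
    fix b assume le: "\<forall>k. Q (k, 0) <= b * (norm k)\<^sup>2"
    have "Q' (k, 0) <= (c * b) * (norm k)\<^sup>2" for k
      unfolding Qk using le c by (simp add: mult.assoc)
    then have "c * \<alpha> <= (c * b) * trace_const p TYPE('n)"
      using sj xt qQ jW unfolding subsol_jets_def by blast
    then have "c * \<alpha> <= c * (b * trace_const p TYPE('n))" by (simp add: mult.assoc)
    then show "\<alpha> <= b * trace_const p TYPE('n)" by (rule mult_left_le_imp_le) (rule c)
  qed
qed

section \<open>Exterior balls and semicontinuous extensions\<close>

lemma modulus_continuous:
  assumes "modulus \<omega>" shows "continuous_on {0..} \<omega>"
proof -
  have "continuous (at x within {0..}) \<omega>" if "x >= 0" for x
  proof (cases "x = 0")
    case True
    have "at (0::real) within {0..} = at_right 0"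
      by (rule at_within_nhd[of _ UNIV]) auto
    moreover have "(\<omega> \<longlongrightarrow> \<omega> 0) (at_right 0)" using assms(1) by (metis modulus_def)
    ultimately show ?thesis using True by (simp add: continuous_within)
  next
    case False
    then have "isCont \<omega> x"
      using that assms(1) continuous_on_eq_continuous_at[of "{0<..}" \<omega>] unfolding modulus_def by auto
    then show ?thesis by (rule continuous_at_imp_continuous_at_within)
  qed
  then show ?thesis by (simp add: continuous_on_eq_continuous_within)
qed

lemma psi_bounds:
  assumes "modulus \<omega>" "0 < r" "0 < \<delta>"
  shows "0 < psi r \<omega> \<delta>" "psi r \<omega> \<delta> <= \<delta>" "!!s. s \<in> {0..r} ==> (psi r \<omega> \<delta>)\<^sup>2 <= s\<^sup>2 + (\<omega> s - \<delta>)\<^sup>2"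
proof -
  have \<omega>0: "\<omega> 0 = 0" using assms(1) by (simp add: modulus_def)
  obtain s where s: "s \<in> {0..r}" "psi r \<omega> \<delta> = sqrt (s\<^sup>2 + (\<omega> s - \<delta>)\<^sup>2)"
    "!!s'. s' \<in> {0..r} ==> psi r \<omega> \<delta> <= sqrt (s'\<^sup>2 + (\<omega> s' - \<delta>)\<^sup>2)"
    using psi_attained[OF assms(1) less_imp_le[OF assms(2)]] by metis
  have "s\<^sup>2 + (\<omega> s - \<delta>)\<^sup>2 > 0"
  proof (cases "s = 0")
    case True then show ?thesis using \<omega>0 assms(3) by simp
  next
    case False then show ?thesis by (simp add: add_pos_nonneg)
  qed
  then show pos: "0 < psi r \<omega> \<delta>" using s(2) by simp
  show "psi r \<omega> \<delta> <= \<delta>" using s(3)[of 0] assms(2,3) \<omega>0 by simp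
  show "(psi r \<omega> \<delta>)\<^sup>2 <= s\<^sup>2 + (\<omega> s - \<delta>)\<^sup>2" if "s \<in> {0..r}" for s
  proof -
    have "(psi r \<omega> \<delta>)\<^sup>2 <= (sqrt (s\<^sup>2 + (\<omega> s - \<delta>)\<^sup>2))\<^sup>2" using s(3)[OF that] pos by (intro power_mono) auto
    then show ?thesis by simp
  qed
qed

text \<open>
  A segment from the shifted point \<open>p + \<delta> e\<close> to a point of \<open>\<Omega>\<close> meets \<open>\<Gamma>\<close>.  At horizontal
  distance \<open>s\<close> from \<open>p\<close> the graph rises by at most \<open>\<omega>(s)\<close>, so a boundary point has distance at least
  \<open>sqrt (s\<^sup>2 + (\<omega>(s) - \<delta>)\<^sup>2)\<close> from the shifted point as long as \<open>\<omega>(s) \<le> \<delta>\<close>; beyond, \<open>s\<close> alone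
  exceeds the solution of \<open>\<omega>(s) = \<delta>\<close>, where the square root equals \<open>s\<close>.
\<close>

lemma exterior_ball:
  fixes \<Omega> :: "(real^'n) set"
  assumes cls: "class_C0 r \<omega> \<Omega>" and md: "modulus \<omega>" and x0: "x0 \<in> frontier \<Omega>"
  obtains e where "norm e = 1"
    "!!p \<delta> w. p \<in> frontier \<Omega> ==> norm (p - x0) < r / 2 ==> 0 < \<delta> ==> \<delta> < r / 4 ==> w \<in> \<Omega> ==>
       psi r \<omega> \<delta> <= norm (w - (p + \<delta> *\<^sub>R e))"
proof -
  have r: "r > 0" using cls by (simp add: class_C0_def)
  have "\<exists>e \<zeta>. norm e = 1 \<and>
        ball x0 r \<inter> \<Omega> = {y' + yN *\<^sub>R e | y' yN. y' \<in> hyperplane e \<and> y' + yN *\<^sub>R e \<in> ball x0 r \<and> yN < \<zeta> y'} \<and>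
        ball x0 r \<inter> frontier \<Omega> = {y' + yN *\<^sub>R e | y' yN. y' \<in> hyperplane e \<and> y' + yN *\<^sub>R e \<in> ball x0 r \<and> yN = \<zeta> y'} \<and>
        (\<forall>y' \<in> hyperplane e. \<forall>z' \<in> hyperplane e.
           y' + \<zeta> y' *\<^sub>R e \<in> ball x0 r \<inter> frontier \<Omega> --> z' + \<zeta> z' *\<^sub>R e \<in> ball x0 r \<inter> frontier \<Omega> -->
           \<bar>\<zeta> y' - \<zeta> z'\<bar> <= \<omega> (norm (y' - z')))"
    by (rule bspec[OF conjunct2[OF cls[unfolded class_C0_def]] x0])
  then obtain e \<zeta> where ez: "norm e = 1 \<and>
        ball x0 r \<inter> \<Omega> = {y' + yN *\<^sub>R e | y' yN. y' \<in> hyperplane e \<and> y' + yN *\<^sub>R e \<in> ball x0 r \<and> yN < \<zeta> y'} \<and>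
        ball x0 r \<inter> frontier \<Omega> = {y' + yN *\<^sub>R e | y' yN. y' \<in> hyperplane e \<and> y' + yN *\<^sub>R e \<in> ball x0 r \<and> yN = \<zeta> y'} \<and>
        (\<forall>y' \<in> hyperplane e. \<forall>z' \<in> hyperplane e.
           y' + \<zeta> y' *\<^sub>R e \<in> ball x0 r \<inter> frontier \<Omega> --> z' + \<zeta> z' *\<^sub>R e \<in> ball x0 r \<inter> frontier \<Omega> -->
           \<bar>\<zeta> y' - \<zeta> z'\<bar> <= \<omega> (norm (y' - z')))" by (elim exE)
  note e = conjunct1[OF ez] and inside = conjunct1[OF conjunct2[OF ez]]
    and bdry = conjunct1[OF conjunct2[OF conjunct2[OF ez]]] and mod = conjunct2[OF conjunct2[OF conjunct2[OF ez]], rule_format]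
  have ee: "e \<bullet> e = 1" using e by (simp add: norm_eq_1)
  define pr where "pr w = w - (w \<bullet> e) *\<^sub>R e" for w
  have prh: "pr w \<in> hyperplane e" for w by (simp add: pr_def hyperplane_def inner_diff_left ee)
  have dec: "pr w + (w \<bullet> e) *\<^sub>R e = w" for w by (simp add: pr_def)
  have uniq: "pr (y' + yN *\<^sub>R e) = y'" "(y' + yN *\<^sub>R e) \<bullet> e = yN" if "y' \<in> hyperplane e" for y' yN
    using that by (simp_all add: pr_def hyperplane_def inner_add_left ee)
  have inB: "w \<bullet> e < \<zeta> (pr w)" if "w \<in> ball x0 r" "w \<in> \<Omega>" for w
  proof -
    have "w \<in> ball x0 r \<inter> \<Omega>" using that by simp
    then show ?thesis unfolding inside using uniq by auto
  qed
  have onB: "w \<bullet> e = \<zeta> (pr w)" if "w \<in> ball x0 r" "w \<in> frontier \<Omega>" for w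
  proof -
    have "w \<in> ball x0 r \<inter> frontier \<Omega>" using that by simp
    then show ?thesis unfolding bdry using uniq by auto
  qed
  show thesis
  proof (rule that[OF e])
    fix p \<delta> w assume p: "p \<in> frontier \<Omega>" "norm (p - x0) < r / 2" and \<delta>: "0 < \<delta>" "\<delta> < r / 4" and w: "w \<in> \<Omega>"
    note ps = psi_bounds[OF md r \<delta>(1)]
    define z where "z = p + \<delta> *\<^sub>R e"
    have pB: "p \<in> ball x0 r" using p(2) r by (simp add: dist_norm norm_minus_commute)
    have pz: "p \<bullet> e = \<zeta> (pr p)" by (rule onB[OF pB p(1)])
    have prz: "pr z = pr p" by (simp add: z_def pr_def inner_add_left ee algebra_simps)
    have ze: "z \<bullet> e = p \<bullet> e + \<delta>" by (simp add: z_def inner_add_left ee)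
    have near: "v \<in> ball x0 r" if "norm (v - z) < \<delta>" for v
    proof -
      have "norm (v - x0) = norm ((v - z) + \<delta> *\<^sub>R e + (p - x0))" by (simp add: z_def)
      also have "\<dots> <= norm (v - z) + norm (\<delta> *\<^sub>R e) + norm (p - x0)" by (meson add_right_mono norm_triangle_ineq order_trans)
      also have "\<dots> < r" using that p(2) \<delta> e by simp
      finally show ?thesis by (simp add: dist_norm norm_minus_commute)
    qed
    have zB: "z \<in> ball x0 r" using near[of z] \<delta> by simp
    have zO: "z \<notin> \<Omega>" using inB[OF zB] prz ze pz \<delta> by auto
    show "psi r \<omega> \<delta> <= norm (w - (p + \<delta> *\<^sub>R e))"
    proof (rule ccontr)
      assume "\<not> ?thesis"
      then have wz: "norm (w - z) < psi r \<omega> \<delta>" by (simp add: z_def)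
      have "closed_segment w z \<inter> frontier \<Omega> \<noteq> {}"
        by (rule connected_Int_frontier) (use w zO in auto)
      then obtain g where g: "g \<in> closed_segment w z" "g \<in> frontier \<Omega>" by auto
      have gz: "norm (g - z) < psi r \<omega> \<delta>"
        using segment_bound(2)[OF g(1)] wz by (simp add: norm_minus_commute)
      have gB: "g \<in> ball x0 r" using near[of g] gz ps(2) by linarith
      have ge: "g \<bullet> e = \<zeta> (pr g)" by (rule onB[OF gB g(2)])
      define s where "s = norm (pr g - pr p)"
      have "pr g + \<zeta> (pr g) *\<^sub>R e = g" "pr p + \<zeta> (pr p) *\<^sub>R e = p" using dec ge pz by metis+
      then have m: "\<bar>\<zeta> (pr g) - \<zeta> (pr p)\<bar> <= \<omega> s"
        unfolding s_def by (intro mod prh) (use gB g(2) pB p(1) in auto)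
      define h where "h = g \<bullet> e - z \<bullet> e"
      have gzd: "g - z = (pr g - pr p) + h *\<^sub>R e"
      proof -
        have "g - z = (pr g + (g \<bullet> e) *\<^sub>R e) - (pr z + (z \<bullet> e) *\<^sub>R e)" by (simp only: dec)
        then show ?thesis by (simp add: prz h_def scaleR_diff_left)
      qed
      have orth: "(pr g - pr p) \<bullet> e = 0" using prh[of g] prh[of p] by (simp add: hyperplane_def inner_diff_left)
      have n2: "(norm (g - z))\<^sup>2 = s\<^sup>2 + h\<^sup>2"
        unfolding gzd s_def power2_norm_eq_inner using orth ee
        by (simp add: inner_add_left inner_add_right inner_commute power2_eq_square)
      have h: "h = \<zeta> (pr g) - \<zeta> (pr p) - \<delta>" using ge pz ze by (simp add: h_def)
      have s0: "s >= 0" by (simp add: s_def)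
      have "s\<^sup>2 <= (norm (g - z))\<^sup>2" using n2 by simp
      then have sg: "s <= norm (g - z)" by (rule power2_le_imp_le) simp
      then have sr: "s \<in> {0..r}" "s < psi r \<omega> \<delta>" using gz ps(2) \<delta> s0 by auto
      show False
      proof (cases "\<omega> s <= \<delta>")
        case True
        have "\<bar>\<omega> s - \<delta>\<bar> <= \<bar>h\<bar>" using True m h by linarith
        then have "(\<omega> s - \<delta>)\<^sup>2 <= h\<^sup>2" by (simp only: abs_le_square_iff)
        then have "(psi r \<omega> \<delta>)\<^sup>2 <= (norm (g - z))\<^sup>2" using ps(3)[OF sr(1)] n2 by linarith
        then have "psi r \<omega> \<delta> <= norm (g - z)" by (rule power2_le_imp_le) simp
        then show False using gz by simp
      next
        case False
        have c: "continuous_on {0..s} \<omega>" by (rule continuous_on_subset[OF modulus_continuous[OF md]]) auto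
        have "\<omega> 0 = 0" using md by (simp add: modulus_def)
        then have "\<exists>x\<ge>0. x <= s \<and> \<omega> x = \<delta>" using False \<delta> s0 c by (intro IVT') auto
        then obtain s1 where s1: "0 <= s1" "s1 <= s" "\<omega> s1 = \<delta>" by auto
        have "(psi r \<omega> \<delta>)\<^sup>2 <= s1\<^sup>2" using ps(3)[of s1] s1 sr by simp
        then have "psi r \<omega> \<delta> <= s1" by (rule power2_le_imp_le) (rule s1(1))
        then show False using s1(2) sr(2) by simp
      qed
    qed
  qed
qed

text \<open>
  Upper semicontinuity across \<open>\<Gamma>\<close> holds because the boundary values do not exceed the constant.
\<close>

lemma usc_extend_by_constant:
  fixes W :: "(real^'n) \<times> real => real"
  assumes usc: "usc_on (\<Omega> \<times> {0<..}) W" and op: "open \<Omega>"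
    and bd: "!!y s \<eta>. y \<in> frontier \<Omega> ==> s > 0 ==> \<eta> > 0 ==> \<forall>\<^sub>F w in at (y, s) within \<Omega> \<times> {0<..}. W w < m + \<eta>"
  shows "usc_on (UNIV \<times> {0<..}) (\<lambda>w. if fst w \<in> \<Omega> then max (W w) m else m)" (is "usc_on _ ?V")
  unfolding usc_on_def
proof (intro ballI allI impI)
  fix z c assume z: "z \<in> UNIV \<times> {0::real<..}" and c: "?V z < c"
  have "m <= ?V z" by simp
  then have mc: "m < c" using c by linarith
  have "\<forall>\<^sub>F w in at z within \<Omega> \<times> {0<..}. W w < c"
  proof (cases "fst z \<in> \<Omega>")
    case True
    then have "z \<in> \<Omega> \<times> {0<..}" "W z < c" using z c by (auto simp: mem_Times_iff)
    then show ?thesis using usc unfolding usc_on_def by blast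
  next
    case False
    show ?thesis
    proof (cases "fst z \<in> frontier \<Omega>")
      case True
      then show ?thesis using bd[OF True, of "snd z" "c - m"] mc z by (simp add: mem_Times_iff)
    next
      case False
      then have "fst z \<notin> closure \<Omega>" using \<open>fst z \<notin> \<Omega>\<close> op by (simp add: frontier_def interior_open)
      then have "open ((- closure \<Omega>) \<times> (UNIV :: real set))" "z \<in> (- closure \<Omega>) \<times> UNIV" by (auto intro: open_Times simp: mem_Times_iff)
      then have "\<forall>\<^sub>F w in at z within \<Omega> \<times> {0<..}. w \<in> (- closure \<Omega>) \<times> (UNIV :: real set)"
        by (meson eventually_at_topological)
      moreover have "\<forall>\<^sub>F w in at z within \<Omega> \<times> {0<..}. w \<in> \<Omega> \<times> {0<..}" by (simp add: eventually_at_topological) auto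
      ultimately show ?thesis
      proof eventually_elim
        case (elim w)
        then show ?case using closure_subset by (auto simp: mem_Times_iff)
      qed
    qed
  qed
  then obtain U where U: "open U" "z \<in> U" "!!w. w \<in> U ==> w \<noteq> z ==> w \<in> \<Omega> \<times> {0<..} ==> W w < c"
    unfolding eventually_at_topological by blast
  show "\<forall>\<^sub>F w in at z within UNIV \<times> {0<..}. ?V w < c"
    unfolding eventually_at_topological
  proof (intro exI[of _ U] conjI ballI impI)
    fix w assume w: "w \<in> U" "w \<noteq> z" "w \<in> UNIV \<times> {0<..}"
    show "?V w < c"
    proof (cases "fst w \<in> \<Omega>")
      case True
      then have "W w < c" using U(3)[OF w(1,2)] w(3) by (simp add: mem_Times_iff)
      then show ?thesis using True mc by simp
    qed (use mc in simp)
  qed (use U in auto)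
qed

lemma usc_on_shift:
  fixes h :: "'a::real_normed_vector => real"
  assumes "usc_on S' h" "!!z. z \<in> S ==> z + c \<in> S'"
  shows "usc_on S (\<lambda>z. h (z + c))"
  unfolding usc_on_def
proof (intro ballI allI impI)
  fix z d assume z: "z \<in> S" "h (z + c) < d"
  then have "\<forall>\<^sub>F w in at (z + c) within S'. h w < d" using assms unfolding usc_on_def by blast
  then obtain U where U: "open U" "z + c \<in> U" "!!w. w \<in> U ==> w \<noteq> z + c ==> w \<in> S' ==> h w < d"
    unfolding eventually_at_topological by blast
  have o: "open ((\<lambda>w. w + c) -` U)" by (rule open_vimage[OF U(1)]) (intro continuous_intros)
  show "\<forall>\<^sub>F w in at z within S. h (w + c) < d"
    unfolding eventually_at_topological
    by (rule exI[of _ "(\<lambda>w. w + c) -` U"]) (use o U assms(2) in auto)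
qed

lemma usc_on_mono_compose:
  assumes usc: "usc_on S h" and low: "!!z. z \<in> S ==> h z >= m"
    and mono: "!!r s. m <= r ==> r <= s ==> \<psi> r <= (\<psi> s :: real)" and cont: "!!r. isCont \<psi> r"
  shows "usc_on S (\<lambda>z. \<psi> (h z))"
  unfolding usc_on_def
proof (intro ballI allI impI)
  fix z c assume z: "z \<in> S" "\<psi> (h z) < c"
  have "\<forall>\<^sub>F r in at (h z). \<psi> r < c"
    using cont[of "h z"] z(2) unfolding isCont_def by (rule order_tendstoD(2))
  then obtain d where d: "d > 0" "!!r. r \<noteq> h z ==> dist r (h z) < d ==> \<psi> r < c"
    unfolding eventually_at by auto
  have "\<forall>\<^sub>F w in at z within S. h w < h z + d / 2" using usc z(1) d(1) unfolding usc_on_def by simp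
  moreover have "\<forall>\<^sub>F w in at z within S. w \<in> S" by (simp add: eventually_at_topological) auto
  ultimately show "\<forall>\<^sub>F w in at z within S. \<psi> (h w) < c"
  proof eventually_elim
    case (elim w)
    have "\<psi> (h w) <= \<psi> (h z + d / 2)" using elim low[of w] by (intro mono) auto
    also have "\<dots> < c" using d(2)[of "h z + d / 2"] d(1) by (simp add: dist_real_def)
    finally show ?case .
  qed
qed

lemma usc_on_subset:
  assumes "usc_on S h" "S' \<subseteq> S" shows "usc_on S' h"
  using assms unfolding usc_on_def by (metis (no_types, lifting) at_le filter_leD subsetD)

lemma taylor_quadratic_bound:
  fixes \<phi> \<phi>' \<phi>'' :: "real => real"
  assumes d1: "!!t. t \<in> {\<alpha>..\<beta>} ==> (\<phi> has_real_derivative \<phi>' t) (at t)"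
    and d2: "!!t. t \<in> {\<alpha>..\<beta>} ==> (\<phi>' has_real_derivative \<phi>'' t) (at t)"
    and c: "continuous_on {\<alpha>..\<beta>} \<phi>''" and ab: "\<alpha> <= \<beta>"
  obtains K where "K >= 0" "!!s t. s \<in> {\<alpha>..\<beta>} ==> t \<in> {\<alpha>..\<beta>} ==> \<bar>\<phi> t - \<phi> s - \<phi>' s * (t - s)\<bar> <= K * (t - s)\<^sup>2"
    "!!s t. s \<in> {\<alpha>..\<beta>} ==> t \<in> {\<alpha>..\<beta>} ==> \<bar>\<phi> t - \<phi> s\<bar> <= K * \<bar>t - s\<bar>"
    "!!t. t \<in> {\<alpha>..\<beta>} ==> \<bar>\<phi> t\<bar> <= K" "!!t. t \<in> {\<alpha>..\<beta>} ==> \<bar>\<phi>' t\<bar> <= K"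
proof -
  have bnd: "\<exists>K. \<forall>t\<in>{\<alpha>..\<beta>}. \<bar>h t\<bar> <= K" if "continuous_on {\<alpha>..\<beta>} h" for h :: "real => real"
  proof -
    have "compact (h ` {\<alpha>..\<beta>})" using that by (intro compact_continuous_image) auto
    then have "bounded (h ` {\<alpha>..\<beta>})" by (rule compact_imp_bounded)
    then show ?thesis unfolding bounded_iff by auto
  qed
  have c1: "continuous_on {\<alpha>..\<beta>} \<phi>" "continuous_on {\<alpha>..\<beta>} \<phi>'"
    using DERIV_isCont[OF d1] DERIV_isCont[OF d2] by (auto intro!: continuous_at_imp_continuous_on)
  obtain K0 K1 K2 where K012: "\<forall>t\<in>{\<alpha>..\<beta>}. \<bar>\<phi> t\<bar> <= K0" "\<forall>t\<in>{\<alpha>..\<beta>}. \<bar>\<phi>' t\<bar> <= K1" "\<forall>t\<in>{\<alpha>..\<beta>}. \<bar>\<phi>'' t\<bar> <= K2"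
    using bnd[OF c1(1)] bnd[OF c1(2)] bnd[OF c] by blast
  define K where "K = max K0 (max K1 K2)"
  have K: "\<bar>\<phi> t\<bar> <= K" "\<bar>\<phi>' t\<bar> <= K" "\<bar>\<phi>'' t\<bar> <= K" if "t \<in> {\<alpha>..\<beta>}" for t
    using K012 that unfolding K_def by force+
  have K0: "K >= 0" using K(1)[of \<alpha>] ab by (auto intro: order_trans[OF abs_ge_zero])
  have mvt: "\<bar>h t - h s\<bar> <= C * \<bar>t - s\<bar>"
    if st: "s \<in> {\<alpha>..\<beta>}" "t \<in> {\<alpha>..\<beta>}" and d: "!!t. t \<in> {\<alpha>..\<beta>} ==> (h has_real_derivative h' t) (at t)"
      and b: "!!v. v \<in> {min s t..max s t} ==> \<bar>h' v\<bar> <= C" for h h' :: "real => real" and s t C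
  proof (cases s t rule: linorder_cases)
    case less
    have "\<exists>z. z > s \<and> z < t \<and> h t - h s = (t - s) * h' z"
      by (rule MVT2[OF less]) (use st in \<open>auto intro!: d\<close>)
    then obtain z where z: "z > s" "z < t" "h t - h s = (t - s) * h' z" by blast
    show ?thesis using b[of z] z mult_right_mono[of "\<bar>h' z\<bar>" C "\<bar>t - s\<bar>"] by (simp add: abs_mult mult.commute)
  next
    case greater
    have "\<exists>z. z > t \<and> z < s \<and> h s - h t = (s - t) * h' z"
      by (rule MVT2[OF greater]) (use st in \<open>auto intro!: d\<close>)
    then obtain z where z: "z > t" "z < s" "h s - h t = (s - t) * h' z" by blast
    have "\<bar>h t - h s\<bar> = \<bar>h' z\<bar> * \<bar>t - s\<bar>" using z(3) by (metis abs_minus_commute abs_mult mult.commute)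
    then show ?thesis using b[of z] z mult_right_mono[of "\<bar>h' z\<bar>" C "\<bar>t - s\<bar>"] by simp
  qed auto
  show thesis
  proof (rule that[OF K0])
    fix s t assume st: "s \<in> {\<alpha>..\<beta>}" "t \<in> {\<alpha>..\<beta>}"
    show "\<bar>\<phi> t - \<phi> s\<bar> <= K * \<bar>t - s\<bar>" 
    proof (rule mvt[OF st d1])
      show "\<bar>\<phi>' v\<bar> <= K" if v: "v \<in> {min s t..max s t}" for v by (rule K(2)) (use v st in auto)
    qed
    define h where "h v = \<phi> v - \<phi>' s * v" for v
    have "\<bar>h t - h s\<bar> <= (K * \<bar>t - s\<bar>) * \<bar>t - s\<bar>"
    proof (rule mvt[OF st])
      show "(h has_real_derivative \<phi>' v - \<phi>' s) (at v)" if "v \<in> {\<alpha>..\<beta>}" for v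
        unfolding h_def using d1[OF that] by (auto intro!: derivative_eq_intros)
      show "\<bar>\<phi>' v - \<phi>' s\<bar> <= K * \<bar>t - s\<bar>" if v: "v \<in> {min s t..max s t}" for v
      proof -
        have v2: "v \<in> {\<alpha>..\<beta>}" using v st by auto
        have "\<bar>\<phi>' v - \<phi>' s\<bar> <= K * \<bar>v - s\<bar>" 
        proof (rule mvt[OF st(1) v2 d2])
          show "\<bar>\<phi>'' u\<bar> <= K" if u: "u \<in> {min s v..max s v}" for u by (rule K(3)) (use u st v2 in auto)
        qed
        also have "\<dots> <= K * \<bar>t - s\<bar>" using v K0 by (intro mult_left_mono) auto
        finally show ?thesis .
      qed
    qed
    moreover have "h t - h s = \<phi> t - \<phi> s - \<phi>' s * (t - s)" by (simp add: h_def algebra_simps)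
    ultimately show "\<bar>\<phi> t - \<phi> s - \<phi>' s * (t - s)\<bar> <= K * (t - s)\<^sup>2" by (simp add: power2_eq_square)
  qed (use K in auto)
qed

lemma log_growth_bound:
  fixes m c \<epsilon> :: real
  assumes "m > 0" "c >= 0" "\<epsilon> > 0"
  obtains C where "C >= 0" "!!y. y >= 0 ==> (m / 2) * ln (1 + (c * y)\<^sup>2) <= \<epsilon> * y + C"
proof -
  define \<sigma> where "\<sigma> = min 1 (\<epsilon> / (m * (c + 1)))"
  have \<sigma>: "\<sigma> > 0" "\<sigma> <= 1" using assms by (auto simp: \<sigma>_def)
  have \<sigma>c: "m * (\<sigma> * c) <= \<epsilon>"
  proof -
    have "\<sigma> * (m * (c + 1)) <= \<epsilon> / (m * (c + 1)) * (m * (c + 1))" using assms by (intro mult_right_mono) (auto simp: \<sigma>_def)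
    also have "\<dots> = \<epsilon>" using assms by simp
    finally have "\<sigma> * (m * (c + 1)) <= \<epsilon>" .
    moreover have "m * (\<sigma> * c) <= \<sigma> * (m * (c + 1))" using assms \<sigma> by (simp add: algebra_simps)
    ultimately show ?thesis by linarith
  qed
  show thesis
  proof (rule that[of "m * (1 - ln \<sigma>)"])
    have "ln \<sigma> <= 0" using \<sigma> by simp
    then show "0 <= m * (1 - ln \<sigma>)" using assms by simp
    fix y :: real assume y: "y >= 0"
    define v where "v = c * y"
    have v: "v >= 0" using assms y by (simp add: v_def)
    have "1 + v\<^sup>2 <= (1 + v)\<^sup>2" using v by (simp add: power2_eq_square algebra_simps)
    then have "ln (1 + v\<^sup>2) <= ln ((1 + v)\<^sup>2)" by (intro ln_mono) (auto simp: add_pos_nonneg)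
    also have "\<dots> = 2 * ln (1 + v)" using v by (simp add: ln_realpow)
    finally have 1: "ln (1 + v\<^sup>2) <= 2 * ln (1 + v)" .
    have "ln (\<sigma> * (1 + v)) <= \<sigma> * (1 + v) - 1" using \<sigma> v by (intro ln_le_minus_one) simp
    moreover have "ln (\<sigma> * (1 + v)) = ln \<sigma> + ln (1 + v)" using \<sigma> v by (intro ln_mult_pos) auto
    ultimately have "ln (1 + v) <= \<sigma> * v + 1 - ln \<sigma>" using \<sigma> by (simp add: distrib_left)
    then have "(m / 2) * ln (1 + v\<^sup>2) <= (m / 2) * (2 * (\<sigma> * v + 1 - ln \<sigma>))" using 1 assms by (intro mult_left_mono) auto
    also have "\<dots> = m * (\<sigma> * c) * y + m * (1 - ln \<sigma>)" by (simp add: v_def algebra_simps)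
    also have "\<dots> <= \<epsilon> * y + m * (1 - ln \<sigma>)" using mult_right_mono[OF \<sigma>c y] by simp
    finally show "(m / 2) * ln (1 + (c * y)\<^sup>2) <= \<epsilon> * y + m * (1 - ln \<sigma>)" by (simp add: v_def)
  qed
qed

text \<open>
  In the Gaussian bound the quadratic exponent beats the logarithm as soon as \<open>d\<^sup>2 / t\<close> is large.
\<close>

lemma positivity_layer:
  fixes f :: "(real^'n) \<times> real => real"
  assumes p: "1 < p" and sj: "subsol_jets p \<Omega> f" and op: "open \<Omega>" and \<Gamma>: "frontier \<Omega> \<noteq> {}"
    and M: "M > 0" "!!w. w \<in> \<Omega> \<times> {0<..} ==> f w <= M" and usc: "usc_on (\<Omega> \<times> {0<..}) f"
    and init: "!!x \<eta>. x \<in> \<Omega> ==> \<eta> > 0 ==> \<forall>\<^sub>F w in at (x, 0) within \<Omega> \<times> {0<..}. f w < \<eta>"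
    and l: "l > 0"
  obtains K where "K > 0" "!!x t. x \<in> \<Omega> ==> 0 < t ==> t <= 1 ==> f (x, t) >= l ==> infdist x (frontier \<Omega>) <= K * sqrt t"
proof -
  define b where "b = 1 - recip p"
  define m where "m = trace_const p TYPE('n) / (1 - recip p)"
  define A where "A = m\<^sup>2 + 2 * m"
  have b: "b > 0" using recip_bounds[OF p] by (simp add: b_def)
  have m: "m > 0" using trace_const_pos[OF p, where 'n='n] b unfolding m_def b_def by simp
  have A: "A > 0" unfolding A_def using m by (intro add_nonneg_pos) auto
  obtain C where C: "C >= 0" "!!y. y >= 0 ==> (m / 2) * ln (1 + ((1 / (2 * b * A)) * y)\<^sup>2) <= (1 / (8 * b)) * y + C"
    by (rule log_growth_bound[OF m, of "1 / (2 * b * A)" "1 / (8 * b)"]) (use b A in auto)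
  define K2 where "K2 = 8 * b * (\<bar>ln M\<bar> + 1 + A + C + \<bar>ln l\<bar>) + 1"
  have K2: "K2 > 0" using b A C(1) unfolding K2_def by (intro add_nonneg_pos mult_nonneg_nonneg add_nonneg_nonneg) auto
  show thesis
  proof (rule that[of "sqrt K2"])
    show "sqrt K2 > 0" using K2 by simp
    fix x t assume x: "x \<in> \<Omega>" and t: "0 < t" "t <= 1" and fl: "f (x, t) >= l"
    define d where "d = infdist x (frontier \<Omega>)"
    define y where "y = d\<^sup>2 / t"
    have y: "y >= 0" using t by (simp add: y_def)
    have gb: "f (x, t) <= M * exp (t + A - d\<^sup>2 / (4 * b * t) + (m / 2) * ln (1 + (d\<^sup>2 / (2 * b * A * t))\<^sup>2))"
      using gaussian_upper_bound[OF p sj op \<Gamma> M usc init x t(1)] unfolding b_def m_def A_def d_def by simp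
    have e: "d\<^sup>2 / (4 * b * t) = (1 / (4 * b)) * y" "d\<^sup>2 / (2 * b * A * t) = (1 / (2 * b * A)) * y" by (simp_all add: y_def)
    have "l <= M * exp (t + A - (1 / (4 * b)) * y + (m / 2) * ln (1 + ((1 / (2 * b * A)) * y)\<^sup>2))"
      using gb fl unfolding e by linarith
    also have "\<dots> <= M * exp (1 + A - (1 / (8 * b)) * y + C)"
    proof -
      have "(1 / (4 * b)) * y = (1 / (8 * b)) * y + (1 / (8 * b)) * y" by (simp add: field_simps)
      then show ?thesis using C(2)[OF y] t M(1) by (intro mult_left_mono) auto
    qed
    finally have "ln l <= ln (M * exp (1 + A - (1 / (8 * b)) * y + C))" using l by (intro ln_mono) auto
    also have "\<dots> = ln M + (1 + A - (1 / (8 * b)) * y + C)" using M(1) by (simp add: ln_mult_pos)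
    finally have "(1 / (8 * b)) * y <= \<bar>ln M\<bar> + 1 + A + C + \<bar>ln l\<bar>" by linarith
    then have "8 * b * ((1 / (8 * b)) * y) <= 8 * b * (\<bar>ln M\<bar> + 1 + A + C + \<bar>ln l\<bar>)" using b by (intro mult_left_mono) auto
    then have "y <= K2" using b by (simp add: K2_def)
    then have "d\<^sup>2 <= K2 * t" using t by (simp add: y_def divide_le_eq)
    then have "d <= sqrt (K2 * t)" by (rule real_le_rsqrt)
    then show "infdist x (frontier \<Omega>) <= sqrt K2 * sqrt t" by (simp add: d_def real_sqrt_mult)
  qed
qed

section \<open>No negative values at the corners\<close>

text \<open>
  The natural unit of the doubling argument: all exponents that occur are integral powers of
  \<open>t\<^sup>-\<^sup>1\<^sup>/\<^sup>6\<close>.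
\<close>

definition time_scale :: "real => real" where
  "time_scale t = t powr (- (1/6))"

lemma time_scale_power6:
  assumes "t > 0" shows "time_scale t > 0" "time_scale t ^ 6 = 1 / t"
proof -
  show "time_scale t > 0" using assms by (simp add: time_scale_def)
  have "time_scale t ^ 6 = time_scale t powr (real 6)" using assms by (simp add: time_scale_def powr_realpow)
  also have "\<dots> = t powr (- 1)" by (simp add: time_scale_def powr_powr)
  also have "\<dots> = 1 / t" using assms by (simp add: powr_minus_divide)
  finally show "time_scale t ^ 6 = 1 / t" .
qed

lemma time_scale_ge:
  assumes "t > 0" "J > 0" "t <= 1 / J ^ 6" shows "J <= time_scale t"
proof -
  have "t * J ^ 6 <= 1" using assms by (simp add: le_divide_eq)
  then have "J ^ 6 <= time_scale t ^ 6" using time_scale_power6[OF assms(1)] assms(1) by (simp add: le_divide_eq mult.commute)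
  then show ?thesis using time_scale_power6(1)[OF assms(1)] assms(2) by (metis less_imp_le not_le power_strict_mono zero_less_numeral)
qed

lemma time_scale_deriv:
  assumes "t > 0"
  shows "(time_scale has_real_derivative - (1/6) * time_scale t ^ 7) (at t)"
proof -
  have "((\<lambda>t. t powr (- (1/6))) has_real_derivative (- (1/6)) * t powr (- (1/6) - 1)) (at t)"
    by (rule has_real_derivative_powr[OF assms])
  moreover have "t powr (- (1/6) - 1) = time_scale t ^ 7"
  proof -
    have "time_scale t ^ 7 = time_scale t * time_scale t ^ 6" by (simp add: power_Suc[symmetric])
    also have "\<dots> = t powr (- (1/6)) * t powr (- 1)"
      unfolding time_scale_power6(2)[OF assms] using assms by (simp add: time_scale_def powr_minus_divide)
    also have "\<dots> = t powr (- (1/6) + (- 1))" by (simp only: powr_add)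
    also have "\<dots> = t powr (- (1/6) - 1)" by simp
    finally show ?thesis by simp
  qed
  ultimately show ?thesis unfolding time_scale_def[abs_def] by simp
qed

lemma time_scale_power_deriv:
  assumes "t > 0"
  shows "((\<lambda>t. time_scale t ^ n) has_real_derivative - (real n / 6) * time_scale t ^ (n + 6)) (at t)"
proof (cases n)
  case (Suc k)
  have "((\<lambda>t. time_scale t ^ n) has_real_derivative real n * (- (1/6) * time_scale t ^ 7 * time_scale t ^ (n - Suc 0))) (at t)"
    by (rule DERIV_power[OF time_scale_deriv[OF assms]])
  moreover have "time_scale t ^ 7 * time_scale t ^ (n - Suc 0) = time_scale t ^ (n + 6)"
    unfolding power_add[symmetric] by (rule arg_cong[of _ _ "power (time_scale t)"]) (simp add: Suc)
  ultimately show ?thesis by (simp add: mult.assoc)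
qed simp

lemma time_scale_inverse_deriv:
  assumes "t > 0"
  shows "((\<lambda>t. 1 / time_scale t) has_real_derivative (1/6) * time_scale t ^ 5) (at t)"
proof -
  note J = time_scale_power6[OF assms]
  have d: "((\<lambda>t. inverse (time_scale t)) has_real_derivative - (inverse (time_scale t) * (- (1/6) * time_scale t ^ 7) * inverse (time_scale t))) (at t)"
    by (rule DERIV_inverse'[OF time_scale_deriv[OF assms]]) (use J in simp)
  have e: "- (inverse (time_scale t) * (- (1/6) * time_scale t ^ 7) * inverse (time_scale t)) = (1/6) * time_scale t ^ 5"
    using J(1) by (simp add: field_simps power_numeral_reduce)
  have i: "(\<lambda>t. 1 / time_scale t) = (\<lambda>t. inverse (time_scale t))" by (simp add: inverse_eq_divide)
  show ?thesis using d unfolding e i .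
qed

text \<open>
  The upper limit at the corner is \<open>a\<close>.  The functions \<open>f \<in> [0, (21/20)\<^sup>2]\<close> and
  \<open>g \<in> [- (21/20)\<^sup>2, 0]\<close> are scaled so that a value of \<open>f + g - P\<close> of at least \<open>2/5\<close> forces
  both \<open>f > 0\<close> and \<open>g\<close> above its minimum: contact points then lie in \<open>\<Omega>\<close>, where the equation holds.
  The order of the choices matters: the localisation, then the bad point \<open>(xk, tk)\<close>, then the shift
  \<open>\<delta>\<close> depending on it, then the initial time \<open>ts\<close>, by which the boundary layer is thinner than the exterior ball, and
  finally the parameter \<open>\<iota>\<close> of the regularisation.  The constant \<open>C1\<close>, which has to dominate the error of
  the coupled jets, depends on the localisation only.
\<close>

lemma corner_limsup_nonpos:
  fixes W :: "(real^'n) \<times> real => real"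
  assumes p: "1 < p" and sj: "subsol_jets p \<Omega> W" and op: "open \<Omega>"
    and M: "M > 0" "!!w. w \<in> \<Omega> \<times> {0<..} ==> W w <= M" and usc: "usc_on (\<Omega> \<times> {0<..}) W"
    and init: "!!x \<eta>. x \<in> \<Omega> ==> \<eta> > 0 ==> \<forall>\<^sub>F w in at (x, 0) within \<Omega> \<times> {0<..}. W w < \<eta>"
    and lat: "!!y s \<eta>. y \<in> frontier \<Omega> ==> s > 0 ==> \<eta> > 0 ==> \<forall>\<^sub>F w in at (y, s) within \<Omega> \<times> {0<..}. W w < - 1 + \<eta>"
    and cls: "class_C0 r \<omega> \<Omega>" and md: "modulus \<omega>" and y0: "y0 \<in> frontier \<Omega>" and \<eta>0: "\<eta>0 > 0"
  shows "\<exists>R>0. \<forall>x\<in>\<Omega>. \<forall>t. norm (x - y0) < R --> 0 < t --> t < R --> W (x, t) < \<eta>0"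
proof -
  have r: "r > 0" using cls by (simp add: class_C0_def)
  define A where "A = {c. c >= 0 \<and> (\<exists>R>0. \<forall>x\<in>\<Omega>. \<forall>t. norm (x - y0) < R --> 0 < t --> t < R --> W (x, t) <= c)}"
  have MA: "M \<in> A"
  proof -
    have "\<forall>x\<in>\<Omega>. \<forall>t. norm (x - y0) < 1 --> 0 < t --> t < 1 --> W (x, t) <= M" using M(2) by auto
    then show ?thesis unfolding A_def using M(1) by (intro CollectI conjI exI[of _ 1]) auto
  qed
  define a where "a = Inf A"
  have bb: "bdd_below A" by (rule bdd_belowI[of _ 0]) (simp add: A_def)
  have a0: "a >= 0" unfolding a_def by (rule cInf_greatest) (use MA in \<open>auto simp: A_def\<close>)
  have above: "\<exists>c\<in>A. c < v" if "a < v" for v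
    using cInf_lessD[of A v] MA that unfolding a_def by auto
  have below: "v \<notin> A" if "v < a" for v
    using cInf_lower[OF _ bb, of v] that unfolding a_def by auto
  have "\<not> a > 0"
  proof
    assume a: "a > 0"
    define a' where "a' = (21/20) * a"
    obtain R0 where R0: "R0 > 0" "!!x t. x \<in> \<Omega> ==> norm (x - y0) < R0 ==> 0 < t ==> t < R0 ==> W (x, t) <= a'"
    proof -
      have "a < a'" using a by (simp add: a'_def)
      then obtain c where c: "c \<in> A" "c < a'" using above by blast
      obtain R where R: "R > 0" "!!x t. x \<in> \<Omega> ==> norm (x - y0) < R ==> 0 < t ==> t < R ==> W (x, t) <= c"
        using c(1) unfolding A_def by auto
      show thesis by (rule that[OF R(1)]) (use R(2) c(2) in force)
    qed
    have near: "\<exists>x\<in>\<Omega>. \<exists>t. norm (x - y0) < \<rho> \<and> 0 < t \<and> t < \<rho> \<and> W (x, t) > (19/20) * a" if "\<rho> > 0" for \<rho>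
    proof (rule ccontr)
      assume "\<not> ?thesis"
      then have "\<forall>x\<in>\<Omega>. \<forall>t. norm (x - y0) < \<rho> --> 0 < t --> t < \<rho> --> W (x, t) <= (19/20) * a" by force
      then have "(19/20) * a \<in> A" unfolding A_def using a that by auto
      then show False using below[of "(19/20) * a"] a by simp
    qed
    obtain e where e: "norm e = 1"
      and ext: "!!q \<delta> w. q \<in> frontier \<Omega> ==> norm (q - y0) < r / 2 ==> 0 < \<delta> ==> \<delta> < r / 4 ==> w \<in> \<Omega> ==>
         psi r \<omega> \<delta> <= norm (w - (q + \<delta> *\<^sub>R e))"
      using exterior_ball[OF cls md y0] by metis
    \<comment> \<open>\<open>\<Lambda>\<close> makes the localising term exceed the range of \<open>f\<close> on the sphere of radius \<open>R\<close>.\<close>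
    define b where "b = 1 - recip p"
    have b: "b > 0" using recip_bounds[OF p] by (simp add: b_def)
    define cp where "cp = trace_const p TYPE('n)"
    have cp: "cp > 0" using trace_const_pos[OF p, where 'n='n] by (simp add: cp_def)
    define R1 where "R1 = min 1 (min R0 (r / 4))"
    have R1: "R1 > 0" "R1 <= R0" "R1 <= r / 4" "R1 <= 1" using R0(1) r by (auto simp: R1_def)
    define R where "R = R1 / 2"
    define R2 where "R2 = 3 * R1 / 4"
    have R: "R > 0" using R1 by (simp add: R_def)
    define \<Lambda> where "\<Lambda> = 2 / R\<^sup>2"
    have \<Lambda>: "\<Lambda> > 0" "\<Lambda> * R\<^sup>2 = 2" using R by (auto simp: \<Lambda>_def)
    define \<eta> where "\<eta> = 2 * \<Lambda> * R + 2"
    have \<eta>: "\<eta> >= 2" using \<Lambda> R by (simp add: \<eta>_def)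
    define \<kappa> where "\<kappa> = b / (2 * (441/400))"
    have \<kappa>: "\<kappa> > 0" using b by (simp add: \<kappa>_def)
    define CC where "CC = 24 * \<eta>\<^sup>2 * cp + 2 * \<Lambda> * cp + (5/2) * \<eta> ^ 4 + 96 * real CARD('n) * \<eta> + (5/2) * (5 / (8 * \<kappa>))\<^sup>2"
    have CC: "CC >= 0" unfolding CC_def using cp \<Lambda> \<eta> by (intro add_nonneg_nonneg mult_nonneg_nonneg) auto
    define C1 where "C1 = 6 * (CC + 3)"
    have C1: "C1 > 0" using CC by (simp add: C1_def)
    define J0 where "J0 = max 1 (max (20 * C1) (2 / (R1 / 4) ^ 4))"
    have J0: "J0 >= 1" "J0 >= 20 * C1" "J0 >= 2 / (R1 / 4) ^ 4" by (auto simp: J0_def)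
    \<comment> \<open>Up to time \<open>10 tk\<close> the quartic penalty confines \<open>y\<close>, and \<open>C1 t\<^sup>1\<^sup>/\<^sup>6\<close> is harmless at the bad point.\<close>
    define \<rho> where "\<rho> = min (R / 10) (min (R1 / 80) (1 / (20 * J0 ^ 6)))"
    have \<rho>: "\<rho> > 0" "\<rho> <= R / 10" "\<rho> <= R1 / 80" "\<rho> <= 1 / (20 * J0 ^ 6)" using R R1 J0(1) by (auto simp: \<rho>_def)
    obtain xk tk where k: "xk \<in> \<Omega>" "norm (xk - y0) < \<rho>" "0 < tk" "tk < \<rho>" "W (xk, tk) > (19/20) * a"
      using near[OF \<rho>(1)] by blast
    define T where "T = 10 * tk"
    have T: "T > 0" "2 * T < R1" "T <= 1 / J0 ^ 6" "tk < T" "2 * T <= 1"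
    proof -
      show "T > 0" "tk < T" "2 * T < R1" using k \<rho>(3) R1(1) by (auto simp: T_def)
      have "T <= 10 * (1 / (20 * J0 ^ 6))" using k(4) \<rho>(4) by (simp add: T_def)
      also have "\<dots> = (1 / J0 ^ 6) / 2" by simp
      also have "\<dots> <= 1 / J0 ^ 6"
      proof -
        have half: "v / 2 <= v" if "v >= 0" for v :: real using that by simp
        have "0 <= 1 / J0 ^ 6" using J0(1) by simp
        then show ?thesis by (rule half)
      qed
      finally show "T <= 1 / J0 ^ 6" .
      show "2 * T <= 1" using \<open>2 * T < R1\<close> R1(4) by linarith
    qed
    have JT: "J0 <= time_scale t" if "0 < t" "t <= T" for t
      by (rule time_scale_ge) (use that T(3) J0(1) in auto)
    define Jk where "Jk = time_scale tk"
    have Jk: "Jk >= J0" "Jk >= 1" using JT[of tk] k(3) T(4) J0(1) by (auto simp: Jk_def)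
    \<comment> \<open>At the bad point the shift must cost less than \<open>1/20\<close> in the quartic.\<close>
    define \<delta> where "\<delta> = min (min (r / 8) (R1 / 16)) (min 1 (1 / (20 * Jk ^ 15)))"
    have \<delta>: "\<delta> > 0" "\<delta> < r / 4" "\<delta> < R1 / 8" "\<delta> <= 1" "\<delta> <= 1 / (20 * Jk ^ 15)"
    proof -
      have le: "\<delta> <= min (r / 8) (R1 / 16)" "\<delta> <= min 1 (1 / (20 * Jk ^ 15))"
        unfolding \<delta>_def by (rule min.cobounded1 min.cobounded2)+
      have "min (r / 8) (R1 / 16) <= r / 8" "min (r / 8) (R1 / 16) <= R1 / 16" by (rule min.cobounded1 min.cobounded2)+
      then show "\<delta> < r / 4" "\<delta> < R1 / 8" using le(1) r R1(1) by linarith+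
      show "\<delta> <= 1" by (rule order_trans[OF le(2) min.cobounded1])
      show "\<delta> <= 1 / (20 * Jk ^ 15)" by (rule order_trans[OF le(2) min.cobounded2])
      have "0 < 1 / (20 * Jk ^ 15)" using Jk by simp
      then show "\<delta> > 0" unfolding \<delta>_def min_less_iff_conj using r R1(1) by simp
    qed
    define \<Psi> where "\<Psi> = psi r \<omega> \<delta>"
    have \<Psi>: "\<Psi> > 0" "\<Psi> <= \<delta>" using psi_bounds(1,2)[OF md r \<delta>(1)] by (auto simp: \<Psi>_def)
    obtain K where K: "K > 0" "!!x t. x \<in> \<Omega> ==> 0 < t ==> t <= 1 ==> W (x, t) >= (3/5) * a ==> infdist x (frontier \<Omega>) <= K * sqrt t"
      by (rule positivity_layer[OF p sj op _ M usc init, of "(3/5) * a"]) (use y0 a in auto)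
    define J1 where "J1 = max 1 (2 / (\<Psi> / 4) ^ 4)"
    have J1: "J1 >= 1" "J1 >= 2 / (\<Psi> / 4) ^ 4" by (auto simp: J1_def)
    define ts where "ts = min (tk / 2) (min (1 / J1 ^ 6) ((\<Psi> / (8 * K))\<^sup>2 / 2))"
    have ts: "ts > 0" "ts < tk" "ts <= 1 / J1 ^ 6" "2 * ts <= (\<Psi> / (8 * K))\<^sup>2"
    proof -
      have le: "ts <= tk / 2" "ts <= min (1 / J1 ^ 6) ((\<Psi> / (8 * K))\<^sup>2 / 2)"
        unfolding ts_def by (rule min.cobounded1 min.cobounded2)+
      show "ts < tk" using le(1) k(3) by linarith
      show "ts <= 1 / J1 ^ 6" by (rule order_trans[OF le(2) min.cobounded1])
      have "ts <= (\<Psi> / (8 * K))\<^sup>2 / 2" by (rule order_trans[OF le(2) min.cobounded2])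
      then show "2 * ts <= (\<Psi> / (8 * K))\<^sup>2" by linarith
      have "0 < 1 / J1 ^ 6" "0 < (\<Psi> / (8 * K))\<^sup>2 / 2" using J1(1) \<Psi>(1) K(1) by auto
      then show "ts > 0" unfolding ts_def min_less_iff_conj using k(3) by simp
    qed
    have tsT: "ts < T" using ts T(4) by linarith
    define \<mu>0 where "\<mu>0 = min (ts / 2) (min (\<Psi> / 8) (R1 / 16))"
    have \<mu>0: "\<mu>0 > 0" "\<mu>0 <= ts / 2" "\<mu>0 <= \<Psi> / 8" "\<mu>0 <= R1 / 16" using ts \<Psi> R1 by (auto simp: \<mu>0_def)
    define \<iota> where "\<iota> = \<mu>0\<^sup>2 / 4"
    have \<iota>: "\<iota> > 0" "2 * \<iota> * (441/400) < \<mu>0\<^sup>2" using \<mu>0(1) by (auto simp: \<iota>_def)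
    define \<beta> where "\<beta> = (441/400) / (1 + a')"
    have a'0: "a' > 0" using a by (simp add: a'_def)
    have \<beta>: "\<beta> > 0" "\<beta> * (1 + a') = 441/400" 
    proof -
      show "\<beta> > 0" using a'0 by (simp add: \<beta>_def)
      have "q / v * v = q" if "v \<noteq> 0" for q v :: real using that by simp
      from this[of "1 + a'" "441/400"] show "\<beta> * (1 + a') = 441/400" using a'0 unfolding \<beta>_def by linarith
    qed
    define f where "f w = ((if fst w \<in> \<Omega> then max (W w) 0 else 0) / a)\<^sup>2" for w :: "(real^'n) \<times> real"
    define G0 where "G0 w = (if fst w \<in> \<Omega> then max (W w) (- 1) else - 1)" for w :: "(real^'n) \<times> real"
    define g where "g w = \<beta> * (G0 (w + (\<delta> *\<^sub>R e, 0)) - a')" for w :: "(real^'n) \<times> real"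
    define S1 where "S1 = cball y0 (R + R1 / 8) \<times> {ts / 2..2 * T}"
    define S2 where "S2 = cball y0 (R2 + R1 / 8) \<times> {ts / 2..2 * T}"
    have uscf: "usc_on S1 f"
    proof (rule usc_on_subset)
      have u0: "usc_on (UNIV \<times> {0<..}) (\<lambda>w. if fst w \<in> \<Omega> then max (W w) 0 else 0)"
      proof (rule usc_extend_by_constant[OF usc op])
        fix y s \<eta> assume ys: "y \<in> frontier \<Omega>" "s > (0::real)" "\<eta> > (0::real)"
        show "\<forall>\<^sub>F w in at (y, s) within \<Omega> \<times> {0<..}. W w < 0 + \<eta>"
          using lat[OF ys] by eventually_elim simp
      qed
      show "usc_on (UNIV \<times> {0<..}) f" unfolding f_def[abs_def]
      proof (rule usc_on_mono_compose[OF u0, of 0 "\<lambda>s. (s / a)\<^sup>2"])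
        show "(s / a)\<^sup>2 <= (s' / a)\<^sup>2" if "0 <= s" "s <= s'" for s s' using that a by (intro power_mono divide_right_mono) auto
        show "isCont (\<lambda>s. (s / a)\<^sup>2) s" for s using a by (intro continuous_intros) auto
      qed auto
      show "S1 \<subseteq> UNIV \<times> {0<..}" using ts(1) by (auto simp: S1_def)
    qed
    have uscg: "usc_on S2 g"
    proof -
      have u1: "usc_on (UNIV \<times> {0<..}) G0" unfolding G0_def[abs_def]
        by (rule usc_extend_by_constant[OF usc op]) (use lat in auto)
      have u2: "usc_on S2 (\<lambda>w. G0 (w + (\<delta> *\<^sub>R e, 0)))"
        by (rule usc_on_shift[OF u1]) (use ts(1) in \<open>auto simp: S2_def\<close>)
      show ?thesis unfolding g_def[abs_def]
      proof (rule usc_on_mono_compose[OF u2, of "- 1" "\<lambda>s. \<beta> * (s - a')"])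
        show "\<beta> * (s - a') <= \<beta> * (s' - a')" if "s <= s'" for s s' using that \<beta>(1) by (intro mult_left_mono) auto
        show "isCont (\<lambda>s. \<beta> * (s - a')) s" for s by (intro continuous_intros)
      qed (auto simp: G0_def)
    qed
    have f01: "0 <= f w" "f w <= 441/400" if "w \<in> S1" for w
    proof -
      show "0 <= f w" by (simp add: f_def)
      have w: "norm (fst w - y0) <= R + R1 / 8" "0 < snd w" "snd w <= 2 * T"
        using that ts(1) by (auto simp: S1_def dist_norm norm_minus_commute)
      have "(if fst w \<in> \<Omega> then max (W w) 0 else 0) <= a'"
        using R0(2)[of "fst w" "snd w"] w R1 T(2) a'0 by (auto simp: R_def)
      then have "(if fst w \<in> \<Omega> then max (W w) 0 else 0) / a <= 21/20" using a by (simp add: a'_def divide_le_eq)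
      then have "f w <= (21/20)\<^sup>2" unfolding f_def using a by (intro power_mono) auto
      then show "f w <= 441/400" by (simp add: power2_eq_square)
    qed
    have g01: "- (441/400) <= g w" "g w <= 0" if "w \<in> S2" for w
    proof -
      define v where "v = w + (\<delta> *\<^sub>R e, 0)"
      have w: "norm (fst w - y0) <= R2 + R1 / 8" "0 < snd w" "snd w <= 2 * T"
        using that ts(1) by (auto simp: S2_def dist_norm norm_minus_commute)
      have "norm (fst v - y0) = norm ((fst w - y0) + \<delta> *\<^sub>R e)" by (simp add: v_def algebra_simps)
      also have "\<dots> <= norm (fst w - y0) + \<delta>" using norm_triangle_ineq[of "fst w - y0" "\<delta> *\<^sub>R e"] e \<delta>(1) by simp
      also have "\<dots> < R1" using w(1) \<delta>(3) by (simp add: R2_def)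
      finally have "norm (fst v - y0) < R0" using R1(2) by linarith
      have sv: "snd v = snd w" by (simp add: v_def)
      have "W v <= a'" if "fst v \<in> \<Omega>"
      proof -
        have "W (fst v, snd v) <= a'"
          by (rule R0(2)[OF that \<open>norm (fst v - y0) < R0\<close>]) (use w R1 T(2) sv in auto)
        then show ?thesis by (simp only: prod.collapse)
      qed
      then have "G0 v <= a'" unfolding G0_def using a'0 by auto
      then show "g w <= 0" using \<beta>(1) by (simp add: g_def v_def[symmetric] mult_nonneg_nonpos)
      have "G0 v >= - 1" by (simp add: G0_def)
      then have "\<beta> * (- 1 - a') <= \<beta> * (G0 v - a')" using \<beta>(1) by (intro mult_left_mono) auto
      moreover have "\<beta> * (- 1 - a') = - (441/400)" using \<beta>(2) by (simp add: algebra_simps)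
      ultimately show "- (441/400) <= g w" by (simp add: g_def v_def)
    qed
    have fd: "sup_conv_data S1 \<iota> f (441/400)" unfolding sup_conv_data_def
      using uscf f01(2) \<iota>(1) R R1 tsT ts(1) by (auto simp: S1_def compact_Times)
    have gd: "sup_conv_data S2 \<iota> g 0" unfolding sup_conv_data_def
      using uscg g01(2) \<iota>(1) R R1 tsT ts(1) by (auto simp: S2_def R2_def compact_Times)
    define F where "F = sup_conv S1 \<iota> f"
    define G where "G = sup_conv S2 \<iota> g"
    define lam where "lam t = time_scale t ^ 15" for t
    define lam' where "lam' t = - (15 / 6) * time_scale t ^ 21" for t
    define mu where "mu t = C1 * (1 / time_scale t) + t / (10 * tk)" for t
    define mu' where "mu' t = C1 * ((1/6) * time_scale t ^ 5) + 1 / (10 * tk)" for t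
    have posT: "t > 0" if "t \<in> {ts..T}" for t using that ts(1) by auto
    have contJ: "continuous_on {ts..T} time_scale"
      using DERIV_isCont[OF time_scale_deriv] posT by (auto intro!: continuous_at_imp_continuous_on)
    obtain Kl where Kl: "Kl >= 0" "!!s t. s \<in> {ts..T} ==> t \<in> {ts..T} ==> \<bar>lam t - lam s - lam' s * (t - s)\<bar> <= Kl * (t - s)\<^sup>2"
      "!!s t. s \<in> {ts..T} ==> t \<in> {ts..T} ==> \<bar>lam t - lam s\<bar> <= Kl * \<bar>t - s\<bar>"
      "!!t. t \<in> {ts..T} ==> \<bar>lam t\<bar> <= Kl" "!!t. t \<in> {ts..T} ==> \<bar>lam' t\<bar> <= Kl"
    proof (rule taylor_quadratic_bound[of ts T lam lam' "\<lambda>t. - (15 / 6) * (- (21 / 6) * time_scale t ^ 27)"])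
      fix t assume "t \<in> {ts..T}"
      then have t: "t > 0" by (rule posT)
      show "(lam has_real_derivative lam' t) (at t)"
        using time_scale_power_deriv[OF t, of 15] unfolding lam_def[abs_def] lam'_def by simp
      show "(lam' has_real_derivative - (15 / 6) * (- (21 / 6) * time_scale t ^ 27)) (at t)"
        using DERIV_cmult[OF time_scale_power_deriv[OF t, of 21], of "- (15 / 6)"] unfolding lam'_def[abs_def] by simp
    next
      show "continuous_on {ts..T} (\<lambda>t. - (15 / 6) * (- (21 / 6) * time_scale t ^ 27))" by (intro continuous_intros contJ)
    qed (use tsT in auto)
    obtain Km where Km: "Km >= 0" "!!s t. s \<in> {ts..T} ==> t \<in> {ts..T} ==> \<bar>mu t - mu s - mu' s * (t - s)\<bar> <= Km * (t - s)\<^sup>2"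
      "!!s t. s \<in> {ts..T} ==> t \<in> {ts..T} ==> \<bar>mu t - mu s\<bar> <= Km * \<bar>t - s\<bar>"
      "!!t. t \<in> {ts..T} ==> \<bar>mu t\<bar> <= Km" "!!t. t \<in> {ts..T} ==> \<bar>mu' t\<bar> <= Km"
    proof (rule taylor_quadratic_bound[of ts T mu mu' "\<lambda>t. C1 * ((1/6) * (- (5 / 6) * time_scale t ^ 11)) + 0"])
      fix t assume "t \<in> {ts..T}"
      then have t: "t > 0" by (rule posT)
      have "((\<lambda>t. t / (10 * tk)) has_real_derivative 1 / (10 * tk)) (at t)" by (rule DERIV_cdivide[OF DERIV_ident])
      then show "(mu has_real_derivative mu' t) (at t)"
        unfolding mu_def[abs_def] mu'_def by (intro DERIV_add DERIV_cmult time_scale_inverse_deriv[OF t])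
      have "((\<lambda>t. time_scale t ^ 5) has_real_derivative - (5 / 6) * time_scale t ^ 11) (at t)"
        using time_scale_power_deriv[OF t, of 5] by simp
      then show "(mu' has_real_derivative C1 * ((1/6) * (- (5 / 6) * time_scale t ^ 11)) + 0) (at t)"
        unfolding mu'_def[abs_def] by (intro DERIV_add DERIV_cmult DERIV_const)
    next
      show "continuous_on {ts..T} (\<lambda>t. C1 * ((1/6) * (- (5 / 6) * time_scale t ^ 11)) + 0)" by (intro continuous_intros contJ)
    qed (use tsT in auto)
    define KK where "KK = max Kl Km"
    have KK: "KK >= 0" "Kl <= KK" "Km <= KK" using Kl(1) by (auto simp: KK_def)
    define D where "D = (cball y0 R \<times> cball y0 R2) \<times> {ts..T}"
    define P where "P = doubling_penalty lam \<Lambda> y0 mu"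
    define \<Phi> where "\<Phi> w = F (fst (fst w), snd w) + G (snd (fst w), snd w) - P w" for w
    have Dw: "norm (fst (fst w) - y0) <= R" "norm (snd (fst w) - y0) <= R2" "ts <= snd w" "snd w <= T" if "w \<in> D" for w
      using that by (auto simp: D_def dist_norm norm_minus_commute)
    have Pform: "P w = time_scale (snd w) ^ 15 * norm (fst (fst w) - snd (fst w)) ^ 4 + \<Lambda> * (norm (fst (fst w) - y0))\<^sup>2
        + (C1 * (1 / time_scale (snd w)) + snd w / (10 * tk))" for w
      by (simp add: P_def doubling_penalty_def lam_def mu_def)
    have Pge: "P w >= time_scale (snd w) ^ 15 * norm (fst (fst w) - snd (fst w)) ^ 4" "P w >= \<Lambda> * (norm (fst (fst w) - y0))\<^sup>2"
      "P w >= snd w / (10 * tk)" "P w >= 0" if "w \<in> D" for w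
    proof -
      have t: "snd w > 0" using Dw(3)[OF that] ts(1) by linarith
      have "0 <= time_scale (snd w) ^ 15 * norm (fst (fst w) - snd (fst w)) ^ 4" "0 <= \<Lambda> * (norm (fst (fst w) - y0))\<^sup>2"
        "0 <= C1 * (1 / time_scale (snd w))" "0 <= snd w / (10 * tk)"
        using time_scale_power6(1)[OF t] \<Lambda>(1) C1 t k(3) by (auto intro!: mult_nonneg_nonneg)
      then show "P w >= time_scale (snd w) ^ 15 * norm (fst (fst w) - snd (fst w)) ^ 4" "P w >= \<Lambda> * (norm (fst (fst w) - y0))\<^sup>2"
        "P w >= snd w / (10 * tk)" "P w >= 0" unfolding Pform by linarith+
    qed
    \<comment> \<open>A value of \<open>\<Phi>\<close> of at least \<open>2/5\<close> is incompatible with \<open>f = 0\<close> and with \<open>g\<close> minimal, by the ranges of \<open>f\<close> and \<open>g\<close>.\<close>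
    have contact: "\<exists>x1 t1 y2 t2. (x1, t1) \<in> interior S1 \<and> (y2, t2) \<in> interior S2 \<and>
        F (fst (fst w), snd w) = f (x1, t1) - (norm ((fst (fst w), snd w) - (x1, t1)))\<^sup>2 / (2 * \<iota>) \<and>
        G (snd (fst w), snd w) = g (y2, t2) - (norm ((snd (fst w), snd w) - (y2, t2)))\<^sup>2 / (2 * \<iota>) \<and>
        norm (x1 - fst (fst w)) < \<mu>0 \<and> \<bar>t1 - snd w\<bar> < \<mu>0 \<and> norm (y2 - snd (fst w)) < \<mu>0 \<and> \<bar>t2 - snd w\<bar> < \<mu>0 \<and>
        x1 \<in> \<Omega> \<and> 0 < t1 \<and> t1 <= 1 \<and> W (x1, t1) >= (3/5) * a \<and> y2 + \<delta> *\<^sub>R e \<in> \<Omega> \<and> 0 < t2 \<and> W (y2 + \<delta> *\<^sub>R e, t2) > - 1 \<and>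
        P w <= 1" if w: "w \<in> D" and \<Phi>w: "\<Phi> w >= 2/5" for w
    proof -
      define x where "x = fst (fst w)"
      define y where "y = snd (fst w)"
      define t where "t = snd w"
      note dw = Dw[OF w, folded x_def y_def t_def]
      obtain v1 where v1: "v1 \<in> S1" "F (x, t) = f v1 - (norm ((x, t) - v1))\<^sup>2 / (2 * \<iota>)"
        unfolding F_def using sup_conv_attained[OF fd] by metis
      obtain v2 where v2: "v2 \<in> S2" "G (y, t) = g v2 - (norm ((y, t) - v2))\<^sup>2 / (2 * \<iota>)"
        unfolding G_def using sup_conv_attained[OF gd] by metis
      have xS: "(x, t) \<in> S1" "(y, t) \<in> S2"
        using dw R1(1) ts(1) T(1) by (auto simp: S1_def S2_def dist_norm norm_minus_commute)
      have cl1: "(norm ((x, t) - v1))\<^sup>2 < \<mu>0\<^sup>2" "F (x, t) <= f v1"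
        using sup_conv_close[OF fd xS(1) f01(1) v1(1) v1(2)[unfolded F_def]] \<iota>(2) by (auto simp: F_def)
      have cl2: "(norm ((y, t) - v2))\<^sup>2 < \<mu>0\<^sup>2" "G (y, t) <= g v2"
        using sup_conv_close[OF gd xS(2) g01(1) v2(1) v2(2)[unfolded G_def]] \<iota>(2) by (auto simp: G_def)
      have n1: "norm ((x, t) - v1) < \<mu>0" by (rule power2_less_imp_less[OF cl1(1)]) (use \<mu>0(1) in simp)
      have n2: "norm ((y, t) - v2) < \<mu>0" by (rule power2_less_imp_less[OF cl2(1)]) (use \<mu>0(1) in simp)
      obtain x1 t1 where e1: "v1 = (x1, t1)" by (metis prod.collapse)
      obtain y2 t2 where e2: "v2 = (y2, t2)" by (metis prod.collapse)
      have d1: "norm (x1 - x) < \<mu>0" "\<bar>t1 - t\<bar> < \<mu>0"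
      proof -
        have "norm (x - x1) <= norm (x - x1, t - t1)" "norm (t - t1) <= norm (x - x1, t - t1)" by (rule norm_fst_le norm_snd_le)+
        then show "norm (x1 - x) < \<mu>0" "\<bar>t1 - t\<bar> < \<mu>0" using n1 by (simp_all add: e1 norm_minus_commute abs_minus_commute)
      qed
      have d2: "norm (y2 - y) < \<mu>0" "\<bar>t2 - t\<bar> < \<mu>0"
      proof -
        have "norm (y - y2) <= norm (y - y2, t - t2)" "norm (t - t2) <= norm (y - y2, t - t2)" by (rule norm_fst_le norm_snd_le)+
        then show "norm (y2 - y) < \<mu>0" "\<bar>t2 - t\<bar> < \<mu>0" using n2 by (simp_all add: e2 norm_minus_commute abs_minus_commute)
      qed
      have tt: "ts / 2 < t1" "t1 < 2 * T" "ts / 2 < t2" "t2 < 2 * T" using d1(2) d2(2) dw(3,4) \<mu>0(2) tsT by linarith+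
      have xi: "norm (x1 - y0) < R + R1 / 8" "norm (y2 - y0) < R2 + R1 / 8"
        using norm_triangle_ineq[of "x1 - x" "x - y0"] norm_triangle_ineq[of "y2 - y" "y - y0"] d1(1) d2(1) dw(1,2) \<mu>0(4) R1(1) by simp_all
      have int: "(x1, t1) \<in> interior S1" "(y2, t2) \<in> interior S2"
        unfolding S1_def S2_def interior_Times interior_cball interior_atLeastAtMost_real using xi tt by (simp_all add: dist_norm norm_minus_commute)
      have P: "P w >= 0" by (rule Pge(4)[OF w])
      have sum: "f v1 + g v2 - P w >= 2/5" using \<Phi>w cl1(2) cl2(2) by (simp add: \<Phi>_def x_def y_def t_def)
      have fv: "f v1 >= 2/5" using sum g01(2)[OF v2(1)] P by linarith
      have gv: "g v2 > - (441/400)" using sum f01(2)[OF v1(1)] P by linarith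
      have Pw: "P w <= 1" using sum f01(2)[OF v1(1)] g01(2)[OF v2(1)] by linarith
      have x1: "x1 \<in> \<Omega>" using fv by (auto simp: f_def e1 split: if_splits)
      have W1: "W (x1, t1) >= (3/5) * a"
      proof -
        have fe: "f v1 = (max (W (x1, t1)) 0 / a)\<^sup>2" using x1 by (simp add: f_def e1)
        have "(3/5 :: real)\<^sup>2 = 9/25" by (simp add: power2_eq_square)
        then have "(3/5)\<^sup>2 <= (max (W (x1, t1)) 0 / a)\<^sup>2" using fv unfolding fe by linarith
        then have "3/5 <= max (W (x1, t1)) 0 / a" by (rule power2_le_imp_le) (use a in simp)
        then have "(3/5) * a <= max (W (x1, t1)) 0" using a by (simp add: le_divide_eq)
        then show ?thesis using a by (auto simp: max_def split: if_splits)
      qed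
      have G0v: "G0 (y2 + \<delta> *\<^sub>R e, t2) > - 1"
      proof (rule ccontr)
        assume "\<not> ?thesis"
        then have "G0 (y2 + \<delta> *\<^sub>R e, t2) = - 1" unfolding G0_def by (auto split: if_splits)
        then have "g v2 = \<beta> * (- 1 - a')" by (simp add: g_def e2)
        then show False using gv \<beta>(2) by (simp add: algebra_simps)
      qed
      have y2: "y2 + \<delta> *\<^sub>R e \<in> \<Omega>" using G0v by (auto simp: G0_def split: if_splits)
      have W2: "W (y2 + \<delta> *\<^sub>R e, t2) > - 1" using G0v y2 by (auto simp: G0_def max_def split: if_splits)
      have "0 < t1" "t1 <= 1" "0 < t2" using tt ts(1) T(5) by linarith+
      then show ?thesis
        using int v1(2) v2(2) d1 d2 x1 W1 y2 W2 Pw unfolding e1 e2 x_def y_def t_def by blast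
    qed
    have Dint: "interior D = (ball y0 R \<times> ball y0 R2) \<times> {ts<..<T}"
      by (simp add: D_def interior_Times)
    have Dc: "compact D" by (simp add: D_def compact_Times)
    define z0 where "z0 = ((xk, xk - \<delta> *\<^sub>R e), tk)"
    have xk: "norm (xk - y0) < R / 10" using k(2) \<rho>(2) by linarith
    have z0D: "z0 \<in> D"
    proof -
      have "norm (xk - \<delta> *\<^sub>R e - y0) <= norm (xk - y0) + \<delta>"
        using norm_triangle_ineq4[of "xk - y0" "\<delta> *\<^sub>R e"] e \<delta>(1) by (simp add: algebra_simps)
      then have "norm (xk - \<delta> *\<^sub>R e - y0) <= R2" using xk \<delta>(3) R1(1) by (simp add: R_def R2_def)
      moreover have "norm (xk - y0) <= R" using xk R by linarith
      ultimately show ?thesis using ts(2) T(4) by (simp add: z0_def D_def dist_norm norm_minus_commute)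
    qed
    have \<Phi>z0: "\<Phi> z0 >= 11/20"
    proof -
      have S: "(xk, tk) \<in> S1" "(xk - \<delta> *\<^sub>R e, tk) \<in> S2"
        using Dw[OF z0D] R1(1) ts(1) T(1) by (auto simp: z0_def S1_def S2_def dist_norm norm_minus_commute)
      have "F (xk, tk) >= f (xk, tk)" unfolding F_def using sup_conv_ge[OF fd S(1), of "(xk, tk)"] by simp
      moreover have "f (xk, tk) >= (19/20)\<^sup>2"
      proof -
        have "19/20 <= max (W (xk, tk)) 0 / a" using k(5) a by (simp add: le_divide_eq max_def)
        then have "(19/20)\<^sup>2 <= (max (W (xk, tk)) 0 / a)\<^sup>2" by (intro power_mono) auto
        then show ?thesis using k(1) by (simp add: f_def)
      qed
      ultimately have F0: "F (xk, tk) >= 361/400" by (simp add: power2_eq_square)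
      have "G (xk - \<delta> *\<^sub>R e, tk) >= g (xk - \<delta> *\<^sub>R e, tk)" unfolding G_def using sup_conv_ge[OF gd S(2), of "(xk - \<delta> *\<^sub>R e, tk)"] by simp
      moreover have "g (xk - \<delta> *\<^sub>R e, tk) >= - (441/4000)"
      proof -
        have "G0 (xk, tk) >= (19/20) * a" using k(1,5) by (simp add: G0_def)
        then have "G0 (xk, tk) - a' >= - (a / 10)" by (simp add: a'_def)
        then have "\<beta> * - (a / 10) <= \<beta> * (G0 (xk, tk) - a')" using \<beta>(1) by (intro mult_left_mono) auto
        moreover have "\<beta> * (a / 10) <= \<beta> * (1 + a') / 10"
          using \<beta>(1) a by (simp add: a'_def)
        ultimately show ?thesis unfolding \<beta>(2) by (simp add: g_def)
      qed
      ultimately have G1: "G (xk - \<delta> *\<^sub>R e, tk) >= - (441/4000)" by linarith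
      have nd: "norm (\<delta> *\<^sub>R e) = \<delta>" using e \<delta>(1) by simp
      have "Jk ^ 15 * \<delta> ^ 4 <= 1/20"
      proof -
        have "\<delta> ^ 4 <= \<delta> ^ 1" using \<delta>(1,4) by (intro power_decreasing) auto
        then have "Jk ^ 15 * \<delta> ^ 4 <= Jk ^ 15 * (1 / (20 * Jk ^ 15))" using \<delta>(5) Jk by (intro mult_left_mono) auto
        also have "\<dots> = 1/20" using Jk by simp
        finally show ?thesis .
      qed
      moreover have "\<Lambda> * (norm (xk - y0))\<^sup>2 <= 1/50"
      proof -
        have "(norm (xk - y0))\<^sup>2 <= (R / 10)\<^sup>2" using xk by (intro power_mono) auto
        then have "\<Lambda> * (norm (xk - y0))\<^sup>2 <= \<Lambda> * (R / 10)\<^sup>2" using \<Lambda>(1) by (intro mult_left_mono) auto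
        also have "\<dots> = \<Lambda> * R\<^sup>2 / 100" by (simp add: power_divide)
        finally show ?thesis unfolding \<Lambda>(2) by simp
      qed
      moreover have "C1 * (1 / Jk) <= 1/20" using J0(2) Jk by (simp add: divide_le_eq)
      moreover have "tk / (10 * tk) = 1/10" using k(3) by simp
      moreover have "P z0 = Jk ^ 15 * \<delta> ^ 4 + \<Lambda> * (norm (xk - y0))\<^sup>2 + (C1 * (1 / Jk) + tk / (10 * tk))"
      proof -
        have zz: "fst (fst z0) = xk" "snd (fst z0) = xk - \<delta> *\<^sub>R e" "snd z0 = tk" "xk - (xk - \<delta> *\<^sub>R e) = \<delta> *\<^sub>R e"
          by (simp_all add: z0_def)
        show ?thesis unfolding Pform zz nd Jk_def ..
      qed
      ultimately have "P z0 <= 1/20 + 1/50 + (1/20 + 1/10)" by linarith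
      then show ?thesis using F0 G1 by (simp add: \<Phi>_def z0_def)
    qed
    have gap: "\<Phi> z <= \<Phi> z0 - 1/10" if z: "z \<in> frontier D" for z
    proof (rule ccontr)
      assume "\<not> ?thesis"
      then have big: "\<Phi> z >= 2/5" using \<Phi>z0 by linarith
      have zD: "z \<in> D" using z Dc by (simp add: frontier_def compact_imp_closed)
      have zi: "z \<notin> interior D" using z by (simp add: frontier_def)
      define x where "x = fst (fst z)"
      define y where "y = snd (fst z)"
      define t where "t = snd z"
      note dz = Dw[OF zD, folded x_def y_def t_def]
      have t0: "t > 0" using dz(3) ts(1) by linarith
      obtain x1 t1 y2 t2 where c: "norm (x1 - x) < \<mu>0" "\<bar>t1 - t\<bar> < \<mu>0" "norm (y2 - y) < \<mu>0" "x1 \<in> \<Omega>" "0 < t1" "t1 <= 1"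
        "W (x1, t1) >= (3/5) * a" "y2 + \<delta> *\<^sub>R e \<in> \<Omega>" "P z <= 1"
        using contact[OF zD big] unfolding x_def y_def t_def by blast
      note Pz = Pge[OF zD, folded x_def y_def t_def]
      have J: "time_scale t >= J0" by (rule JT[OF t0 dz(4)])
      have pow15: "time_scale t <= time_scale t ^ 15" using J J0(1) power_increasing[of 1 15 "time_scale t"] by simp
      have zform: "z = ((x, y), t)" by (simp add: x_def y_def t_def)
      have "\<not> (norm (x - y0) < R \<and> norm (y - y0) < R2 \<and> ts < t \<and> t < T)"
      proof
        assume "norm (x - y0) < R \<and> norm (y - y0) < R2 \<and> ts < t \<and> t < T"
        then have "((x, y), t) \<in> interior D" unfolding Dint by (simp add: dist_norm norm_minus_commute)
        then show False using zi by (simp add: zform)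
      qed
      then have "norm (x - y0) = R \<or> (norm (x - y0) < R \<and> norm (y - y0) = R2) \<or> t = T \<or> t = ts"
        using dz by (smt (verit))
      then consider "norm (x - y0) = R" | "norm (x - y0) < R" "norm (y - y0) = R2" | "t = T" | "t = ts" by blast
      then show False
      proof cases
        case 1
        then show False using Pz(2) \<Lambda>(2) c(9) by simp
      next
        case 2
        have "norm (y - y0) <= norm (x - y0) + norm (x - y)"
          using norm_triangle_ineq4[of "x - y0" "x - y"] by simp
        then have "R1 / 4 <= norm (x - y)" using 2 by (simp add: R_def R2_def)
        then have "(R1 / 4) ^ 4 <= norm (x - y) ^ 4" using R1(1) by (intro power_mono) auto
        moreover have "2 / (R1 / 4) ^ 4 <= time_scale t ^ 15" using J J0(3) pow15 by linarith
        ultimately have "2 / (R1 / 4) ^ 4 * (R1 / 4) ^ 4 <= time_scale t ^ 15 * norm (x - y) ^ 4"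
          using R1(1) J J0(1) by (intro mult_mono) auto
        then show False using Pz(1) c(9) R1(1) by simp
      next
        case 3
        then have "t / (10 * tk) = 1" using k(3) by (simp add: T_def)
        have "P z > t / (10 * tk)"
        proof -
          have "C1 * (1 / time_scale t) > 0" using C1 J J0(1) by simp
          moreover have "0 <= time_scale t ^ 15 * norm (x - y) ^ 4" "0 <= \<Lambda> * (norm (x - y0))\<^sup>2"
            using J J0(1) \<Lambda>(1) by auto
          ultimately show ?thesis unfolding Pform x_def y_def t_def by linarith
        qed
        then show False using c(9) \<open>t / (10 * tk) = 1\<close> by linarith
      next
        case 4
        have J1t: "time_scale t >= J1" unfolding 4 by (rule time_scale_ge) (use ts J1(1) in auto)
        have xy: "norm (x - y) < \<Psi> / 4"
        proof (rule ccontr)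
          assume "\<not> ?thesis"
          then have "(\<Psi> / 4) ^ 4 <= norm (x - y) ^ 4" using \<Psi>(1) by (intro power_mono) auto
          moreover have "2 / (\<Psi> / 4) ^ 4 <= time_scale t ^ 15" using J1t J1(2) pow15 by linarith
          ultimately have "2 / (\<Psi> / 4) ^ 4 * (\<Psi> / 4) ^ 4 <= time_scale t ^ 15 * norm (x - y) ^ 4"
            using \<Psi>(1) J J0(1) by (intro mult_mono) auto
          then show False using Pz(1) c(9) \<Psi>(1) by simp
        qed
        have "t1 <= (\<Psi> / (8 * K))\<^sup>2" using c(2) \<mu>0(2) ts(4) 4 ts(1) by linarith
        then have "sqrt t1 <= \<Psi> / (8 * K)" using \<Psi>(1) K(1) by (intro real_le_lsqrt) auto
        then have "K * sqrt t1 <= K * (\<Psi> / (8 * K))" using K(1) by (intro mult_left_mono) auto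
        then have "infdist x1 (frontier \<Omega>) <= \<Psi> / 8" using K(2)[OF c(4-7)] K(1) by simp
        obtain q where q: "q \<in> frontier \<Omega>" "infdist x1 (frontier \<Omega>) = dist x1 q"
          using infdist_attains_inf[of "frontier \<Omega>" x1] y0 by (auto simp: frontier_closed)
        then have xq: "norm (x1 - q) <= \<Psi> / 8" using \<open>infdist x1 (frontier \<Omega>) <= \<Psi> / 8\<close> by (simp add: dist_norm)
        have "norm (q - y0) = norm ((x1 - x) + (x - y0) - (x1 - q))" by simp
        also have "\<dots> <= norm (x1 - x) + norm (x - y0) + norm (x1 - q)"
          by (meson add_right_mono norm_triangle_ineq norm_triangle_ineq4 order_trans)
        also have "\<dots> < r / 2"
        proof -
          have "\<Psi> / 8 <= R1 / 8" using \<Psi>(2) \<delta>(3) R1(1) by linarith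
          then show ?thesis using c(1) \<mu>0(4) dz(1) xq R1(1,3) by (simp add: R_def)
        qed
        finally have "\<Psi> <= norm (y2 + \<delta> *\<^sub>R e - (q + \<delta> *\<^sub>R e))"
          unfolding \<Psi>_def using ext[OF q(1) _ \<delta>(1,2) c(8)] by simp
        also have "\<dots> = norm ((y2 - y) - (x - y) - (x1 - x) + (x1 - q))" by simp
        also have "\<dots> <= norm (y2 - y) + norm (x - y) + norm (x1 - x) + norm (x1 - q)"
          by (meson add_right_mono norm_triangle_ineq norm_triangle_ineq4 order_trans)
        finally show False using c(1,3) xy xq \<mu>0(3) \<Psi>(1) by linarith
      qed
    qed
    have Drho: "snd w \<in> {ts..T} \<and> norm (fst (fst w) - snd (fst w)) <= R + R2" if "w \<in> D" for w
      using Dw[OF that] norm_triangle_ineq4[of "fst (fst w) - y0" "snd (fst w) - y0"] by simp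
    have lamb: "0 <= lam t \<and> lam t <= KK" "\<bar>lam' t\<bar> <= KK" if "t \<in> {ts..T}" for t
      using Kl(4,5)[OF that] KK(2) time_scale_power6(1)[OF posT[OF that]] by (auto simp: lam_def abs_le_iff)
    have tay: "\<bar>lam t - lam s - lam' s * (t - s)\<bar> <= KK * (t - s)\<^sup>2" "\<bar>mu t - mu s - mu' s * (t - s)\<bar> <= KK * (t - s)\<^sup>2"
      "\<bar>lam t - lam s\<bar> <= KK * \<bar>t - s\<bar>" if st: "s \<in> {ts..T}" "t \<in> {ts..T}" for s t
    proof -
      have "Kl * (t - s)\<^sup>2 <= KK * (t - s)\<^sup>2" "Km * (t - s)\<^sup>2 <= KK * (t - s)\<^sup>2" "Kl * \<bar>t - s\<bar> <= KK * \<bar>t - s\<bar>"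
        using KK by (auto intro!: mult_right_mono)
      then show "\<bar>lam t - lam s - lam' s * (t - s)\<bar> <= KK * (t - s)\<^sup>2" "\<bar>mu t - mu s - mu' s * (t - s)\<bar> <= KK * (t - s)\<^sup>2"
        "\<bar>lam t - lam s\<bar> <= KK * \<bar>t - s\<bar>" using Kl(2,3)[OF st] Km(2)[OF st] by linarith+
    qed
    have contlm: "continuous_on {ts..T} lam" "continuous_on {ts..T} mu"
    proof -
      show "continuous_on {ts..T} lam" unfolding lam_def by (intro continuous_intros contJ)
      have "time_scale t \<noteq> 0" if "t \<in> {ts..T}" for t using time_scale_power6(1)[OF posT[OF that]] by simp
      then show "continuous_on {ts..T} mu" unfolding mu_def using k(3) by (intro continuous_intros contJ) auto
    qed
    have RR: "R + R2 >= 0" "\<Lambda> >= 0" using R R1 \<Lambda>(1) by (auto simp: R2_def)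
    obtain x y t \<xi>1 \<alpha>1 B1 \<xi>2 \<alpha>2 B2 q1 q2 q3 where H: "((x, y), t) \<in> interior D" "\<Phi> z0 - 1/10 <= \<Phi> ((x, y), t)"
      "linear B1" "linear B2" "peano2 F (x, t) (\<xi>1, \<alpha>1) B1" "peano2 G (y, t) (\<xi>2, \<alpha>2) B2"
      "norm q1 <= 1" "norm q2 <= 1" "\<bar>q3\<bar> <= 1"
      "\<xi>1 = (4 * lam t * (norm (x - y))\<^sup>2) *\<^sub>R (x - y) + (2 * \<Lambda>) *\<^sub>R (x - y0) + q1"
      "\<xi>2 = - ((4 * lam t * (norm (x - y))\<^sup>2) *\<^sub>R (x - y)) + q2"
      "\<alpha>1 + \<alpha>2 = lam' t * norm (x - y) ^ 4 + mu' t + q3"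
      "!!h1 h2. (h1, 0) \<bullet> B1 (h1, 0) + (h2, 0) \<bullet> B2 (h2, 0)
        <= 12 * lam t * (norm (x - y))\<^sup>2 * (norm (h1 - h2))\<^sup>2 + 2 * \<Lambda> * (norm h1)\<^sup>2"
      using doubling_jets[where T="{ts..T}" and lam=lam and lam'=lam' and mu=mu and mu'=mu' and K=KK and D=D and \<rho>="R + R2"
        and \<Lambda>=\<Lambda> and ?y0.0=y0 and \<gamma>="1/10" and ?z0.0=z0, OF tay(1) tay(2) lamb tay(3) contlm Dc Drho KK(1) RR(2,1) fd gd z0D _
          gap[unfolded \<Phi>_def[abs_def] F_def G_def P_def]]
      unfolding \<Phi>_def[abs_def] F_def G_def P_def by auto
    have zD: "((x, y), t) \<in> D" using H(1) interior_subset by blast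
    have "\<Phi> ((x, y), t) >= 2/5" using H(2) \<Phi>z0 by linarith
    from contact[OF zD this] obtain x1 t1 y2 t2 where c: "(x1, t1) \<in> interior S1" "(y2, t2) \<in> interior S2"
        "F (x, t) = f (x1, t1) - (norm ((x, t) - (x1, t1)))\<^sup>2 / (2 * \<iota>)"
        "G (y, t) = g (y2, t2) - (norm ((y, t) - (y2, t2)))\<^sup>2 / (2 * \<iota>)"
        "x1 \<in> \<Omega>" "0 < t1" "W (x1, t1) >= (3/5) * a" "y2 + \<delta> *\<^sub>R e \<in> \<Omega>" "0 < t2" "W (y2 + \<delta> *\<^sub>R e, t2) > - 1"
      by auto
    define Q1 where "Q1 h = h \<bullet> B1 h" for h
    define Q2 where "Q2 h = h \<bullet> B2 h" for h
    have qf: "qform Q1" "qform Q2" using qformI[OF H(3)] qformI[OF H(4)] by (auto simp: Q1_def Q2_def)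
    have "upper_jet F (x, t) (\<xi>1, \<alpha>1) Q1" unfolding Q1_def[abs_def] by (rule peano2_upper_jet[OF H(5)])
    then have jf: "upper_jet f (x1, t1) (\<xi>1, \<alpha>1) Q1"
      using sup_conv_jet[OF fd _ c(1) c(3)[unfolded F_def]] unfolding F_def by blast
    have "upper_jet G (y, t) (\<xi>2, \<alpha>2) Q2" unfolding Q2_def[abs_def] by (rule peano2_upper_jet[OF H(6)])
    then have jg: "upper_jet g (y2, t2) (\<xi>2, \<alpha>2) Q2"
      using sup_conv_jet[OF gd _ c(2) c(4)[unfolded G_def]] unfolding G_def by blast
    have W1pos: "W (x1, t1) > 0" using c(7) a by (meson less_le_trans mult_pos_pos zero_less_divide_iff zero_less_numeral)
    have pj1: "pde_jet p \<kappa> \<xi>1 \<alpha>1 Q1"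
    proof (rule pde_jet_weaken)
      show "pde_jet p ((1 - recip p) / (2 * f (x1, t1))) \<xi>1 \<alpha>1 Q1"
        by (rule square_subsolution_jet[OF p sj op c(5,6) a _ W1pos qf(1) jf]) (simp add: f_def)
      have "f (x1, t1) <= 441/400" using f01(2)[of "(x1, t1)"] c(1) interior_subset by blast
      moreover have "f (x1, t1) > 0" using W1pos a c(5) by (simp add: f_def)
      ultimately show "\<kappa> <= (1 - recip p) / (2 * f (x1, t1))" unfolding \<kappa>_def b_def[symmetric] using b by (intro divide_left_mono) auto
    qed
    have pj2: "pde_jet p 0 \<xi>2 \<alpha>2 Q2"
      by (rule truncated_shift_jet[where a'=a' and m="- 1", OF p sj op c(8,9) \<beta>(1) _ c(10) qf(2) jg]) (simp add: g_def G0_def)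
    define j where "j = time_scale t"
    have tt: "0 < t" "t <= T" using Dw(3,4)[OF zD] ts(1) by auto
    have j: "j >= 1" using JT[OF tt] J0(1) by (simp add: j_def)
    have e1: "norm ((2 * \<Lambda>) *\<^sub>R (x - y0) + q1) <= \<eta>"
    proof -
      have "norm ((2 * \<Lambda>) *\<^sub>R (x - y0) + q1) <= 2 * \<Lambda> * norm (x - y0) + norm q1"
        using norm_triangle_ineq[of "(2 * \<Lambda>) *\<^sub>R (x - y0)" q1] \<Lambda>(1) by simp
      also have "\<dots> <= 2 * \<Lambda> * R + 1" using Dw(1)[OF zD] H(7) \<Lambda>(1) by (intro add_mono mult_left_mono) auto
      finally show ?thesis by (simp add: \<eta>_def)
    qed
    have e2: "norm q2 <= \<eta>" using H(8) \<eta> by linarith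
    have "\<alpha>1 + \<alpha>2 + (5/2) * (j ^ 21 * norm (x - y) ^ 4)
     <= (24 * \<eta>\<^sup>2 * trace_const p TYPE('n) + 2 * \<Lambda> * trace_const p TYPE('n) + (5/2) * \<eta> ^ 4 + 96 * real CARD('n) * \<eta> + (5/2) * (5 / (8 * \<kappa>))\<^sup>2) * j ^ 5"
    proof (rule coupled_jets_estimate[OF p qf \<kappa> pj1 pj2 j \<eta> RR(2) _ _ e1 e2])
      show "\<xi>1 = (4 * j ^ 15 * (norm (x - y))\<^sup>2) *\<^sub>R (x - y) + ((2 * \<Lambda>) *\<^sub>R (x - y0) + q1)"
        using H(10) by (simp add: lam_def j_def add.assoc)
      show "\<xi>2 = - ((4 * j ^ 15 * (norm (x - y))\<^sup>2) *\<^sub>R (x - y)) + q2" using H(11) by (simp add: lam_def j_def)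
      show "Q1 (h1, 0) + Q2 (h2, 0) <= 12 * j ^ 15 * (norm (x - y))\<^sup>2 * (norm (h1 - h2))\<^sup>2 + 2 * \<Lambda> * (norm h1)\<^sup>2" for h1 h2
        using H(13)[of h1 h2] by (simp add: Q1_def Q2_def lam_def j_def)
    qed
    then have up: "\<alpha>1 + \<alpha>2 + (5/2) * (j ^ 21 * norm (x - y) ^ 4) <= CC * j ^ 5" by (simp add: CC_def cp_def)
    have "\<alpha>1 + \<alpha>2 = - (5/2) * (j ^ 21 * norm (x - y) ^ 4) + ((CC + 3) * j ^ 5 + 1 / (10 * tk)) + q3"
    proof -
      have "C1 * ((1/6) * j ^ 5) = (CC + 3) * j ^ 5" by (simp add: C1_def algebra_simps)
      moreover have "lam' t * norm (x - y) ^ 4 = - (5/2) * (j ^ 21 * norm (x - y) ^ 4)" by (simp add: lam'_def j_def)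
      ultimately show ?thesis unfolding H(12) mu'_def j_def by simp
    qed
    moreover have "1 / (10 * tk) > 0" using k(3) by simp
    moreover have "j ^ 5 >= 1" using j by simp
    ultimately show False using up H(9) unfolding distrib_right abs_le_iff by linarith
  qed
  then have "a < \<eta>0" using a0 \<eta>0 by linarith
  then obtain c where c: "c \<in> A" "c < \<eta>0" using above by blast
  then show ?thesis unfolding A_def by fastforce
qed

section \<open>Short-time asymptotics\<close>

lemma conj_exp_eq:
  assumes "1 < p" shows "conj_exp p = 1 / (1 - recip p)"
proof (cases p)
  case (real s)
  then have s: "s > 1" using assms by simp
  have q: "recip p = 1 / s" using s unfolding recip_def real by (simp add: one_ereal_def)
  have c: "conj_exp p = s / (s - 1)" by (simp add: conj_exp_def real)
  show ?thesis unfolding c q using s by (simp add: field_simps)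
next
  case PInf
  then show ?thesis by (simp add: conj_exp_def recip_def)
next
  case MInf
  then show ?thesis using assms by simp
qed

lemma bounded_solution_boundary_limits:
  assumes "bounded_solution p \<Omega> u"
  shows "!!x. x \<in> \<Omega> ==> (u \<longlongrightarrow> 0) (at (x, 0) within \<Omega> \<times> {0<..})"
    and "!!y s. y \<in> frontier \<Omega> ==> s > 0 ==> (u \<longlongrightarrow> 1) (at (y, s) within \<Omega> \<times> {0<..})"
proof -
  have sub: "\<Omega> \<times> {0<..} \<subseteq> closure \<Omega> \<times> {0::real..}" using closure_subset[of \<Omega>] by auto
  have c: "(u \<longlongrightarrow> u z) (at z within \<Omega> \<times> {0<..})" if "z \<in> \<Omega> \<times> {0} \<union> frontier \<Omega> \<times> {0<..}" for z
  proof -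
    have "continuous (at z within closure \<Omega> \<times> {0..}) u" using assms that unfolding bounded_solution_def by blast
    then have "(u \<longlongrightarrow> u z) (at z within closure \<Omega> \<times> {0..})" by (simp add: continuous_within)
    then show ?thesis by (rule tendsto_within_subset[OF _ sub])
  qed
  have v: "\<forall>x\<in>\<Omega>. u (x, 0) = 0" "\<forall>x\<in>frontier \<Omega>. \<forall>t>0. u (x, t) = 1" using assms by (auto simp: bounded_solution_def)
  show "(u \<longlongrightarrow> 0) (at (x, 0) within \<Omega> \<times> {0<..})" if "x \<in> \<Omega>" for x
    using c[of "(x, 0)"] v(1) that by simp
  show "(u \<longlongrightarrow> 1) (at (y, s) within \<Omega> \<times> {0<..})" if "y \<in> frontier \<Omega>" "s > 0" for y s
    using c[of "(y, s)"] v(2) that by simp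
qed

lemma bounded_solution_regularity:
  fixes u :: "(real^'n) \<times> real => real"
  assumes p: "1 < p" and bs: "bounded_solution p \<Omega> u"
  obtains M where "M > 0" "!!w. w \<in> \<Omega> \<times> {0<..} ==> \<bar>u w\<bar> <= M"
    "subsol_jets p \<Omega> u" "subsol_jets p \<Omega> (\<lambda>w. - u w)" "usc_on (\<Omega> \<times> {0<..}) u" "usc_on (\<Omega> \<times> {0<..}) (\<lambda>w. - u w)"
proof -
  have "bounded (u ` (\<Omega> \<times> {0<..}))" using bs by (simp add: bounded_solution_def)
  then obtain M where M: "M > 0" "!!w. w \<in> \<Omega> \<times> {0<..} ==> \<bar>u w\<bar> <= M" unfolding bounded_pos by auto
  have vs: "viscosity_solution p \<Omega> u" using bs by (simp add: bounded_solution_def)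
  have usc: "usc_on (\<Omega> \<times> {0<..}) u" and lsc: "lsc_on (\<Omega> \<times> {0<..}) u"
    using vs by (simp_all add: viscosity_solution_def viscosity_subsolution_def viscosity_supersolution_def)
  have "usc_on (\<Omega> \<times> {0<..}) (\<lambda>w. - u w)" unfolding usc_on_def
  proof (intro ballI allI impI)
    fix z c assume z: "z \<in> \<Omega> \<times> {0<..}" "- u z < c"
    then have "- c < u z" by linarith
    then have "\<forall>\<^sub>F w in at z within \<Omega> \<times> {0<..}. - c < u w" using lsc z(1) unfolding lsc_on_def by blast
    then show "\<forall>\<^sub>F w in at z within \<Omega> \<times> {0<..}. - u w < c" by eventually_elim linarith
  qed
  then show thesis using that[OF M viscosity_solution_jets[OF p vs M(2)] usc] by blast
qed

text \<open>
  The corners are part of the boundary of \<open>\<Omega> \<times> (0, \<infinity>)\<close>; with their upper limits under control the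
  maximum principle applies to \<open>- u\<close>.
\<close>

lemma bounded_solution_nonneg:
  fixes u :: "(real^'n) \<times> real => real"
  assumes p: "1 < p" and op: "open \<Omega>" and md: "modulus \<omega>" and cls: "class_C0 r \<omega> \<Omega>" and bs: "bounded_solution p \<Omega> u"
    and w: "w \<in> \<Omega> \<times> {0<..}"
  shows "0 <= u w"
proof -
  obtain M where M: "M > 0" "!!w. w \<in> \<Omega> \<times> {0<..} ==> \<bar>u w\<bar> <= M" and sj: "subsol_jets p \<Omega> (\<lambda>w. - u w)"
    and usc: "usc_on (\<Omega> \<times> {0<..}) (\<lambda>w. - u w)"
    using bounded_solution_regularity[OF p bs] by metis
  note lim = bounded_solution_boundary_limits[OF bs]
  have up: "- u w <= M" if "w \<in> \<Omega> \<times> {0<..}" for w using M(2)[OF that] by linarith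
  have init: "\<forall>\<^sub>F w in at (x, 0) within \<Omega> \<times> {0<..}. - u w < \<eta>" if "x \<in> \<Omega>" "\<eta> > 0" for x \<eta>
    by (rule order_tendstoD(2)[OF tendsto_minus[OF lim(1)[OF that(1)]]]) (use that in simp)
  have lat: "\<forall>\<^sub>F w in at (y, s) within \<Omega> \<times> {0<..}. - u w < - 1 + \<eta>" if "y \<in> frontier \<Omega>" "s > 0" "\<eta> > 0" for y s \<eta>
    by (rule order_tendstoD(2)[OF tendsto_minus[OF lim(2)[OF that(1,2)]]]) (use that in simp)
  have "- u w <= 0"
  proof (rule max_principle_zero[OF p sj op up usc _ w])
    fix z :: "(real^'n) \<times> real" and \<eta> :: real
    assume z: "z \<in> closure (\<Omega> \<times> {0<..}) - \<Omega> \<times> {0<..}" and \<eta>: "\<eta> > 0"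
    obtain x t where xt: "z = (x, t)" by (metis prod.collapse)
    have cl: "x \<in> closure \<Omega>" "t >= 0" using z by (auto simp: xt closure_Times)
    show "\<forall>\<^sub>F w in at z within \<Omega> \<times> {0<..}. - u w < \<eta>"
    proof (cases "x \<in> \<Omega>")
      case True
      then have "t = 0" using z cl by (auto simp: xt)
      then show ?thesis using init[OF True \<eta>] by (simp add: xt)
    next
      case False
      then have fr: "x \<in> frontier \<Omega>" using cl op by (simp add: frontier_def interior_open)
      show ?thesis
      proof (cases "t = 0")
        case True
        obtain R where R: "R > 0" "\<forall>x'\<in>\<Omega>. \<forall>t. norm (x' - x) < R --> 0 < t --> t < R --> - u (x', t) < \<eta>"
          using corner_limsup_nonpos[OF p sj op M(1) up usc init lat cls md fr \<eta>] by blast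
        show ?thesis unfolding eventually_at
        proof (intro exI[of _ R] conjI ballI impI)
          fix w assume w: "w \<in> \<Omega> \<times> {0<..}" "w \<noteq> z \<and> dist w z < R"
          obtain x' t' where e: "w = (x', t')" by (metis prod.collapse)
          have "norm (x' - x) <= norm (x' - x, t')" "norm t' <= norm (x' - x, t')" by (rule norm_fst_le norm_snd_le)+
          moreover have "norm (x' - x, t') < R" using conjunct2[OF w(2)] by (simp add: e xt True dist_norm)
          ultimately have "norm (x' - x) < R" "t' < R" unfolding real_norm_def by linarith+
          then show "- u w < \<eta>" using R(2) w(1) by (simp add: e)
        qed (rule R(1))
      next
        case False
        then have "t > 0" using cl by simp
        from lat[OF fr this \<eta>] show ?thesis unfolding xt by eventually_elim linarith
      qed
    qed
  qed
  then show ?thesis by simp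
qed

text \<open>
  Since \<open>\<psi>\<^sub>\<omega>(t) \<le> t\<close>, both \<open>t\<close> and \<open>t log t\<close> are \<open>O(t log \<psi>\<^sub>\<omega>(t))\<close> and all errors other
  than the one from the exterior ball are absorbed.
\<close>

lemma short_time_estimate:
  fixes u :: "(real^'n) \<times> real => real"
  assumes p: "1 < p" and op: "open \<Omega>" and \<Gamma>: "frontier \<Omega> \<noteq> {}" and md: "modulus \<omega>" and cls: "class_C0 r \<omega> \<Omega>"
    and bs: "bounded_solution p \<Omega> u" and Dm: "Dm >= 0"
  obtains C t1 where "C >= 0" "t1 > 0"
    "!!x t. x \<in> \<Omega> ==> infdist x (frontier \<Omega>) <= Dm ==> 0 < t ==> t < t1 ==>
       u (x, t) > 0 \<and> \<bar>4 * t * ln (u (x, t)) + conj_exp p * (infdist x (frontier \<Omega>))\<^sup>2\<bar> <= C * \<bar>t * ln (psi r \<omega> t)\<bar>"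
proof -
  have r: "r > 0" using cls by (simp add: class_C0_def)
  obtain M where M: "M > 0" "!!w. w \<in> \<Omega> \<times> {0<..} ==> \<bar>u w\<bar> <= M" and sj: "subsol_jets p \<Omega> u" "subsol_jets p \<Omega> (\<lambda>w. - u w)"
    and usc: "usc_on (\<Omega> \<times> {0<..}) u" "usc_on (\<Omega> \<times> {0<..}) (\<lambda>w. - u w)"
    using bounded_solution_regularity[OF p bs] by metis
  note lim = bounded_solution_boundary_limits[OF bs]
  have up: "u w <= M" if "w \<in> \<Omega> \<times> {0<..}" for w using M(2)[OF that] by linarith
  have init: "\<forall>\<^sub>F w in at (x, 0) within \<Omega> \<times> {0<..}. u w < \<eta>" if "x \<in> \<Omega>" "\<eta> > 0" for x \<eta>
    by (rule order_tendstoD(2)[OF lim(1)[OF that(1)] that(2)])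
  have lat: "\<forall>\<^sub>F w in at (y, s) within \<Omega> \<times> {0<..}. 1 - \<eta> < u w" if "y \<in> frontier \<Omega>" "s > 0" "\<eta> > 0" for y s \<eta>
    by (rule order_tendstoD(1)[OF lim(2)[OF that(1,2)]]) (use that in simp)
  note nonneg = bounded_solution_nonneg[OF p op md cls bs]
  define b where "b = 1 - recip p"
  define m where "m = trace_const p TYPE('n) / (1 - recip p)"
  define A where "A = m\<^sup>2 + 2 * m"
  have b: "b > 0" using recip_bounds[OF p] by (simp add: b_def)
  have cp: "trace_const p TYPE('n) > 0" by (rule trace_const_pos[OF p])
  have m: "m > 0" using cp b unfolding m_def b_def by simp
  have A: "A > 0" unfolding A_def using m by (intro add_nonneg_pos) auto
  define \<beta> where "\<beta> = trace_const p TYPE('n) / (2 * b) + 1"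
  have \<beta>: "\<beta> > trace_const p TYPE('n) / (2 * (1 - recip p))" "\<beta> > 0" using cp b by (auto simp: \<beta>_def b_def add_pos_pos)
  define c where "c = Dm\<^sup>2 / (2 * b * A)"
  have c: "c >= 0" using b A by (simp add: c_def)
  define E1 where "E1 = \<bar>ln M\<bar> + 1 + A + (m / 2) * ln (1 + c\<^sup>2)"
  have lc: "ln (1 + c\<^sup>2) >= 0" by (intro ln_ge_zero) simp
  have E1: "E1 >= 0" unfolding E1_def using A m lc by simp
  define E2 where "E2 = 8 * \<beta> + 4 * \<beta> * \<bar>ln (4 * b * \<beta>)\<bar> + (2 * Dm + 1) / b"
  have E2: "E2 >= 0" unfolding E2_def using \<beta>(2) b Dm by simp
  define C where "C = E2 + (4 * E1 + 4 * m)"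
  define t1 where "t1 = min (r / 4) (exp (- 1))"
  show thesis
  proof (rule that[of C t1])
    show "C >= 0" using E1 E2 m by (simp add: C_def)
    show "t1 > 0" using r by (simp add: t1_def)
    fix x t assume x: "x \<in> \<Omega>" and dD: "infdist x (frontier \<Omega>) <= Dm" and t: "0 < t" "t < t1"
    define d where "d = infdist x (frontier \<Omega>)"
    have d: "0 <= d" "d <= Dm" using dD by (simp_all add: d_def infdist_nonneg)
    have t4: "t < r / 4" "t < exp (- 1)" using t by (auto simp: t1_def)
    have t1': "t < 1" using t4(2) by (meson exp_le_one_iff less_le_trans neg_le_0_iff_le zero_le_one)
    define \<psi> where "\<psi> = psi r \<omega> t"
    have \<psi>: "0 < \<psi>" "\<psi> <= t" using psi_bounds(1,2)[OF md r t(1)] by (auto simp: \<psi>_def)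
    have lt: "ln t < - 1" using t(1) t4(2) by (metis ln_exp ln_less_cancel_iff exp_gt_zero)
    have l\<psi>: "ln \<psi> <= ln t" using \<psi> by (intro ln_mono) auto
    define l where "l = - ln \<psi>"
    have l: "l >= 1" "- ln t <= l" "\<bar>t * ln \<psi>\<bar> = t * l" using lt l\<psi> t(1) by (auto simp: l_def abs_mult)
    have tl: "t <= t * l" using l(1) t(1) by simp
    have Ctl: "k * t <= k * (t * l)" if "k >= 0" for k using tl that by (rule mult_left_mono)
    obtain y where y: "y \<in> frontier \<Omega>" "infdist x (frontier \<Omega>) = dist x y"
      using infdist_attains_inf[of "frontier \<Omega>" x] \<Gamma> by (auto simp: frontier_closed)
    obtain e where e: "norm e = 1"
      and ext: "!!q \<delta> w. q \<in> frontier \<Omega> ==> norm (q - y) < r / 2 ==> 0 < \<delta> ==> \<delta> < r / 4 ==> w \<in> \<Omega> ==>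
         psi r \<omega> \<delta> <= norm (w - (q + \<delta> *\<^sub>R e))"
      using exterior_ball[OF cls md y(1)] by metis
    define z where "z = y + t *\<^sub>R e"
    have R: "\<psi> <= norm (w - z)" if "w \<in> \<Omega>" for w
      unfolding \<psi>_def z_def by (rule ext[OF y(1) _ t(1) t4(1) that]) (use r in simp)
    have low: "exp (\<beta> * ln (\<psi>\<^sup>2 / (4 * b * \<beta> * t)) - (norm (x - z))\<^sup>2 / (4 * b * t)) <= u (x, t)"
      using exterior_ball_lower[OF p sj(2) op usc(2) nonneg lat \<psi>(1) R \<beta>(1) x t(1)] by (simp add: b_def)
    then have upos: "u (x, t) > 0" using exp_gt_zero less_le_trans by blast
    have "\<beta> * ln (\<psi>\<^sup>2 / (4 * b * \<beta> * t)) - (norm (x - z))\<^sup>2 / (4 * b * t) <= ln (u (x, t))"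
      using low upos by (simp add: ln_ge_iff)
    moreover have "(norm (x - z))\<^sup>2 <= d\<^sup>2 + (2 * Dm + 1) * t"
    proof -
      have "norm (x - z) <= norm (x - y) + norm (t *\<^sub>R e)" using norm_triangle_ineq4[of "x - y" "t *\<^sub>R e"] by (simp add: z_def algebra_simps)
      then have "norm (x - z) <= d + t" using y(2) e t(1) by (simp add: d_def dist_norm)
      then have "(norm (x - z))\<^sup>2 <= (d + t)\<^sup>2" by (intro power_mono) auto
      also have "\<dots> = d\<^sup>2 + (2 * d + t) * t" by (simp add: power2_eq_square algebra_simps)
      also have "\<dots> <= d\<^sup>2 + (2 * Dm + 1) * t" using d t(1) t1' by (intro add_left_mono mult_right_mono) auto
      finally show ?thesis .
    qed
    then have "(norm (x - z))\<^sup>2 / (4 * b * t) <= (d\<^sup>2 + (2 * Dm + 1) * t) / (4 * b * t)" using b t(1) by (intro divide_right_mono) auto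
    moreover have "ln (\<psi>\<^sup>2 / (4 * b * \<beta> * t)) = - 2 * l - ln (4 * b * \<beta>) - ln t"
    proof -
      have "ln (\<psi>\<^sup>2 / (4 * b * \<beta> * t)) = ln (\<psi>\<^sup>2) - ln (4 * b * \<beta> * t)" using \<psi> b \<beta>(2) t(1) by (intro ln_divide_pos) auto
      moreover have "ln (4 * b * \<beta> * t) = ln (4 * b * \<beta>) + ln t" using b \<beta>(2) t(1) by (intro ln_mult_pos) auto
      moreover have "ln (\<psi>\<^sup>2) = - 2 * l" using \<psi> by (simp add: l_def ln_realpow)
      ultimately show ?thesis by simp
    qed
    ultimately have "\<beta> * (- 2 * l - ln (4 * b * \<beta>) - ln t) - (d\<^sup>2 + (2 * Dm + 1) * t) / (4 * b * t) <= ln (u (x, t))" by simp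
    then have "4 * t * (\<beta> * (- 2 * l - ln (4 * b * \<beta>) - ln t) - (d\<^sup>2 + (2 * Dm + 1) * t) / (4 * b * t)) <= 4 * t * ln (u (x, t))"
      using t(1) by (intro mult_left_mono) auto
    moreover have "4 * t * (\<beta> * (- 2 * l - ln (4 * b * \<beta>) - ln t) - (d\<^sup>2 + (2 * Dm + 1) * t) / (4 * b * t))
        = - (8 * \<beta> * (t * l)) - 4 * \<beta> * ln (4 * b * \<beta>) * t - 4 * \<beta> * (t * ln t) - d\<^sup>2 / b - (2 * Dm + 1) / b * t"
    proof -
      have "4 * t * ((d\<^sup>2 + (2 * Dm + 1) * t) / (4 * b * t)) = (d\<^sup>2 + (2 * Dm + 1) * t) / b" using b t(1) by simp
      also have "\<dots> = d\<^sup>2 / b + (2 * Dm + 1) / b * t" by (simp only: add_divide_distrib[of "d\<^sup>2"] times_divide_eq_left)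
      finally have "4 * t * ((d\<^sup>2 + (2 * Dm + 1) * t) / (4 * b * t)) = d\<^sup>2 / b + (2 * Dm + 1) / b * t" .
      then show ?thesis unfolding right_diff_distrib by (simp add: mult_ac)
    qed
    moreover have "4 * \<beta> * (t * ln t) <= 0"
    proof (rule mult_nonneg_nonpos)
      show "t * ln t <= 0" using t(1) t1' by (intro mult_nonneg_nonpos) auto
    qed (use \<beta>(2) in simp)
    moreover have "4 * \<beta> * ln (4 * b * \<beta>) * t <= 4 * \<beta> * \<bar>ln (4 * b * \<beta>)\<bar> * (t * l)"
    proof -
      have "4 * \<beta> * ln (4 * b * \<beta>) * t <= 4 * \<beta> * \<bar>ln (4 * b * \<beta>)\<bar> * t" using \<beta>(2) t(1) by (intro mult_right_mono mult_left_mono) auto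
      also have "\<dots> <= 4 * \<beta> * \<bar>ln (4 * b * \<beta>)\<bar> * (t * l)" using \<beta>(2) by (intro Ctl) auto
      finally show ?thesis .
    qed
    moreover have "(2 * Dm + 1) / b * t <= (2 * Dm + 1) / b * (t * l)" using b Dm by (intro Ctl) auto
    ultimately have L: "4 * t * ln (u (x, t)) + d\<^sup>2 / b >= - (E2 * (t * l))" unfolding E2_def distrib_right by linarith
    have gb: "u (x, t) <= M * exp (t + A - d\<^sup>2 / (4 * b * t) + (m / 2) * ln (1 + (d\<^sup>2 / (2 * b * A * t))\<^sup>2))"
      using gaussian_upper_bound[OF p sj(1) op \<Gamma> M(1) up usc(1) init x t(1)] unfolding b_def m_def A_def d_def by simp
    then have "ln (u (x, t)) <= ln (M * exp (t + A - d\<^sup>2 / (4 * b * t) + (m / 2) * ln (1 + (d\<^sup>2 / (2 * b * A * t))\<^sup>2)))"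
      using upos by (intro ln_mono) auto
    also have "\<dots> = ln M + (t + A - d\<^sup>2 / (4 * b * t) + (m / 2) * ln (1 + (d\<^sup>2 / (2 * b * A * t))\<^sup>2))"
      using M(1) by (simp add: ln_mult_pos)
    also have "(m / 2) * ln (1 + (d\<^sup>2 / (2 * b * A * t))\<^sup>2) <= (m / 2) * (ln (1 + c\<^sup>2) + 2 * l)"
    proof (rule mult_left_mono)
      have "d\<^sup>2 / (2 * b * A * t) <= Dm\<^sup>2 / (2 * b * A * t)" using d b A t(1) by (intro divide_right_mono power_mono) auto
      also have "\<dots> = c / t" by (simp add: c_def)
      finally have "(d\<^sup>2 / (2 * b * A * t))\<^sup>2 <= (c / t)\<^sup>2" using b A t(1) by (intro power_mono) auto
      moreover have "1 + (c / t)\<^sup>2 <= (1 + c\<^sup>2) / t\<^sup>2"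
      proof -
        have "1 <= 1 / t\<^sup>2" using t(1) t1' by (simp add: power_le_one)
        then show ?thesis by (simp add: power_divide add_divide_distrib)
      qed
      ultimately have "ln (1 + (d\<^sup>2 / (2 * b * A * t))\<^sup>2) <= ln ((1 + c\<^sup>2) / t\<^sup>2)"
        by (intro ln_mono) (auto simp: add_pos_nonneg)
      also have "\<dots> = ln (1 + c\<^sup>2) - ln (t\<^sup>2)" using t(1) by (intro ln_divide_pos) (auto simp: add_pos_nonneg)
      also have "ln (t\<^sup>2) = 2 * ln t" using t(1) by (simp add: ln_realpow)
      finally show "ln (1 + (d\<^sup>2 / (2 * b * A * t))\<^sup>2) <= ln (1 + c\<^sup>2) + 2 * l" using l(2) by linarith
    qed (use m in simp)
    finally have "ln (u (x, t)) <= E1 + m * l - d\<^sup>2 / (4 * b * t)" using t1' unfolding E1_def by (simp add: distrib_left)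
    then have "4 * t * ln (u (x, t)) <= 4 * t * (E1 + m * l - d\<^sup>2 / (4 * b * t))" using t(1) by (intro mult_left_mono) auto
    also have "\<dots> = 4 * E1 * t + 4 * m * (t * l) - d\<^sup>2 / b"
    proof -
      have "4 * t * (d\<^sup>2 / (4 * b * t)) = d\<^sup>2 / b" using b t(1) by simp
      then show ?thesis unfolding right_diff_distrib by (simp add: algebra_simps)
    qed
    also have "4 * E1 * t <= 4 * E1 * (t * l)" using E1 by (intro Ctl) auto
    finally have U: "4 * t * ln (u (x, t)) + d\<^sup>2 / b <= (4 * E1 + 4 * m) * (t * l)" by (simp add: distrib_right)
    have "0 <= E2 * (t * l)" "0 <= (4 * E1 + 4 * m) * (t * l)" using E1 E2 m l(1) t(1) by auto
    then have "\<bar>4 * t * ln (u (x, t)) + d\<^sup>2 / b\<bar> <= C * (t * l)" using L U unfolding C_def distrib_right[of E2] by linarith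
    moreover have "conj_exp p * d\<^sup>2 = d\<^sup>2 / b" by (simp add: conj_exp_eq[OF p] b_def)
    ultimately show "u (x, t) > 0 \<and> \<bar>4 * t * ln (u (x, t)) + conj_exp p * (infdist x (frontier \<Omega>))\<^sup>2\<bar> <= C * \<bar>t * ln (psi r \<omega> t)\<bar>"
      using upos l(3) unfolding d_def[symmetric] \<psi>_def[symmetric] by simp
  qed
qed

theorem theorem3p7:
  fixes p :: ereal and r :: real and \<omega> :: "real \<Rightarrow> real"
    and \<Omega> :: "(real^'n) set" and u :: "(real^'n) \<times> real \<Rightarrow> real"
  assumes "CARD('n) \<ge> 2"
    and "1 < p"
    and "open \<Omega>" and "connected \<Omega>" and "frontier \<Omega> \<noteq> {}"
    and "modulus \<omega>" and "class_C0 r \<omega> \<Omega>"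
    and "bounded_solution p \<Omega> u"
  shows "(\<forall>K. compact K \<and> K \<subseteq> closure \<Omega> \<longrightarrow>
            (\<exists>C. \<forall>\<^sub>F t in at_right 0. \<forall>x\<in>K.
               u (x, t) > 0 \<and>
               \<bar>4 * t * ln (u (x, t)) + conj_exp p * (infdist x (frontier \<Omega>))\<^sup>2\<bar>
                 \<le> C * \<bar>t * ln (psi r \<omega> t)\<bar>)) \<and>
         (((\<lambda>t. t * ln (psi r \<omega> t)) \<longlongrightarrow> 0) (at_right 0) \<longrightarrow>
            (\<forall>K. compact K \<and> K \<subseteq> closure \<Omega> \<longrightarrow>
               uniform_limit K (\<lambda>t x. 4 * t * ln (u (x, t)))
                 (\<lambda>x. - conj_exp p * (infdist x (frontier \<Omega>))\<^sup>2) (at_right 0)))"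
proof -
  have main: "\<exists>C. \<forall>\<^sub>F t in at_right 0. \<forall>x\<in>K. u (x, t) > 0 \<and>
               \<bar>4 * t * ln (u (x, t)) + conj_exp p * (infdist x (frontier \<Omega>))\<^sup>2\<bar> \<le> C * \<bar>t * ln (psi r \<omega> t)\<bar>"
    if K: "compact K" "K \<subseteq> closure \<Omega>" for K
  proof -
    have "compact ((\<lambda>x. infdist x (frontier \<Omega>)) ` K)" by (intro compact_continuous_image continuous_on_infdist continuous_on_id K(1))
    then obtain Dm where Dm: "Dm > 0" "\<And>x. x \<in> K \<Longrightarrow> infdist x (frontier \<Omega>) \<le> Dm"
      using compact_imp_bounded bounded_pos by (metis abs_le_D1 imageI real_norm_def)
    obtain C t1 where C: "C \<ge> 0" "t1 > 0" "\<And>x t. x \<in> \<Omega> \<Longrightarrow> infdist x (frontier \<Omega>) \<le> Dm \<Longrightarrow> 0 < t \<Longrightarrow> t < t1 \<Longrightarrow>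
       u (x, t) > 0 \<and> \<bar>4 * t * ln (u (x, t)) + conj_exp p * (infdist x (frontier \<Omega>))\<^sup>2\<bar> \<le> C * \<bar>t * ln (psi r \<omega> t)\<bar>"
      using short_time_estimate[OF assms(2,3,5,6,7,8) less_imp_le[OF Dm(1)]] by metis
    have "\<forall>\<^sub>F t in at_right 0. t \<in> {0<..<t1}" by (rule eventually_at_right_real[OF C(2)])
    then have "\<forall>\<^sub>F t in at_right 0. \<forall>x\<in>K. u (x, t) > 0 \<and>
               \<bar>4 * t * ln (u (x, t)) + conj_exp p * (infdist x (frontier \<Omega>))\<^sup>2\<bar> \<le> C * \<bar>t * ln (psi r \<omega> t)\<bar>"
    proof eventually_elim
      case (elim t)
      show ?case
      proof
        fix x assume x: "x \<in> K"
        show "u (x, t) > 0 \<and> \<bar>4 * t * ln (u (x, t)) + conj_exp p * (infdist x (frontier \<Omega>))\<^sup>2\<bar> \<le> C * \<bar>t * ln (psi r \<omega> t)\<bar>"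
        proof (cases "x \<in> \<Omega>")
          case True
          then show ?thesis using C(3)[OF True Dm(2)[OF x]] elim by simp
        next
          case False
          then have fr: "x \<in> frontier \<Omega>" using x K(2) assms(3) by (auto simp: frontier_def interior_open)
          then have "u (x, t) = 1" using assms(8) elim by (simp add: bounded_solution_def)
          then show ?thesis using fr C(1) by (simp add: infdist_zero)
        qed
      qed
    qed
    then show ?thesis by blast
  qed
  have unif: "uniform_limit K (\<lambda>t x. 4 * t * ln (u (x, t))) (\<lambda>x. - conj_exp p * (infdist x (frontier \<Omega>))\<^sup>2) (at_right 0)"
    if lim: "((\<lambda>t. t * ln (psi r \<omega> t)) \<longlongrightarrow> 0) (at_right 0)" and K: "compact K" "K \<subseteq> closure \<Omega>" for K
  proof (rule uniform_limitI)
    fix \<epsilon> :: real assume \<epsilon>: "\<epsilon> > 0"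
    obtain C where C: "\<forall>\<^sub>F t in at_right 0. \<forall>x\<in>K. u (x, t) > 0 \<and>
               \<bar>4 * t * ln (u (x, t)) + conj_exp p * (infdist x (frontier \<Omega>))\<^sup>2\<bar> \<le> C * \<bar>t * ln (psi r \<omega> t)\<bar>"
      using main[OF K] by blast
    have "((\<lambda>t. C * \<bar>t * ln (psi r \<omega> t)\<bar>) \<longlongrightarrow> C * \<bar>0\<bar>) (at_right 0)" by (intro tendsto_intros lim)
    then have "\<forall>\<^sub>F t in at_right 0. C * \<bar>t * ln (psi r \<omega> t)\<bar> < \<epsilon>" using \<epsilon> by (intro order_tendstoD(2)) auto
    with C show "\<forall>\<^sub>F t in at_right 0. \<forall>x\<in>K. dist (4 * t * ln (u (x, t))) (- conj_exp p * (infdist x (frontier \<Omega>))\<^sup>2) < \<epsilon>"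
    proof eventually_elim
      case (elim t)
      then show ?case by (force simp: dist_real_def)
    qed
  qed
  show ?thesis using main unif by blast
qed

end
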